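(* Let $\rho^+,\rho^-\in\mathbb{R}$ be constants with $\rho^--\rho^+>0$ (Rayleigh–Taylor stable case) and let $\nu_0>0$. There exist a non-negative function $\mathcal{M}$ with $\mathcal{M}(x)=c\,x+O(x^2)$ as $x\to0^+$ (for some constant $c>0$) and a $\delta=\delta(\rho^--\rho^+,\nu_0)>0$ such that, for every $h_0\in A^1_{\nu_0}(\mathbb{T})$ with $$\|h_0\|_{A^1_{\nu_0}}<\delta,$$ so that $$\nu_0-\mathcal{M}(\|h_0\|_{A^1_{\nu_0}})>0,$$ the following holds: there exist a positive non-increasing function $\nu:[0,\infty)\to(0,\nu_0]$ with $\nu(0)=\nu_0$ and a unique global analytic solution $h(\alpha,t)$, with $$h\in C([0,T];A^1_{\nu(t)}(\mathbb{T}))\quad\text{for arbitrary }T>0,$$ of the graph equation (G) written in the context with $h(\cdot,0)=h_0$, and it satisfies $$\|h(t)\|_{A^1_{\nu(t)}}\le\|h_0\|_{A^1_{\nu_0}}\qquad\text{for all }t\ge0.$$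
   Context: $\mathbb{T}=\mathbb{R}/2\pi\mathbb{Z}$; subscripts $\alpha,t$ on $h$ denote partial derivatives. The graph equation (G), for the unknown $h:\mathbb{T}\times[0,\infty)\to\mathbb{R}$, is (time dependence of $h$ suppressed on the right-hand side) $$\begin{aligned}h_t(\alpha,t)&=\frac{\rho^--\rho^+}{8\pi}\int_{\mathbb{T}}\log\big(2(\cosh(h(\alpha)-h(\beta))-\cos(\alpha-\beta))\big)\,h(\beta)\,[1+h_\alpha(\alpha)h_\alpha(\beta)]\,d\beta\\&\quad+\frac{\rho^--\rho^+}{8\pi}\int_{\mathbb{T}}\frac{h(\beta)(h(\alpha)-h(\beta))}{\cosh(h(\alpha)-h(\beta))-\cos(\alpha-\beta)}\,(h_\alpha(\alpha)h_\alpha(\beta)-1)\sinh(h(\alpha)-h(\beta))\,d\beta\\&\quad+\frac{\rho^--\rho^+}{8\pi}\int_{\mathbb{T}}\frac{h(\beta)(h(\alpha)-h(\beta))}{\cosh(h(\alpha)-h(\beta))-\cos(\alpha-\beta)}\,(h_\alpha(\alpha)+h_\alpha(\beta))\sin(\alpha-\beta)\,d\beta.\end{aligned}$$ The Wiener spaces are $A^s_\nu=\{u\in L^2(\mathbb{T}):\|u\|_{A^s_\nu}=\sum_{k\in\mathbb{Z}}e^{\nu|k|}|k|^s|\hat u(k)|<\infty\}$, where $\hat u(k)=\frac1{2\pi}\int_{\mathbb{T}}u(\alpha)e^{-ik\alpha}\,d\alpha$. The notation $h\in C([0,T];A^1_{\nu(t)})$ with $\nu$ non-increasing means that $h(t)\in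 A^1_{\nu(t)}$ for every $t\in[0,T]$ and that $h:[0,T']\to A^1_{\nu(T')}$ is continuous for every $T'\in[0,T]$. *)

theory Defs
  imports "HOL-Analysis.Analysis" "HOL-Library.Landau_Symbols"
begin

(* Functions on the torus R/(2 pi Z) are represented by 2 pi-periodic functions on the real line. *)

definition periodic_2pi :: "(real \<Rightarrow> 'a) \<Rightarrow> bool" where
  "periodic_2pi u \<longleftrightarrow> (\<forall>x. u (x + 2 * pi) = u x)"

definition torus_integral :: "(real \<Rightarrow> 'a::{banach, second_countable_topology}) \<Rightarrow> 'a" where
  "torus_integral f = (LINT x:{0..2*pi}|lborel. f x)"

(* Elements of L^2 are represented by individual functions; distinct representatives of the same
   class are not identified, so equality of elements has to be stated almost everywhere. *)

definition torus_L2 :: "(real \<Rightarrow> real) set" where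
  "torus_L2 = {u. periodic_2pi u \<and> u \<in> borel_measurable borel \<and>
                  set_integrable lborel {0..2*pi} (\<lambda>x. (u x)\<^sup>2)}"

definition fourier_coeff :: "(real \<Rightarrow> real) \<Rightarrow> int \<Rightarrow> complex" where
  "fourier_coeff u k =
     (1 / (2 * pi)) *\<^sub>R torus_integral (\<lambda>x. of_real (u x) * exp (- (\<i> * of_int k * of_real x)))"

definition wiener_term :: "nat \<Rightarrow> real \<Rightarrow> (real \<Rightarrow> real) \<Rightarrow> int \<Rightarrow> real" where
  "wiener_term s \<nu> u k = exp (\<nu> * \<bar>real_of_int k\<bar>) * \<bar>real_of_int k\<bar> ^ s * cmod (fourier_coeff u k)"

definition wiener_space :: "nat \<Rightarrow> real \<Rightarrow> (real \<Rightarrow> real) set" where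
  "wiener_space s \<nu> = {u \<in> torus_L2. wiener_term s \<nu> u summable_on UNIV}"

(* For s > 0 the mode k = 0 has weight 0, so this is only a seminorm: it does not see the mean. *)

definition wiener_norm :: "nat \<Rightarrow> real \<Rightarrow> (real \<Rightarrow> real) \<Rightarrow> real" where
  "wiener_norm s \<nu> u = (\<Sum>\<^sub>\<infinity>k. wiener_term s \<nu> u k)"

(* Functions of space and time take the time first: h t x. *)

definition wiener_continuous :: "nat \<Rightarrow> (real \<Rightarrow> real) \<Rightarrow> real \<Rightarrow> (real \<Rightarrow> real \<Rightarrow> real) \<Rightarrow> bool" where
  "wiener_continuous s \<nu> T h \<longleftrightarrow>
     (\<forall>t\<in>{0..T}. h t \<in> wiener_space s (\<nu> t)) \<and>
     (\<forall>T'\<in>{0..T}. \<forall>t\<in>{0..T'}.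
        ((\<lambda>\<tau>. wiener_norm s (\<nu> T') (\<lambda>x. h \<tau> x - h t x)) \<longlongrightarrow> 0) (at t within {0..T'}))"

(* A real function is real-analytic iff it is the restriction to the real line of a function that
   is holomorphic in a neighbourhood of the real line. *)

definition real_analytic :: "(real \<Rightarrow> real) \<Rightarrow> bool" where
  "real_analytic f \<longleftrightarrow>
     (\<exists>F. F analytic_on \<real> \<and> (\<forall>x. F (complex_of_real x) = complex_of_real (f x)))"

(* The integrands are singular only at y - x in 2 pi Z, a null set, so the values that ln and
   division take there by convention are irrelevant. *)

definition graph_rhs :: "real \<Rightarrow> real \<Rightarrow> (real \<Rightarrow> real) \<Rightarrow> real \<Rightarrow> real" where
  "graph_rhs \<rho>p \<rho>m f x =
     (\<rho>m - \<rho>p) / (8 * pi) * torus_integral (\<lambda>y.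
        ln (2 * (cosh (f x - f y) - cos (x - y))) * f y * (1 + deriv f x * deriv f y))
   + (\<rho>m - \<rho>p) / (8 * pi) * torus_integral (\<lambda>y.
        f y * (f x - f y) / (cosh (f x - f y) - cos (x - y))
          * (deriv f x * deriv f y - 1) * sinh (f x - f y))
   + (\<rho>m - \<rho>p) / (8 * pi) * torus_integral (\<lambda>y.
        f y * (f x - f y) / (cosh (f x - f y) - cos (x - y))
          * (deriv f x + deriv f y) * sin (x - y))"

(* The time derivative at t = 0 is one-sided. *)

definition solves_graph_eq :: "real \<Rightarrow> real \<Rightarrow> (real \<Rightarrow> real \<Rightarrow> real) \<Rightarrow> bool" where
  "solves_graph_eq \<rho>p \<rho>m h \<longleftrightarrow>
     (\<forall>t\<ge>0. \<forall>x. ((\<lambda>\<tau>. h \<tau> x) has_real_derivative graph_rhs \<rho>p \<rho>m (h t) x) (at t within {0..}))"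

(* The initial datum is an L^2 class, hence attained almost everywhere; each h t with t >= 0 is the
   real-analytic, hence pointwise unique, representative of its class. *)

definition global_analytic_solution ::
  "real \<Rightarrow> real \<Rightarrow> (real \<Rightarrow> real) \<Rightarrow> (real \<Rightarrow> real) \<Rightarrow> (real \<Rightarrow> real \<Rightarrow> real) \<Rightarrow> bool" where
  "global_analytic_solution \<rho>p \<rho>m \<nu> h0 h \<longleftrightarrow>
     (\<forall>t\<ge>0. real_analytic (h t)) \<and>
     (\<forall>T>0. wiener_continuous 1 \<nu> T h) \<and>
     solves_graph_eq \<rho>p \<rho>m h \<and>
     (AE x in lborel. h 0 x = h0 x)"

end

theory Submission
  imports Defs "HOL-Complex_Analysis.Complex_Analysis"
begin

text \<open>
  Put \<open>\<rho> = \<rho>m - \<rho>p\<close>.  The kernel by which the graph equation multiplies \<open>h(\<beta>)\<close> has integral 0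
  (\<open>integral_slip_kernel\<close>), so \<open>h(\<beta>)\<close> may be replaced by its deviation from the mean.  At a flat
  interface the kernel is \<open>ln (2 - 2 cos (\<alpha> - \<beta>))\<close>, with Fourier coefficients \<open>- 2 pi / \<bar>k\<bar>\<close>
  (\<open>integral_log_kernel_cis\<close>).  In Fourier variables the equation therefore reads
  \<open>a_k' = - \<rho> / (4 \<bar>k\<bar>) a_k + N_k\<close>, where \<open>N\<close> is of third order in the slope \<open>h_\<alpha>\<close>
  (\<open>graph_rhs_fourier\<close>).

  Two things obstruct a direct fixed point argument: \<open>N\<close> is controlled by the slope, so one derivative
  is lost, and the damping tends to 0 at high frequencies, so it neither recovers this derivative nor
  gives decay at a uniform rate.  Both are overcome by measuring the modes of the slope with the weight
  \<open>V_k(t) = exp (- r(t) \<bar>k\<bar>) \<sigma>(t)\<close>, where \<open>\<sigma>(t) = 1 / (1 + c t)\<close> and \<open>r(t) = r1 + \<alpha> \<sigma>(t)\<close>.  The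
  shrinking radius contributes a term proportional to \<open>\<bar>k\<bar> \<sigma>\<^sup>2\<close> to \<open>V'/V\<close>, the damping is proportional to
  \<open>1 / \<bar>k\<bar>\<close>, and the decaying amplitude costs \<open>c \<sigma>\<close>; by the inequality between arithmetic and geometric
  means \<open>V' / V + \<rho> / (4 \<bar>k\<bar>) \<ge> \<kappa> \<bar>k\<bar> \<sigma>\<^sup>2\<close> (\<open>decay_amgm\<close>).  A cubic forcing, of size \<open>V \<sigma>\<^sup>2\<close>, thus has a
  response of size \<open>V / \<bar>k\<bar>\<close> (\<open>mode_estimate\<close>): the lost derivative is back, with a constant that does not
  depend on the length of the time interval.

  The fixed point is taken in a Banach algebra of Fourier modes that are bounded continuous functions of
  a radius, the time and the integration variable \<open>s = \<alpha> - \<beta>\<close>.  Differences and difference quotients of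
  \<open>h\<close> are bounded multipliers of the slope, and the kernel is a power series in them, so the nonlinearity
  is Lipschitz with a small constant on small balls (\<open>nonlin_lipschitz\<close>).  Hence small data have a
  solution for all times (\<open>fixed_point\<close>).

  For uniqueness the same contraction estimate is applied on short intervals to the difference of two
  solutions (\<open>decaying_flow_unique\<close>), after the pointwise equation has been shown to hold mode by mode;
  continuity in time and the global bound of the constructed solution extend the agreement to all times
  (\<open>analytic_flow_unique\<close>).

  For the radius \<open>\<nu>\<close> the function with \<open>\<nu>(0) = \<nu>0\<close> and \<open>\<nu>(t) = \<nu>0 / 2\<close> for \<open>t > 0\<close> is taken, and \<open>M\<close> is linear.
  The part of the radius that is given up at the start produces a factor smaller than 1, which absorbs
  the constant of the fixed point argument and gives the bound of the solution by the data without a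
  loss (\<open>small_data_well_posed\<close>).
\<close>

section \<open>Absolutely convergent families indexed by the integers\<close>

lemma has_sum_int_imp_sums:
  fixes f :: "int \<Rightarrow> 'a::{comm_monoid_add,topological_space}"
  assumes "(f has_sum S) UNIV"
  shows "(\<lambda>n. f (int_decode n)) sums S"
proof -
  have "((\<lambda>n. f (int_decode n)) has_sum S) UNIV"
    using has_sum_reindex_bij_betw[OF bij_int_decode, of f S] assms by simp
  then show ?thesis by (rule has_sum_imp_sums)
qed

lemma infsum_int_eq_suminf:
  fixes f :: "int \<Rightarrow> 'a::{comm_monoid_add,t2_space}"
  assumes "f summable_on UNIV"
  shows "infsum f UNIV = (\<Sum>n. f (int_decode n))"
  using has_sum_int_imp_sums[OF has_sum_infsum[OF assms]] sums_unique by blast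

lemma summable_int_decode:
  fixes f :: "int \<Rightarrow> 'a::{comm_monoid_add,topological_space}"
  assumes "f summable_on UNIV"
  shows "summable (\<lambda>n. f (int_decode n))"
  using has_sum_int_imp_sums assms unfolding summable_on_def summable_def by blast

lemma summable_on_bounded_by:
  fixes f :: "'i \<Rightarrow> 'a::banach"
  assumes "b summable_on A" "\<And>k. k \<in> A \<Longrightarrow> norm (f k) \<le> b k"
  shows "f summable_on A" "norm (infsum f A) \<le> infsum b A" "(\<lambda>k. norm (f k)) summable_on A"
proof -
  show *: "(\<lambda>k. norm (f k)) summable_on A"
    by (rule summable_on_comparison_test[OF assms(1)]) (use assms(2) in auto)
  then show "f summable_on A" by (rule abs_summable_summable)
  have "norm (infsum f A) \<le> infsum (\<lambda>k. norm (f k)) A" by (rule norm_infsum_bound[OF *])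
  also have "\<dots> \<le> infsum b A" by (rule infsum_mono) (use * assms in auto)
  finally show "norm (infsum f A) \<le> infsum b A" .
qed

text \<open>The majorant has product form: the summable factor \<open>b\<close> makes the series converge, while the
integrable factor \<open>w\<close> may be unbounded, as it has to be for the logarithmic kernel.\<close>

lemma termwise_integral:
  fixes f :: "int \<Rightarrow> 'x \<Rightarrow> 'a::{banach,second_countable_topology}"
  assumes meas: "\<And>k. f k \<in> borel_measurable M"
    and bnd: "\<And>k x. x \<in> space M \<Longrightarrow> norm (f k x) \<le> b k * w x"
    and b: "b summable_on UNIV" and w: "integrable M w" and b0: "\<And>k. b k \<ge> 0" 
  shows "integrable M (\<lambda>x. \<Sum>\<^sub>\<infinity>k. f k x)"
    and "(\<integral>x. (\<Sum>\<^sub>\<infinity>k. f k x) \<partial>M) = (\<Sum>\<^sub>\<infinity>k. \<integral>x. f k x \<partial>M)"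
    and "\<And>k. integrable M (f k)"
    and "\<And>k. norm (\<integral>x. f k x \<partial>M) \<le> b k * (\<integral>x. \<bar>w x\<bar> \<partial>M)"
proof -
  have w': "integrable M (\<lambda>x. \<bar>w x\<bar>)" using w by simp
  have bnd': "norm (f k x) \<le> b k * \<bar>w x\<bar>" if "x \<in> space M" for k x
    using bnd[OF that, of k] mult_left_mono[OF abs_ge_self[of "w x"] b0[of k]] by linarith
  show int: "integrable M (f k)" for k
    by (rule Bochner_Integration.integrable_bound[of M "\<lambda>x. b k * \<bar>w x\<bar>"])
       (use w' meas bnd' b0 in \<open>auto intro!: AE_I2\<close>)
  show nb: "norm (\<integral>x. f k x \<partial>M) \<le> b k * (\<integral>x. \<bar>w x\<bar> \<partial>M)" for k
  proof -
    have "norm (\<integral>x. f k x \<partial>M) \<le> (\<integral>x. norm (f k x) \<partial>M)" by simp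
    also have "\<dots> \<le> (\<integral>x. b k * \<bar>w x\<bar> \<partial>M)"
      by (rule integral_mono) (use int w' bnd' in auto)
    finally have "norm (\<integral>x. f k x \<partial>M) \<le> (\<integral>x. b k * \<bar>w x\<bar> \<partial>M)" .
    then show ?thesis by simp
  qed
  have sb: "summable (\<lambda>n. b (int_decode n))" by (rule summable_int_decode[OF b])
  have sx: "(\<lambda>k. b k * c) summable_on UNIV" for c by (rule summable_on_cmult_left[OF b])
  have s1: "(\<lambda>k. f k x) summable_on UNIV" if "x \<in> space M" for x
    by (rule summable_on_bounded_by(1)[OF sx]) (use bnd' that in auto)
  have s1': "summable (\<lambda>n. norm (f (int_decode n) x))" if "x \<in> space M" for x
    by (rule summable_int_decode[OF summable_on_bounded_by(3)[OF sx]]) (use bnd' that in auto)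
  have n2: "norm (\<integral>x. norm (f k x) \<partial>M) \<le> b k * (\<integral>x. \<bar>w x\<bar> \<partial>M)" for k
  proof -
    have "(\<integral>x. norm (f k x) \<partial>M) \<le> (\<integral>x. b k * \<bar>w x\<bar> \<partial>M)"
      by (rule integral_mono) (use int w' bnd' in auto)
    moreover have "0 \<le> (\<integral>x. norm (f k x) \<partial>M)" by simp
    ultimately have "norm (\<integral>x. norm (f k x) \<partial>M) \<le> (\<integral>x. b k * \<bar>w x\<bar> \<partial>M)" by simp
    then show ?thesis by simp
  qed
  have s2: "summable (\<lambda>n. \<integral>x. norm (f (int_decode n) x) \<partial>M)"
    by (rule summable_int_decode[OF summable_on_bounded_by(1)[OF sx]]) (use n2 in auto)
  have eq: "(\<Sum>\<^sub>\<infinity>k. f k x) = (\<Sum>n. f (int_decode n) x)" if "x \<in> space M" for x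
    using infsum_int_eq_suminf[OF s1[OF that]] .
  have I: "integrable M (\<lambda>x. \<Sum>n. f (int_decode n) x)"
    by (rule integrable_suminf) (use int s1' s2 in auto)
  then show "integrable M (\<lambda>x. \<Sum>\<^sub>\<infinity>k. f k x)"
    by (rule Bochner_Integration.integrable_cong[THEN iffD1, rotated -1]) (use eq in auto)
  have "(\<integral>x. (\<Sum>\<^sub>\<infinity>k. f k x) \<partial>M) = (\<integral>x. (\<Sum>n. f (int_decode n) x) \<partial>M)"
    by (rule Bochner_Integration.integral_cong) (use eq in auto)
  also have "\<dots> = (\<Sum>n. \<integral>x. f (int_decode n) x \<partial>M)"
    by (rule integral_suminf) (use int s1' s2 in auto)
  also have "\<dots> = (\<Sum>\<^sub>\<infinity>k. \<integral>x. f k x \<partial>M)"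
    by (rule infsum_int_eq_suminf[symmetric], rule summable_on_bounded_by(1)[OF sx], rule nb)
  finally show "(\<integral>x. (\<Sum>\<^sub>\<infinity>k. f k x) \<partial>M) = (\<Sum>\<^sub>\<infinity>k. \<integral>x. f k x \<partial>M)" .
qed

section \<open>Trigonometric series on the torus\<close>

text \<open>The torus as a finite measure space, which makes the Bochner integral calculus directly applicable
to \<open>torus_integral\<close>.\<close>

definition circle :: "real measure" where
  "circle = restrict_space lborel {0..2*pi}"

lemma space_circle [simp]: "space circle = {0..2*pi}"
  by (simp add: circle_def space_restrict_space)

lemma torus_integral_circle:
  fixes f :: "real \<Rightarrow> 'a::{banach,second_countable_topology}"
  shows
  "torus_integral f = (\<integral>x. f x \<partial>circle)"
  unfolding torus_integral_def set_lebesgue_integral_def circle_def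
  by (subst integral_restrict_space) auto

lemma integrable_circle_iff:
  fixes f :: "real \<Rightarrow> 'a::{banach,second_countable_topology}"
  shows
  "integrable circle f \<longleftrightarrow> set_integrable lborel {0..2*pi} f"
  unfolding set_integrable_def circle_def by (subst integrable_restrict_space) auto

lemma borel_measurable_circle [measurable (raw)]:
  "f \<in> borel_measurable borel \<Longrightarrow> f \<in> borel_measurable circle"
  unfolding circle_def by (rule measurable_restrict_space1) simp

lemma emeasure_circle: "emeasure circle {0..2*pi} = ennreal (2*pi)"
  unfolding circle_def by (subst emeasure_restrict_space) auto

interpretation circle: finite_measure circle
  by standard (simp add: emeasure_circle)

lemma measure_circle [simp]: "measure circle {0..2*pi} = 2*pi"
  by (simp add: measure_def emeasure_circle)

lemma integrable_circle_bounded: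
  fixes f :: "real \<Rightarrow> 'a::{banach,second_countable_topology}"
  assumes "f \<in> borel_measurable circle" "\<And>x. x \<in> {0..2*pi} \<Longrightarrow> norm (f x) \<le> B"
  shows "integrable circle f"
  by (rule circle.integrable_const_bound[of _ B]) (use assms in \<open>auto intro!: AE_I2\<close>)

lemma cis_measurable [measurable]: "cis \<in> borel_measurable borel"
  by (intro borel_measurable_continuous_onI continuous_intros)

lemma integral_cis_int:
  "(\<integral>x. cis (of_int k * x) \<partial>circle) = (if k = 0 then 2 * pi else 0)"
proof (cases "k = 0")
  case True
  then show ?thesis by (simp add: scaleR_conv_of_real)
next
  case False
  define F where "F x = cis (of_int k * x) / (\<i> * of_int k)" for x :: real
  have D: "(F has_vector_derivative cis (of_int k * x)) (at x within {0..2*pi})" for x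
    unfolding F_def has_vector_derivative_def
    by (rule derivative_eq_intros refl)+
       (use False in \<open>auto simp: scaleR_conv_of_real field_simps\<close>)
  have "(LBINT x=ereal 0..ereal (2*pi). cis (of_int k * x)) = F (2*pi) - F 0"
  proof (rule interval_integral_FTC_finite)
    show "continuous_on {min 0 (2*pi)..max 0 (2*pi)} (\<lambda>x. cis (of_int k * x))"
      by (intro continuous_intros)
    show "\<And>x. min 0 (2*pi) \<le> x \<Longrightarrow> x \<le> max 0 (2*pi) \<Longrightarrow> (F has_vector_derivative cis (of_int k * x)) (at x within {min 0 (2*pi)..max 0 (2*pi)})"
      using D by simp
  qed
  moreover have "F (2*pi) = F 0"
  proof -
    have "cis (of_int k * (2 * pi)) = cis (2 * pi * of_int k)" by (simp only: mult.commute)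
    also have "\<dots> = 1" by (rule cis_multiple_2pi) simp
    finally show ?thesis unfolding F_def by (simp only: mult_zero_right cis_zero)
  qed
  ultimately have "(LBINT x=ereal 0..ereal (2*pi). cis (of_int k * x)) = 0" by simp
  moreover have "(LBINT x=ereal 0..ereal (2*pi). cis (of_int k * x)) = torus_integral (\<lambda>x. cis (of_int k * x))"
    unfolding torus_integral_def using interval_integral_Icc[of 0 "2*pi" "\<lambda>x. cis (of_int k * x)"] by simp
  ultimately have "torus_integral (\<lambda>x. cis (of_int k * x)) = 0" by (simp only:)
  then show ?thesis using False by (simp add: torus_integral_circle)
qed

lemma fourier_coeff_circle:
  "fourier_coeff u k = (\<integral>x. of_real (u x) * cis (- (of_int k * x)) \<partial>circle) / (2 * pi)"
  unfolding fourier_coeff_def torus_integral_circle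
  by (simp add: cis_conv_exp scaleR_conv_of_real field_simps)

lemma trig_series_coeff:
  fixes a :: "int \<Rightarrow> complex"
  assumes s: "(\<lambda>k. norm (a k)) summable_on UNIV"
    and f: "\<And>x. x \<in> {0..2*pi} \<Longrightarrow> f x = (\<Sum>\<^sub>\<infinity>k. a k * cis (of_int k * x))"
  shows "(\<integral>x. f x * cis (- (of_int m * x)) \<partial>circle) = 2 * pi * a m"
proof -
  have "(\<integral>x. f x * cis (- (of_int m * x)) \<partial>circle) = 
      (\<integral>x. (\<Sum>\<^sub>\<infinity>k. a k * cis (of_int (k - m) * x)) \<partial>circle)"
  proof (rule Bochner_Integration.integral_cong)
    fix x assume "x \<in> space circle"
    then have "f x * cis (- (of_int m * x)) = (\<Sum>\<^sub>\<infinity>k. a k * cis (of_int k * x)) * cis (- (of_int m * x))"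
      using f by simp
    also have "\<dots> = (\<Sum>\<^sub>\<infinity>k. a k * cis (of_int k * x) * cis (- (of_int m * x)))"
      by (rule infsum_cmult_left'[symmetric])
    also have "\<dots> = (\<Sum>\<^sub>\<infinity>k. a k * cis (of_int (k - m) * x))"
      by (simp add: mult.assoc cis_mult algebra_simps)
    finally show "f x * cis (- (of_int m * x)) = (\<Sum>\<^sub>\<infinity>k. a k * cis (of_int (k - m) * x))" .
  qed simp
  also have "\<dots> = (\<Sum>\<^sub>\<infinity>k. \<integral>x. a k * cis (of_int (k - m) * x) \<partial>circle)"
    by (rule termwise_integral(2)[where w = "\<lambda>_. 1", OF _ _ s]) (auto simp: norm_mult)
  also have "\<dots> = (\<Sum>\<^sub>\<infinity>k. a k * (if k = m then 2 * pi else 0))"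
    by (simp only: integral_mult_right_zero integral_cis_int) simp
  also have "\<dots> = (\<Sum>\<^sub>\<infinity>k\<in>{m}. a k * (if k = m then 2 * pi else 0))"
    by (rule infsum_cong_neutral) auto
  finally show ?thesis by simp
qed

lemma trig_series_unique:
  fixes a b :: "int \<Rightarrow> complex"
  assumes "(\<lambda>k. norm (a k)) summable_on UNIV" "(\<lambda>k. norm (b k)) summable_on UNIV"
    and "\<And>x. (\<Sum>\<^sub>\<infinity>k. a k * cis (of_int k * x)) = (\<Sum>\<^sub>\<infinity>k. b k * cis (of_int k * x))"
  shows "a = b"
proof
  fix m
  have "2 * pi * a m = 2 * pi * b m"
    using trig_series_coeff[OF assms(1), of "\<lambda>x. (\<Sum>\<^sub>\<infinity>k. a k * cis (of_int k * x))" m]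
      trig_series_coeff[OF assms(2), of "\<lambda>x. (\<Sum>\<^sub>\<infinity>k. a k * cis (of_int k * x))" m] assms(3) by simp
  then show "a m = b m" by simp
qed

section \<open>A weighted Wiener algebra with parameters\<close>

instance bcontfun :: (metric_space, banach) banach ..

text \<open>A parameter \<open>(r, t, s)\<close> consists of a radius of analyticity, a time, and the variable
\<open>s = \<alpha> - \<beta>\<close> of the integrals in the graph equation.  An element of the algebra is a family of
Fourier modes, each a bounded continuous function of the parameter, with summable supremum norms.
The factor \<open>exp (- r \<bar>k\<bar>)\<close> is kept outside the modes (it enters through \<open>damp\<close> below), so the norm
is an analytic Wiener norm although no weight is visible in it.  Since the supremum stands inside
the sum, one element carries a bound of every mode that is uniform over all times and all \<open>s\<close>.\<close>

type_synonym param = "real \<times> real \<times> real"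

typedef wiener = "{b :: int \<Rightarrow> (param \<Rightarrow>\<^sub>C complex). (\<lambda>k. norm (b k)) summable_on UNIV}"
  morphisms mode Wiener
  by (rule exI[of _ "\<lambda>_. 0"]) simp

setup_lifting type_definition_wiener

lemma mode_summable: "(\<lambda>k. norm (mode b k)) summable_on UNIV"
  using mode[of b] by simp

lemma wiener_eqI: "(\<And>k. mode a k = mode b k) \<Longrightarrow> a = b"
  by (simp add: mode_inject[symmetric] fun_eq_iff)

instantiation wiener :: real_normed_vector
begin

lift_definition zero_wiener :: wiener is "\<lambda>_. 0" by simp
lift_definition plus_wiener :: "wiener \<Rightarrow> wiener \<Rightarrow> wiener" is "\<lambda>a b k. a k + b k"
proof -
  fix f g :: "int \<Rightarrow> param \<Rightarrow>\<^sub>C complex"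
  assume f: "(\<lambda>k. norm (f k)) summable_on UNIV" and g: "(\<lambda>k. norm (g k)) summable_on UNIV"
  show "(\<lambda>k. norm (f k + g k)) summable_on UNIV"
    by (rule summable_on_bounded_by(3)[OF summable_on_add[OF f g]]) (rule norm_triangle_ineq)
qed
lift_definition minus_wiener :: "wiener \<Rightarrow> wiener \<Rightarrow> wiener" is "\<lambda>a b k. a k - b k"
proof -
  fix f g :: "int \<Rightarrow> param \<Rightarrow>\<^sub>C complex"
  assume f: "(\<lambda>k. norm (f k)) summable_on UNIV" and g: "(\<lambda>k. norm (g k)) summable_on UNIV"
  show "(\<lambda>k. norm (f k - g k)) summable_on UNIV"
    by (rule summable_on_bounded_by(3)[OF summable_on_add[OF f g]]) (rule norm_triangle_ineq4)
qed
lift_definition uminus_wiener :: "wiener \<Rightarrow> wiener" is "\<lambda>a k. - a k" by simp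
lift_definition scaleR_wiener :: "real \<Rightarrow> wiener \<Rightarrow> wiener" is "\<lambda>c a k. c *\<^sub>R a k"
  by (simp add: summable_on_cmult_right)
definition norm_wiener :: "wiener \<Rightarrow> real" where "norm_wiener a = (\<Sum>\<^sub>\<infinity>k. norm (mode a k))"
definition dist_wiener :: "wiener \<Rightarrow> wiener \<Rightarrow> real" where "dist_wiener a b = norm (a - b)"
definition sgn_wiener :: "wiener \<Rightarrow> wiener" where "sgn_wiener a = inverse (norm a) *\<^sub>R a"
definition uniformity_wiener :: "(wiener \<times> wiener) filter"
  where "uniformity_wiener = (INF e\<in>{0 <..}. principal {(x, y). dist x y < e})"
definition open_wiener :: "wiener set \<Rightarrow> bool"
  where "open_wiener S = (\<forall>x\<in>S. \<forall>\<^sub>F (x', y) in uniformity. x' = x \<longrightarrow> y \<in> S)"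

lemmas mode_simps [simp] = zero_wiener.rep_eq plus_wiener.rep_eq minus_wiener.rep_eq
  uminus_wiener.rep_eq scaleR_wiener.rep_eq

lemma norm_mode_le: "norm (mode a k) \<le> norm a"
  using finite_sum_le_infsum[OF mode_summable[of a], of "{k}"] by (simp add: norm_wiener_def)

instance
proof
  fix a b c :: wiener and x y :: real
  show "a + b + c = a + (b + c)" "a + b = b + a" "0 + a = a" "- a + a = 0" "a - b = a + - b"
    "x *\<^sub>R (a + b) = x *\<^sub>R a + x *\<^sub>R b" "(x + y) *\<^sub>R a = x *\<^sub>R a + y *\<^sub>R a"
    "x *\<^sub>R y *\<^sub>R a = (x * y) *\<^sub>R a" "1 *\<^sub>R a = a"
    by (auto intro!: wiener_eqI simp: algebra_simps)
  show "dist a b = norm (a - b)" by (simp add: dist_wiener_def)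
  show "sgn a = inverse (norm a) *\<^sub>R a" by (simp add: sgn_wiener_def)
  show "norm (x *\<^sub>R a) = \<bar>x\<bar> * norm a"
    by (simp add: norm_wiener_def infsum_cmult_right')
  show "norm (a + b) \<le> norm a + norm b"
    unfolding norm_wiener_def infsum_add[OF mode_summable mode_summable, symmetric]
    by (intro infsum_mono summable_on_add mode_summable) (simp add: norm_triangle_ineq)
  show "norm a = 0 \<longleftrightarrow> a = 0"
  proof
    assume "norm a = 0"
    then have "norm (mode a k) = 0" for k using norm_mode_le[of a k] by simp
    then show "a = 0" by (intro wiener_eqI) simp
  qed (simp add: norm_wiener_def)
qed (rule uniformity_wiener_def open_wiener_def)+

end

lemma norm_wiener_le:
  assumes "\<And>k. norm (mode a k) \<le> b k" "b summable_on UNIV"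
  shows "norm a \<le> (\<Sum>\<^sub>\<infinity>k. b k)"
  unfolding norm_wiener_def by (rule infsum_mono) (use assms mode_summable in auto)

lemma norm_wiener_leI:
  assumes "\<And>k. norm (mode a k) \<le> C * norm (mode b k)"
  shows "norm a \<le> C * norm b"
proof -
  have "norm a \<le> (\<Sum>\<^sub>\<infinity>k. C * norm (mode b k))"
    by (rule norm_wiener_le[OF assms]) (intro summable_on_cmult_right mode_summable)
  then show ?thesis by (simp add: norm_wiener_def infsum_cmult_right')
qed

lemma norm_apply_mode_le: "norm (mode a k p) \<le> norm (mode a k)"
  by (rule norm_bounded)

lemma sum_norm_mode_le: "finite F \<Longrightarrow> (\<Sum>k\<in>F. norm (mode a k)) \<le> norm a"
  using finite_sum_le_infsum[OF mode_summable[of a]] by (simp add: norm_wiener_def)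

instance wiener :: banach
proof
  fix X :: "nat \<Rightarrow> wiener"
  assume X: "Cauchy X"
  have "Cauchy (\<lambda>n. mode (X n) k)" for k
  proof (rule CauchyI')
    fix e :: real assume "e > 0"
    then obtain M where M: "\<And>m n. m \<ge> M \<Longrightarrow> n \<ge> M \<Longrightarrow> dist (X m) (X n) < e"
      using X unfolding Cauchy_def by blast
    show "\<exists>M. \<forall>m\<ge>M. \<forall>n>m. dist (mode (X m) k) (mode (X n) k) < e"
    proof (intro exI allI impI)
      fix m n :: nat assume "m \<ge> M" "n > m"
      then have "norm (X m - X n) < e" using M[of m n] by (simp add: dist_norm)
      then show "dist (mode (X m) k) (mode (X n) k) < e"
        using norm_mode_le[of "X m - X n" k] by (simp add: dist_norm)
    qed
  qed
  then have "\<forall>k. \<exists>l. (\<lambda>n. mode (X n) k) \<longlonglongrightarrow> l"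
    using Cauchy_convergent unfolding convergent_def by blast
  then obtain L where L: "\<And>k. (\<lambda>n. mode (X n) k) \<longlonglongrightarrow> L k" by metis
  have tail: "(\<Sum>k\<in>F. norm (mode (X n) k - L k)) \<le> e"
    if F: "finite F" and M: "\<And>m n. m \<ge> M \<Longrightarrow> n \<ge> M \<Longrightarrow> dist (X m) (X n) < e" "n \<ge> M" for F n e M
  proof (rule tendsto_upperbound)
    show "((\<lambda>m. \<Sum>k\<in>F. norm (mode (X n) k - mode (X m) k)) \<longlongrightarrow> (\<Sum>k\<in>F. norm (mode (X n) k - L k))) sequentially"
      by (intro tendsto_intros L)
    show "\<forall>\<^sub>F m in sequentially. (\<Sum>k\<in>F. norm (mode (X n) k - mode (X m) k)) \<le> e"
      using eventually_ge_at_top[of M]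
    proof eventually_elim
      case (elim m)
      show ?case using sum_norm_mode_le[OF F, of "X n - X m"] M(1)[of n m] M(2) elim by (simp add: dist_norm)
    qed
  qed simp
  have LS: "(\<lambda>k. norm (L k)) summable_on UNIV"
  proof -
    obtain M where M: "\<And>m n. m \<ge> M \<Longrightarrow> n \<ge> M \<Longrightarrow> dist (X m) (X n) < 1"
      using X unfolding Cauchy_def by (meson zero_less_one)
    have "(\<Sum>k\<in>F. norm (L k)) \<le> 1 + norm (X M)" if "finite F" for F
    proof -
      have t: "(\<Sum>k\<in>F. norm (mode (X M) k - L k)) \<le> 1"
        by (rule tail[OF that, of M]) (use M in auto)
      have "(\<Sum>k\<in>F. norm (L k)) \<le> (\<Sum>k\<in>F. norm (mode (X M) k - L k) + norm (mode (X M) k))"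
        by (intro sum_mono) (metis norm_minus_commute norm_triangle_sub add.commute)
      also have "\<dots> \<le> 1 + norm (X M)"
        unfolding sum.distrib using t sum_norm_mode_le[OF that, of "X M"] by simp
      finally show ?thesis .
    qed
    then show ?thesis by (intro nonneg_bdd_above_summable_on) (auto intro!: bdd_aboveI2)
  qed
  define Y where "Y = Wiener L"
  have Y: "mode Y = L" unfolding Y_def by (rule Wiener_inverse) (use LS in simp)
  have "X \<longlonglongrightarrow> Y"
  proof (rule metric_LIMSEQ_I)
    fix e :: real assume e: "e > 0"
    then obtain M where M: "\<And>m n. m \<ge> M \<Longrightarrow> n \<ge> M \<Longrightarrow> dist (X m) (X n) < e / 2"
      using X unfolding Cauchy_def by (meson half_gt_zero)
    have "dist (X n) Y < e" if "n \<ge> M" for n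
    proof -
      have "norm (X n - Y) \<le> e / 2"
        unfolding norm_wiener_def
        by (rule infsum_le_finite_sums[OF mode_summable]) (use tail[OF _ M that] in \<open>simp add: Y\<close>)
      then show ?thesis using e by (simp add: dist_norm)
    qed
    then show "\<exists>no. \<forall>n\<ge>no. dist (X n) Y < e" by blast
  qed
  then show "convergent X" unfolding convergent_def by blast
qed

subsection \<open>Evaluation\<close>

definition damp :: "param \<Rightarrow> int \<Rightarrow> real" where
  "damp p k = exp (- (\<bar>fst p\<bar> * \<bar>real_of_int k\<bar>))"

lemma damp_pos [simp]: "damp p k > 0" and damp_le_1 [simp]: "damp p k \<le> 1" and damp_0 [simp]: "damp p 0 = 1"
  and damp_nz [simp]: "damp p k \<noteq> 0"
  by (auto simp: damp_def)

definition eval :: "param \<Rightarrow> real \<Rightarrow> wiener \<Rightarrow> complex" where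
  "eval p x b = (\<Sum>\<^sub>\<infinity>k. mode b k p * damp p k * cis (of_int k * x))"

lemma norm_eval_term: "norm (mode b k p * damp p k * cis (of_int k * x)) \<le> norm (mode b k)"
proof -
  have "norm (mode b k p * damp p k * cis (of_int k * x)) = norm (mode b k p) * damp p k"
    by (simp add: norm_mult less_imp_le[OF damp_pos])
  also have "\<dots> \<le> norm (mode b k) * 1"
    by (intro mult_mono norm_apply_mode_le) (auto simp: less_imp_le[OF damp_pos])
  finally show ?thesis by simp
qed

lemma eval_summable:
  "(\<lambda>k. mode b k p * damp p k * cis (of_int k * x)) summable_on UNIV"
  "(\<lambda>k. norm (mode b k p * damp p k * cis (of_int k * x))) summable_on UNIV"
  by (rule summable_on_bounded_by[OF mode_summable norm_eval_term])+

lemma norm_eval_le: "norm (eval p x b) \<le> norm b"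
  unfolding eval_def norm_wiener_def by (rule summable_on_bounded_by(2)[OF mode_summable norm_eval_term])

lemma eval_add: "eval p x (a + b) = eval p x a + eval p x b"
  unfolding eval_def using infsum_add[OF eval_summable(1)[of a p x] eval_summable(1)[of b p x]]
  by (simp add: algebra_simps)

lemma eval_scaleR: "eval p x (c *\<^sub>R a) = c *\<^sub>R eval p x a"
  unfolding eval_def using infsum_scaleR_right[of c "\<lambda>k. mode a k p * damp p k * cis (of_int k * x)" UNIV]
  by simp

lemma bounded_linear_eval: "bounded_linear (eval p x)"
  by (rule bounded_linear_intro[of _ 1]) (auto simp: eval_add eval_scaleR norm_eval_le)

lemma eval_minus: "eval p x (a - b) = eval p x a - eval p x b"
  by (rule linear_diff) (simp add: bounded_linear_eval bounded_linear.linear)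

lemma eval_uminus: "eval p x (- a) = - eval p x a"
  by (rule linear_neg) (simp add: bounded_linear_eval bounded_linear.linear)

lemma eval_zero: "eval p x 0 = 0"
  by (simp add: eval_def)

text \<open>A point of evaluation is a parameter together with a point of the torus, and by uniqueness of
Fourier coefficients an element is determined by its values there.  Identities in the algebra can
therefore be checked between complex numbers.\<close>

lemma eval_injective:
  assumes "\<And>p x. eval p x a = eval p x b"
  shows "a = b"
proof (rule wiener_eqI, rule bcontfun_eqI)
  fix k p
  have s: "(\<lambda>k. norm (mode c k p * damp p k)) summable_on UNIV" for c
    using eval_summable(2)[of c p 0] by simp
  have "(\<lambda>k. mode a k p * damp p k) = (\<lambda>k. mode b k p * damp p k)"
    by (rule trig_series_unique[OF s s]) (use assms[of p] in \<open>simp add: eval_def\<close>)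
  then show "mode a k p = mode b k p" by (metis damp_nz mult_right_cancel of_real_eq_0_iff)
qed

subsection \<open>Multiplication\<close>

text \<open>The correction in the convolution that makes the product of two damped modes a damped mode again.
It is at most 1 by the triangle inequality \<open>\<bar>j + l\<bar> \<le> \<bar>j\<bar> + \<bar>l\<bar>\<close>, which is the reason why the norm is
submultiplicative.\<close>

definition conv_weight :: "param \<Rightarrow> int \<Rightarrow> int \<Rightarrow> real" where
  "conv_weight p j l = exp (- (\<bar>fst p\<bar> * (\<bar>real_of_int j\<bar> + \<bar>real_of_int l\<bar> - \<bar>real_of_int (j + l)\<bar>)))"

lemma conv_weight: "conv_weight p j l * damp p (j + l) = damp p j * damp p l"
  unfolding conv_weight_def damp_def by (simp add: exp_add[symmetric] algebra_simps)

lemma conv_weight_bounds: "0 < conv_weight p j l" "conv_weight p j l \<le> 1"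
  unfolding conv_weight_def by auto

definition conv_term :: "int \<Rightarrow> int \<Rightarrow> (param \<Rightarrow>\<^sub>C complex) \<Rightarrow> (param \<Rightarrow>\<^sub>C complex) \<Rightarrow> (param \<Rightarrow>\<^sub>C complex)"
  where "conv_term j l f g = Bcontfun (\<lambda>p. of_real (conv_weight p j l) * f p * g p)"

lemma apply_Bcontfun:
  assumes "continuous_on UNIV f" "\<And>x. norm (f x) \<le> B"
  shows "apply_bcontfun (Bcontfun f) x = f x"
  by (subst Bcontfun_inverse[OF bcontfun_normI[OF assms]]) simp

lemma norm_Bcontfun_le:
  assumes "continuous_on UNIV f" "\<And>x. norm (f x) \<le> B"
  shows "norm (Bcontfun f) \<le> B"
  by (rule norm_bound) (simp add: apply_Bcontfun[OF assms] assms)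

lemma apply_conv_term: "conv_term j l f g p = of_real (conv_weight p j l) * f p * g p"
  unfolding conv_term_def
proof (rule apply_Bcontfun)
  show "continuous_on UNIV (\<lambda>p. of_real (conv_weight p j l) * f p * g p)"
    unfolding conv_weight_def by (intro continuous_intros continuous_on_apply_bcontfun)
  fix p
  have "norm (of_real (conv_weight p j l) * f p * g p) = conv_weight p j l * norm (f p) * norm (g p)"
    using conv_weight_bounds[of p j l] by (simp add: norm_mult)
  also have "\<dots> \<le> 1 * norm f * norm g"
    using conv_weight_bounds[of p j l] by (intro mult_mono mult_nonneg_nonneg norm_bounded) auto
  finally show "norm (of_real (conv_weight p j l) * f p * g p) \<le> 1 * norm f * norm g" .
qed

lemma norm_conv_term: "norm (conv_term j l f g) \<le> norm f * norm g"
proof (rule norm_bound)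
  fix p
  have "norm (conv_term j l f g p) = conv_weight p j l * norm (f p) * norm (g p)"
    using conv_weight_bounds[of p j l] by (simp add: apply_conv_term norm_mult)
  also have "\<dots> \<le> 1 * norm f * norm g"
    using conv_weight_bounds[of p j l] by (intro mult_mono mult_nonneg_nonneg norm_bounded) auto
  finally show "norm (conv_term j l f g p) \<le> norm f * norm g" by simp
qed

lemma conv_summable:
  fixes B C :: "int \<Rightarrow> real"
  assumes B: "B summable_on UNIV" and C: "C summable_on UNIV" and pos: "\<And>k. B k \<ge> 0" "\<And>k. C k \<ge> 0"
  shows "(\<lambda>(k, j). B j * C (k - j)) summable_on UNIV \<times> UNIV"
    and "(\<lambda>j. B j * C (k - j)) summable_on UNIV"
    and "(\<lambda>k. \<Sum>\<^sub>\<infinity>j. B j * C (k - j)) summable_on UNIV"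
    and "(\<Sum>\<^sub>\<infinity>k. \<Sum>\<^sub>\<infinity>j. B j * C (k - j)) = infsum B UNIV * infsum C UNIV"
proof -
  have 1: "(\<lambda>(j, l). B j * C l) summable_on UNIV \<times> UNIV"
  proof -
    have "(\<lambda>p. norm (case p of (j, l) \<Rightarrow> B j * C l)) summable_on UNIV \<times> UNIV"
    proof (rule Infinite_Sum.abs_summable_on_Sigma_iff[THEN iffD2], intro conjI ballI)
      show "(\<lambda>l. norm (case (j, l) of (j, l) \<Rightarrow> B j * C l)) summable_on UNIV" for j
        using C pos by (simp add: abs_mult summable_on_cmult_right)
      show "(\<lambda>j. norm (\<Sum>\<^sub>\<infinity>l. norm (case (j, l) of (j, l) \<Rightarrow> B j * C l))) summable_on UNIV"
        using B C pos by (simp add: abs_mult infsum_cmult_right' summable_on_cmult_left infsum_nonneg)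
    qed
    then show ?thesis by (rule abs_summable_summable)
  qed
  have bij: "bij_betw (\<lambda>(k, j). (j, k - j)) (UNIV \<times> UNIV :: (int \<times> int) set) (UNIV \<times> UNIV)"
    by (rule bij_betwI[where g = "\<lambda>(j, l). (j + l, j)"]) auto
  show 2: "(\<lambda>(k, j). B j * C (k - j)) summable_on UNIV \<times> UNIV"
    using summable_on_reindex_bij_betw[OF bij, of "\<lambda>(j, l). B j * C l"] 1 by (simp add: case_prod_unfold)
  show "(\<lambda>j. B j * C (k - j)) summable_on UNIV" for k
    using summable_on_SigmaD1[OF 2, of k] by simp
  show "(\<lambda>k. \<Sum>\<^sub>\<infinity>j. B j * C (k - j)) summable_on UNIV"
    using summable_on_Sigma_banach[OF 2] by simp
  have "(\<Sum>\<^sub>\<infinity>k. \<Sum>\<^sub>\<infinity>j. B j * C (k - j)) = infsum (\<lambda>(k, j). B j * C (k - j)) (UNIV \<times> UNIV)"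
    using infsum_Sigma'_banach[OF 2] by simp
  also have "\<dots> = infsum (\<lambda>(j, l). B j * C l) (UNIV \<times> UNIV)"
    using infsum_reindex_bij_betw[OF bij, of "\<lambda>(j, l). B j * C l"] by (simp add: case_prod_unfold)
  also have "\<dots> = (\<Sum>\<^sub>\<infinity>j. \<Sum>\<^sub>\<infinity>l. B j * C l)"
    using infsum_Sigma'_banach[OF 1] by simp
  also have "\<dots> = infsum B UNIV * infsum C UNIV"
    by (simp add: infsum_cmult_right' infsum_cmult_left')
  finally show "(\<Sum>\<^sub>\<infinity>k. \<Sum>\<^sub>\<infinity>j. B j * C (k - j)) = infsum B UNIV * infsum C UNIV" .
qed

lemma conv_product:
  fixes f g :: "int \<Rightarrow> complex"
  assumes B: "B summable_on UNIV" and C: "C summable_on UNIV"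
    and f: "\<And>k. norm (f k) \<le> B k" and g: "\<And>k. norm (g k) \<le> C k"
  shows "(\<Sum>\<^sub>\<infinity>k. \<Sum>\<^sub>\<infinity>j. f j * g (k - j)) = infsum f UNIV * infsum g UNIV"
proof -
  have pos: "B k \<ge> 0" "C k \<ge> 0" for k using f[of k] g[of k] norm_ge_zero order_trans by blast+
  have bij: "bij_betw (\<lambda>(k, j). (j, k - j)) (UNIV \<times> UNIV :: (int \<times> int) set) (UNIV \<times> UNIV)"
    by (rule bij_betwI[where g = "\<lambda>(j, l). (j + l, j)"]) auto
  have 2: "(\<lambda>(k, j). f j * g (k - j)) summable_on UNIV \<times> UNIV"
    by (rule summable_on_bounded_by(1)[OF conv_summable(1)[OF B C pos]])
       (auto simp: norm_mult intro!: mult_mono f g pos)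
  then have 1: "(\<lambda>(j, l). f j * g l) summable_on UNIV \<times> UNIV"
    using summable_on_reindex_bij_betw[OF bij, of "\<lambda>(j, l). f j * g l"] by (simp add: case_prod_unfold)
  have "(\<Sum>\<^sub>\<infinity>k. \<Sum>\<^sub>\<infinity>j. f j * g (k - j)) = infsum (\<lambda>(k, j). f j * g (k - j)) (UNIV \<times> UNIV)"
    using infsum_Sigma'_banach[OF 2] by simp
  also have "\<dots> = infsum (\<lambda>(j, l). f j * g l) (UNIV \<times> UNIV)"
    using infsum_reindex_bij_betw[OF bij, of "\<lambda>(j, l). f j * g l"] by (simp add: case_prod_unfold)
  also have "\<dots> = (\<Sum>\<^sub>\<infinity>j. \<Sum>\<^sub>\<infinity>l. f j * g l)"
    using infsum_Sigma'_banach[OF 1] by simp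
  also have "\<dots> = infsum f UNIV * infsum g UNIV"
    by (simp add: infsum_cmult_right' infsum_cmult_left')
  finally show ?thesis .
qed

lemma conv_terms_summable:
  "(\<lambda>j. conv_term j (k - j) (mode a j) (mode b (k - j))) summable_on UNIV"
  "norm (\<Sum>\<^sub>\<infinity>j. conv_term j (k - j) (mode a j) (mode b (k - j))) \<le> (\<Sum>\<^sub>\<infinity>j. norm (mode a j) * norm (mode b (k - j)))"
  by (rule summable_on_bounded_by[OF conv_summable(2)[OF mode_summable mode_summable] norm_conv_term]; simp)+

instantiation wiener :: "{times, one}"
begin

definition times_wiener :: "wiener \<Rightarrow> wiener \<Rightarrow> wiener" where
  "times_wiener a b = Wiener (\<lambda>k. \<Sum>\<^sub>\<infinity>j. conv_term j (k - j) (mode a j) (mode b (k - j)))"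

lift_definition one_wiener :: wiener is "\<lambda>k. if k = 0 then const_bcontfun 1 else 0"
  by (rule finite_nonzero_values_imp_summable_on, rule finite_subset[of _ "{0}"]) auto

instance ..
end

lemma mode_times:
  "mode (a * b) k = (\<Sum>\<^sub>\<infinity>j. conv_term j (k - j) (mode a j) (mode b (k - j)))"
proof -
  have "(\<lambda>k. norm (\<Sum>\<^sub>\<infinity>j. conv_term j (k - j) (mode a j) (mode b (k - j)))) summable_on UNIV"
    by (rule summable_on_bounded_by(3)[OF conv_summable(3)[OF mode_summable[of a] mode_summable[of b]]])
       (use conv_terms_summable in auto)
  then show ?thesis unfolding times_wiener_def by (subst Wiener_inverse) auto
qed

lemma norm_times_wiener: "norm (a * b :: wiener) \<le> norm a * norm b"
proof -
  have "norm (a * b) \<le> (\<Sum>\<^sub>\<infinity>k. \<Sum>\<^sub>\<infinity>j. norm (mode a j) * norm (mode b (k - j)))"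
    by (rule norm_wiener_le)
       (use conv_terms_summable(2) conv_summable(3)[OF mode_summable[of a] mode_summable[of b]] in \<open>auto simp: mode_times\<close>)
  also have "\<dots> = norm a * norm b"
    unfolding norm_wiener_def by (rule conv_summable(4)[OF mode_summable mode_summable]) auto
  finally show ?thesis .
qed

lemma bounded_linear_apply_bcontfun:
  "bounded_linear (\<lambda>f :: 'a::metric_space \<Rightarrow>\<^sub>C 'b::real_normed_vector. f p)"
  by (rule bounded_linear_intro[of _ 1]) (auto simp: norm_bounded)

lemma eval_times: "eval p x (a * b) = eval p x a * eval p x b"
proof -
  let ?F = "\<lambda>a k. mode a k p * damp p k * cis (of_int k * x)"
  have "eval p x (a * b) = (\<Sum>\<^sub>\<infinity>k. \<Sum>\<^sub>\<infinity>j. ?F a j * ?F b (k - j))"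
    unfolding eval_def
  proof (rule infsum_cong)
    fix k :: int
    have "mode (a * b) k p = (\<Sum>\<^sub>\<infinity>j. conv_term j (k - j) (mode a j) (mode b (k - j)) p)"
      unfolding mode_times
      using has_sum_bounded_linear[OF bounded_linear_apply_bcontfun has_sum_infsum[OF conv_terms_summable(1)[of k a b]], of p]
      by (rule infsumI[symmetric])
    then have "mode (a * b) k p * damp p k * cis (of_int k * x)
       = (\<Sum>\<^sub>\<infinity>j. conv_term j (k - j) (mode a j) (mode b (k - j)) p * (of_real (damp p k) * cis (of_int k * x)))"
      by (simp add: infsum_cmult_left' mult.assoc)
    also have "\<dots> = (\<Sum>\<^sub>\<infinity>j. ?F a j * ?F b (k - j))"
    proof (rule infsum_cong)
      fix j :: int
      have "complex_of_real (conv_weight p j (k - j)) * damp p k = complex_of_real (damp p j) * damp p (k - j)"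
        using conv_weight[of p j "k - j"] by (simp flip: of_real_mult)
      moreover have "cis (of_int k * x) = cis (of_int j * x) * cis (of_int (k - j) * x)"
        by (simp add: cis_mult algebra_simps)
      ultimately show "conv_term j (k - j) (mode a j) (mode b (k - j)) p * (of_real (damp p k) * cis (of_int k * x)) = ?F a j * ?F b (k - j)"
        unfolding apply_conv_term by (simp add: algebra_simps)
    qed
    finally show "mode (a * b) k p * damp p k * cis (of_int k * x) = (\<Sum>\<^sub>\<infinity>j. ?F a j * ?F b (k - j))" .
  qed
  also have "\<dots> = eval p x a * eval p x b"
    unfolding eval_def
    by (rule conv_product[OF mode_summable[of a] mode_summable[of b] norm_eval_term norm_eval_term])
  finally show ?thesis .
qed

lemma eval_one: "eval p x 1 = 1"
proof -
  have "eval p x 1 = (\<Sum>\<^sub>\<infinity>k\<in>{0}. mode 1 k p * damp p k * cis (of_int k * x))"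
    unfolding eval_def by (rule infsum_cong_neutral) (auto simp: one_wiener.rep_eq)
  then show ?thesis by (simp add: one_wiener.rep_eq)
qed

lemmas eval_simps = eval_add eval_minus eval_uminus eval_zero eval_one eval_times eval_scaleR

text \<open>Evaluation is multiplicative, so the ring laws hold in the algebra because they hold for its values.\<close>

instance wiener :: "{real_normed_algebra_1, comm_ring_1}"
proof
  fix a b c :: wiener and r :: real
  show "norm (a * b) \<le> norm a * norm b" by (rule norm_times_wiener)
  show one: "norm (1 :: wiener) = 1"
  proof -
    have "norm (1 :: wiener) = (\<Sum>\<^sub>\<infinity>k\<in>{0}. norm (mode 1 k))"
      unfolding norm_wiener_def by (rule infsum_cong_neutral) (auto simp: one_wiener.rep_eq)
    moreover have "norm (const_bcontfun 1 :: param \<Rightarrow>\<^sub>C complex) = 1"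
      by (rule antisym[OF norm_bound]) (use norm_bounded[of "const_bcontfun 1 :: param \<Rightarrow>\<^sub>C complex" "(0,0,0)"] in auto)
    ultimately show ?thesis by (simp add: one_wiener.rep_eq)
  qed
  then show "(0 :: wiener) \<noteq> 1" by (metis norm_zero zero_neq_one)
qed (auto intro!: eval_injective simp: eval_simps algebra_simps)

section \<open>Power series and Fourier multipliers in the algebra\<close>

text \<open>Only series with coefficients bounded by 1 are used, and only at arguments of norm at most 1/2: a
geometric series then bounds the sum and its Lipschitz constant, for real and complex numbers and
for elements of the algebra alike.\<close>

definition pser :: "(nat \<Rightarrow> real) \<Rightarrow> 'a::{real_normed_algebra_1,banach} \<Rightarrow> 'a" where
  "pser a x = (\<Sum>n. a n *\<^sub>R x ^ n)"

lemma pser_summable: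
  fixes x :: "'a::{real_normed_algebra_1,banach}"
  assumes "\<And>n. \<bar>a n\<bar> \<le> 1" "norm x \<le> 1/2"
  shows "summable (\<lambda>n. norm (a n *\<^sub>R x ^ n))" "summable (\<lambda>n. a n *\<^sub>R x ^ n)"
    "norm (a n *\<^sub>R x ^ n) \<le> (1/2) ^ n"
proof -
  show le: "norm (a n *\<^sub>R x ^ n) \<le> (1/2) ^ n" for n
  proof -
    have "norm (a n *\<^sub>R x ^ n) = \<bar>a n\<bar> * norm (x ^ n)" by simp
    also have "\<dots> \<le> 1 * (1/2) ^ n"
      by (intro mult_mono assms order_trans[OF norm_power_ineq] power_mono) auto
    finally show ?thesis by simp
  qed
  show *: "summable (\<lambda>n. norm (a n *\<^sub>R x ^ n))"
    by (rule summable_comparison_test'[of "\<lambda>n. (1/2) ^ n" 0]) (use le in auto)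
  then show "summable (\<lambda>n. a n *\<^sub>R x ^ n)" by (rule summable_norm_cancel)
qed

lemma norm_pser_le:
  fixes x :: "'a::{real_normed_algebra_1,banach}"
  assumes "\<And>n. \<bar>a n\<bar> \<le> 1" "norm x \<le> 1/2"
  shows "norm (pser a x) \<le> 2"
proof -
  have "norm (pser a x) \<le> (\<Sum>n. norm (a n *\<^sub>R x ^ n))"
    unfolding pser_def by (rule summable_norm) (rule pser_summable[OF assms])
  also have "\<dots> \<le> (\<Sum>n. (1/2) ^ n)"
    by (rule suminf_le) (use pser_summable[OF assms] in \<open>auto intro!: summable_geometric\<close>)
  also have "\<dots> = 2" by (simp add: suminf_geometric)
  finally show ?thesis .
qed

definition pser_lip :: real where "pser_lip = (\<Sum>n. real n * (1/2) ^ n * 2)"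

lemma pser_lipschitz:
  fixes x y :: "'a::{real_normed_algebra_1,comm_ring_1,banach}"
  assumes a: "\<And>n. \<bar>a n\<bar> \<le> 1" and x: "norm x \<le> 1/2" and y: "norm y \<le> 1/2"
  shows "norm (pser a x - pser a y) \<le> pser_lip * norm (x - y)"
proof -
  have s: "summable (\<lambda>n. real n * (1/2) ^ n)"
    by (rule summable_comparison_test'[OF sums_summable[OF geometric_deriv_sums[of "1/2 :: real"]], of 0]) auto
  have le: "norm (a n *\<^sub>R x ^ n - a n *\<^sub>R y ^ n) \<le> real n * (1/2) ^ n * 2 * norm (x - y)" for n
  proof -
    have "norm ((2 *\<^sub>R x) ^ n - (2 *\<^sub>R y) ^ n) \<le> real n * norm (2 *\<^sub>R x - 2 *\<^sub>R y)"
      by (rule norm_power_diff) (use x y in auto)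
    then have "2 ^ n * norm (x ^ n - y ^ n) \<le> real n * (2 * norm (x - y))"
      by (simp flip: scaleR_right_diff_distrib)
    then have "norm (x ^ n - y ^ n) \<le> real n * (1/2) ^ n * 2 * norm (x - y)"
      by (simp add: field_simps power_divide)
    moreover have "norm (a n *\<^sub>R x ^ n - a n *\<^sub>R y ^ n) \<le> 1 * norm (x ^ n - y ^ n)"
      unfolding scaleR_right_diff_distrib[symmetric] norm_scaleR by (rule mult_right_mono) (use a in auto)
    ultimately show ?thesis by simp
  qed
  have "norm (pser a x - pser a y) = norm (\<Sum>n. a n *\<^sub>R x ^ n - a n *\<^sub>R y ^ n)"
    unfolding pser_def by (subst suminf_diff) (use pser_summable a x y in auto)
  also have "\<dots> \<le> (\<Sum>n. real n * (1/2) ^ n * 2 * norm (x - y))"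
    by (rule norm_suminf_le[OF le]) (intro summable_mult2 s)
  also have "\<dots> = pser_lip * norm (x - y)"
    unfolding pser_lip_def by (rule suminf_mult2[symmetric]) (intro summable_mult2 s)
  finally show ?thesis .
qed

lemma eval_power: "eval p x (a ^ n) = eval p x a ^ n"
  by (induction n) (simp_all add: eval_simps)

lemma eval_pser:
  assumes "\<And>n. \<bar>a n\<bar> \<le> 1" "norm w \<le> 1/2"
  shows "eval p x (pser a w) = pser a (eval p x w)"
  unfolding pser_def
  using bounded_linear.suminf[OF bounded_linear_eval pser_summable(2)[OF assms], of p x]
  by (simp add: eval_scaleR eval_power)

lemma pser_of_real:
  fixes x :: real
  assumes "\<And>n. \<bar>a n\<bar> \<le> 1" "\<bar>x\<bar> \<le> 1/2"
  shows "pser a (complex_of_real x) = complex_of_real (pser a x)"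
proof -
  have "summable (\<lambda>n. a n *\<^sub>R x ^ n)" by (rule pser_summable(2)) (use assms in auto)
  from suminf_of_real[OF this, where 'a = complex]
  show ?thesis unfolding pser_def by (simp add: scaleR_conv_of_real)
qed

text \<open>The Taylor coefficients of \<open>2 (cosh x - 1) / x\<^sup>2\<close>, \<open>sinh x / x\<close>, \<open>ln (1 + x) / x\<close> and \<open>1 / (1 + x)\<close>.\<close>

definition cosh_coeff :: "nat \<Rightarrow> real" where "cosh_coeff n = (if even n then 2 / fact (n + 2) else 0)"
definition sinh_coeff :: "nat \<Rightarrow> real" where "sinh_coeff n = (if even n then 1 / fact (n + 1) else 0)"
definition ln_coeff :: "nat \<Rightarrow> real" where "ln_coeff n = (-1) ^ n / real (n + 1)"
definition inv_coeff :: "nat \<Rightarrow> real" where "inv_coeff n = (-1) ^ n"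

lemma fact_ge_2: "(2::real) \<le> fact (n + 2)"
proof -
  have "fact 2 \<le> (fact (n + 2) :: real)" by (rule fact_mono) simp
  then show ?thesis by simp
qed

lemma coeff_bounds:
  "\<bar>cosh_coeff n\<bar> \<le> 1" "\<bar>sinh_coeff n\<bar> \<le> 1" "\<bar>ln_coeff n\<bar> \<le> 1" "\<bar>inv_coeff n\<bar> \<le> 1"
  using fact_ge_2[of n] fact_ge_1[of "n+1", where 'a = real]
  by (auto simp: cosh_coeff_def sinh_coeff_def ln_coeff_def inv_coeff_def power_abs divide_le_eq_1)

lemma pser_cosh:
  fixes x :: real assumes "\<bar>x\<bar> \<le> 1/2"
  shows "x ^ 2 * pser cosh_coeff x = 2 * (cosh x - 1)"
proof -
  have "(\<lambda>n. if even n then x ^ n /\<^sub>R fact n else 0) sums cosh x" by (rule cosh_converges)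
  then have "(\<lambda>n. if even (n + 2) then x ^ (n + 2) /\<^sub>R fact (n + 2) else 0) sums (cosh x - 1)"
    using sums_split_initial_segment[of "\<lambda>n. if even n then x ^ n /\<^sub>R fact n else 0" "cosh x" 2]
    by (simp add: numeral_2_eq_2 lessThan_Suc)
  then have "(\<lambda>n. 2 * (if even (n + 2) then x ^ (n + 2) /\<^sub>R fact (n + 2) else 0)) sums (2 * (cosh x - 1))"
    by (rule sums_mult)
  moreover have "(\<lambda>n. 2 * (if even (n + 2) then x ^ (n + 2) /\<^sub>R fact (n + 2) else 0)) = (\<lambda>n. x ^ 2 * (cosh_coeff n *\<^sub>R x ^ n))"
    by (auto simp: cosh_coeff_def fun_eq_iff power2_eq_square divide_inverse)
  ultimately have "(\<lambda>n. x ^ 2 * (cosh_coeff n *\<^sub>R x ^ n)) sums (2 * (cosh x - 1))" by simp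
  moreover have "(\<lambda>n. x ^ 2 * (cosh_coeff n *\<^sub>R x ^ n)) sums (x ^ 2 * pser cosh_coeff x)"
    unfolding pser_def by (intro sums_mult summable_sums pser_summable(2)) (use assms coeff_bounds in auto)
  ultimately show ?thesis using sums_unique2 by blast
qed

lemma pser_sinh:
  fixes x :: real assumes "\<bar>x\<bar> \<le> 1/2"
  shows "x * pser sinh_coeff x = sinh x"
proof -
  have "(\<lambda>n. if even n then 0 else x ^ n /\<^sub>R fact n) sums sinh x" by (rule sinh_converges)
  then have "(\<lambda>n. if even (n + 1) then 0 else x ^ (n + 1) /\<^sub>R fact (n + 1)) sums sinh x"
    using sums_split_initial_segment[of "\<lambda>n. if even n then 0 else x ^ n /\<^sub>R fact n" "sinh x" 1] by simp
  moreover have "(\<lambda>n. if even (n + 1) then 0 else x ^ (n + 1) /\<^sub>R fact (n + 1)) = (\<lambda>n. x * (sinh_coeff n *\<^sub>R x ^ n))"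
    by (auto simp: sinh_coeff_def fun_eq_iff divide_inverse)
  ultimately have "(\<lambda>n. x * (sinh_coeff n *\<^sub>R x ^ n)) sums sinh x" by simp
  moreover have "(\<lambda>n. x * (sinh_coeff n *\<^sub>R x ^ n)) sums (x * pser sinh_coeff x)"
    unfolding pser_def by (intro sums_mult summable_sums pser_summable(2)) (use assms coeff_bounds in auto)
  ultimately show ?thesis using sums_unique2 by blast
qed

lemma pser_ln:
  fixes x :: real assumes "\<bar>x\<bar> \<le> 1/2"
  shows "x * pser ln_coeff x = ln (1 + x)"
proof -
  have "ln (1 + x) = (\<Sum>n. (- 1) ^ n * (1 / real (n + 1)) * (1 + x - 1) ^ Suc n)"
    by (rule ln_series) (use assms in auto)
  also have "\<dots> = (\<Sum>n. x * (ln_coeff n *\<^sub>R x ^ n))" by (simp add: ln_coeff_def mult_ac)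
  also have "\<dots> = x * pser ln_coeff x"
    unfolding pser_def by (intro suminf_mult pser_summable(2)) (use assms coeff_bounds in auto)
  finally show ?thesis by simp
qed

lemma pser_inv:
  fixes x :: real assumes "\<bar>x\<bar> \<le> 1/2"
  shows "pser inv_coeff x = 1 / (1 + x)"
proof -
  have "pser inv_coeff x = (\<Sum>n. (- x) ^ n)" unfolding pser_def inv_coeff_def by (simp add: power_minus[of x])
  also have "\<dots> = 1 / (1 - (- x))" by (rule suminf_geometric) (use assms in auto)
  finally show ?thesis by simp
qed

subsection \<open>Scalars and multipliers\<close>

lift_definition scal :: "(param \<Rightarrow>\<^sub>C complex) \<Rightarrow> wiener" is "\<lambda>f k. if k = 0 then f else 0"
  by (rule finite_nonzero_values_imp_summable_on, rule finite_subset[of _ "{0}"]) auto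

lemma eval_scal: "eval p x (scal f) = f p"
proof -
  have "eval p x (scal f) = (\<Sum>\<^sub>\<infinity>k\<in>{0}. mode (scal f) k p * damp p k * cis (of_int k * x))"
    unfolding eval_def by (rule infsum_cong_neutral) (auto simp: scal.rep_eq)
  then show ?thesis by (simp add: scal.rep_eq)
qed

lemma norm_scal: "norm (scal f) = norm f"
proof -
  have "norm (scal f) = (\<Sum>\<^sub>\<infinity>k\<in>{0}. norm (mode (scal f) k))"
    unfolding norm_wiener_def by (rule infsum_cong_neutral) (auto simp: scal.rep_eq)
  then show ?thesis by (simp add: scal.rep_eq)
qed

definition multiplier :: "(int \<Rightarrow> param \<Rightarrow> complex) \<Rightarrow> wiener \<Rightarrow> wiener" where
  "multiplier m b = Wiener (\<lambda>k. Bcontfun (\<lambda>p. m k p * mode b k p))"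

locale multiplier_bound =
  fixes m :: "int \<Rightarrow> param \<Rightarrow> complex" and C :: real
  assumes cont: "\<And>k. continuous_on UNIV (m k)" and bound: "\<And>k p. norm (m k p) \<le> C"
begin

lemma C_nonneg: "C \<ge> 0" using bound[of 0 "(0,0,0)"] norm_ge_zero order_trans by blast

lemma bcont: "continuous_on UNIV (\<lambda>p. m k p * mode b k p)" "norm (m k p * mode b k p) \<le> C * norm (mode b k)"
  by (intro continuous_intros cont continuous_on_apply_bcontfun)
     (auto simp: norm_mult intro!: mult_mono bound norm_bounded C_nonneg)

lemma mode_multiplier: "mode (multiplier m b) k p = m k p * mode b k p"
proof -
  have "(\<lambda>k. norm (Bcontfun (\<lambda>p. m k p * mode b k p))) summable_on UNIV"
    by (rule summable_on_bounded_by(1)[OF summable_on_cmult_right[OF mode_summable]])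
       (use norm_Bcontfun_le[OF bcont] in auto)
  then have "mode (multiplier m b) k = Bcontfun (\<lambda>p. m k p * mode b k p)"
    unfolding multiplier_def by (subst Wiener_inverse) auto
  then show ?thesis using apply_Bcontfun[OF bcont] by simp
qed

lemma norm_multiplier: "norm (multiplier m b) \<le> C * norm b"
  by (rule norm_wiener_leI, rule norm_bound) (simp add: mode_multiplier bcont)

lemma multiplier_diff: "multiplier m (a - b) = multiplier m a - multiplier m b"
  by (intro wiener_eqI bcontfun_eqI) (simp add: mode_multiplier algebra_simps)

lemma multiplier_zero: "multiplier m 0 = 0"
  using multiplier_diff[of 0 0] by simp

end

subsection \<open>Maps that are bounded and Lipschitz on a ball\<close>

text \<open>The nonlinearity is assembled from maps of this kind, so that its Lipschitz bound is read off from
its shape.  The radius 1/4 keeps every argument of a power series below 1/2.\<close>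

definition tame :: "(wiener \<Rightarrow> wiener) \<Rightarrow> bool" where
  "tame u \<longleftrightarrow> (\<exists>A. \<forall>g g'. norm g \<le> 1/4 \<longrightarrow> norm g' \<le> 1/4 \<longrightarrow>
     norm (u g) \<le> A \<and> norm (u g - u g') \<le> A * norm (g - g'))"

lemma tameE:
  assumes "tame u"
  obtains A where "A \<ge> 0" "\<And>g. norm g \<le> 1/4 \<Longrightarrow> norm (u g) \<le> A"
    "\<And>g g'. norm g \<le> 1/4 \<Longrightarrow> norm g' \<le> 1/4 \<Longrightarrow> norm (u g - u g') \<le> A * norm (g - g')"
proof -
  obtain A where A: "\<forall>g g'. norm g \<le> 1/4 \<longrightarrow> norm g' \<le> 1/4 \<longrightarrow>
     norm (u g) \<le> A \<and> norm (u g - u g') \<le> A * norm (g - g')" using assms unfolding tame_def by blast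
  have "norm (u 0) \<le> A" using A[rule_format, of 0 0] by simp
  then have "A \<ge> 0" using norm_ge_zero order_trans by blast
  then show thesis using A by (intro that[of A]) auto
qed

lemma tameI:
  assumes "\<And>g. norm g \<le> 1/4 \<Longrightarrow> norm (u g) \<le> A"
    "\<And>g g'. norm g \<le> 1/4 \<Longrightarrow> norm g' \<le> 1/4 \<Longrightarrow> norm (u g - u g') \<le> B * norm (g - g')"
  shows "tame u"
  unfolding tame_def
proof (intro exI[of _ "max A B"] allI impI conjI)
  fix g g' :: wiener assume g: "norm g \<le> 1/4" "norm g' \<le> 1/4"
  show "norm (u g) \<le> max A B" using assms(1)[OF g(1)] by simp
  have "norm (u g - u g') \<le> B * norm (g - g')" by (rule assms(2)[OF g])
  also have "\<dots> \<le> max A B * norm (g - g')" by (rule mult_right_mono) auto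
  finally show "norm (u g - u g') \<le> max A B * norm (g - g')" .
qed

lemma tame_const: "tame (\<lambda>_. c)"
  by (rule tameI[of _ "norm c" 0]) auto

lemma tame_id: "tame (\<lambda>g. g)"
  by (rule tameI[of _ "1/4" 1]) auto

lemma tame_add: assumes "tame u" "tame v" shows "tame (\<lambda>g. u g + v g)"
proof -
  obtain A where A: "A \<ge> 0" "\<And>g. norm g \<le> 1/4 \<Longrightarrow> norm (u g) \<le> A"
    "\<And>g g'. norm g \<le> 1/4 \<Longrightarrow> norm g' \<le> 1/4 \<Longrightarrow> norm (u g - u g') \<le> A * norm (g - g')"
    using tameE[OF assms(1)] by blast
  obtain B where B: "B \<ge> 0" "\<And>g. norm g \<le> 1/4 \<Longrightarrow> norm (v g) \<le> B"
    "\<And>g g'. norm g \<le> 1/4 \<Longrightarrow> norm g' \<le> 1/4 \<Longrightarrow> norm (v g - v g') \<le> B * norm (g - g')"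
    using tameE[OF assms(2)] by blast
  show ?thesis
  proof (rule tameI[of _ "A + B" "A + B"])
    fix g g' :: wiener assume g: "norm g \<le> 1/4"
    show "norm (u g + v g) \<le> A + B" by (rule norm_triangle_le) (use A(2)[OF g] B(2)[OF g] in simp)
    assume g': "norm g' \<le> 1/4"
    have "norm (u g + v g - (u g' + v g')) \<le> norm (u g - u g') + norm (v g - v g')"
      using norm_triangle_ineq[of "u g - u g'" "v g - v g'"] by (simp add: algebra_simps)
    then show "norm (u g + v g - (u g' + v g')) \<le> (A + B) * norm (g - g')"
      using A(3)[OF g g'] B(3)[OF g g'] by (simp add: algebra_simps)
  qed
qed

lemma norm_mult_diff_le:
  fixes a b a' b' :: "'a::real_normed_algebra"
  assumes "norm a \<le> A" "norm b' \<le> B" "norm (a - a') \<le> dA" "norm (b - b') \<le> dB"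
  shows "norm (a * b - a' * b') \<le> A * dB + dA * B"
proof -
  have "a * b - a' * b' = a * (b - b') + (a - a') * b'" by (simp add: algebra_simps)
  then have "norm (a * b - a' * b') \<le> norm (a * (b - b')) + norm ((a - a') * b')"
    by (metis norm_triangle_ineq)
  also have "\<dots> \<le> norm a * norm (b - b') + norm (a - a') * norm b'"
    by (intro add_mono norm_mult_ineq)
  also have "\<dots> \<le> A * dB + dA * B"
    using assms by (intro add_mono mult_mono) (auto intro: order_trans[OF norm_ge_zero])
  finally show ?thesis .
qed

lemma tame_mult: assumes "tame u" "tame v" shows "tame (\<lambda>g. u g * v g)"
proof -
  obtain A where A: "A \<ge> 0" "\<And>g. norm g \<le> 1/4 \<Longrightarrow> norm (u g) \<le> A"
    "\<And>g g'. norm g \<le> 1/4 \<Longrightarrow> norm g' \<le> 1/4 \<Longrightarrow> norm (u g - u g') \<le> A * norm (g - g')"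
    using tameE[OF assms(1)] by blast
  obtain B where B: "B \<ge> 0" "\<And>g. norm g \<le> 1/4 \<Longrightarrow> norm (v g) \<le> B"
    "\<And>g g'. norm g \<le> 1/4 \<Longrightarrow> norm g' \<le> 1/4 \<Longrightarrow> norm (v g - v g') \<le> B * norm (g - g')"
    using tameE[OF assms(2)] by blast
  show ?thesis
  proof (rule tameI[of _ "A * B" "A * B + A * B"])
    fix g g' :: wiener assume g: "norm g \<le> 1/4"
    show "norm (u g * v g) \<le> A * B"
      by (rule order_trans[OF norm_mult_ineq]) (intro mult_mono A(2)[OF g] B(2)[OF g] A(1) norm_ge_zero)
    assume g': "norm g' \<le> 1/4"
    have "norm (u g * v g - u g' * v g') \<le> A * (B * norm (g - g')) + (A * norm (g - g')) * B"
      by (rule norm_mult_diff_le) (use A B g g' in auto)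
    then show "norm (u g * v g - u g' * v g') \<le> (A * B + A * B) * norm (g - g')"
      by (simp add: algebra_simps)
  qed
qed

lemma tame_diff: assumes "tame u" "tame v" shows "tame (\<lambda>g. u g - v g)"
  using tame_add[OF assms(1) tame_mult[OF tame_const[of "- 1"] assms(2)]] by simp

lemma tame_multiplier: assumes "multiplier_bound m C" shows "tame (multiplier m)"
proof -
  interpret multiplier_bound m C by fact
  show ?thesis
  proof (rule tameI[of _ "C * (1/4)" C])
    show "norm (multiplier m g) \<le> C * (1/4)" if "norm g \<le> 1/4" for g
      by (rule order_trans[OF norm_multiplier mult_left_mono[OF that C_nonneg]])
    show "norm (multiplier m g - multiplier m g') \<le> C * norm (g - g')" for g g'
      using norm_multiplier[of "g - g'"] by (simp add: multiplier_diff)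
  qed
qed

lemma tame_pser:
  assumes a: "\<And>n. \<bar>a n\<bar> \<le> 1" and u: "tame u" and s: "\<And>g. norm g \<le> 1/4 \<Longrightarrow> norm (u g) \<le> 1/2"
  shows "tame (\<lambda>g. pser a (u g))"
proof -
  obtain A where "A \<ge> 0" "\<And>g. norm g \<le> 1/4 \<Longrightarrow> norm (u g) \<le> A"
    and A: "\<And>g g'. norm g \<le> 1/4 \<Longrightarrow> norm g' \<le> 1/4 \<Longrightarrow> norm (u g - u g') \<le> A * norm (g - g')"
    using tameE[OF u] by blast
  have "0 \<le> pser_lip * norm (1/2 - 0 :: real)"
    by (rule order_trans[OF norm_ge_zero pser_lipschitz[of "\<lambda>_. 0"]]) auto
  then have L: "pser_lip \<ge> 0" by simp
  show ?thesis
  proof (rule tameI[of _ 2 "pser_lip * A"])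
    fix g g' :: wiener assume g: "norm g \<le> 1/4"
    show "norm (pser a (u g)) \<le> 2" by (rule norm_pser_le[OF a s[OF g]])
    assume g': "norm g' \<le> 1/4"
    have "norm (pser a (u g) - pser a (u g')) \<le> pser_lip * norm (u g - u g')"
      by (rule pser_lipschitz[OF a s[OF g] s[OF g']])
    also have "\<dots> \<le> pser_lip * (A * norm (g - g'))" by (rule mult_left_mono[OF A[OF g g'] L])
    finally show "norm (pser a (u g) - pser a (u g')) \<le> pser_lip * A * norm (g - g')" by simp
  qed
qed

section \<open>The nonlinearity as an element of the algebra\<close>

text \<open>The quotient \<open>(1 - exp (- \<i> k s)) / (1 - exp (- \<i> s))\<close>, written as a finite sum so that it is continuous
also where the denominator vanishes.\<close>

definition dirichlet :: "int \<Rightarrow> real \<Rightarrow> complex" where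
  "dirichlet k s = (if k \<ge> 0 then (\<Sum>j<nat k. cis (- s) ^ j) else - (\<Sum>j<nat (- k). cis s ^ Suc j))"

lemma dirichlet_mult: "dirichlet k s * (1 - cis (- s)) = 1 - cis (- (of_int k * s))"
proof (cases "k \<ge> 0")
  case True
  have "cis (- s) ^ nat k = cis (- (of_int k * s))"
    using True by (simp add: Complex.DeMoivre)
  then show ?thesis
    using True one_diff_power_eq[of "cis (- s)" "nat k"] by (simp add: dirichlet_def mult.commute)
next
  case False
  have c: "cis s ^ nat (- k) = cis (- (of_int k * s))"
    using False by (simp add: Complex.DeMoivre)
  have cc: "cis s * cis (- s) = 1" by (simp add: cis_mult)
  have "dirichlet k s * (1 - cis (- s)) = - (\<Sum>j<nat (- k). cis s ^ j) * (cis s * (1 - cis (- s)))"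
    using False by (simp add: dirichlet_def sum_distrib_right sum_distrib_left mult_ac)
  also have "\<dots> = (1 - cis s) * (\<Sum>j<nat (- k). cis s ^ j)"
    using cc by (simp add: algebra_simps)
  also have "\<dots> = 1 - cis s ^ nat (- k)" by (rule one_diff_power_eq[symmetric])
  finally show ?thesis unfolding c .
qed

lemma norm_dirichlet: "norm (dirichlet k s) \<le> \<bar>real_of_int k\<bar>"
proof (cases "k \<ge> 0")
  case True
  have "norm (\<Sum>j<nat k. cis (- s) ^ j) \<le> (\<Sum>j<nat k. 1)"
    by (rule sum_norm_le) (simp add: norm_power)
  then show ?thesis using True by (simp add: dirichlet_def)
next
  case False
  have "norm (\<Sum>j<nat (- k). cis s ^ Suc j) \<le> (\<Sum>j<nat (- k). 1)"
    by (rule sum_norm_le) (simp add: norm_power norm_mult)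
  then show ?thesis using False by (simp add: dirichlet_def)
qed

lemma continuous_on_dirichlet [continuous_intros]:
  assumes "continuous_on A f" shows "continuous_on A (\<lambda>x. dirichlet k (f x))"
  unfolding dirichlet_def by (cases "k \<ge> 0") (auto intro!: continuous_intros assms)

text \<open>Let \<open>f'\<close> be represented in the algebra.  These multipliers turn it into \<open>f' (x - s)\<close>, into
\<open>f (x - s)\<close> without its mean, into \<open>f x - f (x - s)\<close>, and into the latter divided by
\<open>1 - exp (- \<i> s)\<close>.  Dividing by \<open>\<i> k\<close> returns the derivative that separates \<open>f'\<close> from \<open>f\<close>, and the
Dirichlet sum costs one power of \<open>k\<close> at most, so all four are bounded.\<close>

definition shift_mult :: "int \<Rightarrow> param \<Rightarrow> complex" where
  "shift_mult k p = cis (- (of_int k * snd (snd p)))"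
definition prim_mult :: "int \<Rightarrow> param \<Rightarrow> complex" where
  "prim_mult k p = (if k = 0 then 0 else cis (- (of_int k * snd (snd p))) / (\<i> * of_int k))"
definition incr_mult :: "int \<Rightarrow> param \<Rightarrow> complex" where
  "incr_mult k p = (if k = 0 then 0 else (1 - cis (- (of_int k * snd (snd p)))) / (\<i> * of_int k))"
definition quot_mult :: "int \<Rightarrow> param \<Rightarrow> complex" where
  "quot_mult k p = (if k = 0 then 0 else dirichlet k (snd (snd p)) / (\<i> * of_int k))"

lemma abs_int_ge_1: "k \<noteq> 0 \<Longrightarrow> 1 \<le> \<bar>real_of_int k\<bar>"
  by (metis of_int_1_le_iff of_int_abs int_one_le_iff_zero_less zero_less_abs_iff)

interpretation shift: multiplier_bound shift_mult 1
  by standard (auto simp: shift_mult_def intro!: continuous_intros)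

interpretation prim: multiplier_bound prim_mult 1
proof
  show "continuous_on UNIV (prim_mult k)" for k
    unfolding prim_mult_def by (cases "k = 0") (auto intro!: continuous_intros)
  show "norm (prim_mult k p) \<le> 1" for k p
    using abs_int_ge_1[of k] by (auto simp: prim_mult_def norm_divide norm_mult)
qed

interpretation incr: multiplier_bound incr_mult 2
proof
  show "continuous_on UNIV (incr_mult k)" for k
    unfolding incr_mult_def by (cases "k = 0") (auto intro!: continuous_intros)
  show "norm (incr_mult k p) \<le> 2" for k p
  proof (cases "k = 0")
    case False
    let ?z = "1 - cis (- (of_int k * snd (snd p)))"
    have "norm ?z \<le> 2" using norm_triangle_ineq4[of 1 "cis (- (of_int k * snd (snd p)))"] by simp
    moreover have "norm (?z / (\<i> * of_int k)) \<le> norm ?z"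
      using abs_int_ge_1[OF False] by (simp add: norm_divide norm_mult divide_le_eq mult_le_cancel_left1)
    ultimately show ?thesis using False by (simp add: incr_mult_def)
  qed (simp add: incr_mult_def)
qed

interpretation quot: multiplier_bound quot_mult 1
proof
  show "continuous_on UNIV (quot_mult k)" for k
    unfolding quot_mult_def by (cases "k = 0") (auto intro!: continuous_intros)
  show "norm (quot_mult k p) \<le> 1" for k p
    using abs_int_ge_1[of k] norm_dirichlet[of k] by (auto simp: quot_mult_def norm_divide norm_mult)
qed

definition rot :: "param \<Rightarrow>\<^sub>C complex" where "rot = Bcontfun (\<lambda>p. cis (- snd (snd p)))"
definition half_cot :: "param \<Rightarrow>\<^sub>C complex" where
  "half_cot = Bcontfun (\<lambda>p. \<i> / 2 * (1 + cis (- snd (snd p))))"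

lemma rot: "rot p = cis (- snd (snd p))" and norm_rot: "norm rot \<le> 1"
  unfolding rot_def
  by (rule apply_Bcontfun[of _ 1] norm_Bcontfun_le; auto intro!: continuous_intros)+

lemma half_cot: "half_cot p = \<i> / 2 * (1 + cis (- snd (snd p)))"
proof -
  have "norm (1 + cis (- snd (snd p))) \<le> 2" for p :: param
    using norm_triangle_ineq[of 1 "cis (- snd (snd p))"] by simp
  then show ?thesis unfolding half_cot_def
    by (intro apply_Bcontfun[of _ 1]) (auto intro!: continuous_intros simp: norm_mult)
qed

text \<open>Write \<open>\<theta> = f x - f (x - s)\<close> and \<open>D = 2 - 2 cos s\<close>, let \<open>w\<close> represent the amplitude \<open>\<sigma>\<close> and \<open>g\<close> the
slope \<open>f'/\<sigma>\<close>.  Then \<open>\<sigma>\<^sup>2 sq_quot g\<close> is \<open>\<theta>\<^sup>2 / D\<close>, and \<open>ratio w g\<close> is the number \<open>y\<close> in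
\<open>2 (cosh \<theta> - cos s) = D (1 + y)\<close>: the logarithm of the kernel splits into \<open>ln D + ln (1 + y)\<close> and its
denominator into \<open>D\<close> times \<open>1 + y\<close>, and each singular factor \<open>1 / D\<close> is absorbed by a difference quotient
of \<open>f\<close>.  What remains is a power series in the algebra.\<close>

definition sq_quot :: "wiener \<Rightarrow> wiener" where
  "sq_quot g = - (scal rot * (multiplier quot_mult g * multiplier quot_mult g))"
definition cosh_fac :: "wiener \<Rightarrow> wiener \<Rightarrow> wiener" where
  "cosh_fac w g = pser cosh_coeff (w * multiplier incr_mult g)"
definition sinh_fac :: "wiener \<Rightarrow> wiener \<Rightarrow> wiener" where
  "sinh_fac w g = pser sinh_coeff (w * multiplier incr_mult g)"
definition ratio :: "wiener \<Rightarrow> wiener \<Rightarrow> wiener" where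
  "ratio w g = w * w * (sq_quot g * cosh_fac w g)"
definition slopes :: "wiener \<Rightarrow> wiener \<Rightarrow> wiener" where
  "slopes w g = w * w * (g * multiplier shift_mult g)"
definition cofactor :: "wiener \<Rightarrow> wiener \<Rightarrow> wiener" where
  "cofactor w g =
     sq_quot g * cosh_fac w g * pser ln_coeff (ratio w g) * (1 + slopes w g)
     + 2 *\<^sub>R (sq_quot g * sinh_fac w g * pser inv_coeff (ratio w g) * (slopes w g - 1))
     + 2 *\<^sub>R (scal half_cot * multiplier quot_mult g * pser inv_coeff (ratio w g) * (g + multiplier shift_mult g))"
definition nonlin_log :: "wiener \<Rightarrow> wiener" where
  "nonlin_log g = multiplier prim_mult g * (g * multiplier shift_mult g)"
definition nonlin_reg :: "wiener \<Rightarrow> wiener \<Rightarrow> wiener" where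
  "nonlin_reg w g = multiplier prim_mult g * cofactor w g"

lemma norm_mult_le:
  fixes a b :: "'a::real_normed_algebra"
  assumes "norm a \<le> A" "norm b \<le> B" shows "norm (a * b) \<le> A * B"
  by (rule order_trans[OF norm_mult_ineq mult_mono[OF assms]])
     (use assms order_trans[OF norm_ge_zero] in auto)

lemma norm_incr_le:
  assumes "norm w \<le> 1" "norm g \<le> 1/4"
  shows "norm (w * multiplier incr_mult g) \<le> 1/2"
proof -
  have "norm (w * multiplier incr_mult g) \<le> 1 * (2 * (1/4))"
    by (rule norm_mult_le) (use assms incr.norm_multiplier[of g] in auto)
  then show ?thesis by simp
qed

lemma norm_ratio_le:
  assumes w: "norm w \<le> 1" and g: "norm g \<le> 1/4"
  shows "norm (ratio w g) \<le> 1/2"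
proof -
  have q: "norm (multiplier quot_mult g) \<le> 1/4" using quot.norm_multiplier[of g] g by simp
  have "norm (scal rot * (multiplier quot_mult g * multiplier quot_mult g)) \<le> 1 * (1/4 * (1/4))"
    by (intro norm_mult_le q) (simp add: norm_scal norm_rot)
  then have "norm (sq_quot g) \<le> 1 * (1/4 * (1/4))" by (simp add: sq_quot_def)
  moreover have "norm (cosh_fac w g) \<le> 2"
    unfolding cosh_fac_def by (rule norm_pser_le[OF coeff_bounds(1) norm_incr_le[OF w g]])
  ultimately have "norm (ratio w g) \<le> (1 * 1) * (1 * (1/4 * (1/4)) * 2)"
    unfolding ratio_def by (intro norm_mult_le w)
  then show ?thesis by simp
qed

lemmas tame_intros = tame_const tame_id tame_add tame_diff tame_mult
  tame_multiplier[OF shift.multiplier_bound_axioms] tame_multiplier[OF prim.multiplier_bound_axioms]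
  tame_multiplier[OF incr.multiplier_bound_axioms] tame_multiplier[OF quot.multiplier_bound_axioms]

lemma tame_scaleR: "tame u \<Longrightarrow> tame (\<lambda>g. c *\<^sub>R u g)"
  using tame_mult[OF tame_const[of "c *\<^sub>R 1"], of u] by simp

lemma tame_uminus: "tame u \<Longrightarrow> tame (\<lambda>g. - u g)"
  using tame_scaleR[of u "-1"] by simp

lemma tame_cofactor:
  assumes w: "norm w \<le> 1"
  shows "tame (cofactor w)"
proof -
  have sq: "tame sq_quot" unfolding sq_quot_def by (intro tame_uminus tame_intros)
  have c: "tame (cosh_fac w)" unfolding cosh_fac_def
    by (rule tame_pser[OF coeff_bounds(1)]) (use norm_incr_le[OF w] in \<open>auto intro!: tame_intros\<close>)
  have s: "tame (sinh_fac w)" unfolding sinh_fac_def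
    by (rule tame_pser[OF coeff_bounds(2)]) (use norm_incr_le[OF w] in \<open>auto intro!: tame_intros\<close>)
  have r: "tame (ratio w)" unfolding ratio_def by (intro tame_intros sq c)
  have sl: "tame (slopes w)" unfolding slopes_def by (intro tame_intros)
  have l: "tame (\<lambda>g. pser ln_coeff (ratio w g))"
    by (rule tame_pser[OF coeff_bounds(3) r norm_ratio_le[OF w]])
  have i: "tame (\<lambda>g. pser inv_coeff (ratio w g))"
    by (rule tame_pser[OF coeff_bounds(4) r norm_ratio_le[OF w]])
  show ?thesis unfolding cofactor_def by (intro tame_scaleR tame_intros sq c s r sl l i)
qed

lemma cofactor_zero: "cofactor w 0 = 0"
  by (simp add: cofactor_def sq_quot_def quot.multiplier_zero)

text \<open>Both factors vanish at 0, so on the ball of radius \<open>R\<close> the Lipschitz constant of the product is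
proportional to \<open>R\<close>.  This makes the fixed point problem a contraction for small data.\<close>

lemma small_lipschitz:
  assumes U: "tame U" and U0: "U 0 = 0"
  obtains A where "A \<ge> 0" "\<And>R g g'. R \<le> 1/4 \<Longrightarrow> norm g \<le> R \<Longrightarrow> norm g' \<le> R \<Longrightarrow>
     norm (multiplier prim_mult g * U g - multiplier prim_mult g' * U g') \<le> A * R * norm (g - g')"
proof -
  obtain A where A: "A \<ge> 0" "\<And>g. norm g \<le> 1/4 \<Longrightarrow> norm (U g) \<le> A"
    "\<And>g g'. norm g \<le> 1/4 \<Longrightarrow> norm g' \<le> 1/4 \<Longrightarrow> norm (U g - U g') \<le> A * norm (g - g')"
    using tameE[OF U] by blast
  have "norm (multiplier prim_mult g * U g - multiplier prim_mult g' * U g') \<le> (2 * A) * R * norm (g - g')"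
    if "R \<le> 1/4" "norm g \<le> R" "norm g' \<le> R" for R g g'
  proof -
    have "norm (U g') \<le> A * norm g'" using A(3)[of g' 0] U0 that by simp
    also have "\<dots> \<le> A * R" using that A(1) by (intro mult_left_mono) auto
    finally have U': "norm (U g') \<le> A * R" .
    have "norm (multiplier prim_mult g * U g - multiplier prim_mult g' * U g')
      \<le> R * (A * norm (g - g')) + norm (g - g') * (A * R)"
      by (rule norm_mult_diff_le)
         (use that prim.norm_multiplier[of g] prim.norm_multiplier[of "g - g'"] A(3)[of g g'] U' in
            \<open>auto simp: prim.multiplier_diff\<close>)
    then show ?thesis by (simp add: algebra_simps)
  qed
  then show thesis using A(1) by (intro that[of "2 * A"]) auto
qed

lemma nonlin_lipschitz:
  assumes w: "norm w \<le> 1"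
  obtains A where "A \<ge> 0"
    "\<And>R g g'. R \<le> 1/4 \<Longrightarrow> norm g \<le> R \<Longrightarrow> norm g' \<le> R \<Longrightarrow> norm (nonlin_log g - nonlin_log g') \<le> A * R * norm (g - g')"
    "\<And>R g g'. R \<le> 1/4 \<Longrightarrow> norm g \<le> R \<Longrightarrow> norm g' \<le> R \<Longrightarrow> norm (nonlin_reg w g - nonlin_reg w g') \<le> A * R * norm (g - g')"
proof -
  have "tame (\<lambda>g. g * multiplier shift_mult g)" by (intro tame_intros)
  then obtain A where A: "A \<ge> 0"
    "\<And>R g g'. R \<le> 1/4 \<Longrightarrow> norm g \<le> R \<Longrightarrow> norm g' \<le> R \<Longrightarrow> norm (nonlin_log g - nonlin_log g') \<le> A * R * norm (g - g')"
    unfolding nonlin_log_def by (rule small_lipschitz) (simp, blast)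
  obtain B where B: "B \<ge> 0"
    "\<And>R g g'. R \<le> 1/4 \<Longrightarrow> norm g \<le> R \<Longrightarrow> norm g' \<le> R \<Longrightarrow> norm (nonlin_reg w g - nonlin_reg w g') \<le> B * R * norm (g - g')"
    unfolding nonlin_reg_def by (rule small_lipschitz[OF tame_cofactor[OF w] cofactor_zero]) blast
  have mono: "C * R * norm (g - g') \<le> max A B * R * norm (g - g')" if "norm g \<le> R" "C \<le> max A B" for C R and g g' :: wiener
    using that order_trans[OF norm_ge_zero that(1)] by (intro mult_right_mono) auto
  show thesis
  proof (rule that[of "max A B"])
    show "0 \<le> max A B" using A(1) by simp
    fix R and g g' :: wiener assume R: "R \<le> 1/4" "norm g \<le> R" "norm g' \<le> R"
    show "norm (nonlin_log g - nonlin_log g') \<le> max A B * R * norm (g - g')"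
      by (rule order_trans[OF A(2)[OF R] mono[OF R(2)]]) simp
    show "norm (nonlin_reg w g - nonlin_reg w g') \<le> max A B * R * norm (g - g')"
      by (rule order_trans[OF B(2)[OF R] mono[OF R(2)]]) simp
  qed
qed

lemma nonlin_zero: "nonlin_log 0 = 0" "nonlin_reg w 0 = 0"
  by (simp_all add: nonlin_log_def nonlin_reg_def prim.multiplier_zero)

subsection \<open>Pointwise meaning\<close>

lemma one_minus_cis_neg: "(1 - cis (- s)) * (1 - cis s) = complex_of_real (2 - 2 * cos s)"
  by (auto simp: complex_eq_iff algebra_simps)

text \<open>Away from \<open>s = 0\<close> the integrand of the graph equation for a function with slope \<open>\<sigma> g\<close> is its
linearisation at the flat interface plus \<open>\<sigma>\<^sup>3\<close> times the value of an element of the algebra.  The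
cube of \<open>\<sigma>\<close> is the decay in time gained from the cubic order of the nonlinearity.\<close>

lemma eval_nonlin:
  fixes p :: param and d0 d1 F th \<sigma> :: real
  defines "s \<equiv> snd (snd p)"
  assumes w: "norm w \<le> 1" and g: "norm g \<le> 1/4" and D: "2 - 2 * cos s > 0"
    and \<sigma>: "eval p x w = of_real \<sigma>" and d0: "eval p x g = of_real d0"
    and d1: "eval p x (multiplier shift_mult g) = of_real d1"
    and F: "eval p x (multiplier prim_mult g) = of_real F"
    and th: "eval p x (multiplier incr_mult g) = of_real th"
    and q: "eval p x (multiplier quot_mult g) * (1 - cis (- s)) = of_real th"
  defines "\<theta> \<equiv> \<sigma> * th"
  defines "E \<equiv> cosh \<theta> - cos s"
  shows "complex_of_real (ln (2 * E) * (\<sigma> * F) * (1 + (\<sigma> * d0) * (\<sigma> * d1))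
     + (\<sigma> * F) * \<theta> / E * ((\<sigma> * d0) * (\<sigma> * d1) - 1) * sinh \<theta> + (\<sigma> * F) * \<theta> / E * (\<sigma> * d0 + \<sigma> * d1) * sin s)
     = of_real (ln (2 - 2 * cos s)) * of_real (\<sigma> * F)
       + of_real (\<sigma> ^ 3) * (of_real (ln (2 - 2 * cos s)) * eval p x (nonlin_log g) + eval p x (nonlin_reg w g))"
    and "E > 0" 
proof -
  define D' where "D' = 2 - 2 * cos s"
  have D': "D' > 0" using D by (simp add: D'_def)
  define qv where "qv = eval p x (multiplier quot_mult g)"
  have nz: "1 - cis (- s) \<noteq> 0" "1 - cis s \<noteq> 0"
    using one_minus_cis_neg[of s] D by (metis less_irrefl mult_zero_left mult_zero_right of_real_eq_0_iff)+
  have qv: "qv = of_real th / (1 - cis (- s))" using q nz by (simp add: qv_def field_simps)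
  have c1: "- cis (- s) * (1 - cis s) = 1 - cis (- s)" by (simp add: algebra_simps cis_mult)
  have z: "- (cis (- s) * (qv * qv)) = of_real (th ^ 2 / D')"
  proof -
    have "of_real D' = (1 - cis (- s)) * (1 - cis s)" unfolding D'_def by (rule one_minus_cis_neg[symmetric])
    then have "- (cis (- s) * (qv * qv)) * of_real D'
        = (qv * (1 - cis (- s))) * (qv * (- cis (- s) * (1 - cis s)))" by (simp add: mult_ac)
    also have "\<dots> = of_real (th ^ 2)" unfolding c1 using q by (simp add: qv_def power2_eq_square)
    finally show ?thesis using D' by (simp add: field_simps)
  qed
  have hc: "half_cot p * qv = of_real (th * sin s / D')"
  proof -
    have "of_real D' = (1 - cis (- s)) * (1 - cis s)" unfolding D'_def by (rule one_minus_cis_neg[symmetric])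
    then have "half_cot p * qv * of_real D' = half_cot p * (qv * (1 - cis (- s))) * (1 - cis s)"
      by (simp only: mult_ac)
    also have "\<dots> = of_real th * (\<i> / 2 * ((1 + cis (- s)) * (1 - cis s)))"
      unfolding q[folded qv_def] half_cot s_def[symmetric] by (simp only: mult_ac)
    also have "(1 + cis (- s)) * (1 - cis s) = - 2 * \<i> * sin s"
      by (auto simp: complex_eq_iff algebra_simps)
    finally show ?thesis using D' by (simp add: field_simps)
  qed
  have th_small: "\<bar>\<theta>\<bar> \<le> 1/2"
    using norm_eval_le[of p x "w * multiplier incr_mult g"] norm_incr_le[OF w g]
    by (simp add: eval_times \<sigma> th \<theta>_def norm_mult abs_mult)
  define Ev where "Ev = pser cosh_coeff \<theta>"
  define Sv where "Sv = pser sinh_coeff \<theta>"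
  define zv where "zv = th ^ 2 / D'"
  define y where "y = \<sigma> * \<sigma> * (zv * Ev)"
  have sq: "eval p x (sq_quot g) = of_real zv"
    unfolding sq_quot_def eval_simps eval_scal rot s_def[symmetric] using z by (simp add: qv_def zv_def)
  have ev_incr: "eval p x (w * multiplier incr_mult g) = of_real \<theta>"
    by (simp add: eval_times \<sigma> th \<theta>_def)
  have cf: "eval p x (cosh_fac w g) = of_real Ev"
    unfolding cosh_fac_def eval_pser[OF coeff_bounds(1) norm_incr_le[OF w g]] ev_incr Ev_def
    by (rule pser_of_real[OF coeff_bounds(1) th_small])
  have sf: "eval p x (sinh_fac w g) = of_real Sv"
    unfolding sinh_fac_def eval_pser[OF coeff_bounds(2) norm_incr_le[OF w g]] ev_incr Sv_def
    by (rule pser_of_real[OF coeff_bounds(2) th_small])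
  have ry: "eval p x (ratio w g) = of_real y"
    by (simp add: ratio_def eval_times \<sigma> sq cf y_def)
  have ys: "\<bar>y\<bar> \<le> 1/2"
    using norm_eval_le[of p x "ratio w g"] norm_ratio_le[OF w g] by (simp add: ry)
  have ln: "eval p x (pser ln_coeff (ratio w g)) = of_real (pser ln_coeff y)"
    unfolding eval_pser[OF coeff_bounds(3) norm_ratio_le[OF w g]] ry
    by (rule pser_of_real[OF coeff_bounds(3) ys])
  have iv: "eval p x (pser inv_coeff (ratio w g)) = of_real (1 / (1 + y))"
    unfolding eval_pser[OF coeff_bounds(4) norm_ratio_le[OF w g]] ry pser_of_real[OF coeff_bounds(4) ys]
      pser_inv[OF ys] ..
  have sl: "eval p x (slopes w g) = of_real ((\<sigma> * d0) * (\<sigma> * d1))"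
    by (simp add: slopes_def eval_times \<sigma> d0 d1)
  have yD: "D' * y = 2 * (cosh \<theta> - 1)"
  proof -
    have "D' * y = \<theta> ^ 2 * Ev" using D' by (simp add: y_def zv_def \<theta>_def power2_eq_square)
    then show ?thesis using pser_cosh[OF th_small] by (simp add: Ev_def)
  qed
  \<comment> \<open>the factorisation that separates the singularity in \<open>s\<close> from the dependence on the profile\<close>
  have E: "2 * E = D' * (1 + y)" unfolding distrib_left yD unfolding E_def D'_def by simp
  have y1: "1 + y > 0" using ys by linarith
  show "E > 0" using E D' y1 mult_pos_pos[of D' "1 + y"] by linarith
  have lnE: "ln (2 * E) = ln D' + y * pser ln_coeff y"
    unfolding E pser_ln[OF ys] by (rule ln_mult_pos[OF D' y1])
  have sh: "sinh \<theta> = \<theta> * Sv" using pser_sinh[OF th_small] by (simp add: Sv_def)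
  have Einv: "1 / E = 2 / (D' * (1 + y))" unfolding E[symmetric] by simp
  have A1: "\<theta> / E * sinh \<theta> = \<sigma> ^ 2 * (2 * (zv * Sv * (1 / (1 + y))))"
  proof -
    have "\<theta> / E * sinh \<theta> = \<theta> * sinh \<theta> * (1 / E)" by simp
    also have "\<dots> = \<sigma> ^ 2 * (2 * (zv * Sv * (1 / (1 + y))))"
      unfolding Einv sh unfolding zv_def \<theta>_def by (simp add: power2_eq_square)
    finally show ?thesis .
  qed
  have A2: "\<theta> / E * sin s = \<sigma> * (2 * (th * sin s / D' * (1 / (1 + y))))"
  proof -
    have "\<theta> / E * sin s = \<theta> * sin s * (1 / E)" by simp
    also have "\<dots> = \<sigma> * (2 * (th * sin s / D' * (1 / (1 + y))))"
      unfolding Einv \<theta>_def by simp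
    finally show ?thesis .
  qed
  define P where "P = (\<sigma> * d0) * (\<sigma> * d1)"
  define L where "L = pser ln_coeff y"
  define I where "I = 1 / (1 + y)"
  have lnE': "ln (2 * E) = ln D' + \<sigma> * \<sigma> * (zv * Ev) * L"
    using lnE unfolding L_def[symmetric] by (simp add: y_def)
  have lhs: "ln (2 * E) * (\<sigma> * F) * (1 + P) + (\<sigma> * F) * \<theta> / E * (P - 1) * sinh \<theta> + (\<sigma> * F) * \<theta> / E * (\<sigma> * d0 + \<sigma> * d1) * sin s
    = ln D' * (\<sigma> * F) + \<sigma> ^ 3 * (ln D' * (F * (d0 * d1)) + F * (zv * Ev * L * (1 + P)
        + 2 * (zv * Sv * I * (P - 1)) + 2 * (th * sin s / D' * I * (d0 + d1))))"
  proof -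
    have "ln (2 * E) * (\<sigma> * F) * (1 + P) + (\<sigma> * F) * \<theta> / E * (P - 1) * sinh \<theta> + (\<sigma> * F) * \<theta> / E * (\<sigma> * d0 + \<sigma> * d1) * sin s
      = (ln D' + \<sigma> * \<sigma> * (zv * Ev) * L) * (\<sigma> * F) * (1 + P) + (\<sigma> * F) * (\<theta> / E * sinh \<theta>) * (P - 1)
        + (\<sigma> * F) * (\<theta> / E * sin s) * (\<sigma> * d0 + \<sigma> * d1)"
      unfolding lnE' by (simp add: mult_ac)
    also have "\<dots> = ln D' * (\<sigma> * F) + \<sigma> ^ 3 * (ln D' * (F * (d0 * d1)) + F * (zv * Ev * L * (1 + P)
        + 2 * (zv * Sv * I * (P - 1)) + 2 * (th * sin s / D' * I * (d0 + d1))))"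
      unfolding A1[folded I_def] A2[folded I_def]
      unfolding P_def by (simp add: algebra_simps power2_eq_square power3_eq_cube)
    finally show ?thesis .
  qed
  have co: "eval p x (cofactor w g) = of_real (zv * Ev * L * (1 + P)
        + 2 * (zv * Sv * I * (P - 1)) + 2 * (th * sin s / D' * I * (d0 + d1)))"
    unfolding cofactor_def eval_simps eval_scal sq cf sf ln[folded L_def] iv[folded I_def] sl d0 d1 P_def[symmetric] qv_def[symmetric] hc
    by (simp add: scaleR_conv_of_real)
  show "complex_of_real (ln (2 * E) * (\<sigma> * F) * (1 + (\<sigma> * d0) * (\<sigma> * d1))
     + (\<sigma> * F) * \<theta> / E * ((\<sigma> * d0) * (\<sigma> * d1) - 1) * sinh \<theta> + (\<sigma> * F) * \<theta> / E * (\<sigma> * d0 + \<sigma> * d1) * sin s)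
     = of_real (ln (2 - 2 * cos s)) * of_real (\<sigma> * F)
       + of_real (\<sigma> ^ 3) * (of_real (ln (2 - 2 * cos s)) * eval p x (nonlin_log g) + eval p x (nonlin_reg w g))"
    unfolding P_def[symmetric] D'_def[symmetric] lhs nonlin_log_def nonlin_reg_def eval_times F d0 d1 co by simp
qed

section \<open>Integrals of periodic functions\<close>

lemma periodic_2pi_int:
  assumes "periodic_2pi f" shows "f (x + 2 * pi * of_int n) = f x"
proof -
  have nat: "f (x + 2 * pi * of_nat m) = f x" for m x
  proof (induction m)
    case (Suc m)
    have "f (x + 2 * pi * of_nat (Suc m)) = f (x + 2 * pi * of_nat m + 2 * pi)" by (simp add: algebra_simps)
    also have "\<dots> = f x" using Suc assms by (simp add: periodic_2pi_def)
    finally show ?case .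
  qed simp
  show ?thesis
  proof (cases "n \<ge> 0")
    case True then show ?thesis using nat[of x "nat n"] by simp
  next
    case False
    then have "f (x + 2 * pi * of_int n + 2 * pi * of_nat (nat (- n))) = f (x + 2 * pi * of_int n)" by (intro nat)
    then show ?thesis using False by (simp add: algebra_simps)
  qed
qed

lemma circle_reflect:
  fixes f :: "real \<Rightarrow> 'a::{banach,second_countable_topology}"
  shows "(\<integral>s. f (2 * pi - s) \<partial>circle) = (\<integral>s. f s \<partial>circle)"
    and "integrable circle f \<Longrightarrow> integrable circle (\<lambda>s. f (2 * pi - s))"
proof -
  have i: "indicator {0..2*pi} (2 * pi + (- 1) * s) = (indicator {0..2*pi} s :: real)" for s
    by (auto simp: indicator_def)
  have "(\<integral>s. indicator {0..2*pi} s *\<^sub>R f s \<partial>lborel) = (\<integral>s. indicator {0..2*pi} s *\<^sub>R f (2 * pi - s) \<partial>lborel)"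
    by (subst lborel_integral_real_affine[where c = "-1" and t = "2 * pi"]) (simp_all only: i, simp_all)
  then show "(\<integral>s. f (2 * pi - s) \<partial>circle) = (\<integral>s. f s \<partial>circle)"
    unfolding torus_integral_circle[symmetric] torus_integral_def set_lebesgue_integral_def by simp
  assume "integrable circle f"
  then have "integrable lborel (\<lambda>s. indicator {0..2*pi} s *\<^sub>R f s)"
    by (simp add: integrable_circle_iff set_integrable_def)
  from lborel_integrable_real_affine[OF this, of "-1" "2 * pi"]
  have "integrable lborel (\<lambda>s. indicator {0..2*pi} s *\<^sub>R f (2 * pi - s))"
    by (simp only: i) simp
  then show "integrable circle (\<lambda>s. f (2 * pi - s))"
    by (simp add: integrable_circle_iff set_integrable_def)
qed

lemma circle_shift_aux:
  fixes f :: "real \<Rightarrow> 'a::{banach,second_countable_topology}"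
  assumes per: "periodic_2pi f" and int: "integrable circle f" and a: "0 \<le> a" "a \<le> 2 * pi"
  shows "(\<integral>s. f (s + a) \<partial>circle) = (\<integral>s. f s \<partial>circle)" "integrable circle (\<lambda>s. f (s + a))"
proof -
  have I: "set_integrable lborel {0..2*pi} f" using int by (simp add: integrable_circle_iff)
  have I1: "set_integrable lborel {a..2*pi} f" "set_integrable lborel {0..a} f"
    by (rule set_integrable_subset[OF I]; use a in auto)+
  have i: "indicator {0..a} (- (2*pi) + 1 * s) *\<^sub>R f (- (2*pi) + 1 * s) = (indicator {2*pi..2*pi+a} s :: real) *\<^sub>R f s" for s
    using per[unfolded periodic_2pi_def, rule_format, of "s - 2*pi"] by (auto simp: indicator_def algebra_simps)
  have I2: "set_integrable lborel {2*pi..2*pi+a} f"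
    using lborel_integrable_real_affine[OF I1(2)[unfolded set_integrable_def], of 1 "- (2*pi)"]
    unfolding i set_integrable_def by simp
  have e2: "(LINT s:{0..a}|lborel. f s) = (LINT s:{2*pi..2*pi+a}|lborel. f s)"
    unfolding set_lebesgue_integral_def
    by (subst lborel_integral_real_affine[where c = 1 and t = "- (2*pi)"]) (simp_all only: i, simp_all)
  have ae: "AE x in lborel. \<not> (x \<in> {a..2*pi} \<and> x \<in> {2*pi..2*pi+a})"
    using AE_lborel_singleton[of "2*pi"] by eventually_elim auto
  have ae0: "AE x in lborel. \<not> (x \<in> {0..a} \<and> x \<in> {a..2*pi})"
    using AE_lborel_singleton[of a] by eventually_elim auto
  have U: "{a..2*pi+a} = {a..2*pi} \<union> {2*pi..2*pi+a}" "{0..2*pi} = {0..a} \<union> {a..2*pi}" using a by auto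
  have I3: "set_integrable lborel {a..2*pi+a} f" unfolding U by (rule set_integrable_Un[OF I1(1) I2]) auto
  have "(LINT s:{a..2*pi+a}|lborel. f s) = (LINT s:{a..2*pi}|lborel. f s) + (LINT s:{2*pi..2*pi+a}|lborel. f s)"
    unfolding U by (rule set_integral_Un_AE[OF ae _ _ I1(1) I2]) auto
  also have "\<dots> = (LINT s:{0..2*pi}|lborel. f s)"
    unfolding U e2[symmetric] by (subst set_integral_Un_AE[OF ae0 _ _ I1(2) I1(1)]) auto
  finally have e3: "(LINT s:{a..2*pi+a}|lborel. f s) = (LINT s:{0..2*pi}|lborel. f s)" .
  have j: "indicator {a..2*pi+a} (a + 1 * s) *\<^sub>R f (a + 1 * s) = (indicator {0..2*pi} s :: real) *\<^sub>R f (s + a)" for s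
    by (auto simp: indicator_def add.commute)
  have "(LINT s:{a..2*pi+a}|lborel. f s) = (LINT s:{0..2*pi}|lborel. f (s + a))"
    unfolding set_lebesgue_integral_def
    by (subst lborel_integral_real_affine[where c = 1 and t = a]) (simp_all only: j, simp_all)
  with e3 show "(\<integral>s. f (s + a) \<partial>circle) = (\<integral>s. f s \<partial>circle)"
    unfolding torus_integral_circle[symmetric] torus_integral_def by simp
  show "integrable circle (\<lambda>s. f (s + a))"
    using lborel_integrable_real_affine[OF I3[unfolded set_integrable_def], of 1 a]
    unfolding j integrable_circle_iff set_integrable_def by simp
qed

lemma circle_shift:
  fixes f :: "real \<Rightarrow> 'a::{banach,second_countable_topology}"
  assumes per: "periodic_2pi f" and int: "integrable circle f"
  shows "(\<integral>s. f (s + a) \<partial>circle) = (\<integral>s. f s \<partial>circle)" "integrable circle (\<lambda>s. f (s + a))"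
proof -
  define n where "n = \<lfloor>a / (2 * pi)\<rfloor>"
  define b where "b = a - 2 * pi * of_int n"
  have "of_int n \<le> a / (2 * pi)" "a / (2 * pi) < of_int n + 1" unfolding n_def by linarith+
  then have b: "0 \<le> b" "b \<le> 2 * pi" by (auto simp: b_def field_simps)
  have "f (s + a) = f (s + b)" for s
    using periodic_2pi_int[OF per, of "s + b" n] by (simp add: b_def algebra_simps)
  then show "(\<integral>s. f (s + a) \<partial>circle) = (\<integral>s. f s \<partial>circle)" "integrable circle (\<lambda>s. f (s + a))"
    using circle_shift_aux[OF per int b] by simp_all
qed

text \<open>The kernel of the graph equation is most naturally a function of \<open>s = x - y\<close>; by periodicity the
substitution does not change the domain of integration.\<close>

lemma circle_convolve:
  fixes f :: "real \<Rightarrow> 'a::{banach,second_countable_topology}"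
  assumes per: "periodic_2pi f" and int: "integrable circle f"
  shows "(\<integral>y. f (x - y) \<partial>circle) = (\<integral>s. f s \<partial>circle)"
proof -
  have "(\<integral>y. f (x - y) \<partial>circle) = (\<integral>y. f (x - (2 * pi - y)) \<partial>circle)"
    using circle_reflect(1)[of "\<lambda>y. f (x - y)"] by simp
  also have "\<dots> = (\<integral>y. f (y + (x - 2 * pi)) \<partial>circle)" by (simp add: algebra_simps)
  finally show ?thesis using circle_shift(1)[OF per int] by simp
qed

lemma AE_circle_interior: "AE s in circle. 0 < s \<and> s < 2 * pi"
proof -
  have "AE s in lborel. s \<noteq> 0 \<and> s \<noteq> 2 * pi"
    using AE_lborel_singleton[of 0] AE_lborel_singleton[of "2*pi"] by eventually_elim auto
  then have "AE s in lborel. s \<in> {0..2*pi} \<longrightarrow> 0 < s \<and> s < 2 * pi"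
    by eventually_elim auto
  then show ?thesis unfolding circle_def by (subst AE_restrict_space_iff) auto
qed

lemma cos_lt_1: "0 < s \<Longrightarrow> s < 2 * pi \<Longrightarrow> cos s < 1"
proof -
  assume s: "0 < s" "s < 2 * pi"
  have "sin (s / 2) > 0" by (rule sin_gt_zero) (use s in auto)
  moreover have "cos s = 1 - 2 * sin (s / 2) ^ 2" using cos_double_sin[of "s / 2"] by simp
  ultimately show "cos s < 1" by simp
qed

lemma has_integral_circle:
  fixes f :: "real \<Rightarrow> real"
  assumes "(f has_integral I) {0..2*pi}" "integrable circle f"
  shows "(\<integral>s. f s \<partial>circle) = I"
  unfolding torus_integral_circle[symmetric] torus_integral_def
  using set_borel_integral_eq_integral(2)[of "{0..2*pi}" f] assms integral_unique[OF assms(1)]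
  by (simp add: integrable_circle_iff)

section \<open>The logarithmic kernel\<close>

definition log_kernel :: "real \<Rightarrow> real" where "log_kernel s = ln (2 - 2 * cos s)"

lemma continuous_sqrt_ln: "continuous_on {0..} (\<lambda>y::real. sqrt y * ln y)"
  unfolding continuous_on_def
proof
  fix y :: real assume "y \<in> {0..}"
  show "((\<lambda>y. sqrt y * ln y) \<longlongrightarrow> sqrt y * ln y) (at y within {0..})"
  proof (cases "y = 0")
    case True
    have "((\<lambda>y::real. sqrt y * ln y) \<longlongrightarrow> 0) (at_right 0)" by real_asymp
    then show ?thesis using True by (simp add: at_within_Ici_at_right)
  next
    case False
    then have "isCont (\<lambda>y. sqrt y * ln y) y" using \<open>y \<in> {0..}\<close> by (intro continuous_intros) auto
    then show ?thesis unfolding isCont_def by (rule tendsto_within_subset) simp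
  qed
qed

text \<open>Since \<open>sqrt y * ln y\<close> tends to 0 at 0, a factor of the size of \<open>sqrt g\<close> cancels the logarithmic
singularity; this gives continuity of primitives up to the endpoints.\<close>

lemma continuous_dominated_log:
  fixes f g h :: "real \<Rightarrow> real"
  assumes f: "continuous_on A f" and g: "continuous_on A g" "\<And>s. s \<in> A \<Longrightarrow> g s \<ge> 0"
    and dom: "\<And>s. s \<in> A \<Longrightarrow> \<bar>f s\<bar> \<le> C * sqrt (g s)"
  shows "continuous_on A (\<lambda>s. f s * ln (g s))"
  unfolding continuous_on_def
proof
  fix s assume s: "s \<in> A"
  show "((\<lambda>s. f s * ln (g s)) \<longlongrightarrow> f s * ln (g s)) (at s within A)"
  proof (cases "g s = 0")
    case False
    then have "continuous (at s within A) (\<lambda>s. f s * ln (g s))"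
      using f g s by (intro continuous_intros) (auto simp: continuous_on_eq_continuous_within)
    then show ?thesis by (simp add: continuous_within)
  next
    case True
    have c: "continuous_on A (\<lambda>s. C * \<bar>sqrt (g s) * ln (g s)\<bar>)"
      by (intro continuous_intros continuous_on_compose2[OF continuous_sqrt_ln g(1)]) (use g in auto)
    have "((\<lambda>s. f s * ln (g s)) \<longlongrightarrow> 0) (at s within A)"
    proof (rule Lim_null_comparison)
      show "((\<lambda>s. C * \<bar>sqrt (g s) * ln (g s)\<bar>) \<longlongrightarrow> 0) (at s within A)"
        using c s True unfolding continuous_on_def by force
      show "\<forall>\<^sub>F s in at s within A. norm (f s * ln (g s)) \<le> C * \<bar>sqrt (g s) * ln (g s)\<bar>"
        using dom by (auto simp: eventually_at_filter abs_mult mult.assoc[symmetric] g intro!: always_eventually mult_right_mono)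
    qed
    then show ?thesis using True by simp
  qed
qed

lemma two_minus_two_cos_ge: "0 \<le> 2 - 2 * cos (s::real)" "2 - 2 * cos s \<le> 4"
  using cos_le_one[of s] cos_ge_minus_one[of s] by linarith+

lemma abs_sin_le_sqrt: "\<bar>sin (s::real)\<bar> \<le> sqrt (2 - 2 * cos s)"
proof (rule real_le_rsqrt)
  have "(sin s)\<^sup>2 = (1 - cos s) * (1 + cos s)" using sin_squared_eq[of s] by (simp add: algebra_simps power2_eq_square)
  also have "\<dots> \<le> (1 - cos s) * 2" by (rule mult_left_mono) auto
  finally show "\<bar>sin s\<bar>\<^sup>2 \<le> 2 - 2 * cos s" by simp
qed

lemma abs_sin_nat_le: "\<bar>sin (real n * s)\<bar> \<le> real n * \<bar>sin s\<bar>"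
proof (induction n)
  case (Suc n)
  have "\<bar>sin (real (Suc n) * s)\<bar> = \<bar>sin (real n * s) * cos s + cos (real n * s) * sin s\<bar>"
    by (simp add: distrib_right sin_add algebra_simps)
  also have "\<dots> \<le> \<bar>sin (real n * s)\<bar> * 1 + 1 * \<bar>sin s\<bar>"
    by (rule order_trans[OF abs_triangle_ineq]) (unfold abs_mult, intro add_mono mult_mono, auto)
  finally show ?case using Suc by (simp add: algebra_simps)
qed simp

lemma log_kernel_measurable [measurable]: "log_kernel \<in> borel_measurable borel"
  unfolding log_kernel_def by measurable

text \<open>The cosine polynomial \<open>sin s * sin (n s) / (1 - cos s)\<close> and its primitive.  It appears when the
logarithmic kernel is integrated by parts against \<open>cos (n s)\<close>, because the derivative of the kernel is
\<open>sin s / (1 - cos s)\<close>.\<close>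

fun conj_dirichlet :: "nat \<Rightarrow> real \<Rightarrow> real" where
  "conj_dirichlet 0 s = 0"
| "conj_dirichlet (Suc 0) s = 1 + cos s"
| "conj_dirichlet (Suc (Suc n)) s = conj_dirichlet (Suc n) s + cos (real (Suc n) * s) + cos (real (Suc (Suc n)) * s)"

fun conj_dirichlet_int :: "nat \<Rightarrow> real \<Rightarrow> real" where
  "conj_dirichlet_int 0 s = 0"
| "conj_dirichlet_int (Suc 0) s = s + sin s"
| "conj_dirichlet_int (Suc (Suc n)) s = conj_dirichlet_int (Suc n) s + sin (real (Suc n) * s) / real (Suc n)
     + sin (real (Suc (Suc n)) * s) / real (Suc (Suc n))"

lemma conj_dirichlet_eq: "sin s * sin (real (Suc n) * s) = (1 - cos s) * conj_dirichlet (Suc n) s"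
proof (induction n)
  case 0
  show ?case using sin_squared_eq[of s] by (simp add: algebra_simps power2_eq_square)
next
  case (Suc n)
  define A where "A = real (Suc n) * s"
  have a: "real (Suc (Suc n)) * s = A + s" by (simp add: A_def algebra_simps)
  have s2: "sin s * sin s = (1 - cos s) * (1 + cos s)"
    using sin_squared_eq[of s] by (simp add: algebra_simps power2_eq_square)
  have "sin s * sin (A + s) - sin s * sin A = - (1 - cos s) * (sin s * sin A) + cos A * (sin s * sin s)"
    by (simp add: sin_add algebra_simps)
  also have "\<dots> = (1 - cos s) * (cos A + cos (A + s))"
    unfolding s2 by (simp add: cos_add algebra_simps)
  finally have "sin s * sin (A + s) = (1 - cos s) * conj_dirichlet (Suc n) s + (1 - cos s) * (cos A + cos (A + s))"
    using Suc unfolding A_def by linarith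
  then show ?case unfolding conj_dirichlet.simps a A_def[symmetric] by (simp only: distrib_left add.assoc)
qed

lemma conj_dirichlet_int_deriv:
  "(conj_dirichlet_int (Suc n) has_real_derivative conj_dirichlet (Suc n) s) (at s)"
proof (induction n)
  case 0
  show ?case by (auto intro!: derivative_eq_intros simp: fun_eq_iff simp del: One_nat_def)
next
  case (Suc n)
  show ?case unfolding conj_dirichlet_int.simps conj_dirichlet.simps
    by (rule derivative_eq_intros Suc refl | simp)+
qed

lemma sin_nat_2pi: "sin (real n * (2 * pi)) = 0"
  using sin_int_2pin[of "int n"] by (simp add: mult.commute)

lemma conj_dirichlet_int_ends: "conj_dirichlet_int (Suc n) 0 = 0" "conj_dirichlet_int (Suc n) (2 * pi) = 2 * pi"
  by (induction n) (simp_all only: conj_dirichlet_int.simps sin_nat_2pi, simp_all)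

lemma log_kernel_has_integral_cos:
  "((\<lambda>s. log_kernel s * cos (real (Suc n) * s)) has_integral - (2 * pi / real (Suc n))) {0..2*pi}"
proof -
  let ?k = "real (Suc n)"
  define P where "P s = (sin (?k * s) * ln (2 - 2 * cos s) - conj_dirichlet_int (Suc n) s) / ?k" for s
  have c0: "continuous_on A (conj_dirichlet_int (Suc n))" for A
    by (meson DERIV_continuous_on has_field_derivative_at_within conj_dirichlet_int_deriv)
  have "continuous_on {0..2*pi} (\<lambda>s. sin (?k * s) * ln (2 - 2 * cos s))"
  proof (rule continuous_dominated_log[where C = ?k])
    show "\<bar>sin (?k * s)\<bar> \<le> ?k * sqrt (2 - 2 * cos s)" for s
      by (rule order_trans[OF abs_sin_nat_le mult_left_mono[OF abs_sin_le_sqrt]]) simp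
  qed (auto intro!: continuous_intros two_minus_two_cos_ge)
  then have "continuous_on {0..2*pi} P" unfolding P_def
    by (rule continuous_on_divide[OF continuous_on_diff[OF _ c0]]) auto
  then have "((\<lambda>s. log_kernel s * cos (?k * s)) has_integral (P (2*pi) - P 0)) {0..2*pi}"
  proof (rule fundamental_theorem_of_calculus_interior[rotated])
    fix s assume "s \<in> {0<..<2*pi}"
    then have d: "1 - cos s > 0" using cos_lt_1[of s] by auto
    have "(P has_real_derivative ((cos (?k * s) * ?k * ln (2 - 2 * cos s) + sin (?k * s) * (1 / (2 - 2 * cos s) * (2 * sin s))) - conj_dirichlet (Suc n) s) / ?k) (at s)"
      unfolding P_def
      by (rule derivative_eq_intros conj_dirichlet_int_deriv refl | use d in simp)+
    moreover have "sin (?k * s) * (1 / (2 - 2 * cos s) * (2 * sin s)) = conj_dirichlet (Suc n) s"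
      using conj_dirichlet_eq[of s n] d by (simp add: field_simps)
    moreover have "((cos (?k * s) * ?k * ln (2 - 2 * cos s) + conj_dirichlet (Suc n) s) - conj_dirichlet (Suc n) s) / ?k
        = log_kernel s * cos (?k * s)"
      unfolding log_kernel_def by (simp del: of_nat_Suc conj_dirichlet.simps)
    ultimately have "(P has_real_derivative log_kernel s * cos (?k * s)) (at s)"
      by (simp only:)
    then show "(P has_vector_derivative log_kernel s * cos (?k * s)) (at s)"
      by (simp add: has_real_derivative_iff_has_vector_derivative)
  qed simp
  moreover have "P (2*pi) = - (2 * pi / ?k)" "P 0 = 0"
    unfolding P_def conj_dirichlet_int_ends sin_nat_2pi by simp_all
  ultimately show ?thesis by simp
qed

lemma integrable_log_kernel: "integrable circle log_kernel"
proof -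
  have "continuous_on {0..2*pi} (\<lambda>s. (1 - cos s) * ln (2 - 2 * cos s))"
  proof (rule continuous_dominated_log[where C = 1])
    fix s :: real
    have "1 - cos s = sqrt ((1 - cos s) * (1 - cos s))" using two_minus_two_cos_ge[of s] by simp
    also have "\<dots> \<le> sqrt (2 * (1 - cos s))"
      using two_minus_two_cos_ge[of s] by (intro real_sqrt_le_mono mult_right_mono) auto
    finally show "\<bar>1 - cos s\<bar> \<le> 1 * sqrt (2 - 2 * cos s)"
      using two_minus_two_cos_ge[of s] by (simp add: algebra_simps)
  qed (auto intro!: continuous_intros two_minus_two_cos_ge)
  then have "(\<lambda>s. (1 - cos s) * ln (2 - 2 * cos s)) integrable_on {0..2*pi}"
    by (rule integrable_continuous_interval)
  moreover have "(\<lambda>s. log_kernel s * cos s) integrable_on {0..2*pi}"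
    using log_kernel_has_integral_cos[of 0] by auto
  ultimately have "(\<lambda>s. (1 - cos s) * ln (2 - 2 * cos s) + log_kernel s * cos s) integrable_on {0..2*pi}"
    by (rule integrable_add)
  then have lk: "log_kernel integrable_on {0..2*pi}"
    by (rule integrable_eq) (simp add: log_kernel_def algebra_simps)
  have le: "log_kernel s \<le> ln 4" for s
  proof (cases "2 - 2 * cos s = 0")
    case False
    then have "0 < 2 - 2 * cos s" using two_minus_two_cos_ge(1)[of s] by linarith
    then show ?thesis unfolding log_kernel_def using two_minus_two_cos_ge(2)[of s]
      by (intro ln_le_cancel_iff[THEN iffD2]) auto
  qed (simp add: log_kernel_def)
  have "(\<lambda>s. ln 4 - log_kernel s) absolutely_integrable_on {0..2*pi}"
    by (rule nonnegative_absolutely_integrable_1) (use le lk in \<open>auto intro!: integrable_diff\<close>)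
  then have "integrable lebesgue (\<lambda>s. indicator {0..2*pi} s *\<^sub>R (ln 4 - log_kernel s))"
    by (simp add: set_integrable_def)
  then have "integrable lborel (\<lambda>s. indicator {0..2*pi} s *\<^sub>R (ln 4 - log_kernel s))"
    by (subst (asm) integrable_completion) auto
  then have "integrable circle (\<lambda>s. ln 4 - log_kernel s)"
    by (simp add: integrable_circle_iff set_integrable_def)
  then have "integrable circle (\<lambda>s. ln 4 - (ln 4 - log_kernel s))"
    by (rule Bochner_Integration.integrable_diff[OF circle.integrable_const])
  moreover have "(\<lambda>s. ln 4 - (ln 4 - log_kernel s)) = log_kernel" by auto
  ultimately show ?thesis by (simp only:)
qed

lemma integrable_log_kernel_mult:
  fixes f :: "real \<Rightarrow> real"
  assumes "f \<in> borel_measurable borel" "\<And>s. \<bar>f s\<bar> \<le> B"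
  shows "integrable circle (\<lambda>s. log_kernel s * f s)"
  by (rule Bochner_Integration.integrable_bound[of circle "\<lambda>s. \<bar>log_kernel s\<bar> * B"])
     (use assms integrable_log_kernel in \<open>auto intro!: AE_I2 mult_left_mono simp: abs_mult intro: order_trans[OF _ abs_ge_self]\<close>)

lemma integral_log_kernel_cos: "(\<integral>s. log_kernel s * cos (real (Suc n) * s) \<partial>circle) = - (2 * pi / real (Suc n))"
  by (rule has_integral_circle[OF log_kernel_has_integral_cos], rule integrable_log_kernel_mult[of _ 1]) auto

lemma log_kernel_periodic: "periodic_2pi log_kernel"
  by (simp add: periodic_2pi_def log_kernel_def)

lemma log_kernel_double: "cos s \<noteq> 1 \<Longrightarrow> cos s \<noteq> -1 \<Longrightarrow> log_kernel s + log_kernel (s + pi) = log_kernel (2 * s)"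
proof -
  assume "cos s \<noteq> 1" "cos s \<noteq> -1"
  then have "cos s < 1" "cos s > -1"
    using cos_le_one[of s] cos_ge_minus_one[of s] unfolding less_le by auto
  then have pos: "2 - 2 * cos s > 0" "2 - 2 * cos (s + pi) > 0" by auto
  have "(2 - 2 * cos s) * (2 - 2 * cos (s + pi)) = 2 - 2 * cos (2 * s)"
    unfolding cos_double sin_squared_eq by (simp add: algebra_simps power2_eq_square)
  then show ?thesis unfolding log_kernel_def using ln_mult_pos[OF pos] by simp
qed

lemma integral_circle_double:
  fixes f :: "real \<Rightarrow> real"
  assumes per: "periodic_2pi f" and int: "integrable circle f"
  shows "(\<integral>s. f (2 * s) \<partial>circle) = (\<integral>s. f s \<partial>circle)"
proof -
  have I: "set_integrable lborel {0..2*pi} f" using int by (simp add: integrable_circle_iff)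
  have i: "indicator {0..2*pi} (- (2*pi) + 1 * s) *\<^sub>R f (- (2*pi) + 1 * s) = (indicator {2*pi..4*pi} s :: real) *\<^sub>R f s" for s
    using per[unfolded periodic_2pi_def, rule_format, of "s - 2*pi"] by (auto simp: indicator_def algebra_simps)
  have I2: "set_integrable lborel {2*pi..4*pi} f"
    using lborel_integrable_real_affine[OF I[unfolded set_integrable_def], of 1 "- (2*pi)"]
    unfolding i set_integrable_def by simp
  have e2: "(LINT s:{0..2*pi}|lborel. f s) = (LINT s:{2*pi..4*pi}|lborel. f s)"
    unfolding set_lebesgue_integral_def
    by (subst lborel_integral_real_affine[where c = 1 and t = "- (2*pi)"]) (simp_all only: i, simp_all)
  have ae: "AE x in lborel. \<not> (x \<in> {0..2*pi} \<and> x \<in> {2*pi..4*pi})"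
    using AE_lborel_singleton[of "2*pi"] by eventually_elim auto
  have U: "{0..4*pi} = {0..2*pi} \<union> {2*pi..4*pi}" by auto
  have e3: "(LINT s:{0..4*pi}|lborel. f s) = 2 * (LINT s:{0..2*pi}|lborel. f s)"
    unfolding U using set_integral_Un_AE[OF ae _ _ I I2] e2 by simp
  have j: "indicator {0..4*pi} (0 + 2 * s) *\<^sub>R f (0 + 2 * s) = (indicator {0..2*pi} s :: real) *\<^sub>R f (2 * s)" for s
    by (auto simp: indicator_def)
  have "(LINT s:{0..4*pi}|lborel. f s) = \<bar>2\<bar> *\<^sub>R (LINT s:{0..2*pi}|lborel. f (2 * s))"
    unfolding set_lebesgue_integral_def
    using lborel_integral_real_affine[of 2 "\<lambda>s. indicator {0..4*pi} s *\<^sub>R f s" 0] unfolding j by simp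
  with e3 show ?thesis unfolding torus_integral_circle[symmetric] torus_integral_def by simp
qed

text \<open>The functional equation \<open>log_kernel s + log_kernel (s + pi) = log_kernel (2 s)\<close> integrates to \<open>2 I = I\<close>
for the mean value \<open>I\<close>.\<close>

lemma integral_log_kernel: "(\<integral>s. log_kernel s \<partial>circle) = 0"
proof -
  have s: "integrable circle (\<lambda>s. log_kernel (s + pi))" "(\<integral>s. log_kernel (s + pi) \<partial>circle) = (\<integral>s. log_kernel s \<partial>circle)"
    by (rule circle_shift[OF log_kernel_periodic integrable_log_kernel])+
  have "AE s in circle. cos s \<noteq> 1 \<and> cos s \<noteq> -1"
  proof -
    have "AE s in lborel. s \<noteq> pi" by (rule AE_lborel_singleton)
    then have "AE s in circle. s \<noteq> pi" unfolding circle_def by (subst AE_restrict_space_iff) auto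
    with AE_circle_interior show ?thesis
    proof eventually_elim
      case (elim s)
      then have "cos s < 1" using cos_lt_1 by simp
      moreover have "cos s \<noteq> -1"
      proof
        assume "cos s = -1"
        then have "cos (s + pi) = 1" by simp
        then obtain n :: int where n: "s + pi = n * 2 * pi" using cos_one_2pi_int[of "s + pi"] by auto
        then have "s = (2 * n - 1) * pi" by (simp add: algebra_simps)
        with elim have "0 < (2 * real_of_int n - 1) * pi" "(2 * real_of_int n - 1) * pi < 2 * pi" by auto
        then have "0 < 2 * real_of_int n - 1" "2 * real_of_int n - 1 < 2"
          by (simp_all add: zero_less_mult_iff)
        then have "n = 1" by linarith
        with \<open>s = (2 * n - 1) * pi\<close> elim show False by simp
      qed
      ultimately show ?case by simp
    qed
  qed
  then have "(\<integral>s. log_kernel (2 * s) \<partial>circle) = (\<integral>s. log_kernel s + log_kernel (s + pi) \<partial>circle)"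
  proof (intro integral_cong_AE)
    assume *: "AE s in circle. cos s \<noteq> 1 \<and> cos s \<noteq> -1"
    show "AE s in circle. log_kernel (2 * s) = log_kernel s + log_kernel (s + pi)"
      using * by eventually_elim (simp add: log_kernel_double)
  qed (auto intro!: borel_measurable_circle)
  also have "\<dots> = 2 * (\<integral>s. log_kernel s \<partial>circle)"
    using s integrable_log_kernel by simp
  finally show ?thesis
    using integral_circle_double[OF log_kernel_periodic integrable_log_kernel] by simp
qed

lemma integral_log_kernel_cis:
  "(\<integral>s. of_real (log_kernel s) * cis (- (of_int k * s)) \<partial>circle) = (if k = 0 then 0 else - (2 * pi / \<bar>real_of_int k\<bar>))"
proof -
  have ic: "integrable circle (\<lambda>s. log_kernel s * cos (of_int k * s))"
    and isn: "integrable circle (\<lambda>s. log_kernel s * sin (of_int k * s))"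
    by (rule integrable_log_kernel_mult[of _ 1]; auto)+
  have sin0: "(\<integral>s. log_kernel s * sin (of_int k * s) \<partial>circle) = 0"
  proof -
    have "log_kernel (2 * pi - s) * sin (of_int k * (2 * pi - s)) = - (log_kernel s * sin (of_int k * s))" for s
      using sin_int_2pin[of k] cos_int_2pin[of k]
      by (simp add: log_kernel_def right_diff_distrib sin_diff mult.commute[of "of_int k" "2 * pi"] mult.assoc)
    then have "(\<integral>s. log_kernel s * sin (of_int k * s) \<partial>circle) = - (\<integral>s. log_kernel s * sin (of_int k * s) \<partial>circle)"
      using circle_reflect(1)[of "\<lambda>s. log_kernel s * sin (of_int k * s)"] by simp
    then show ?thesis by simp
  qed
  have cos0: "(\<integral>s. log_kernel s * cos (of_int k * s) \<partial>circle) = (if k = 0 then 0 else - (2 * pi / \<bar>real_of_int k\<bar>))"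
  proof (cases "k = 0")
    case False
    define n where "n = nat \<bar>k\<bar> - 1"
    have n: "real (Suc n) = \<bar>real_of_int k\<bar>" using False by (simp add: n_def)
    have "cos (of_int k * s) = cos (real (Suc n) * s)" for s
      unfolding n by (cases "k \<ge> 0") auto
    then show ?thesis using integral_log_kernel_cos[of n] False unfolding n by simp
  qed (simp add: integral_log_kernel)
  have "(\<integral>s. of_real (log_kernel s) * cis (- (of_int k * s)) \<partial>circle)
    = (\<integral>s. of_real (log_kernel s * cos (of_int k * s)) - \<i> * of_real (log_kernel s * sin (of_int k * s)) \<partial>circle)"
    by (rule Bochner_Integration.integral_cong) (auto simp: complex_eq_iff)
  also have "\<dots> = of_real (\<integral>s. log_kernel s * cos (of_int k * s) \<partial>circle) - \<i> * of_real (\<integral>s. log_kernel s * sin (of_int k * s) \<partial>circle)"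
    using Bochner_Integration.integral_diff[OF integrable_of_real[OF ic] integrable_mult_right[OF integrable_of_real[OF isn]], of \<i>]
    by (simp only: integral_complex_of_real integral_mult_right_zero)
  finally show ?thesis using sin0 cos0 by simp
qed

section \<open>Constants do not move the interface\<close>

lemma sq_le_cosh: "(t::real)\<^sup>2 \<le> 2 * (cosh t - 1)"
proof -
  have "\<bar>t / 2\<bar> \<le> \<bar>sinh (t / 2)\<bar>"
    using real_le_abs_sinh[of "t / 2"] by (simp add: sinh_field_def exp_minus)
  then have "(t / 2)\<^sup>2 \<le> (sinh (t / 2))\<^sup>2" by (rule abs_le_square_iff[THEN iffD1])
  moreover have "cosh t = 1 + 2 * (sinh (t / 2))\<^sup>2"
    using cosh_double[of "t / 2"] cosh_square_eq[of "t / 2"] by simp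
  ultimately show ?thesis by (simp add: power_divide)
qed

text \<open>The kernel by which \<open>h(\<beta>)\<close> is multiplied in the graph equation, as a function of \<open>s = \<alpha> - \<beta>\<close> and up
to the constant factor.\<close>

definition slip_kernel :: "(real \<Rightarrow> real) \<Rightarrow> (real \<Rightarrow> real) \<Rightarrow> real \<Rightarrow> real \<Rightarrow> real" where
  "slip_kernel f f' x s =
     ln (2 * (cosh (f x - f (x - s)) - cos s)) * (1 + f' x * f' (x - s))
     + (f x - f (x - s)) / (cosh (f x - f (x - s)) - cos s) * (f' x * f' (x - s) - 1) * sinh (f x - f (x - s))
     + (f x - f (x - s)) / (cosh (f x - f (x - s)) - cos s) * (f' x + f' (x - s)) * sin s"

text \<open>Adding a constant to the weight \<open>h(\<beta>)\<close> does not change the right-hand side.  The reason is that the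
kernel differs from \<open>ln (2 - 2 cos s)\<close>, which has integral 0, by an \<open>s\<close>-derivative of a function that
vanishes at both ends of the period.  The part of the kernel that contains \<open>f' x\<close> is the derivative of
\<open>f' x * \<theta> * ln (2 E)\<close>; a primitive \<open>\<psi>\<close> of the rest is found by inserting a parameter \<open>l\<close> that
deforms \<open>\<theta>\<close> into \<open>l \<theta>\<close> and integrating over \<open>l\<close>.\<close>

lemma integral_slip_kernel:
  assumes per: "periodic_2pi f" and der: "\<And>y. (f has_real_derivative f' y) (at y)"
    and cont: "continuous_on UNIV f'" and int: "integrable circle (slip_kernel f f' x)"
  shows "(\<integral>s. slip_kernel f f' x s \<partial>circle) = 0"
proof -
  define \<theta> where "\<theta> s = f x - f (x - s)" for s
  define E where "E s = cosh (\<theta> s) - cos s" for s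
  define u where "u s l = cosh (l * \<theta> s) - cos s" for s l
  define g where "g s l = l * (\<theta> s)\<^sup>2 * sin s / u s l" for s l
  define R where "R s l = ln (2 * u s l) - l * \<theta> s * sinh (l * \<theta> s) / u s l
     + l\<^sup>2 * \<theta> s * f' (x - s) * sin s / u s l" for s l
  \<comment> \<open>both the \<open>s\<close>-derivative of \<open>g\<close> and the \<open>l\<close>-derivative of \<open>R\<close>\<close>
  define gs where "gs s l = 2 * l * \<theta> s * f' (x - s) * sin s / u s l + l * (\<theta> s)\<^sup>2 * cos s / u s l
     - l * (\<theta> s)\<^sup>2 * sin s * (l * f' (x - s) * sinh (l * \<theta> s) + sin s) / (u s l)\<^sup>2" for s l
  define \<psi> where "\<psi> s = integral (cbox 0 1) (g s)" for s
  have d\<theta>: "(\<theta> has_real_derivative f' (x - s)) (at s)" for s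
    unfolding \<theta>_def by (rule derivative_eq_intros DERIV_chain'[OF _ der] refl | simp)+
  have c\<theta>: "continuous_on A \<theta>" for A
    by (meson DERIV_continuous_on has_field_derivative_at_within d\<theta>)
  have cf': "continuous_on A (\<lambda>s. f' (x - s))" for A
    by (rule continuous_on_compose2[OF cont]) (auto intro!: continuous_intros)
  have u: "u s l > 0" if "s \<in> {0<..<2*pi}" for s l
    using cos_lt_1[of s] that cosh_real_ge_1[of "l * \<theta> s"] by (simp add: u_def)
  have u0: "u s l \<ge> 0" for s l
    using cos_le_one[of s] cosh_real_ge_1[of "l * \<theta> s"] unfolding u_def by linarith
  have us: "(u s has_real_derivative \<theta> s * sinh (l * \<theta> s)) (at l)" for s l
    unfolding u_def by (rule derivative_eq_intros refl | simp)+
  have ul: "((\<lambda>s. u s l) has_real_derivative l * f' (x - s) * sinh (l * \<theta> s) + sin s) (at s)" for s l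
    unfolding u_def by (rule derivative_eq_intros d\<theta> refl | simp)+
  have key: "((sinh a)\<^sup>2 + (sin s)\<^sup>2) = (cosh a + cos s) * (cosh a - cos s)" for a s :: real
    using cosh_square_eq[of a] sin_squared_eq[of s] by (simp add: algebra_simps power2_eq_square)
  have dR: "(R s has_real_derivative gs s l) (at l)" if s: "s \<in> {0<..<2*pi}" for s l
  proof -
    define S C c n \<phi> t U where "S = sinh (l * \<theta> s)" and "C = cosh (l * \<theta> s)" and "c = cos s" and "n = sin s"
      and "\<phi> = f' (x - s)" and "t = \<theta> s" and "U = u s l"
    have U: "U > 0" using u[OF s] by (simp add: U_def)
    have id: "S\<^sup>2 + n\<^sup>2 = (C + c) * U"
      unfolding S_def n_def C_def c_def U_def u_def by (rule key)
    have "(R s has_real_derivative (1 / (2 * U) * (2 * (t * S)) - ((t * S + l * t * (C * t)) * U - l * t * S * (t * S)) / (U * U)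
        + (2 * l * t * \<phi> * n * U - l\<^sup>2 * t * \<phi> * n * (t * S)) / (U * U))) (at l)"
      unfolding R_def S_def C_def c_def n_def \<phi>_def t_def U_def
      by (rule derivative_eq_intros us refl | use u[OF s, of l] in simp)+
    moreover have "1 / (2 * U) * (2 * (t * S)) - ((t * S + l * t * (C * t)) * U - l * t * S * (t * S)) / (U * U)
        + (2 * l * t * \<phi> * n * U - l\<^sup>2 * t * \<phi> * n * (t * S)) / (U * U)
      = 2 * l * t * \<phi> * n / U + l * t\<^sup>2 * c / U - l * t\<^sup>2 * n * (l * \<phi> * S + n) / U\<^sup>2"
    proof -
      have "l * t\<^sup>2 * (S\<^sup>2 + n\<^sup>2) = l * t\<^sup>2 * ((C + c) * U)" by (simp only: id)
      then have num: "t * S * U - ((t * S + l * t * (C * t)) * U - l * t * S * (t * S)) + (2 * l * t * \<phi> * n * U - l\<^sup>2 * t * \<phi> * n * (t * S))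
        = 2 * l * t * \<phi> * n * U + l * t\<^sup>2 * c * U - l * t\<^sup>2 * n * (l * \<phi> * S + n)"
        by (simp add: algebra_simps power2_eq_square)
      have "1 / (2 * U) * (2 * (t * S)) = t * S * U / (U * U)"
        "2 * l * t * \<phi> * n / U = 2 * l * t * \<phi> * n * U / (U * U)" "l * t\<^sup>2 * c / U = l * t\<^sup>2 * c * U / (U * U)"
        using U by simp_all
      then show ?thesis
        unfolding power2_eq_square[of U] by (simp only: add_divide_distrib[symmetric] diff_divide_distrib[symmetric] num)
    qed
    ultimately show ?thesis unfolding gs_def S_def C_def c_def n_def \<phi>_def t_def U_def by (simp only:)
  qed
  have dg: "((\<lambda>s. g s l) has_real_derivative gs s l) (at s)" if s: "s \<in> {0<..<2*pi}" for s l
  proof -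
    have "((\<lambda>s. g s l) has_real_derivative ((l * (2 * \<theta> s * f' (x - s)) * sin s + l * (\<theta> s)\<^sup>2 * cos s) * u s l
        - l * (\<theta> s)\<^sup>2 * sin s * (l * f' (x - s) * sinh (l * \<theta> s) + sin s)) / (u s l * u s l)) (at s)"
      unfolding g_def
      by (rule derivative_eq_intros ul d\<theta> refl | use u[OF s, of l] in simp)+
    moreover have "((l * (2 * \<theta> s * f' (x - s)) * sin s + l * (\<theta> s)\<^sup>2 * cos s) * u s l
        - l * (\<theta> s)\<^sup>2 * sin s * (l * f' (x - s) * sinh (l * \<theta> s) + sin s)) / (u s l * u s l) = gs s l"
      unfolding gs_def using u[OF s, of l] by (simp add: diff_divide_distrib add_divide_distrib power2_eq_square)
    ultimately show ?thesis by (simp only:)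
  qed
  have d\<psi>: "(\<psi> has_real_derivative R s 1 - R s 0) (at s)" if s: "s \<in> {0<..<2*pi}" for s
  proof -
    have "(\<psi> has_real_derivative integral (cbox 0 1) (gs s)) (at s within {0<..<2*pi})"
      unfolding \<psi>_def
    proof (rule leibniz_rule_field_derivative)
      show "((\<lambda>s. g s l) has_real_derivative gs s l) (at s within {0<..<2*pi})" if "s \<in> {0<..<2*pi}" for s l
        by (rule has_field_derivative_at_within[OF dg[OF that]])
      show "g s integrable_on cbox 0 1" if "s \<in> {0<..<2*pi}" for s
      proof (rule integrable_continuous)
        have "u s l \<noteq> 0" for l using u[OF that, of l] by simp
        then show "continuous_on (cbox 0 1) (g s)"
          unfolding g_def u_def by (intro continuous_intros) auto
      qed
      have "u (fst z) (snd z) \<noteq> 0" if "z \<in> {0<..<2*pi} \<times> cbox 0 1" for z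
        using u[of "fst z" "snd z"] that by auto
      then show "continuous_on ({0<..<2*pi} \<times> cbox 0 1) (\<lambda>(s, l). gs s l)"
        unfolding case_prod_unfold gs_def u_def
        by (intro continuous_intros continuous_on_compose2[OF c\<theta>[of UNIV]] continuous_on_compose2[OF cf'[of UNIV]]) auto
    qed (use s in auto)
    moreover have "(gs s has_integral (R s 1 - R s 0)) {0..1}"
      by (rule fundamental_theorem_of_calculus)
         (use dR[OF s] in \<open>auto simp: has_real_derivative_iff_has_vector_derivative[symmetric] intro: has_field_derivative_at_within\<close>)
    ultimately show ?thesis
      using s by (simp add: at_within_open[of s "{0<..<2*pi}"] integral_unique)
  qed
  have \<psi>_le: "\<bar>\<psi> s\<bar> \<le> \<bar>\<theta> s\<bar>" for s
  proof (cases "g s integrable_on cbox 0 1")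
    case True
    have "norm (g s l) \<le> \<bar>\<theta> s\<bar>" for l
    proof -
      have "0 \<le> (\<bar>l * \<theta> s\<bar> - \<bar>sin s\<bar>)\<^sup>2" by simp
      then have "2 * (\<bar>l * \<theta> s\<bar> * \<bar>sin s\<bar>) \<le> (l * \<theta> s)\<^sup>2 + (sin s)\<^sup>2"
        by (simp add: power2_diff)
      also have "(sin s)\<^sup>2 \<le> 2 - 2 * cos s"
        using power_mono[OF abs_sin_le_sqrt[of s], of 2] two_minus_two_cos_ge[of s] by simp
      finally have le: "\<bar>l * \<theta> s\<bar> * \<bar>sin s\<bar> \<le> u s l"
        using sq_le_cosh[of "l * \<theta> s"] by (simp add: u_def)
      have "norm (g s l) = \<bar>\<theta> s\<bar> * ((\<bar>l * \<theta> s\<bar> * \<bar>sin s\<bar>) / u s l)"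
        using u0[of s l] by (simp add: g_def abs_mult power2_eq_square mult_ac)
      also have "\<dots> \<le> \<bar>\<theta> s\<bar> * 1"
        by (rule mult_left_mono) (use le u0[of s l] in \<open>auto simp: divide_le_eq_1\<close>)
      finally show ?thesis by simp
    qed
    then have "norm (\<psi> s) \<le> integral (cbox 0 1) (\<lambda>_::real. \<bar>\<theta> s\<bar>)"
      unfolding \<psi>_def by (intro integral_norm_bound_integral True) auto
    then show ?thesis by simp
  qed (simp add: \<psi>_def not_integrable_integral)
  \<comment> \<open>the periodic primitive; it vanishes at the endpoints because \<open>\<theta>\<close> does\<close>
  define A where "A s = f' x * (\<theta> s * ln (2 * E s)) + \<psi> s" for s
  have K: "slip_kernel f f' x s - log_kernel s = f' x * (f' (x - s) * ln (2 * E s) + \<theta> s * (f' (x - s) * sinh (\<theta> s) + sin s) / E s) + (R s 1 - R s 0)" for s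
    unfolding slip_kernel_def \<theta>_def[symmetric] E_def[symmetric] log_kernel_def R_def u_def
    by (simp add: E_def[symmetric] add_divide_distrib diff_divide_distrib algebra_simps)
  have ends: "\<theta> 0 = 0" "\<theta> (2*pi) = 0"
    using per[unfolded periodic_2pi_def, rule_format, of "x - 2*pi"] by (simp_all add: \<theta>_def)
  have c\<psi>: "continuous_on {0..2*pi} \<psi>"
    unfolding continuous_on_def
  proof
    fix s :: real assume s: "s \<in> {0..2*pi}"
    show "(\<psi> \<longlongrightarrow> \<psi> s) (at s within {0..2*pi})"
    proof (cases "s \<in> {0<..<2*pi}")
      case True
      then have "isCont \<psi> s" by (rule DERIV_isCont[OF d\<psi>])
      then show ?thesis unfolding isCont_def by (rule tendsto_within_subset) simp
    next
      case False
      then have t0: "\<theta> s = 0" using s ends by (cases "s = 0") auto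
      then have "((\<lambda>s. \<bar>\<theta> s\<bar>) \<longlongrightarrow> 0) (at s within {0..2*pi})"
        using c\<theta>[of "{0..2*pi}"] s unfolding continuous_on_def by (force intro: tendsto_rabs_zero)
      then have "(\<psi> \<longlongrightarrow> 0) (at s within {0..2*pi})"
        by (rule Lim_null_comparison[rotated]) (use \<psi>_le in auto)
      then show ?thesis using \<psi>_le[of s] t0 by simp
    qed
  qed
  have "continuous_on {0..2*pi} (\<lambda>s. \<theta> s * ln (2 * E s))"
  proof (rule continuous_dominated_log[where C = 1])
    fix s
    have "2 * (cosh (\<theta> s) - 1) \<le> 2 * E s" using cos_le_one[of s] by (simp add: E_def)
    with sq_le_cosh[of "\<theta> s"] have "(\<theta> s)\<^sup>2 \<le> 2 * E s" by (rule order_trans)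
    then show "\<bar>\<theta> s\<bar> \<le> 1 * sqrt (2 * E s)" by (simp add: real_le_rsqrt)
    show "0 \<le> 2 * E s" using u0[of s 1] by (simp add: u_def E_def)
  qed (auto simp: E_def intro!: continuous_intros c\<theta>)
  then have "continuous_on {0..2*pi} A"
    unfolding A_def by (rule continuous_on_add[OF continuous_on_mult_left c\<psi>])
  then have "((\<lambda>s. slip_kernel f f' x s - log_kernel s) has_integral (A (2*pi) - A 0)) {0..2*pi}"
  proof (rule fundamental_theorem_of_calculus_interior[rotated])
    fix s assume s: "s \<in> {0<..<2*pi}"
    have E: "E s > 0" using u[OF s, of 1] by (simp add: u_def E_def)
    have dE: "(E has_real_derivative f' (x - s) * sinh (\<theta> s) + sin s) (at s)"
      unfolding E_def by (rule derivative_eq_intros d\<theta> refl | simp)+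
    have "(A has_real_derivative slip_kernel f f' x s - log_kernel s) (at s)"
    proof -
      define D where "D = f' (x - s) * sinh (\<theta> s) + sin s"
      have "((\<lambda>s. ln (2 * E s)) has_real_derivative inverse (2 * E s) * (2 * D)) (at s)"
        unfolding D_def by (rule DERIV_chain2[OF DERIV_ln DERIV_cmult[OF dE]]) (use E in simp)
      then have d2: "((\<lambda>s. \<theta> s * ln (2 * E s)) has_real_derivative f' (x - s) * ln (2 * E s) + inverse (2 * E s) * (2 * D) * \<theta> s) (at s)"
        by (rule DERIV_mult[OF d\<theta>])
      have e: "inverse (2 * E s) * (2 * D) * \<theta> s = \<theta> s * D / E s"
        using E by (simp add: field_simps)
      have "((\<lambda>s. f' x * (\<theta> s * ln (2 * E s)) + \<psi> s) has_real_derivative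
          f' x * (f' (x - s) * ln (2 * E s) + \<theta> s * D / E s) + (R s 1 - R s 0)) (at s)"
        by (rule DERIV_add[OF DERIV_cmult[OF d2[unfolded e]] d\<psi>[OF s]])
      then show ?thesis unfolding A_def K D_def .
    qed
    then show "(A has_vector_derivative slip_kernel f f' x s - log_kernel s) (at s)"
      by (simp add: has_real_derivative_iff_has_vector_derivative)
  qed simp
  moreover have "A (2*pi) = 0" "A 0 = 0"
    using \<psi>_le[of 0] \<psi>_le[of "2*pi"] by (simp_all add: A_def ends)
  ultimately have "((\<lambda>s. slip_kernel f f' x s - log_kernel s) has_integral 0) {0..2*pi}" by simp
  then have "(\<integral>s. slip_kernel f f' x s - log_kernel s \<partial>circle) = 0"
    by (rule has_integral_circle) (rule Bochner_Integration.integrable_diff[OF int integrable_log_kernel])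
  then show ?thesis
    unfolding Bochner_Integration.integral_diff[OF int integrable_log_kernel] by (simp add: integral_log_kernel)
qed

section \<open>Uniqueness of Fourier coefficients\<close>

lemma integrable_circle_mult:
  fixes F g :: "real \<Rightarrow> complex"
  assumes "integrable circle F" "g \<in> borel_measurable circle" "\<And>x. norm (g x) \<le> B"
  shows "integrable circle (\<lambda>x. F x * g x)"
  by (rule Bochner_Integration.integrable_bound[of circle "\<lambda>x. B * norm (F x)"])
     (use assms borel_measurable_integrable[OF assms(1)] in
       \<open>auto intro!: AE_I2 mult_right_mono simp: norm_mult mult.commute[of "norm (F _)"] intro: order_trans[OF _ abs_ge_self]\<close>)

lemma cnj_measurable [measurable]: "cnj \<in> borel_measurable borel"
  by (intro borel_measurable_continuous_onI continuous_intros)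

lemma borel_measurable_cnj:
  "f \<in> borel_measurable M \<Longrightarrow> (\<lambda>x. cnj (f x)) \<in> borel_measurable M"
  by (rule measurable_compose[OF _ cnj_measurable])

text \<open>Bessel's inequality: a bounded function cannot have the same nonzero Fourier coefficient at
infinitely many frequencies.\<close>

lemma bessel_constant_coeff:
  fixes g :: "real \<Rightarrow> complex"
  assumes g: "g \<in> borel_measurable circle" "\<And>x. norm (g x) \<le> B"
    and S: "infinite S" and coeff: "\<And>n. n \<in> S \<Longrightarrow> (\<integral>x. g x * cis (- (of_int n * x)) \<partial>circle) = A"
  shows "A = 0"
proof (rule ccontr)
  assume A: "A \<noteq> 0"
  have ig: "integrable circle g" by (rule integrable_circle_bounded[OF g(1)]) (rule g(2))
  have igg: "integrable circle (\<lambda>x. g x * cnj (g x))"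
    by (rule integrable_circle_mult[OF ig borel_measurable_cnj[OF g(1)], of B]) (simp add: g(2))
  obtain m :: nat where m: "of_nat m * (norm A)\<^sup>2 > 2 * pi * Re (\<integral>x. g x * cnj (g x) \<partial>circle)"
    using reals_Archimedean3[of "(norm A)\<^sup>2"] A by auto
  obtain N where N: "finite N" "card N = m" "N \<subseteq> S" using infinite_arbitrarily_large[OF S] by blast
  define a where "a = A / (2 * pi)"
  define T where "T x = (\<Sum>n\<in>N. a * cis (of_int n * x))" for x
  have mT: "T \<in> borel_measurable circle" unfolding T_def by measurable
  have bT: "norm (T x) \<le> real m * norm a" for x
    using sum_norm_le[of N "\<lambda>n. a * cis (of_int n * x)" "\<lambda>_. norm a"] N by (simp add: T_def norm_mult)
  have iT: "integrable circle (\<lambda>x. u x * cnj (T x))" if "integrable circle u" for u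
    by (rule integrable_circle_mult[OF that borel_measurable_cnj[OF mT]]) (unfold complex_mod_cnj, rule bT)
  have IT: "integrable circle T" by (rule integrable_circle_bounded[OF mT]) (rule bT)
  have gT: "(\<integral>x. g x * cnj (T x) \<partial>circle) = of_nat m * cnj a * A"
  proof -
    have "(\<integral>x. g x * cnj (T x) \<partial>circle) = (\<integral>x. (\<Sum>n\<in>N. cnj a * (g x * cis (- (of_int n * x)))) \<partial>circle)"
      unfolding T_def by (simp add: sum_distrib_left cis_cnj mult_ac)
    also have "\<dots> = (\<Sum>n\<in>N. \<integral>x. cnj a * (g x * cis (- (of_int n * x))) \<partial>circle)"
      by (rule Bochner_Integration.integral_sum) (intro integrable_mult_right integrable_circle_mult[OF ig, of _ 1], auto)
    also have "\<dots> = (\<Sum>n\<in>N. cnj a * A)" using coeff N by (intro sum.cong) auto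
    finally show ?thesis using N by simp
  qed
  have Tc: "(\<integral>x. T x * cis (- (of_int n * x)) \<partial>circle) = 2 * pi * a" if "n \<in> N" for n
  proof -
    have "(\<integral>x. T x * cis (- (of_int n * x)) \<partial>circle) = (\<integral>x. (\<Sum>k\<in>N. a * cis (of_int (k - n) * x)) \<partial>circle)"
    proof (rule Bochner_Integration.integral_cong[OF refl])
      fix x
      have "cis (of_int k * x) * cis (- (of_int n * x)) = cis (of_int (k - n) * x)" for k
        by (simp add: cis_mult algebra_simps)
      then show "T x * cis (- (of_int n * x)) = (\<Sum>k\<in>N. a * cis (of_int (k - n) * x))"
        unfolding T_def sum_distrib_right mult.assoc by simp
    qed
    also have "\<dots> = (\<Sum>k\<in>N. \<integral>x. a * cis (of_int (k - n) * x) \<partial>circle)"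
      by (rule Bochner_Integration.integral_sum) (intro integrable_mult_right integrable_circle_bounded[of _ 1], auto)
    also have "\<dots> = (\<Sum>k\<in>N. if k = n then 2 * pi * a else 0)"
      by (rule sum.cong[OF refl]) (simp only: integral_mult_right_zero integral_cis_int, simp)
    finally show ?thesis using N that by simp
  qed
  have TT: "(\<integral>x. T x * cnj (T x) \<partial>circle) = of_nat m * cnj a * A"
  proof -
    have "(\<integral>x. T x * cnj (T x) \<partial>circle) = (\<integral>x. (\<Sum>n\<in>N. cnj a * (T x * cis (- (of_int n * x)))) \<partial>circle)"
      by (rule Bochner_Integration.integral_cong) (auto simp: T_def[of "_ :: real", THEN arg_cong[of _ _ cnj]] sum_distrib_left cis_cnj mult_ac)
    also have "\<dots> = (\<Sum>n\<in>N. \<integral>x. cnj a * (T x * cis (- (of_int n * x))) \<partial>circle)"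
      by (rule Bochner_Integration.integral_sum) (intro integrable_mult_right integrable_circle_mult[OF IT, of _ 1], auto)
    also have "\<dots> = (\<Sum>n\<in>N. cnj a * A)" using Tc by (intro sum.cong) (auto simp: a_def)
    finally show ?thesis using N by simp
  qed
  have Tg: "(\<integral>x. T x * cnj (g x) \<partial>circle) = of_nat m * a * cnj A"
  proof -
    have "(\<integral>x. T x * cnj (g x) \<partial>circle) = (\<integral>x. cnj (g x * cnj (T x)) \<partial>circle)" by (simp add: mult.commute)
    also have "\<dots> = cnj (\<integral>x. g x * cnj (T x) \<partial>circle)" by (simp del: complex_cnj_mult)
    finally show ?thesis by (simp add: gT)
  qed
  have iTg: "integrable circle (\<lambda>x. T x * cnj (g x))"
    by (rule integrable_circle_mult[OF IT borel_measurable_cnj[OF g(1)], of B]) (simp add: g(2))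
  have "0 \<le> (\<integral>x. (norm (g x - T x))\<^sup>2 \<partial>circle)" by simp
  also have "\<dots> = Re (of_real (\<integral>x. (norm (g x - T x))\<^sup>2 \<partial>circle))" by simp
  also have "of_real (\<integral>x. (norm (g x - T x))\<^sup>2 \<partial>circle) = (\<integral>x. (g x * cnj (g x) - g x * cnj (T x)) - (T x * cnj (g x) - T x * cnj (T x)) \<partial>circle)"
    unfolding integral_complex_of_real[symmetric] 
    by (rule Bochner_Integration.integral_cong) (auto simp del: of_real_power simp add: complex_norm_square algebra_simps)
  also have "\<dots> = (\<integral>x. g x * cnj (g x) \<partial>circle) - of_nat m * cnj a * A - (of_nat m * a * cnj A - of_nat m * cnj a * A)"
    using igg iT[OF ig] iT[OF IT] iTg gT TT Tg by simp
  also have "Re \<dots> = Re (\<integral>x. g x * cnj (g x) \<partial>circle) - of_nat m * Re (a * cnj A)"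
    by (simp add: algebra_simps)
  also have "a * cnj A = of_real ((norm A)\<^sup>2 / (2 * pi))"
    unfolding a_def using complex_norm_square[of A] by (simp del: of_real_power)
  finally have "of_nat m * (norm A)\<^sup>2 \<le> 2 * pi * Re (\<integral>x. g x * cnj (g x) \<partial>circle)"
    by (simp add: field_simps)
  with m show False by simp
qed

lemma norm_cis_minus_1: "norm (cis x - 1) = sqrt (2 - 2 * cos x)"
proof -
  have "(cos x - 1)\<^sup>2 + (sin x)\<^sup>2 = 2 - 2 * cos x"
    using sin_cos_squared_add[of x] by (simp add: power2_eq_square algebra_simps)
  then show ?thesis by (simp add: cmod_def)
qed

lemma quarter_le_sin: "0 \<le> x \<Longrightarrow> x \<le> pi / 2 \<Longrightarrow> x / 2 \<le> sin (x::real)"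
proof -
  assume x: "0 \<le> x" "x \<le> pi / 2"
  show ?thesis
  proof (cases "x \<le> pi / 3")
    case True
    have "sin 0 - 0 / 2 \<le> sin x - x / 2"
    proof (rule DERIV_nonneg_imp_nondecreasing[OF x(1)])
      fix y assume y: "0 \<le> y" "y \<le> x"
      have "cos (pi / 3) \<le> cos y" by (rule cos_monotone_0_pi_le) (use y True in auto)
      then have "0 \<le> cos y - 1 / 2" by (simp add: cos_60)
      moreover have "((\<lambda>x. sin x - x / 2) has_real_derivative cos y - 1 / 2) (at y)"
        by (auto intro!: derivative_eq_intros)
      ultimately show "\<exists>d. ((\<lambda>x. sin x - x / 2) has_real_derivative d) (at y) \<and> 0 \<le> d" by blast
    qed
    then show ?thesis by simp
  next
    case False
    have "sin (pi / 3) \<le> sin x" by (rule sin_monotone_2pi_le) (use x False in auto)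
    moreover have "16 / 10 \<le> sqrt 3" by (rule real_le_rsqrt) (simp add: power2_eq_square)
    moreover have "pi \<le> 32 / 10" using pi_approx(2) by simp
    then have "x / 2 \<le> 8 / 10" using x by simp
    ultimately show ?thesis by (simp add: sin_60)
  qed
qed

lemma half_le_sqrt_cos:
  assumes "0 \<le> x" "x \<le> pi" shows "x / 2 \<le> sqrt (2 - 2 * cos x)"
proof (rule real_le_rsqrt)
  have "x / 4 \<le> sin (x / 2)" using quarter_le_sin[of "x / 2"] assms by simp
  then have "(x / 4)\<^sup>2 \<le> (sin (x / 2))\<^sup>2" using assms by (intro power_mono) auto
  moreover have "2 - 2 * cos x = 4 * (sin (x / 2))\<^sup>2" using cos_double_sin[of "x / 2"] by simp
  ultimately show "(x / 2)\<^sup>2 \<le> 2 - 2 * cos x" by (simp add: power2_eq_square)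
qed

text \<open>Chernoff's argument.  The Lipschitz condition makes \<open>(H x - H 0) / (cis x - 1)\<close> bounded.  If all
coefficients of \<open>H\<close> vanish, those of the quotient change only between the frequencies \<open>-1\<close> and \<open>0\<close>, where
they jump by a multiple of \<open>H 0\<close>; but Bessel's inequality forces both constant tails to be 0.\<close>

lemma lipschitz_zero_coeffs:
  fixes H :: "real \<Rightarrow> complex"
  assumes per: "periodic_2pi H" and lip: "\<And>x y. norm (H x - H y) \<le> L * \<bar>x - y\<bar>"
    and coeff: "\<And>k. (\<integral>x. H x * cis (- (of_int k * x)) \<partial>circle) = 0"
  shows "H 0 = 0"
proof -
  have L: "L \<ge> 0" using order_trans[OF norm_ge_zero lip[of 1 0]] by simp
  have "continuous_on UNIV H"
    by (rule lipschitz_on_continuous_on[of L]) (auto intro!: lipschitz_onI L simp: dist_norm lip)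
  then have mH: "H \<in> borel_measurable borel" by (rule borel_measurable_continuous_onI)
  have H2: "H (2 * pi) = H 0" using per[unfolded periodic_2pi_def, rule_format, of 0] by simp
  define g where "g x = (if x \<in> {0..2*pi} then (H x - H 0) / (cis x - 1) else 0)" for x
  have bg: "norm (g x) \<le> 2 * L" for x
  proof -
    have *: "norm ((H x - H 0) / (cis x - 1)) \<le> 2 * L" if d: "0 \<le> d" "d \<le> pi" "norm (H x - H 0) \<le> L * d" "cos x = cos d" for d
    proof -
      have n: "norm (cis x - 1) = sqrt (2 - 2 * cos d)" by (simp add: norm_cis_minus_1 d)
      have "L * d \<le> 2 * L * norm (cis x - 1)"
        unfolding n using mult_left_mono[OF half_le_sqrt_cos[OF d(1,2)], of "2 * L"] L by simp
      with d(3) have "norm (H x - H 0) \<le> 2 * L * norm (cis x - 1)" by linarith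
      then show ?thesis using L by (cases "cis x = 1") (auto simp: norm_divide divide_le_eq)
    qed
    show ?thesis
    proof (cases "x \<in> {0..2*pi}")
      case True
      show ?thesis
      proof (cases "x \<le> pi")
        case T: True
        then show ?thesis using *[of x] lip[of x 0] True by (simp add: g_def)
      next
        case False
        then show ?thesis using *[of "2*pi - x"] lip[of x "2*pi"] True H2 by (simp add: g_def)
      qed
    next
      case False
      then have "g x = 0" unfolding g_def by (rule if_not_P)
      then show ?thesis using L by simp
    qed
  qed
  have mg: "g \<in> borel_measurable circle"
    unfolding g_def by (rule borel_measurable_circle) (use mH in measurable)
  have ig: "integrable circle (\<lambda>x. g x * cis (- (of_int k * x)))" for k
    by (rule integrable_circle_bounded[of _ "2 * L"]) (use mg bg in \<open>auto simp: norm_mult\<close>)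
  have iH: "integrable circle (\<lambda>x. H x * cis (- (of_int k * x)))" for k
  proof (rule integrable_circle_bounded)
    fix x :: real assume "x \<in> {0..2*pi}"
    then have "L * \<bar>x - 0\<bar> \<le> L * (2 * pi)" using L by (intro mult_left_mono) auto
    then have "norm (H x) \<le> norm (H 0) + L * (2 * pi)"
      using lip[of x 0] norm_triangle_sub[of "H x" "H 0"] by linarith
    then show "norm (H x * cis (- (of_int k * x))) \<le> norm (H 0) + L * (2 * pi)" by (simp add: norm_mult)
  qed (use mH in \<open>auto intro!: borel_measurable_circle\<close>)
  define G where "G k = (\<integral>x. g x * cis (- (of_int k * x)) \<partial>circle)" for k
  have step: "G (k - 1) - G k = - H 0 * (if k = 0 then 2 * pi else 0)" for k
  proof -
    have "G (k - 1) - G k = (\<integral>x. g x * cis (- (of_int (k - 1) * x)) - g x * cis (- (of_int k * x)) \<partial>circle)"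
      unfolding G_def by (rule Bochner_Integration.integral_diff[symmetric, OF ig ig])
    also have "\<dots> = (\<integral>x. H x * cis (- (of_int k * x)) - H 0 * cis (of_int (- k) * x) \<partial>circle)"
    proof (rule Bochner_Integration.integral_cong[OF refl])
      fix x assume x: "x \<in> space circle"
      have "cis (- (of_int (k - 1) * x)) = cis (- (of_int k * x)) * cis x"
        by (simp add: cis_mult algebra_simps)
      then have "g x * cis (- (of_int (k - 1) * x)) - g x * cis (- (of_int k * x)) = g x * (cis x - 1) * cis (- (of_int k * x))"
        by (simp add: algebra_simps)
      also have "g x * (cis x - 1) = H x - H 0"
      proof (cases "cis x = 1")
        case True
        then have "sqrt (2 - 2 * cos x) = 0" by (simp flip: norm_cis_minus_1)
        then have "cos x = 1" by simp
        then have "x = 0 \<or> x = 2 * pi" using cos_lt_1[of x] x by force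
        then show ?thesis using True H2 by auto
      qed (use x in \<open>simp add: g_def\<close>)
      finally show "g x * cis (- (of_int (k - 1) * x)) - g x * cis (- (of_int k * x)) = H x * cis (- (of_int k * x)) - H 0 * cis (of_int (- k) * x)"
        by (simp add: algebra_simps)
    qed
    also have "\<dots> = 0 - H 0 * (if k = 0 then 2 * pi else 0)"
      by (subst Bochner_Integration.integral_diff[OF iH], rule integrable_circle_bounded[of _ "norm (H 0)"])
         (auto simp: coeff norm_mult integral_cis_int simp del: of_int_minus)
    finally show ?thesis by simp
  qed
  have pos: "G (int n) = G 0" for n
    using step[of "int (Suc _)"] by (induction n) auto
  have neg: "G (- 1 - int n) = G (- 1)" for n
    using step[of "- 1 - int _"] by (induction n) (auto simp: algebra_simps)
  have "G 0 = 0"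
  proof (rule bessel_constant_coeff[OF mg bg])
    show "infinite (range int)" by (simp add: finite_image_iff)
    show "\<And>n. n \<in> range int \<Longrightarrow> (\<integral>x. g x * cis (- (of_int n * x)) \<partial>circle) = G 0"
      using pos by (auto simp: G_def)
  qed
  moreover have "G (- 1) = 0"
  proof (rule bessel_constant_coeff[OF mg bg])
    show "infinite (range (\<lambda>n. - 1 - int n))" by (subst finite_image_iff) (auto simp: inj_on_def)
    show "\<And>n. n \<in> range (\<lambda>n. - 1 - int n) \<Longrightarrow> (\<integral>x. g x * cis (- (of_int n * x)) \<partial>circle) = G (- 1)"
      using neg by (auto simp: G_def)
  qed
  ultimately show ?thesis using step[of 0] by simp
qed

text \<open>Correlating \<open>F\<close> with the Lipschitz function \<open>\<eta>\<close> produces a Lipschitz function whose Fourier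
coefficients are again all 0.\<close>

lemma integral_lipschitz_zero_coeffs:
  fixes F :: "real \<Rightarrow> complex" and \<eta> :: "real \<Rightarrow> real"
  assumes F: "integrable circle F" and coeff: "\<And>k. (\<integral>x. F x * cis (- (of_int k * x)) \<partial>circle) = 0"
    and per: "periodic_2pi \<eta>" and lip: "\<And>x y. \<bar>\<eta> x - \<eta> y\<bar> \<le> L * \<bar>x - y\<bar>" and bnd: "\<And>x. \<bar>\<eta> x\<bar> \<le> B"
  shows "(\<integral>x. F x * of_real (\<eta> x) \<partial>circle) = 0"
proof -
  interpret pair_sigma_finite circle circle ..
  have L: "L \<ge> 0" using order_trans[OF abs_ge_zero lip[of 1 0]] by simp
  have "continuous_on UNIV \<eta>"
    by (rule lipschitz_on_continuous_on[of L]) (auto intro!: lipschitz_onI L simp: dist_norm lip)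
  then have m\<eta> [measurable]: "\<eta> \<in> borel_measurable borel" by (rule borel_measurable_continuous_onI)
  have mF [measurable]: "F \<in> borel_measurable circle" using F by auto
  have iF: "integrable circle (\<lambda>y. F y * of_real (\<eta> (y + x)))" for x
  proof (rule integrable_circle_mult[OF F])
    show "(\<lambda>y. complex_of_real (\<eta> (y + x))) \<in> borel_measurable circle"
      by (rule borel_measurable_circle) measurable
    show "norm (complex_of_real (\<eta> (y + x))) \<le> B" for y using bnd by simp
  qed
  define \<Phi> where "\<Phi> x = (\<integral>y. F y * of_real (\<eta> (y + x)) \<partial>circle)" for x
  have "\<Phi> 0 = 0"
  proof (rule lipschitz_zero_coeffs)
    show "periodic_2pi \<Phi>"
      using per by (simp add: periodic_2pi_def \<Phi>_def add.assoc[symmetric])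
    show "norm (\<Phi> x - \<Phi> x') \<le> (\<integral>y. norm (F y) * L \<partial>circle) * \<bar>x - x'\<bar>" for x x'
    proof -
      have "\<Phi> x - \<Phi> x' = (\<integral>y. F y * of_real (\<eta> (y + x)) - F y * of_real (\<eta> (y + x')) \<partial>circle)"
        unfolding \<Phi>_def by (rule Bochner_Integration.integral_diff[symmetric, OF iF iF])
      also have "norm \<dots> \<le> (\<integral>y. norm (F y) * (L * \<bar>x - x'\<bar>) \<partial>circle)"
      proof (rule Bochner_Integration.integral_norm_bound_integral)
        show "integrable circle (\<lambda>y. F y * of_real (\<eta> (y + x)) - F y * of_real (\<eta> (y + x')))"
          by (rule Bochner_Integration.integrable_diff[OF iF iF])
        show "integrable circle (\<lambda>y. norm (F y) * (L * \<bar>x - x'\<bar>))" using F by auto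
        fix y
        have "norm (F y * of_real (\<eta> (y + x)) - F y * of_real (\<eta> (y + x'))) = norm (F y) * \<bar>\<eta> (y + x) - \<eta> (y + x')\<bar>"
          unfolding right_diff_distrib[symmetric] of_real_diff[symmetric] norm_mult norm_of_real ..
        also have "\<dots> \<le> norm (F y) * (L * \<bar>x - x'\<bar>)"
          using lip[of "y + x" "y + x'"] by (intro mult_left_mono) auto
        finally show "norm (F y * of_real (\<eta> (y + x)) - F y * of_real (\<eta> (y + x'))) \<le> norm (F y) * (L * \<bar>x - x'\<bar>)" .
      qed
      finally show ?thesis by (simp add: mult.assoc[symmetric])
    qed
    fix k
    have int2: "integrable (circle \<Otimes>\<^sub>M circle) (\<lambda>(x, y). F y * of_real (\<eta> (y + x)) * cis (- (of_int k * x)))"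
    proof (rule Bochner_Integration.integrable_bound)
      have id: "(\<lambda>x. x) \<in> circle \<rightarrow>\<^sub>M borel" by (rule borel_measurable_circle) simp
      have [measurable]: "fst \<in> circle \<Otimes>\<^sub>M circle \<rightarrow>\<^sub>M borel"
        using measurable_compose[OF measurable_fst[of circle circle] id] by simp
      have [measurable]: "snd \<in> circle \<Otimes>\<^sub>M circle \<rightarrow>\<^sub>M borel"
        using measurable_compose[OF measurable_snd[of circle circle] id] by simp
      have [measurable]: "(\<lambda>p. F (snd p)) \<in> borel_measurable (circle \<Otimes>\<^sub>M circle)"
        by (rule measurable_compose[OF measurable_snd mF])
      show "integrable (circle \<Otimes>\<^sub>M circle) (\<lambda>p. norm (F (snd p)) * B)"
        by (rule Fubini_integrable) (use F in auto)
      show "(\<lambda>(x, y). F y * of_real (\<eta> (y + x)) * cis (- (of_int k * x))) \<in> borel_measurable (circle \<Otimes>\<^sub>M circle)"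
        unfolding case_prod_unfold by measurable
      show "AE p in circle \<Otimes>\<^sub>M circle. norm (case p of (x, y) \<Rightarrow> F y * of_real (\<eta> (y + x)) * cis (- (of_int k * x))) \<le> norm (norm (F (snd p)) * B)"
      proof (rule AE_I2)
        fix p
        have "norm (F (snd p)) * \<bar>\<eta> (snd p + fst p)\<bar> \<le> norm (F (snd p)) * \<bar>B\<bar>"
          using bnd[of "snd p + fst p"] by (intro mult_left_mono) auto
        then show "norm (case p of (x, y) \<Rightarrow> F y * of_real (\<eta> (y + x)) * cis (- (of_int k * x))) \<le> norm (norm (F (snd p)) * B)"
          by (simp add: case_prod_unfold norm_mult abs_mult)
      qed
    qed
    have "(\<integral>x. \<Phi> x * cis (- (of_int k * x)) \<partial>circle) = (\<integral>x. (\<integral>y. F y * of_real (\<eta> (y + x)) * cis (- (of_int k * x)) \<partial>circle) \<partial>circle)"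
      unfolding \<Phi>_def by (simp del: integral_mult_left_zero add: integral_mult_left_zero[symmetric])
    also have "\<dots> = (\<integral>y. (\<integral>x. F y * of_real (\<eta> (y + x)) * cis (- (of_int k * x)) \<partial>circle) \<partial>circle)"
      by (rule Fubini_integral[symmetric, OF int2])
    also have "\<dots> = (\<integral>y. F y * cis (- (of_int (- k) * y)) * (\<integral>z. of_real (\<eta> z) * cis (- (of_int k * z)) \<partial>circle) \<partial>circle)"
    proof (rule Bochner_Integration.integral_cong[OF refl])
      fix y
      let ?f = "\<lambda>z. of_real (\<eta> z) * cis (- (of_int k * z))"
      have per': "periodic_2pi ?f"
        unfolding periodic_2pi_def
      proof
        fix z
        have "cis (- (of_int k * (z + 2 * pi))) = cis (- (of_int k * z)) * cis (2 * pi * of_int (- k))"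
          by (simp add: cis_mult algebra_simps)
        moreover have "cis (2 * pi * of_int (- k)) = 1" by (rule cis_multiple_2pi) simp
        ultimately show "?f (z + 2 * pi) = ?f z" using per by (simp add: periodic_2pi_def)
      qed
      have int': "integrable circle ?f"
      proof (rule integrable_circle_bounded)
        show "?f \<in> borel_measurable circle" by (rule borel_measurable_circle) measurable
        show "norm (?f z) \<le> B" for z using bnd by (simp add: norm_mult)
      qed
      have "F y * of_real (\<eta> (y + x)) * cis (- (of_int k * x)) = F y * cis (- (of_int (- k) * y)) * ?f (x + y)" for x
      proof -
        have "cis (- (of_int k * x)) = cis (- (of_int (- k) * y)) * cis (- (of_int k * (x + y)))"
          by (simp add: cis_mult algebra_simps)
        then show ?thesis by (simp add: add.commute)
      qed
      then show "(\<integral>x. F y * of_real (\<eta> (y + x)) * cis (- (of_int k * x)) \<partial>circle)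
        = F y * cis (- (of_int (- k) * y)) * (\<integral>z. of_real (\<eta> z) * cis (- (of_int k * z)) \<partial>circle)"
        using circle_shift(1)[OF per' int', of y] by (simp only: integral_mult_right_zero)
    qed
    also have "\<dots> = 0" using coeff[of "- k"] by (simp only: integral_mult_left_zero) simp
    finally show "(\<integral>x. \<Phi> x * cis (- (of_int k * x)) \<partial>circle) = 0" .
  qed
  then show ?thesis by (simp add: \<Phi>_def)
qed

lemma cos_arc:
  assumes a: "0 \<le> a" "a < 2 * pi" and y: "0 \<le> y" "y < 2 * pi"
  shows "cos (a / 2) \<le> cos (y - a / 2) \<longleftrightarrow> y \<le> a"
proof (cases "y \<le> a")
  case True
  have "\<bar>y - a / 2\<bar> \<le> a / 2" using True y by linarith
  then have "cos (a / 2) \<le> cos \<bar>y - a / 2\<bar>"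
    by (intro cos_monotone_0_pi_le) (use a in auto)
  then show ?thesis using True by simp
next
  case False
  have "cos (y - a / 2) < cos (a / 2)"
  proof (cases "y - a / 2 \<le> pi")
    case T: True
    then show ?thesis by (intro cos_monotone_0_pi) (use False a in auto)
  next
    case F: False
    have "cos (2 * pi - (y - a / 2)) < cos (a / 2)"
      by (intro cos_monotone_0_pi) (use False F a y in auto)
    then show ?thesis by (simp add: cos_diff)
  qed
  then show ?thesis using False by simp
qed

text \<open>The indicator of an arc is the limit of Lipschitz functions.  The distance from the arc is measured
by \<open>d\<close> through a cosine, so that periodicity holds by construction.\<close>

lemma integral_arc_zero_coeffs:
  fixes F :: "real \<Rightarrow> complex"
  assumes F: "integrable circle F" and coeff: "\<And>k. (\<integral>x. F x * cis (- (of_int k * x)) \<partial>circle) = 0"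
    and a: "0 \<le> a" "a < 2 * pi"
  shows "(\<integral>x. indicator {..a} x *\<^sub>R F x \<partial>circle) = 0"
proof -
  define d where "d y = max 0 (cos (a / 2) - cos (y - a / 2))" for y
  define \<eta> where "\<eta> n y = max 0 (1 - real n * d y)" for n y
  have d0: "d y \<ge> 0" for y by (simp add: d_def)
  have cosl: "\<bar>cos x - cos y\<bar> \<le> \<bar>x - y\<bar>" for x y :: real
  proof -
    have "\<bar>cos x - cos y\<bar> = 2 * \<bar>sin ((x + y) / 2)\<bar> * \<bar>sin ((y - x) / 2)\<bar>"
      by (simp add: cos_diff_cos abs_mult)
    also have "\<dots> \<le> 2 * 1 * \<bar>(y - x) / 2\<bar>"
      by (intro mult_mono abs_sin_x_le_abs_x) auto
    finally show ?thesis by simp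
  qed
  have zero: "(\<integral>x. F x * of_real (\<eta> n x) \<partial>circle) = 0" for n
  proof (rule integral_lipschitz_zero_coeffs[OF F coeff])
    show "periodic_2pi (\<eta> n)"
      unfolding periodic_2pi_def \<eta>_def d_def
    proof
      fix x :: real
      have "x + 2 * pi - a / 2 = (x - a / 2) + 2 * pi" by simp
      then have "cos (x + 2 * pi - a / 2) = cos (x - a / 2)" by (simp only: cos_periodic)
      then show "max 0 (1 - real n * max 0 (cos (a / 2) - cos (x + 2 * pi - a / 2))) = max 0 (1 - real n * max 0 (cos (a / 2) - cos (x - a / 2)))" by simp
    qed
    show "\<bar>\<eta> n x\<bar> \<le> 1" for x using d0[of x] by (auto simp: \<eta>_def)
    show "\<bar>\<eta> n x - \<eta> n y\<bar> \<le> real n * \<bar>x - y\<bar>" for x y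
    proof -
      have m: "\<bar>max 0 u - max 0 v\<bar> \<le> \<bar>u - v\<bar>" for u v :: real by auto
      have "\<bar>\<eta> n x - \<eta> n y\<bar> \<le> \<bar>(1 - real n * d x) - (1 - real n * d y)\<bar>" unfolding \<eta>_def by (rule m)
      also have "\<dots> = real n * \<bar>d x - d y\<bar>" by (simp add: abs_mult right_diff_distrib[symmetric] abs_minus_commute)
      also have "\<dots> \<le> real n * \<bar>x - y\<bar>"
      proof (rule mult_left_mono)
        have "\<bar>d x - d y\<bar> \<le> \<bar>cos (x - a / 2) - cos (y - a / 2)\<bar>" unfolding d_def by (rule order_trans[OF m]) auto
        also have "\<dots> \<le> \<bar>x - y\<bar>" using cosl[of "x - a / 2" "y - a / 2"] by simp
        finally show "\<bar>d x - d y\<bar> \<le> \<bar>x - y\<bar>" .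
      qed simp
      finally show ?thesis .
    qed
  qed
  have [measurable]: "F \<in> borel_measurable circle" using F by auto
  have [measurable]: "(\<lambda>x. complex_of_real (\<eta> n x)) \<in> borel_measurable circle" for n
    by (rule borel_measurable_circle) (unfold \<eta>_def d_def, measurable)
  have "(\<lambda>n. \<integral>x. F x * of_real (\<eta> n x) \<partial>circle) \<longlonglongrightarrow> (\<integral>x. indicator {..a} x *\<^sub>R F x \<partial>circle)"
  proof (rule integral_dominated_convergence[where w = "\<lambda>x. norm (F x)"])
    show "(\<lambda>x. indicator {..a} x *\<^sub>R F x) \<in> borel_measurable circle"
      by (rule borel_measurable_scaleR[OF borel_measurable_circle \<open>F \<in> borel_measurable circle\<close>]) measurable
    show "AE x in circle. (\<lambda>n. F x * of_real (\<eta> n x)) \<longlonglongrightarrow> indicator {..a} x *\<^sub>R F x"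
      using AE_circle_interior
    proof eventually_elim
      case (elim x)
      have "(\<lambda>n. \<eta> n x) \<longlonglongrightarrow> indicator {..a} x"
      proof (cases "x \<le> a")
        case True
        then have "d x = 0" using cos_arc[OF a, of x] elim by (simp add: d_def)
        then show ?thesis using True by (simp add: \<eta>_def)
      next
        case False
        then have d: "d x > 0" using cos_arc[OF a, of x] elim by (simp add: d_def)
        have "eventually (\<lambda>n. \<eta> n x = 0) sequentially"
        proof -
          obtain m :: nat where m: "1 < real m * d x" using reals_Archimedean3[OF d] by blast
          have "\<eta> n x = 0" if "n \<ge> m" for n
          proof -
            have "real m * d x \<le> real n * d x" using that d by simp
            with m show ?thesis by (simp add: \<eta>_def)
          qed
          then show ?thesis by (auto simp: eventually_sequentially)
        qed
        then show ?thesis using False by (simp add: tendsto_eventually)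
      qed
      then have "(\<lambda>n. F x * of_real (\<eta> n x)) \<longlonglongrightarrow> F x * of_real (indicator {..a} x)"
        by (intro tendsto_intros)
      then show ?case by (simp add: scaleR_conv_of_real mult.commute)
    qed
    show "AE x in circle. norm (F x * of_real (\<eta> n x)) \<le> norm (F x)" for n
    proof (rule AE_I2)
      fix x
      have "\<bar>\<eta> n x\<bar> \<le> 1" using d0[of x] by (auto simp: \<eta>_def)
      then show "norm (F x * of_real (\<eta> n x)) \<le> norm (F x)"
        using mult_left_mono[of "\<bar>\<eta> n x\<bar>" 1 "norm (F x)"] by (simp add: norm_mult)
    qed
  qed (use F in auto)
  then show ?thesis unfolding zero by (simp add: LIMSEQ_const_iff)
qed

text \<open>Uniqueness of Fourier coefficients for integrable functions: the integral over every arc vanishes,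
hence over every Borel set, and the density is 0.\<close>

lemma AE_zero_coeffs:
  fixes F :: "real \<Rightarrow> complex"
  assumes F: "integrable circle F" and coeff: "\<And>k. (\<integral>x. F x * cis (- (of_int k * x)) \<partial>circle) = 0"
  shows "AE x in circle. F x = 0"
proof -
  define F' where "F' x = indicator {0..2*pi} x *\<^sub>R F x" for x
  have iF': "integrable lborel F'"
    using F unfolding integrable_circle_iff set_integrable_def F'_def .
  have arc: "(\<integral>x. indicator {..a} x *\<^sub>R F' x \<partial>lborel) = 0" for a
  proof -
    have "(\<integral>x. indicator {..a} x *\<^sub>R F' x \<partial>lborel) = (\<integral>x. indicator {..a} x *\<^sub>R F x \<partial>circle)"
      unfolding torus_integral_circle[symmetric] torus_integral_def set_lebesgue_integral_def F'_def
      by (simp add: mult.commute)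
    also have "\<dots> = 0"
    proof -
      consider "a < 0" | "0 \<le> a" "a < 2 * pi" | "2 * pi \<le> a" by linarith
      then show ?thesis
      proof cases
        case 1
        have "(\<integral>x. indicator {..a} x *\<^sub>R F x \<partial>circle) = (\<integral>x. 0 \<partial>circle)"
          by (rule Bochner_Integration.integral_cong) (use 1 in auto)
        then show ?thesis by simp
      next
        case 2
        then show ?thesis by (rule integral_arc_zero_coeffs[OF F coeff])
      next
        case 3
        have "(\<integral>x. indicator {..a} x *\<^sub>R F x \<partial>circle) = (\<integral>x. F x \<partial>circle)"
          by (rule Bochner_Integration.integral_cong) (use 3 in auto)
        then show ?thesis using coeff[of 0] by simp
      qed
    qed
    finally show ?thesis .
  qed
  have tot: "(\<integral>x. F' x \<partial>lborel) = 0"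
    using coeff[of 0] unfolding torus_integral_circle[symmetric] torus_integral_def set_lebesgue_integral_def F'_def by simp
  have "(LINT x:A|lborel. F' x) = 0" if "A \<in> sets lborel" for A
  proof -
    have A: "A \<in> sigma_sets UNIV (range (\<lambda>a::real. {..a}))"
      using that unfolding sets_lborel borel_eq_atMost by simp
    have "Int_stable (range (\<lambda>a::real. {..a}))" "range (\<lambda>a::real. {..a}) \<subseteq> Pow UNIV"
      by (auto simp: Int_stable_def)
    then show ?thesis using A
    proof (induction A rule: sigma_sets_induct_disjoint)
      case (basic A)
      then show ?case using arc by (auto simp: set_lebesgue_integral_def)
    next
      case empty
      show ?case by (simp add: set_lebesgue_integral_def)
    next
      case (compl A)
      have m: "A \<in> sets lborel" using compl(1) unfolding sets_lborel borel_eq_atMost by simp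
      have "(LINT x:UNIV - A|lborel. F' x) = (\<integral>x. F' x - indicator A x *\<^sub>R F' x \<partial>lborel)"
        unfolding set_lebesgue_integral_def
        by (rule Bochner_Integration.integral_cong) (auto simp: indicator_def)
      also have "\<dots> = (\<integral>x. F' x \<partial>lborel) - (\<integral>x. indicator A x *\<^sub>R F' x \<partial>lborel)"
        by (rule Bochner_Integration.integral_diff[OF iF' integrable_mult_indicator[OF m iF']])
      finally show ?case using compl(2) tot by (simp add: set_lebesgue_integral_def)
    next
      case (union A)
      have m: "A i \<in> sets lborel" for i using union(2) unfolding sets_lborel borel_eq_atMost by auto
      have "(LINT x:(\<Union>(range A))|lborel. F' x) = (\<Sum>i. LINT x:A i|lborel. F' x)"
      proof (rule lebesgue_integral_countable_add[OF m])
        show "\<And>i j. i \<noteq> j \<Longrightarrow> A i \<inter> A j = {}" using union(1) by (auto simp: disjoint_family_on_def)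
        show "set_integrable lborel (\<Union>(range A)) F'"
          unfolding set_integrable_def by (rule integrable_mult_indicator[OF _ iF']) (use m in auto)
      qed
      then show ?case using union(3) by simp
    qed
  qed
  then have "AE x in lborel. F' x = 0" by (rule sigma_finite_measure.density_zero[OF lborel.sigma_finite_measure_axioms iF'])
  then have "AE x in lborel. x \<in> {0..2*pi} \<longrightarrow> F x = 0"
    by eventually_elim (auto simp: F'_def)
  then show ?thesis unfolding circle_def by (subst AE_restrict_space_iff) auto
qed

lemma AE_circle_periodic:
  assumes per: "\<And>x. P (x + 2 * pi) \<longleftrightarrow> P x" and ae: "AE x in circle. P x"
  shows "AE x in lborel. P x"
proof -
  have perP: "periodic_2pi P" using per by (auto simp: periodic_2pi_def)
  have ae0: "AE x in lborel. x \<in> {0..2*pi} \<longrightarrow> P x"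
    using ae unfolding circle_def by (subst (asm) AE_restrict_space_iff) auto
  have "AE x in lborel. 2 * pi * of_int n + x \<in> {0..2*pi} \<longrightarrow> P (2 * pi * of_int n + x)" for n :: int
  proof (rule AE_distrD[of "(+) (2 * pi * of_int n)" lborel borel])
    show "AE x in distr lborel borel ((+) (2 * pi * of_int n)). x \<in> {0..2*pi} \<longrightarrow> P x"
      unfolding lborel_distr_plus by (rule ae0)
  qed simp
  then have "AE x in lborel. \<forall>n::int. 2 * pi * of_int n + x \<in> {0..2*pi} \<longrightarrow> P (2 * pi * of_int n + x)"
    by (subst AE_all_countable) auto
  then show ?thesis
  proof eventually_elim
    case (elim x)
    define n where "n = - \<lfloor>x / (2 * pi)\<rfloor>"
    have "- of_int n \<le> x / (2 * pi)" "x / (2 * pi) < - of_int n + 1" unfolding n_def by linarith+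
    then have "2 * pi * of_int n + x \<in> {0..2*pi}" by (auto simp: field_simps)
    with elim have "P (2 * pi * of_int n + x)" by blast
    then show ?case using periodic_2pi_int[OF perP, of x n] by (simp add: add.commute)
  qed
qed

lemma continuous_AE_zero:
  fixes G :: "real \<Rightarrow> complex"
  assumes "continuous_on UNIV G" "AE x in lborel. G x = 0"
  shows "G x = 0"
proof (rule ccontr)
  assume "G x \<noteq> 0"
  have "open (G -` (- {0}))" by (rule open_vimage) (use assms in auto)
  moreover have "G -` (- {0}) \<noteq> {}" using \<open>G x \<noteq> 0\<close> by auto
  ultimately have "\<not> negligible (G -` (- {0}))" by (rule open_not_negligible)
  moreover have "G -` (- {0}) \<in> null_sets lborel"
  proof (rule AE_iff_null_sets[THEN iffD2])
    show "G -` (- {0}) \<in> sets lborel" using \<open>open (G -` (- {0}))\<close> by simp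
    show "AE x in lborel. x \<notin> G -` (- {0})" using assms(2) by eventually_elim auto
  qed
  ultimately show False
    using negligible_iff_null_sets null_sets_completionI by blast
qed

section \<open>Functions with exponentially decaying Fourier coefficients\<close>

lemma abs_le_exp:
  assumes "d > 0" shows "\<bar>real_of_int k\<bar> \<le> exp (d * \<bar>real_of_int k\<bar>) / d"
proof -
  have "d * \<bar>real_of_int k\<bar> \<le> exp (d * \<bar>real_of_int k\<bar>)"
    by (rule order_trans[OF _ exp_ge_add_one_self]) simp
  then show ?thesis using assms by (simp add: field_simps)
qed

lemma exp_decay_summable:
  assumes "d > 0" shows "(\<lambda>k::int. exp (- d * \<bar>real_of_int k\<bar>)) summable_on UNIV"
proof -
  have q: "0 < exp (- d)" "exp (- d) < 1" using assms by auto
  have s: "(\<lambda>n::nat. exp (- d) ^ n) summable_on UNIV"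
    by (rule summable_nonneg_imp_summable_on) (use q in \<open>auto intro!: summable_geometric\<close>)
  have e: "exp (- d * \<bar>real_of_int k\<bar>) = exp (- d) ^ nat \<bar>k\<bar>" for k :: int
    by (subst exp_of_nat_mult[symmetric]) (simp add: mult.commute)
  have "(\<lambda>k::int. exp (- d) ^ nat \<bar>k\<bar>) summable_on (range int \<union> range (\<lambda>n. - int n))"
  proof (rule summable_on_union)
    show "(\<lambda>k::int. exp (- d) ^ nat \<bar>k\<bar>) summable_on range int"
      by (subst summable_on_reindex) (use s in \<open>auto simp: o_def\<close>)
    show "(\<lambda>k::int. exp (- d) ^ nat \<bar>k\<bar>) summable_on range (\<lambda>n. - int n)"
      by (subst summable_on_reindex) (use s in \<open>auto simp: o_def inj_on_def\<close>)
  qed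
  moreover have "range int \<union> range (\<lambda>n. - int n) = UNIV"
    by (metis (no_types, lifting) UNIV_eq_I UnCI int_cases2 rangeI)
  ultimately show ?thesis unfolding e by simp
qed

definition trig_sum :: "(int \<Rightarrow> complex) \<Rightarrow> real \<Rightarrow> complex" where
  "trig_sum a x = (\<Sum>\<^sub>\<infinity>k. a k * cis (of_int k * x))"

definition exp_decay :: "real \<Rightarrow> (int \<Rightarrow> complex) \<Rightarrow> bool" where
  "exp_decay r a \<longleftrightarrow> (\<exists>B. \<forall>k. norm (a k) \<le> B * exp (- r * \<bar>real_of_int k\<bar>))"

lemma exp_decay_summable_norm:
  assumes "exp_decay r a" "r > 0"
  shows "(\<lambda>k. norm (a k)) summable_on UNIV"
proof -
  obtain B where B: "\<And>k. norm (a k) \<le> B * exp (- r * \<bar>real_of_int k\<bar>)" using assms unfolding exp_decay_def by blast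
  show ?thesis
    by (rule summable_on_bounded_by(3)[OF summable_on_cmult_right[OF exp_decay_summable[OF assms(2)]] B])
qed

lemma exp_decay_derivative:
  assumes "exp_decay r a" "0 < r" "s < r"
  shows "exp_decay s (\<lambda>k. \<i> * of_int k * a k)"
proof -
  obtain B where B: "\<And>k. norm (a k) \<le> B * exp (- r * \<bar>real_of_int k\<bar>)" using assms unfolding exp_decay_def by blast
  have "norm (\<i> * of_int k * a k) \<le> B / (r - s) * exp (- s * \<bar>real_of_int k\<bar>)" for k
  proof -
    have "norm (\<i> * of_int k * a k) = \<bar>real_of_int k\<bar> * norm (a k)" by (simp add: norm_mult)
    also have "\<dots> \<le> exp ((r - s) * \<bar>real_of_int k\<bar>) / (r - s) * (B * exp (- r * \<bar>real_of_int k\<bar>))"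
      by (intro mult_mono abs_le_exp B) (use assms in auto)
    also have "\<dots> = B / (r - s) * (exp ((r - s) * \<bar>real_of_int k\<bar>) * exp (- r * \<bar>real_of_int k\<bar>))" by simp
    also have "exp ((r - s) * \<bar>real_of_int k\<bar>) * exp (- r * \<bar>real_of_int k\<bar>) = exp (- s * \<bar>real_of_int k\<bar>)"
      by (simp add: exp_add[symmetric] algebra_simps)
    finally show ?thesis .
  qed
  then show ?thesis unfolding exp_decay_def by blast
qed

text \<open>The trigonometric series converges locally uniformly in a complex strip whose half-width is the
rate of decay.\<close>

lemma exp_decay_holomorphic:
  assumes "exp_decay r a" "r > 0"
  obtains g g' where
    "\<And>z. \<bar>Im z\<bar> < r \<Longrightarrow> (g has_field_derivative g' z) (at z)"
    "\<And>x. g (of_real x) = trig_sum a x"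
    "\<And>x. g' (of_real x) = trig_sum (\<lambda>k. \<i> * of_int k * a k) x"
proof -
  obtain B where B: "\<And>k. norm (a k) \<le> B * exp (- r * \<bar>real_of_int k\<bar>)" using assms unfolding exp_decay_def by blast
  have B0: "B \<ge> 0" using order_trans[OF norm_ge_zero B[of 0]] by simp
  define S where "S = {z. \<bar>Im z\<bar> < r}"
  define f where "f n z = a (int_decode n) * exp (\<i> * of_int (int_decode n) * z)" for n z
  define f' where "f' n z = \<i> * of_int (int_decode n) * a (int_decode n) * exp (\<i> * of_int (int_decode n) * z)" for n z
  have "open S" unfolding S_def by (intro open_Collect_less continuous_intros)
  moreover have "(f n has_field_derivative f' n z) (at z)" for n z
    unfolding f_def f'_def by (auto intro!: derivative_eq_intros)
  moreover have "\<exists>d h. 0 < d \<and> summable h \<and> range h \<subseteq> \<real>\<^sub>\<ge>\<^sub>0 \<and> (\<forall>\<^sub>F n in sequentially. \<forall>y\<in>ball z d \<inter> S. cmod (f n y) \<le> cmod (h n))"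
    if z: "z \<in> S" for z
  proof -
    define d where "d = (r - \<bar>Im z\<bar>) / 2"
    have d: "d > 0" using z by (simp add: d_def S_def)
    define h where "h n = complex_of_real (B * exp (- d * \<bar>real_of_int (int_decode n)\<bar>))" for n
    have "summable h"
      unfolding h_def by (intro summable_of_real summable_mult summable_int_decode exp_decay_summable d)
    moreover have "range h \<subseteq> \<real>\<^sub>\<ge>\<^sub>0" using B0 by (auto simp: h_def)
    moreover have "cmod (f n y) \<le> cmod (h n)" if y: "y \<in> ball z d" for n y
    proof -
      let ?k = "int_decode n"
      have "\<bar>Im y - Im z\<bar> \<le> d" using y abs_Im_le_cmod[of "y - z"] by (simp add: dist_norm norm_minus_commute)
      moreover have "2 * d = r - \<bar>Im z\<bar>" unfolding d_def by simp
      ultimately have Im: "\<bar>Im y\<bar> \<le> r - d" by linarith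
      have "cmod (exp (\<i> * of_int ?k * y)) = exp (- (of_int ?k * Im y))" by (simp add: norm_exp_eq_Re)
      also have "\<dots> \<le> exp (\<bar>real_of_int ?k\<bar> * (r - d))"
      proof -
        have "- (of_int ?k * Im y) \<le> \<bar>real_of_int ?k\<bar> * \<bar>Im y\<bar>" by (metis abs_ge_minus_self abs_mult)
        also have "\<dots> \<le> \<bar>real_of_int ?k\<bar> * (r - d)" using Im by (intro mult_left_mono) auto
        finally show ?thesis by simp
      qed
      finally have "cmod (f n y) \<le> (B * exp (- r * \<bar>real_of_int ?k\<bar>)) * exp (\<bar>real_of_int ?k\<bar> * (r - d))"
        unfolding f_def norm_mult by (intro mult_mono B) (use B0 in auto)
      also have "\<dots> = cmod (h n)" unfolding h_def using B0
        by (simp add: exp_add[symmetric] norm_mult algebra_simps)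
      finally show ?thesis .
    qed
    ultimately show ?thesis
      by (intro exI[of _ d] exI[of _ h] conjI always_eventually allI ballI d) auto
  qed
  ultimately obtain g g' where g: "\<And>z. z \<in> S \<Longrightarrow> ((\<lambda>n. f n z) sums g z) \<and> ((\<lambda>n. f' n z) sums g' z) \<and> (g has_field_derivative g' z) (at z)"
    using series_and_derivative_comparison_complex[of S f f'] by blast
  have x: "complex_of_real x \<in> S" for x using assms by (simp add: S_def)
  have e: "exp (\<i> * of_int k * of_real x) = cis (of_int k * x)" for k x
    by (simp add: cis_conv_exp mult.assoc)
  show thesis
  proof (rule that[of g g'])
    show "(g has_field_derivative g' z) (at z)" if "\<bar>Im z\<bar> < r" for z using g that by (simp add: S_def)
    have s0: "(\<lambda>k. a k * cis (of_int k * x)) summable_on UNIV" for x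
      by (rule summable_on_bounded_by(1)[OF exp_decay_summable_norm[OF assms]]) (simp add: norm_mult)
    have s1: "(\<lambda>k. \<i> * of_int k * a k * cis (of_int k * x)) summable_on UNIV" for x
      by (rule summable_on_bounded_by(1)[OF exp_decay_summable_norm[OF exp_decay_derivative[OF assms, of "r/2"]]])
         (use assms in \<open>auto simp: norm_mult\<close>)
    show "g (of_real x) = trig_sum a x" for x
      using g[OF x] has_sum_int_imp_sums[OF has_sum_infsum[OF s0]] sums_unique2
      unfolding f_def e trig_sum_def by blast
    show "g' (of_real x) = trig_sum (\<lambda>k. \<i> * of_int k * a k) x" for x
      using g[OF x] has_sum_int_imp_sums[OF has_sum_infsum[OF s1]] sums_unique2
      unfolding f'_def e trig_sum_def by blast
  qed
qed

lemma trig_sum_vector_derivative: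
  assumes "exp_decay r a" "r > 0"
  shows "(trig_sum a has_vector_derivative trig_sum (\<lambda>k. \<i> * of_int k * a k) x) (at x)"
proof -
  obtain g g' where g: "\<And>z. \<bar>Im z\<bar> < r \<Longrightarrow> (g has_field_derivative g' z) (at z)"
    "\<And>x. g (of_real x) = trig_sum a x" "\<And>x. g' (of_real x) = trig_sum (\<lambda>k. \<i> * of_int k * a k) x"
    using exp_decay_holomorphic[OF assms] by blast
  have "(g has_field_derivative g' (of_real x)) (at (of_real x))" using g(1) assms(2) by simp
  from has_vector_derivative_real_field[OF this] show ?thesis
    unfolding g(2,3) by simp
qed

lemma trig_sum_continuous:
  assumes "(\<lambda>k. norm (a k)) summable_on UNIV"
  shows "continuous_on UNIV (trig_sum a)"
proof -
  have "uniform_limit UNIV (\<lambda>n x. \<Sum>i<n. a (int_decode i) * cis (of_int (int_decode i) * x)) (\<lambda>x. \<Sum>i. a (int_decode i) * cis (of_int (int_decode i) * x)) sequentially"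
    by (rule Weierstrass_m_test[where M = "\<lambda>i. norm (a (int_decode i))"])
       (use summable_int_decode[OF assms] in \<open>auto simp: norm_mult\<close>)
  then have "continuous_on UNIV (\<lambda>x. \<Sum>i. a (int_decode i) * cis (of_int (int_decode i) * x))"
    by (rule uniform_limit_theorem[rotated]) (auto intro!: always_eventually continuous_intros)
  moreover have "trig_sum a x = (\<Sum>i. a (int_decode i) * cis (of_int (int_decode i) * x))" for x
    unfolding trig_sum_def
    by (rule infsum_int_eq_suminf, rule summable_on_bounded_by(1)[OF assms]) (simp add: norm_mult)
  ultimately show ?thesis by (simp add: fun_eq_iff[symmetric])
qed

lemma trig_sum_periodic: "trig_sum a (x + 2 * pi) = trig_sum a x"
proof -
  have "cis (of_int k * (x + 2 * pi)) = cis (of_int k * x)" for k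
  proof -
    have "cis (of_int k * (x + 2 * pi)) = cis (of_int k * x) * cis (2 * pi * of_int k)"
      by (simp add: cis_mult algebra_simps)
    also have "cis (2 * pi * of_int k) = 1" by (rule cis_multiple_2pi) simp
    finally show ?thesis by simp
  qed
  then show ?thesis by (simp add: trig_sum_def)
qed

lemma trig_sum_real:
  assumes "\<And>k. a (- k) = cnj (a k)"
  shows "trig_sum a x = of_real (Re (trig_sum a x))"
proof -
  have "cnj (trig_sum a x) = (\<Sum>\<^sub>\<infinity>k. cnj (a k * cis (of_int k * x)))"
    unfolding trig_sum_def by (simp only: infsum_cnj)
  also have "\<dots> = (\<Sum>\<^sub>\<infinity>k. a (- k) * cis (of_int (- k) * x))" by (simp add: assms cis_cnj)
  also have "\<dots> = trig_sum a x"
    unfolding trig_sum_def by (rule infsum_reindex_bij_betw[of uminus UNIV UNIV "\<lambda>k. a k * cis (of_int k * x)"])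
      (auto intro!: bij_betwI[where g = uminus])
  finally show ?thesis by (metis complex_is_Real_iff complex_cnj_cancel_iff Reals_cnj_iff of_real_Re)
qed

lemma fourier_coeff_trig_sum:
  assumes "(\<lambda>k. norm (a k)) summable_on UNIV" "\<And>x. of_real (f x) = trig_sum a x"
  shows "fourier_coeff f k = a k"
  unfolding fourier_coeff_circle
  using trig_series_coeff[OF assms(1), of "\<lambda>x. of_real (f x)" k] assms(2) by (simp add: trig_sum_def)

lemma torus_L2_integrable:
  assumes "u \<in> torus_L2" shows "integrable circle u"
proof (rule Bochner_Integration.integrable_bound)
  have "integrable circle (\<lambda>x. (u x)\<^sup>2)" using assms by (simp add: torus_L2_def integrable_circle_iff)
  then show "integrable circle (\<lambda>x. 1 + (u x)\<^sup>2)" by simp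
  show "u \<in> borel_measurable circle" using assms by (auto simp: torus_L2_def intro: borel_measurable_circle)
  show "AE x in circle. norm (u x) \<le> norm (1 + (u x)\<^sup>2)"
  proof (rule AE_I2)
    fix x
    have "0 \<le> (\<bar>u x\<bar> - 1)\<^sup>2" by simp
    then have "2 * \<bar>u x\<bar> \<le> 1 + (u x)\<^sup>2" by (simp add: power2_diff)
    then show "norm (u x) \<le> norm (1 + (u x)\<^sup>2)" by simp
  qed
qed

text \<open>The series has the same Fourier coefficients as the function.\<close>

lemma fourier_series_AE:
  assumes per: "periodic_2pi u" and int: "integrable circle u"
    and s: "(\<lambda>k. norm (fourier_coeff u k)) summable_on UNIV"
  shows "AE x in lborel. of_real (u x) = trig_sum (fourier_coeff u) x"
proof (rule AE_circle_periodic)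
  show "complex_of_real (u (x + 2 * pi)) = trig_sum (fourier_coeff u) (x + 2 * pi) \<longleftrightarrow> of_real (u x) = trig_sum (fourier_coeff u) x" for x
    using per trig_sum_periodic[of "fourier_coeff u" x] by (simp add: periodic_2pi_def)
  have iS: "integrable circle (trig_sum (fourier_coeff u))"
  proof (rule integrable_circle_bounded)
    show "trig_sum (fourier_coeff u) \<in> borel_measurable circle"
      by (intro borel_measurable_circle borel_measurable_continuous_onI trig_sum_continuous s)
    show "norm (trig_sum (fourier_coeff u) x) \<le> (\<Sum>\<^sub>\<infinity>k. norm (fourier_coeff u k))" for x
      unfolding trig_sum_def by (rule summable_on_bounded_by(2)[OF s]) (simp add: norm_mult)
  qed
  have iu: "integrable circle (\<lambda>x. complex_of_real (u x))" by (rule integrable_of_real[OF int])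
  have m: "(\<lambda>x. cis (- (of_int k * x))) \<in> borel_measurable circle" for k
    by (rule borel_measurable_circle) measurable
  have "AE x in circle. of_real (u x) - trig_sum (fourier_coeff u) x = 0"
  proof (rule AE_zero_coeffs)
    show "integrable circle (\<lambda>x. of_real (u x) - trig_sum (fourier_coeff u) x)"
      by (rule Bochner_Integration.integrable_diff[OF iu iS])
    fix k
    have "(\<integral>x. (of_real (u x) - trig_sum (fourier_coeff u) x) * cis (- (of_int k * x)) \<partial>circle)
      = (\<integral>x. of_real (u x) * cis (- (of_int k * x)) \<partial>circle) - (\<integral>x. trig_sum (fourier_coeff u) x * cis (- (of_int k * x)) \<partial>circle)"
      unfolding left_diff_distrib
      by (rule Bochner_Integration.integral_diff[OF integrable_circle_mult[OF iu m, where B = 1] integrable_circle_mult[OF iS m, where B = 1]]) auto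
    also have "(\<integral>x. trig_sum (fourier_coeff u) x * cis (- (of_int k * x)) \<partial>circle) = 2 * pi * fourier_coeff u k"
      by (rule trig_series_coeff[OF s]) (simp add: trig_sum_def)
    also have "(\<integral>x. of_real (u x) * cis (- (of_int k * x)) \<partial>circle) = 2 * pi * fourier_coeff u k"
      by (simp add: fourier_coeff_circle)
    finally show "(\<integral>x. (of_real (u x) - trig_sum (fourier_coeff u) x) * cis (- (of_int k * x)) \<partial>circle) = 0" by simp
  qed
  then show "AE x in circle. complex_of_real (u x) = trig_sum (fourier_coeff u) x" by eventually_elim simp
qed

lemma fourier_series:
  assumes "periodic_2pi u" "continuous_on UNIV u" "(\<lambda>k. norm (fourier_coeff u k)) summable_on UNIV"
    and "integrable circle u"
  shows "of_real (u x) = trig_sum (fourier_coeff u) x"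
proof -
  have "of_real (u x) - trig_sum (fourier_coeff u) x = 0"
  proof (rule continuous_AE_zero)
    show "continuous_on UNIV (\<lambda>x. of_real (u x) - trig_sum (fourier_coeff u) x)"
      by (intro continuous_intros assms trig_sum_continuous)
    show "AE x in lborel. of_real (u x) - trig_sum (fourier_coeff u) x = 0"
      using fourier_series_AE[OF assms(1,4,3)] by eventually_elim simp
  qed
  then show ?thesis by simp
qed

lemma fourier_coeff_minus: "fourier_coeff u (- k) = cnj (fourier_coeff u k)"
proof -
  have "cnj (\<integral>x. of_real (u x) * cis (- (of_int k * x)) \<partial>circle) = (\<integral>x. cnj (of_real (u x) * cis (- (of_int k * x))) \<partial>circle)"
    by (simp del: complex_cnj_mult)
  then show ?thesis unfolding fourier_coeff_circle by (simp add: cis_cnj)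
qed

section \<open>The right-hand side in Fourier variables\<close>

text \<open>Up to the factor \<open>\<sigma>\<^sup>3\<close>, the damping and a constant, the \<open>k\<close>-th Fourier coefficient of the nonlinear part of
the right-hand side.\<close>

definition nonlin_mode :: "wiener \<Rightarrow> wiener \<Rightarrow> int \<Rightarrow> real \<Rightarrow> real \<Rightarrow> complex" where
  "nonlin_mode w g k r t = (\<integral>s. of_real (log_kernel s) * mode (nonlin_log g) k (r, t, s) + mode (nonlin_reg w g) k (r, t, s) \<partial>circle)"

text \<open>The linearised equation damps the mode \<open>k\<close> at this rate; it comes from the coefficients
\<open>- 2 pi / \<bar>k\<bar>\<close> of the logarithmic kernel and the factor \<open>\<rho> / (8 pi)\<close> of the equation.\<close>

definition decay_rate :: "real \<Rightarrow> int \<Rightarrow> real" where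
  "decay_rate \<rho> k = (if k = 0 then 0 else \<rho> / (4 * \<bar>real_of_int k\<bar>))"

lemma mode_measurable: "(\<lambda>s. mode b k (r, t, s)) \<in> borel_measurable circle"
  by (intro borel_measurable_circle borel_measurable_continuous_onI
      continuous_on_compose2[OF continuous_on_apply_bcontfun[of UNIV]] continuous_intros) auto

definition log_weight :: "real \<Rightarrow> real" where "log_weight s = \<bar>log_kernel s\<bar> + 1"

lemma integrable_log_weight: "integrable circle log_weight"
  unfolding log_weight_def using integrable_log_kernel by auto

text \<open>The interface at one instant: \<open>f\<close> has the Fourier coefficients \<open>a\<close>, and its slope is \<open>\<sigma>\<close> times the
function that \<open>g\<close> represents at the parameters \<open>(r, t, s)\<close>, for every \<open>s\<close>.\<close>

locale profile =
  fixes a :: "int \<Rightarrow> complex" and f :: "real \<Rightarrow> real" and d r t \<sigma> :: real and g w :: wiener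
  assumes decay: "exp_decay d a" "d > 0" and f: "\<And>x. of_real (f x) = trig_sum a x"
    and \<sigma>: "\<sigma> > 0" and w: "norm w \<le> 1" and eval_w: "\<And>s x. eval (r, t, s) x w = of_real \<sigma>"
    and g: "norm g \<le> 1/4"
    and coeff: "\<And>k s. of_real \<sigma> * (mode g k (r, t, s) * of_real (damp (r, t, s) k)) = \<i> * of_int k * a k"
begin

definition f' :: "real \<Rightarrow> real" where "f' y = Re (trig_sum (\<lambda>k. \<i> * of_int k * a k) y)"
definition mean :: real where "mean = Re (a 0)"

lemma a_summable: "(\<lambda>k. norm (a k)) summable_on UNIV"
  by (rule exp_decay_summable_norm[OF decay])

lemma da_summable: "(\<lambda>k. norm (\<i> * of_int k * a k)) summable_on UNIV"
  by (rule exp_decay_summable_norm[OF exp_decay_derivative[OF decay, of "d/2"]]) (use decay in auto)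

lemma a_terms_summable: "(\<lambda>k. a k * cis (of_int k * x)) summable_on UNIV"
  by (rule summable_on_bounded_by(1)[OF a_summable]) (simp add: norm_mult)

lemma mean: "complex_of_real mean = a 0"
proof -
  have "fourier_coeff f 0 = a 0" by (rule fourier_coeff_trig_sum[OF a_summable f])
  then have "a 0 = cnj (a 0)" using fourier_coeff_minus[of f 0] by simp
  then show ?thesis unfolding mean_def by (metis Reals_cnj_iff of_real_Re)
qed

lemma f_deriv: "(f has_real_derivative f' y) (at y)"
  and f'_trig: "of_real (f' y) = trig_sum (\<lambda>k. \<i> * of_int k * a k) y"
proof -
  have v: "((\<lambda>y. complex_of_real (f y)) has_vector_derivative trig_sum (\<lambda>k. \<i> * of_int k * a k) y) (at y)"
    unfolding f by (rule trig_sum_vector_derivative[OF decay])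
  have "((\<lambda>y. Re (complex_of_real (f y))) has_vector_derivative f' y) (at y)"
    unfolding f'_def by (rule bounded_linear.has_vector_derivative[OF bounded_linear_Re v])
  then show "(f has_real_derivative f' y) (at y)"
    by (simp add: has_real_derivative_iff_has_vector_derivative)
  have "((\<lambda>y. Im (complex_of_real (f y))) has_vector_derivative Im (trig_sum (\<lambda>k. \<i> * of_int k * a k) y)) (at y)"
    by (rule bounded_linear.has_vector_derivative[OF bounded_linear_Im v])
  then have "((\<lambda>y. 0 :: real) has_vector_derivative Im (trig_sum (\<lambda>k. \<i> * of_int k * a k) y)) (at y)" by simp
  then have "Im (trig_sum (\<lambda>k. \<i> * of_int k * a k) y) = 0"
    using vector_derivative_unique_at has_vector_derivative_const by metis
  then show "of_real (f' y) = trig_sum (\<lambda>k. \<i> * of_int k * a k) y"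
    by (simp add: f'_def complex_eq_iff)
qed

lemma f_cont: "continuous_on A f"
  by (meson DERIV_continuous_on f_deriv has_field_derivative_at_within)

lemma f'_cont: "continuous_on A f'"
proof -
  have "continuous_on UNIV f'" unfolding f'_def
    by (intro continuous_intros trig_sum_continuous[OF da_summable])
  then show ?thesis by (rule continuous_on_subset) simp
qed

lemma f_per: "periodic_2pi f"
proof -
  have "complex_of_real (f (x + 2 * pi)) = of_real (f x)" for x unfolding f by (rule trig_sum_periodic)
  then show ?thesis by (simp add: periodic_2pi_def)
qed

lemma f'_per: "f' (y + 2 * pi) = f' y"
  by (simp add: f'_def trig_sum_periodic)

lemma mode_g: "mode g k (r, t, s) * of_real (damp (r, t, s) k) = \<i> * of_int k * a k / of_real \<sigma>"
  using coeff[of k s] \<sigma> by (simp add: field_simps)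

lemma eval_multiplier_g:
  assumes m: "multiplier_bound m C"
    and h: "\<And>k. m k (r, t, s) * (\<i> * of_int k * a k) * cis (of_int k * x) = h k" 
  shows "eval (r, t, s) x (multiplier m g) = infsum h UNIV / of_real \<sigma>"
proof -
  interpret m: multiplier_bound m C by fact
  have "eval (r, t, s) x (multiplier m g) = (\<Sum>\<^sub>\<infinity>k. h k / of_real \<sigma>)"
    unfolding eval_def m.mode_multiplier
  proof (rule infsum_cong)
    fix k
    have "m k (r, t, s) * mode g k (r, t, s) * of_real (damp (r, t, s) k) * cis (of_int k * x)
      = m k (r, t, s) * (mode g k (r, t, s) * of_real (damp (r, t, s) k)) * cis (of_int k * x)" by simp
    then show "m k (r, t, s) * mode g k (r, t, s) * of_real (damp (r, t, s) k) * cis (of_int k * x) = h k / of_real \<sigma>"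
      unfolding mode_g h[symmetric] by simp
  qed
  also have "\<dots> = infsum h UNIV / of_real \<sigma>"
    using infsum_cmult_left'[of h "1 / of_real \<sigma>" UNIV] by (simp add: divide_inverse)
  finally show ?thesis .
qed

lemma eval_g: "eval (r, t, s) x g = of_real (f' x / \<sigma>)"
proof -
  have "eval (r, t, s) x g = (\<Sum>\<^sub>\<infinity>k. \<i> * of_int k * a k * cis (of_int k * x) * (1 / of_real \<sigma>))"
    unfolding eval_def mode_g by simp
  also have "\<dots> = of_real (f' x) * (1 / of_real \<sigma>)"
    unfolding infsum_cmult_left' f'_trig trig_sum_def ..
  finally show ?thesis by simp
qed

lemma eval_shift: "eval (r, t, s) x (multiplier shift_mult g) = of_real (f' (x - s) / \<sigma>)"
proof -
  have "eval (r, t, s) x (multiplier shift_mult g) = infsum (\<lambda>k. \<i> * of_int k * a k * cis (of_int k * (x - s))) UNIV / of_real \<sigma>"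
  proof (rule eval_multiplier_g[OF shift.multiplier_bound_axioms])
    fix k
    have "cis (of_int k * (x - s)) = cis (- (of_int k * s)) * cis (of_int k * x)" by (simp add: cis_mult algebra_simps)
    then show "shift_mult k (r, t, s) * (\<i> * of_int k * a k) * cis (of_int k * x) = \<i> * of_int k * a k * cis (of_int k * (x - s))"
      by (simp add: shift_mult_def)
  qed
  then show ?thesis by (simp add: f'_trig trig_sum_def)
qed

lemma sum_nonzero_modes: "(\<Sum>\<^sub>\<infinity>k. if k = 0 then 0 else a k * cis (of_int k * y)) = of_real (f y - mean)"
proof -
  have "((\<lambda>k. a k * cis (of_int k * y)) has_sum of_real (f y)) UNIV"
    using has_sum_infsum[OF a_terms_summable[of y]] by (simp add: f trig_sum_def)
  moreover have "((\<lambda>k. if k = 0 then a 0 else 0) has_sum a 0) UNIV"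
    by (rule has_sum_finite_neutralI[of "{0}"]) auto
  ultimately have "((\<lambda>k. a k * cis (of_int k * y) + - (if k = 0 then a 0 else 0)) has_sum (of_real (f y) + - a 0)) UNIV"
    by (intro has_sum_add has_sum_uminusI)
  moreover have "(\<lambda>k. a k * cis (of_int k * y) + - (if k = 0 then a 0 else 0)) = (\<lambda>k. if k = 0 then 0 else a k * cis (of_int k * y))"
    by auto
  ultimately show ?thesis by (simp add: infsumI mean)
qed

lemma eval_prim: "eval (r, t, s) x (multiplier prim_mult g) = of_real ((f (x - s) - mean) / \<sigma>)"
proof -
  have "eval (r, t, s) x (multiplier prim_mult g) = infsum (\<lambda>k. if k = 0 then 0 else a k * cis (of_int k * (x - s))) UNIV / of_real \<sigma>"
  proof (rule eval_multiplier_g[OF prim.multiplier_bound_axioms])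
    fix k
    have "cis (of_int k * (x - s)) = cis (- (of_int k * s)) * cis (of_int k * x)" by (simp add: cis_mult algebra_simps)
    then show "prim_mult k (r, t, s) * (\<i> * of_int k * a k) * cis (of_int k * x) = (if k = 0 then 0 else a k * cis (of_int k * (x - s)))"
      by (simp add: prim_mult_def)
  qed
  then show ?thesis unfolding sum_nonzero_modes by simp
qed

lemma eval_incr: "eval (r, t, s) x (multiplier incr_mult g) = of_real ((f x - f (x - s)) / \<sigma>)"
proof -
  have "eval (r, t, s) x (multiplier incr_mult g) = infsum (\<lambda>k. a k * cis (of_int k * x) + - (a k * cis (of_int k * (x - s)))) UNIV / of_real \<sigma>"
  proof (rule eval_multiplier_g[OF incr.multiplier_bound_axioms])
    fix k
    have c: "cis (of_int k * (x - s)) = cis (- (of_int k * s)) * cis (of_int k * x)" by (simp add: cis_mult algebra_simps)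
    have "incr_mult k (r, t, s) * (\<i> * of_int k * a k) = (if k = 0 then 0 else (1 - cis (- (of_int k * s))) * a k)"
      by (simp add: incr_mult_def)
    then show "incr_mult k (r, t, s) * (\<i> * of_int k * a k) * cis (of_int k * x) = a k * cis (of_int k * x) + - (a k * cis (of_int k * (x - s)))"
      unfolding c by (cases "k = 0") (simp_all add: left_diff_distrib)
  qed
  also have "infsum (\<lambda>k. a k * cis (of_int k * x) + - (a k * cis (of_int k * (x - s)))) UNIV = of_real (f x - f (x - s))"
    using infsum_add[OF a_terms_summable summable_on_uminus[THEN iffD2, OF a_terms_summable], of x "x - s"]
    by (simp add: f trig_sum_def infsum_uminus)
  finally show ?thesis by simp
qed

lemma eval_quot: "eval (r, t, s) x (multiplier quot_mult g) * (1 - cis (- s)) = of_real ((f x - f (x - s)) / \<sigma>)"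
proof -
  have "eval (r, t, s) x (multiplier quot_mult g) * (1 - cis (- s)) = eval (r, t, s) x (multiplier incr_mult g)"
    unfolding eval_def infsum_cmult_left'[symmetric] quot.mode_multiplier incr.mode_multiplier
  proof (rule infsum_cong)
    fix k
    have q: "incr_mult k (r, t, s) = quot_mult k (r, t, s) * (1 - cis (- s))"
      using dirichlet_mult[of k s] by (simp add: quot_mult_def incr_mult_def)
    show "quot_mult k (r, t, s) * mode g k (r, t, s) * of_real (damp (r, t, s) k) * cis (of_int k * x) * (1 - cis (- s))
      = incr_mult k (r, t, s) * mode g k (r, t, s) * of_real (damp (r, t, s) k) * cis (of_int k * x)"
      unfolding q by (simp only: mult_ac)
  qed
  then show ?thesis by (simp only: eval_incr)
qed

lemma increment_small: "\<bar>f x - f (x - s)\<bar> \<le> 1/2"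
proof -
  have "norm (eval (r, t, s) x (w * multiplier incr_mult g)) \<le> 1/2"
    by (rule order_trans[OF norm_eval_le norm_incr_le[OF w g]])
  moreover have "eval (r, t, s) x (w * multiplier incr_mult g) = of_real (f x - f (x - s))"
    using \<sigma> by (simp add: eval_times eval_w eval_incr)
  ultimately show ?thesis by (metis norm_of_real)
qed

definition E :: "real \<Rightarrow> real \<Rightarrow> real" where "E x s = cosh (f x - f (x - s)) - cos s"

text \<open>The denominator controls the singularity of every term of the kernel: \<open>E\<close> is at least \<open>1 - cos s\<close>, and
the factors that accompany \<open>1 / E\<close> are bounded by a multiple of \<open>E\<close>.\<close>

lemma E_bounds: "2 - 2 * cos s \<le> 2 * E x s" "2 * E x s \<le> 8" "\<bar>f x - f (x - s)\<bar> * \<bar>sin s\<bar> \<le> E x s"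
  "\<bar>(f x - f (x - s)) * sinh (f x - f (x - s))\<bar> \<le> 4 * E x s"
proof -
  define \<theta> where "\<theta> = f x - f (x - s)"
  have th: "\<bar>\<theta>\<bar> \<le> 1/2" unfolding \<theta>_def by (rule increment_small)
  show "2 - 2 * cos s \<le> 2 * E x s" using cosh_real_ge_1[of \<theta>] by (simp add: E_def \<theta>_def)
  have c: "2 * (cosh \<theta> - 1) \<le> 2 * E x s" by (simp add: E_def \<theta>_def)
  have sq: "\<theta>\<^sup>2 \<le> 2 * E x s" using order_trans[OF sq_le_cosh c] .
  have "\<bar>pser cosh_coeff \<theta>\<bar> \<le> 2" "\<bar>pser sinh_coeff \<theta>\<bar> \<le> 2"
    using norm_pser_le[of cosh_coeff \<theta>] norm_pser_le[of sinh_coeff \<theta>] coeff_bounds th by auto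
  note P = this
  have "2 * (cosh \<theta> - 1) \<le> \<theta>\<^sup>2 * 2"
    unfolding pser_cosh[OF th, symmetric] by (rule mult_left_mono) (use P in auto)
  also have "\<theta>\<^sup>2 \<le> (1/2)\<^sup>2" using th abs_le_square_iff[of \<theta> "1/2"] by simp
  finally have "2 * (cosh \<theta> - 1) \<le> 1" by (simp add: power2_eq_square)
  moreover have "2 * E x s = 2 * (cosh \<theta> - 1) + (2 - 2 * cos s)" by (simp add: E_def \<theta>_def)
  ultimately show "2 * E x s \<le> 8" using two_minus_two_cos_ge(2)[of s] by linarith
  have "\<bar>\<theta> * sinh \<theta>\<bar> = \<theta>\<^sup>2 * \<bar>pser sinh_coeff \<theta>\<bar>"
    unfolding pser_sinh[OF th, symmetric] by (simp add: abs_mult power2_eq_square)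
  also have "\<dots> \<le> \<theta>\<^sup>2 * 2" by (rule mult_left_mono) (use P in auto)
  finally show "\<bar>(f x - f (x - s)) * sinh (f x - f (x - s))\<bar> \<le> 4 * E x s" using sq unfolding \<theta>_def by linarith
  have "0 \<le> (\<bar>\<theta>\<bar> - \<bar>sin s\<bar>)\<^sup>2" by simp
  then have "2 * (\<bar>\<theta>\<bar> * \<bar>sin s\<bar>) \<le> \<theta>\<^sup>2 + (sin s)\<^sup>2" by (simp add: power2_diff)
  also have "(sin s)\<^sup>2 \<le> 2 - 2 * cos s"
    using power_mono[OF abs_sin_le_sqrt[of s], of 2] two_minus_two_cos_ge[of s] by simp
  also have "\<theta>\<^sup>2 \<le> 2 * (cosh \<theta> - 1)" by (rule sq_le_cosh)
  finally show "\<bar>f x - f (x - s)\<bar> * \<bar>sin s\<bar> \<le> E x s" by (simp add: E_def \<theta>_def)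
qed

definition K1 :: "real \<Rightarrow> real \<Rightarrow> real" where
  "K1 x s = ln (2 * E x s) * (1 + f' x * f' (x - s))"
definition K2 :: "real \<Rightarrow> real \<Rightarrow> real" where
  "K2 x s = (f x - f (x - s)) / E x s * (f' x * f' (x - s) - 1) * sinh (f x - f (x - s))"
definition K3 :: "real \<Rightarrow> real \<Rightarrow> real" where
  "K3 x s = (f x - f (x - s)) / E x s * (f' x + f' (x - s)) * sin s"

lemma slip_kernel_split: "slip_kernel f f' x s = K1 x s + K2 x s + K3 x s"
  by (simp add: slip_kernel_def K1_def K2_def K3_def E_def)

lemma f_bound: "\<exists>B\<ge>0. \<forall>y. \<bar>f y\<bar> \<le> B" and f'_bound: "\<exists>B\<ge>0. \<forall>y. \<bar>f' y\<bar> \<le> B"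
proof -
  have n: "norm (trig_sum b y) \<le> (\<Sum>\<^sub>\<infinity>k. norm (b k))" if "(\<lambda>k. norm (b k)) summable_on UNIV" for b y
    unfolding trig_sum_def by (rule summable_on_bounded_by(2)[OF that]) (simp add: norm_mult)
  have "\<bar>f y\<bar> \<le> (\<Sum>\<^sub>\<infinity>k. norm (a k))" for y using n[OF a_summable, of y] by (simp add: f[symmetric])
  moreover have "0 \<le> (\<Sum>\<^sub>\<infinity>k. norm (a k))" by (rule infsum_nonneg) simp
  ultimately show "\<exists>B\<ge>0. \<forall>y. \<bar>f y\<bar> \<le> B" by blast
  have "\<bar>f' y\<bar> \<le> (\<Sum>\<^sub>\<infinity>k. norm (\<i> * of_int k * a k))" for y using n[OF da_summable, of y] by (simp add: f'_trig[symmetric])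
  moreover have "0 \<le> (\<Sum>\<^sub>\<infinity>k. norm (\<i> * of_int k * a k))" by (rule infsum_nonneg) simp
  ultimately show "\<exists>B\<ge>0. \<forall>y. \<bar>f' y\<bar> \<le> B" by blast
qed

lemma abs_ln_E: "\<bar>ln (2 * E x s)\<bar> \<le> 8 * log_weight s" if s: "0 < s" "s < 2 * pi"
proof -
  have D: "0 < 2 - 2 * cos s" using cos_lt_1[OF s] by simp
  have "log_kernel s \<le> ln (2 * E x s)"
    unfolding log_kernel_def using D E_bounds(1)[where s = s and x = x] by (intro ln_le_cancel_iff[THEN iffD2]) auto
  moreover have "ln (2 * E x s) \<le> 2 * E x s - 1" by (rule ln_le_minus_one) (use D E_bounds(1)[of s x] in linarith)
  ultimately show ?thesis using E_bounds(2)[of x s] by (auto simp: log_weight_def)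
qed

lemma integrable_K:
  assumes u: "continuous_on UNIV u" "\<And>s. \<bar>u s\<bar> \<le> B"
  shows "integrable circle (\<lambda>s. K1 x s * u s)" "integrable circle (\<lambda>s. K2 x s * u s)" "integrable circle (\<lambda>s. K3 x s * u s)"
proof -
  obtain C where C: "C \<ge> 0" "\<And>y. \<bar>f' y\<bar> \<le> C" using f'_bound by blast
  have B: "B \<ge> 0" using u(2)[of 0] by simp
  have [measurable]: "f \<in> borel_measurable borel" "f' \<in> borel_measurable borel" "u \<in> borel_measurable borel"
    using f_cont f'_cont u(1) by (auto intro: borel_measurable_continuous_onI)
  have [measurable]: "(\<lambda>s. sinh (f x - f (x - s))) \<in> borel_measurable borel" "(\<lambda>s. E x s) \<in> borel_measurable borel"
    unfolding E_def by (intro borel_measurable_continuous_onI continuous_intros continuous_on_compose2[OF f_cont[of UNIV]]; simp)+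
  have w1: "1 \<le> log_weight s" for s by (simp add: log_weight_def)
  have W: "integrable circle (\<lambda>s. 8 * (1 + C * C + 2 * C) * B * log_weight s)"
    using integrable_log_weight by simp
  have main: "integrable circle (\<lambda>s. K s * u s)"
    if m: "K \<in> borel_measurable borel" and b: "\<And>s. 0 < s \<Longrightarrow> s < 2 * pi \<Longrightarrow> \<bar>K s\<bar> \<le> 8 * log_weight s * (1 + C * C + 2 * C)" for K
  proof (rule Bochner_Integration.integrable_bound[OF W])
    show "(\<lambda>s. K s * u s) \<in> borel_measurable circle" by (rule borel_measurable_circle) (use m in measurable)
    show "AE s in circle. norm (K s * u s) \<le> norm (8 * (1 + C * C + 2 * C) * B * log_weight s)"
      using AE_circle_interior
    proof eventually_elim
      case (elim s)
      have "norm (K s * u s) \<le> (8 * log_weight s * (1 + C * C + 2 * C)) * B"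
        unfolding real_norm_def abs_mult using w1[of s] C(1)
        by (intro mult_mono b u) (use elim in auto)
      also have "\<dots> = 8 * (1 + C * C + 2 * C) * B * log_weight s" by simp
      finally show ?case using abs_ge_self[of "8 * (1 + C * C + 2 * C) * B * log_weight s"] by simp
    qed
  qed
  have CC: "\<bar>f' x * f' y\<bar> \<le> C * C" for y unfolding abs_mult by (intro mult_mono C) auto
  show "integrable circle (\<lambda>s. K1 x s * u s)"
  proof (rule main)
    show "K1 x \<in> borel_measurable borel" unfolding K1_def by measurable
    fix s assume s: "0 < s" "s < 2 * pi"
    have "\<bar>1 + f' x * f' (x - s)\<bar> \<le> 1 + C * C + 2 * C" using CC[of "x - s"] C(1) by linarith
    then show "\<bar>K1 x s\<bar> \<le> 8 * log_weight s * (1 + C * C + 2 * C)"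
      unfolding K1_def abs_mult using w1[of s] by (intro mult_mono abs_ln_E s) auto
  qed
  have q: "\<bar>p * q\<bar> \<le> 8 * log_weight s * (1 + C * C + 2 * C)" if "\<bar>p\<bar> \<le> 4" "\<bar>q\<bar> \<le> 1 + C * C + 2 * C" for p q s
    unfolding abs_mult using that w1[of s] by (intro mult_mono) auto
  show "integrable circle (\<lambda>s. K2 x s * u s)"
  proof (rule main)
    show "K2 x \<in> borel_measurable borel" unfolding K2_def by measurable
    fix s assume s: "0 < s" "s < 2 * pi"
    have E: "E x s > 0" using E_bounds(1)[of s x] cos_lt_1[OF s] by simp
    have "\<bar>(f x - f (x - s)) * sinh (f x - f (x - s)) / E x s\<bar> \<le> 4"
      using E_bounds(4)[of x s] E by (simp add: abs_divide divide_le_eq)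
    moreover have "\<bar>f' x * f' (x - s) - 1\<bar> \<le> 1 + C * C + 2 * C" using CC[of "x - s"] C(1) by linarith
    ultimately have "\<bar>((f x - f (x - s)) * sinh (f x - f (x - s)) / E x s) * (f' x * f' (x - s) - 1)\<bar> \<le> 8 * log_weight s * (1 + C * C + 2 * C)"
      by (rule q)
    then show "\<bar>K2 x s\<bar> \<le> 8 * log_weight s * (1 + C * C + 2 * C)" by (simp add: K2_def mult_ac)
  qed
  show "integrable circle (\<lambda>s. K3 x s * u s)"
  proof (rule main)
    show "K3 x \<in> borel_measurable borel" unfolding K3_def by measurable
    fix s assume s: "0 < s" "s < 2 * pi"
    have E: "E x s > 0" using E_bounds(1)[of s x] cos_lt_1[OF s] by simp
    have "\<bar>(f x - f (x - s)) * sin s / E x s\<bar> \<le> 4"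
      using E_bounds(3)[of x s] E by (simp add: abs_divide abs_mult divide_le_eq)
    moreover have "\<bar>f' x + f' (x - s)\<bar> \<le> 1 + C * C + 2 * C" using C(2)[of x] C(2)[of "x - s"] zero_le_square[of C] by linarith
    ultimately have "\<bar>((f x - f (x - s)) * sin s / E x s) * (f' x + f' (x - s))\<bar> \<le> 8 * log_weight s * (1 + C * C + 2 * C)"
      by (rule q)
    then show "\<bar>K3 x s\<bar> \<le> 8 * log_weight s * (1 + C * C + 2 * C)" by (simp add: K3_def mult_ac)
  qed
qed

lemma slip_kernel_integrable:
  assumes u: "continuous_on UNIV u" "\<And>s. \<bar>u s\<bar> \<le> B"
  shows "integrable circle (\<lambda>s. slip_kernel f f' x s * u s)"
  unfolding slip_kernel_split distrib_right
  by (intro Bochner_Integration.integrable_add integrable_K[OF u])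

text \<open>The mean may be subtracted because the kernel has integral 0.  Without this step the nonlinearity
would contain the function itself and not only its slope.\<close>

lemma graph_rhs_slip:
  "graph_rhs \<rho>p \<rho>m f x = (\<rho>m - \<rho>p) / (8 * pi) * (\<integral>s. slip_kernel f f' x s * (f (x - s) - mean) \<partial>circle)"
proof -
  obtain B where B: "\<And>y. \<bar>f y\<bar> \<le> B" using f_bound by blast
  have fs: "continuous_on UNIV (\<lambda>s. f (x - s))" "\<And>s. \<bar>f (x - s)\<bar> \<le> B"
    using B by (auto intro!: continuous_intros continuous_on_compose2[OF f_cont[of UNIV]])
  have d: "deriv f = f'" using DERIV_imp_deriv[OF f_deriv] by auto
  have per: "periodic_2pi (\<lambda>s. K1 x s * f (x - s))" "periodic_2pi (\<lambda>s. K2 x s * f (x - s))" "periodic_2pi (\<lambda>s. K3 x s * f (x - s))"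
  proof -
    have "f (x - (s + 2 * pi)) = f (x - s)" "f' (x - (s + 2 * pi)) = f' (x - s)" for s
      using f_per[unfolded periodic_2pi_def, rule_format, of "x - s - 2 * pi"] f'_per[of "x - s - 2 * pi"]
      by (simp_all add: algebra_simps)
    then show "periodic_2pi (\<lambda>s. K1 x s * f (x - s))" "periodic_2pi (\<lambda>s. K2 x s * f (x - s))" "periodic_2pi (\<lambda>s. K3 x s * f (x - s))"
      by (simp_all add: periodic_2pi_def K1_def K2_def K3_def E_def)
  qed
  have I1: "torus_integral (\<lambda>y. ln (2 * (cosh (f x - f y) - cos (x - y))) * f y * (1 + deriv f x * deriv f y)) = (\<integral>s. K1 x s * f (x - s) \<partial>circle)"
    unfolding torus_integral_circle circle_convolve[OF per(1) integrable_K(1)[OF fs], of x, symmetric] d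
    by (rule Bochner_Integration.integral_cong) (simp_all add: K1_def E_def)
  have I2: "torus_integral (\<lambda>y. f y * (f x - f y) / (cosh (f x - f y) - cos (x - y))
          * (deriv f x * deriv f y - 1) * sinh (f x - f y)) = (\<integral>s. K2 x s * f (x - s) \<partial>circle)"
    unfolding torus_integral_circle circle_convolve[OF per(2) integrable_K(2)[OF fs], of x, symmetric] d
    by (rule Bochner_Integration.integral_cong) (simp_all add: K2_def E_def)
  have I3: "torus_integral (\<lambda>y. f y * (f x - f y) / (cosh (f x - f y) - cos (x - y))
          * (deriv f x + deriv f y) * sin (x - y)) = (\<integral>s. K3 x s * f (x - s) \<partial>circle)"
    unfolding torus_integral_circle circle_convolve[OF per(3) integrable_K(3)[OF fs], of x, symmetric] d
    by (rule Bochner_Integration.integral_cong) (simp_all add: K3_def E_def)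
  have "(\<integral>s. slip_kernel f f' x s * f (x - s) \<partial>circle) = (\<integral>s. K1 x s * f (x - s) \<partial>circle) + (\<integral>s. K2 x s * f (x - s) \<partial>circle) + (\<integral>s. K3 x s * f (x - s) \<partial>circle)"
    unfolding slip_kernel_split distrib_right
    using integrable_K[OF fs, of x] by simp
  then have 1: "graph_rhs \<rho>p \<rho>m f x = (\<rho>m - \<rho>p) / (8 * pi) * (\<integral>s. slip_kernel f f' x s * f (x - s) \<partial>circle)"
    unfolding graph_rhs_def I1 I2 I3 by (simp add: distrib_left)
  have one: "continuous_on UNIV (\<lambda>_::real. mean)" "\<And>s::real. \<bar>mean\<bar> \<le> \<bar>mean\<bar>" by auto
  have "integrable circle (slip_kernel f f' x)" using slip_kernel_integrable[of "\<lambda>_. 1" 1 x] by simp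
  then have "(\<integral>s. slip_kernel f f' x s \<partial>circle) = 0" by (rule integral_slip_kernel[OF f_per f_deriv f'_cont])
  then have "(\<integral>s. slip_kernel f f' x s * (f (x - s) - mean) \<partial>circle) = (\<integral>s. slip_kernel f f' x s * f (x - s) \<partial>circle)"
    unfolding right_diff_distrib
    using slip_kernel_integrable[OF fs, of x] slip_kernel_integrable[OF one, of x] by simp
  then show ?thesis unfolding 1 by simp
qed

lemma slip_pointwise:
  assumes s: "0 < s" "s < 2 * pi"
  shows "complex_of_real (slip_kernel f f' x s * (f (x - s) - mean)) = of_real (log_kernel s) * of_real (f (x - s) - mean)
     + of_real (\<sigma> ^ 3) * (of_real (log_kernel s) * eval (r, t, s) x (nonlin_log g) + eval (r, t, s) x (nonlin_reg w g))"
proof -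
  have D: "0 < 2 - 2 * cos (snd (snd (r, t, s)))" using cos_lt_1[OF s] by simp
  have S: "\<sigma> * (y / \<sigma>) = y" for y using \<sigma> by simp
  show ?thesis
    using eval_nonlin(1)[OF w g D eval_w eval_g eval_shift eval_prim eval_incr, of x] eval_quot[of s x]
    unfolding S by (simp add: slip_kernel_def log_kernel_def algebra_simps)
qed

lemma trig_sum_log_integral:
  "(\<integral>s. of_real (log_kernel s) * of_real (f (x - s) - mean) \<partial>circle) = (\<Sum>\<^sub>\<infinity>k. (if k = 0 then 0 else - (2 * pi / \<bar>real_of_int k\<bar>)) * a k * cis (of_int k * x))"
proof -
  define h where "h k s = of_real (log_kernel s) * (if k = 0 then 0 else a k * cis (of_int k * (x - s)))" for k s
  have "(\<integral>s. of_real (log_kernel s) * of_real (f (x - s) - mean) \<partial>circle) = (\<integral>s. (\<Sum>\<^sub>\<infinity>k. h k s) \<partial>circle)"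
    unfolding sum_nonzero_modes[symmetric] h_def by (simp add: infsum_cmult_right')
  also have "\<dots> = (\<Sum>\<^sub>\<infinity>k. \<integral>s. h k s \<partial>circle)"
  proof (rule termwise_integral(2)[OF _ _ a_summable integrable_log_weight])
    show "h k \<in> borel_measurable circle" for k
      unfolding h_def by (rule borel_measurable_circle, cases "k = 0") (simp_all, measurable)
    show "norm (h k s) \<le> norm (a k) * log_weight s" for k s
      by (auto simp: h_def norm_mult log_weight_def algebra_simps)
  qed simp
  also have "\<dots> = (\<Sum>\<^sub>\<infinity>k. (if k = 0 then 0 else - (2 * pi / \<bar>real_of_int k\<bar>)) * a k * cis (of_int k * x))"
  proof (rule infsum_cong)
    fix k
    show "(\<integral>s. h k s \<partial>circle) = (if k = 0 then 0 else - (2 * pi / \<bar>real_of_int k\<bar>)) * a k * cis (of_int k * x)"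
    proof (cases "k = 0")
      case False
      have "h k s = (a k * cis (of_int k * x)) * (of_real (log_kernel s) * cis (- (of_int k * s)))" for s
      proof -
        have "cis (of_int k * (x - s)) = cis (- (of_int k * s)) * cis (of_int k * x)" by (simp add: cis_mult algebra_simps)
        then show ?thesis using False by (simp add: h_def)
      qed
      then have "(\<integral>s. h k s \<partial>circle) = (a k * cis (of_int k * x)) * (\<integral>s. of_real (log_kernel s) * cis (- (of_int k * s)) \<partial>circle)"
        by (simp only: integral_mult_right_zero)
      then show ?thesis using False unfolding integral_log_kernel_cis by simp
    qed (simp add: h_def)
  qed
  finally show ?thesis .
qed

lemma nonlin_integral:
  "integrable circle (\<lambda>s. of_real (log_kernel s) * eval (r, t, s) x (nonlin_log g) + eval (r, t, s) x (nonlin_reg w g))"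
  "(\<integral>s. of_real (log_kernel s) * eval (r, t, s) x (nonlin_log g) + eval (r, t, s) x (nonlin_reg w g) \<partial>circle)
    = (\<Sum>\<^sub>\<infinity>k. nonlin_mode w g k r t * of_real (damp (r, t, 0) k) * cis (of_int k * x))"
proof -
  define h where "h k s = (of_real (log_kernel s) * mode (nonlin_log g) k (r, t, s) + mode (nonlin_reg w g) k (r, t, s)) * (of_real (damp (r, t, 0) k) * cis (of_int k * x))" for k s
  define b where "b k = norm (mode (nonlin_log g) k) + norm (mode (nonlin_reg w g) k)" for k
  have eq: "of_real (log_kernel s) * eval (r, t, s) x (nonlin_log g) + eval (r, t, s) x (nonlin_reg w g) = (\<Sum>\<^sub>\<infinity>k. h k s)" for s
  proof -
    have "of_real (log_kernel s) * eval (r, t, s) x (nonlin_log g) + eval (r, t, s) x (nonlin_reg w g)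
      = (\<Sum>\<^sub>\<infinity>k. of_real (log_kernel s) * (mode (nonlin_log g) k (r, t, s) * of_real (damp (r, t, s) k) * cis (of_int k * x)) + mode (nonlin_reg w g) k (r, t, s) * of_real (damp (r, t, s) k) * cis (of_int k * x))"
      unfolding eval_def infsum_cmult_right'[symmetric]
      by (rule infsum_add[symmetric]) (intro summable_on_cmult_right eval_summable)+
    then show ?thesis unfolding h_def by (simp add: damp_def algebra_simps)
  qed
  have m: "h k \<in> borel_measurable circle" for k
  proof -
    have [measurable]: "(\<lambda>s. complex_of_real (log_kernel s)) \<in> borel_measurable circle"
      by (rule borel_measurable_circle) measurable
    note [measurable] = mode_measurable
    show ?thesis unfolding h_def by measurable
  qed
  have bnd: "norm (h k s) \<le> b k * log_weight s" for k s
  proof -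
    have "norm (h k s) \<le> norm (of_real (log_kernel s) * mode (nonlin_log g) k (r, t, s) + mode (nonlin_reg w g) k (r, t, s)) * 1"
      unfolding h_def norm_mult by (intro mult_left_mono) (auto simp: less_imp_le[OF damp_pos])
    also have "\<dots> \<le> \<bar>log_kernel s\<bar> * norm (mode (nonlin_log g) k) + 1 * norm (mode (nonlin_reg w g) k)"
      by (simp, rule order_trans[OF norm_triangle_ineq]) (auto simp: norm_mult intro!: add_mono mult_left_mono norm_bounded)
    also have "\<dots> \<le> log_weight s * norm (mode (nonlin_log g) k) + log_weight s * norm (mode (nonlin_reg w g) k)"
      by (intro add_mono mult_right_mono) (auto simp: log_weight_def)
    finally show ?thesis by (simp add: b_def algebra_simps)
  qed
  have bs: "b summable_on UNIV" unfolding b_def by (intro summable_on_add mode_summable)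
  note T = termwise_integral[of h circle b log_weight, OF m bnd bs integrable_log_weight]
  have b0: "b k \<ge> 0" for k by (simp add: b_def)
  show "integrable circle (\<lambda>s. of_real (log_kernel s) * eval (r, t, s) x (nonlin_log g) + eval (r, t, s) x (nonlin_reg w g))"
    unfolding eq by (rule T(1)) (rule b0)
  show "(\<integral>s. of_real (log_kernel s) * eval (r, t, s) x (nonlin_log g) + eval (r, t, s) x (nonlin_reg w g) \<partial>circle)
    = (\<Sum>\<^sub>\<infinity>k. nonlin_mode w g k r t * of_real (damp (r, t, 0) k) * cis (of_int k * x))"
    unfolding eq T(2)[OF b0] unfolding h_def nonlin_mode_def integral_mult_left_zero by (simp add: mult.assoc)
qed

end

lemma norm_nonlin_integrand:
  "norm (of_real (log_kernel s) * mode b k p + mode c k p) \<le> log_weight s * (norm (mode b k) + norm (mode c k))"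
proof -
  have "norm (of_real (log_kernel s) * mode b k p + mode c k p) \<le> \<bar>log_kernel s\<bar> * norm (mode b k) + 1 * norm (mode c k)"
    by (rule order_trans[OF norm_triangle_ineq]) (auto simp: norm_mult intro!: add_mono mult_left_mono norm_bounded)
  also have "\<dots> \<le> log_weight s * norm (mode b k) + log_weight s * norm (mode c k)"
    by (intro add_mono mult_right_mono) (auto simp: log_weight_def)
  finally show ?thesis by (simp add: distrib_left)
qed

lemma nonlin_integrand:
  "integrable circle (\<lambda>s. of_real (log_kernel s) * mode b k (r, t, s) + mode c k (r, t, s))" (is "integrable circle ?f")
  "norm (\<integral>s. of_real (log_kernel s) * mode b k (r, t, s) + mode c k (r, t, s) \<partial>circle)
    \<le> (\<integral>s. log_weight s \<partial>circle) * (norm (mode b k) + norm (mode c k))"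
proof -
  note le = norm_nonlin_integrand
  have m: "?f \<in> borel_measurable circle"
  proof -
    have [measurable]: "(\<lambda>s. complex_of_real (log_kernel s)) \<in> borel_measurable circle"
      by (rule borel_measurable_circle) measurable
    note [measurable] = mode_measurable
    show ?thesis by measurable
  qed
  have W: "integrable circle (\<lambda>s. log_weight s * (norm (mode b k) + norm (mode c k)))"
    using integrable_log_weight by simp
  show i: "integrable circle ?f"
    by (rule Bochner_Integration.integrable_bound[OF W m]) (use le in \<open>auto intro!: AE_I2 intro: order_trans[OF _ abs_ge_self]\<close>)
  have "norm (\<integral>s. ?f s \<partial>circle) \<le> (\<integral>s. log_weight s * (norm (mode b k) + norm (mode c k)) \<partial>circle)"
    by (rule Bochner_Integration.integral_norm_bound_integral[OF i W le])
  then show "norm (\<integral>s. ?f s \<partial>circle) \<le> (\<integral>s. log_weight s \<partial>circle) * (norm (mode b k) + norm (mode c k))"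
    by simp
qed

lemma nonlin_mode_diff_bound:
  "norm (nonlin_mode w g k r t - nonlin_mode w g' k r t) \<le> (\<integral>s. log_weight s \<partial>circle) *
     (norm (mode (nonlin_log g - nonlin_log g') k) + norm (mode (nonlin_reg w g - nonlin_reg w g') k))"
proof -
  have "nonlin_mode w g k r t - nonlin_mode w g' k r t
    = (\<integral>s. of_real (log_kernel s) * mode (nonlin_log g - nonlin_log g') k (r, t, s) + mode (nonlin_reg w g - nonlin_reg w g') k (r, t, s) \<partial>circle)"
    unfolding nonlin_mode_def
    by (subst Bochner_Integration.integral_diff[symmetric, OF nonlin_integrand(1) nonlin_integrand(1)])
       (simp add: algebra_simps)
  then show ?thesis by (simp only: nonlin_integrand(2))
qed

lemma nonlin_mode_zero: "nonlin_mode w 0 k r t = 0"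
  by (simp add: nonlin_mode_def nonlin_zero)

lemma nonlin_mode_bound:
  "norm (nonlin_mode w g k r t) \<le> (\<integral>s. log_weight s \<partial>circle) * (norm (mode (nonlin_log g) k) + norm (mode (nonlin_reg w g) k))"
  unfolding nonlin_mode_def by (rule nonlin_integrand(2))

text \<open>The graph equation in Fourier variables.  Convolution with the logarithmic kernel is diagonal and
gives the damping; the rest is read off from the modes of \<open>nonlin_log g\<close> and \<open>nonlin_reg w g\<close>,
integrated over \<open>s\<close>.\<close>

theorem (in profile) graph_rhs_fourier:
  "of_real (graph_rhs \<rho>p \<rho>m f x) = trig_sum (\<lambda>k. - of_real (decay_rate (\<rho>m - \<rho>p) k) * a k
      + of_real ((\<rho>m - \<rho>p) / (8 * pi) * \<sigma> ^ 3) * (nonlin_mode w g k r t * of_real (damp (r, t, 0) k))) x"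
proof -
  define c where "c = complex_of_real ((\<rho>m - \<rho>p) / (8 * pi))"
  define A where "A s = complex_of_real (log_kernel s) * of_real (f (x - s) - mean)" for s
  define N where "N s = of_real (log_kernel s) * eval (r, t, s) x (nonlin_log g) + eval (r, t, s) x (nonlin_reg w g)" for s
  define Ak where "Ak k = (if k = 0 then 0 else - (2 * pi / \<bar>real_of_int k\<bar>)) * a k * cis (of_int k * x)" for k
  define Nk where "Nk k = nonlin_mode w g k r t * of_real (damp (r, t, 0) k) * cis (of_int k * x)" for k
  obtain B where B: "\<And>y. \<bar>f y\<bar> \<le> B" using f_bound by blast
  have "integrable circle (\<lambda>s. log_kernel s * (f (x - s) - mean))"
  proof (rule integrable_log_kernel_mult)
    show "(\<lambda>s. f (x - s) - mean) \<in> borel_measurable borel"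
      by (intro borel_measurable_continuous_onI continuous_intros continuous_on_compose2[OF f_cont[of UNIV]]) auto
    show "\<bar>f (x - s) - mean\<bar> \<le> B + \<bar>mean\<bar>" for s using B[of "x - s"] by linarith
  qed
  from integrable_of_real[OF this] have iA: "integrable circle A" by (simp add: A_def[abs_def])
  have iN: "integrable circle N" unfolding N_def[abs_def] by (rule nonlin_integral(1))
  have cont: "continuous_on UNIV (\<lambda>s. f (x - s) - mean)" "\<bar>f (x - s) - mean\<bar> \<le> B + \<bar>mean\<bar>" for s
    using B[of "x - s"] by (auto intro!: continuous_intros continuous_on_compose2[OF f_cont[of UNIV]])
  have iS: "integrable circle (\<lambda>s. complex_of_real (slip_kernel f f' x s * (f (x - s) - mean)))"
    by (rule integrable_of_real[OF slip_kernel_integrable[OF cont]])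
  have "of_real (graph_rhs \<rho>p \<rho>m f x) = c * (\<integral>s. complex_of_real (slip_kernel f f' x s * (f (x - s) - mean)) \<partial>circle)"
    unfolding graph_rhs_slip c_def integral_complex_of_real by (rule of_real_mult)
  also have "(\<integral>s. complex_of_real (slip_kernel f f' x s * (f (x - s) - mean)) \<partial>circle) = (\<integral>s. A s + of_real (\<sigma> ^ 3) * N s \<partial>circle)"
  proof (rule integral_cong_AE)
    show "AE s in circle. complex_of_real (slip_kernel f f' x s * (f (x - s) - mean)) = A s + of_real (\<sigma> ^ 3) * N s"
      using AE_circle_interior unfolding A_def N_def by eventually_elim (rule slip_pointwise; simp)
    show "(\<lambda>s. A s + of_real (\<sigma> ^ 3) * N s) \<in> borel_measurable circle"
      using iA iN by auto
  qed (use iS in auto)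
  also have "\<dots> = (\<integral>s. A s \<partial>circle) + of_real (\<sigma> ^ 3) * (\<integral>s. N s \<partial>circle)"
    using iA iN by simp
  also have "(\<integral>s. A s \<partial>circle) = (\<Sum>\<^sub>\<infinity>k. Ak k)" unfolding A_def Ak_def by (rule trig_sum_log_integral)
  also have "(\<integral>s. N s \<partial>circle) = (\<Sum>\<^sub>\<infinity>k. Nk k)" unfolding N_def Nk_def by (rule nonlin_integral(2))
  finally have 1: "of_real (graph_rhs \<rho>p \<rho>m f x) = c * ((\<Sum>\<^sub>\<infinity>k. Ak k) + of_real (\<sigma> ^ 3) * (\<Sum>\<^sub>\<infinity>k. Nk k))" .
  have sA: "Ak summable_on UNIV"
  proof (rule summable_on_bounded_by(1)[OF summable_on_cmult_right[OF a_summable, of "2 * pi"]])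
    show "norm (Ak k) \<le> 2 * pi * norm (a k)" for k
    proof (cases "k = 0")
      case False
      have "2 * pi / \<bar>real_of_int k\<bar> \<le> 2 * pi"
        using abs_int_ge_1[OF False] by (simp add: divide_le_eq)
      then have "2 * pi / \<bar>real_of_int k\<bar> * norm (a k) \<le> 2 * pi * norm (a k)" by (intro mult_right_mono) auto
      then show ?thesis using False by (simp add: Ak_def norm_mult norm_divide)
    qed (simp add: Ak_def)
  qed
  have sN: "Nk summable_on UNIV"
  proof (rule summable_on_bounded_by(1)[OF summable_on_cmult_right[OF summable_on_add[OF mode_summable mode_summable]]])
    fix k
    have "norm (Nk k) \<le> norm (nonlin_mode w g k r t) * 1"
      unfolding Nk_def norm_mult by (simp, rule mult_left_le) (auto simp: less_imp_le[OF damp_pos])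
    then show "norm (Nk k) \<le> (\<integral>s. log_weight s \<partial>circle) * (norm (mode (nonlin_log g) k) + norm (mode (nonlin_reg w g) k))"
      using nonlin_mode_bound[of w g k r t] by linarith
  qed
  have "c * ((\<Sum>\<^sub>\<infinity>k. Ak k) + of_real (\<sigma> ^ 3) * (\<Sum>\<^sub>\<infinity>k. Nk k)) = (\<Sum>\<^sub>\<infinity>k. c * (Ak k + of_real (\<sigma> ^ 3) * Nk k))"
    unfolding infsum_cmult_right'[symmetric]
    by (simp only: infsum_add[OF sA summable_on_cmult_right[OF sN]] infsum_cmult_right')
  also have "\<dots> = trig_sum (\<lambda>k. - of_real (decay_rate (\<rho>m - \<rho>p) k) * a k
      + of_real ((\<rho>m - \<rho>p) / (8 * pi) * \<sigma> ^ 3) * (nonlin_mode w g k r t * of_real (damp (r, t, 0) k))) x"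
    unfolding trig_sum_def
  proof (rule infsum_cong)
    fix k :: int
    have "(\<rho>m - \<rho>p) / (8 * pi) * (if k = 0 then 0 else - (2 * pi / \<bar>real_of_int k\<bar>)) = - decay_rate (\<rho>m - \<rho>p) k"
      by (simp add: decay_rate_def field_simps)
    then have "c * (if k = 0 then 0 else - (2 * pi / \<bar>real_of_int k\<bar>)) = - of_real (decay_rate (\<rho>m - \<rho>p) k)"
      unfolding c_def of_real_mult[symmetric] by simp
    then show "c * (Ak k + of_real (\<sigma> ^ 3) * Nk k) = (- of_real (decay_rate (\<rho>m - \<rho>p) k) * a k
      + of_real ((\<rho>m - \<rho>p) / (8 * pi) * \<sigma> ^ 3) * (nonlin_mode w g k r t * of_real (damp (r, t, 0) k))) * cis (of_int k * x)"
      unfolding Ak_def Nk_def distrib_left distrib_right mult.assoc[symmetric] by (simp add: c_def)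
  qed
  finally show ?thesis unfolding 1 .
qed

section \<open>Evolution of a single Fourier mode\<close>

lemma integral_has_vector_derivative_Ici:
  fixes f :: "real \<Rightarrow> 'a::banach"
  assumes "continuous_on {0..} f" "t \<ge> 0"
  shows "((\<lambda>t. integral {0..t} f) has_vector_derivative f t) (at t within {0..})"
proof -
  have "((\<lambda>t. integral {0..t} f) has_vector_derivative f t) (at t within {0..t + 1})"
    by (rule integral_has_vector_derivative) (use assms in \<open>auto intro: continuous_on_subset\<close>)
  moreover have "at t within {0..t + 1} = at t within {0..}"
  proof (rule at_within_nhd)
    show "t \<in> {t - 1<..<t + 1}" by auto
    show "{0..t + 1} \<inter> {t - 1<..<t + 1} - {t} = {0..} \<inter> {t - 1<..<t + 1} - {t}" by auto
  qed auto
  ultimately show ?thesis by simp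
qed

definition duhamel :: "real \<Rightarrow> complex \<Rightarrow> (real \<Rightarrow> complex) \<Rightarrow> real \<Rightarrow> complex" where
  "duhamel l a F t = exp (- l * t) *\<^sub>R (a + integral {0..t} (\<lambda>\<tau>. exp (l * \<tau>) *\<^sub>R F \<tau>))"

lemma duhamel_derivative:
  assumes F: "continuous_on {0..} F" and t: "t \<ge> 0"
  shows "(duhamel l a F has_vector_derivative - of_real l * duhamel l a F t + F t) (at t within {0..})"
proof -
  have "continuous_on {0..} (\<lambda>\<tau>. exp (l * \<tau>) *\<^sub>R F \<tau>)" by (intro continuous_intros F)
  note I = integral_has_vector_derivative_Ici[OF this t]
  have e: "((\<lambda>t. exp (- l * t)) has_vector_derivative - l * exp (- l * t)) (at t within {0..})"
    unfolding has_real_derivative_iff_has_vector_derivative[symmetric]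
    by (auto intro!: derivative_eq_intros)
  have "(duhamel l a F has_vector_derivative exp (- l * t) *\<^sub>R (exp (l * t) *\<^sub>R F t) + (- l * exp (- l * t)) *\<^sub>R (a + integral {0..t} (\<lambda>\<tau>. exp (l * \<tau>) *\<^sub>R F \<tau>))) (at t within {0..})"
    unfolding duhamel_def[abs_def]
    by (rule has_vector_derivative_scaleR[OF e[unfolded has_real_derivative_iff_has_vector_derivative[symmetric]]])
       (use has_vector_derivative_add[OF has_vector_derivative_const I] in simp)
  moreover have "exp (- l * t) *\<^sub>R (exp (l * t) *\<^sub>R F t) = F t"
    by (simp add: exp_minus)
  moreover have "(- l * exp (- l * t)) *\<^sub>R X = - of_real l * (exp (- l * t) *\<^sub>R X)" for X :: complex
    by (simp add: scaleR_conv_of_real)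
  ultimately show ?thesis by (simp add: duhamel_def add.commute)
qed

lemma duhamel_0: "duhamel l a F 0 = a"
  by (simp add: duhamel_def)

lemma duhamel_continuous:
  assumes "continuous_on {0..} F" shows "continuous_on {0..} (duhamel l a F)"
  unfolding continuous_on_eq_continuous_within
  using duhamel_derivative[OF assms] has_vector_derivative_continuous by blast

lemma duhamel_cnj:
  assumes "\<And>\<tau>. \<tau> \<ge> 0 \<Longrightarrow> G \<tau> = cnj (F \<tau>)"
  shows "duhamel l (cnj a) G t = cnj (duhamel l a F t)"
proof -
  have "integral {0..t} (\<lambda>\<tau>. exp (l * \<tau>) *\<^sub>R G \<tau>) = integral {0..t} (\<lambda>\<tau>. cnj (exp (l * \<tau>) *\<^sub>R F \<tau>))"
    by (rule integral_cong) (simp add: assms)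
  also have "\<dots> = cnj (integral {0..t} (\<lambda>\<tau>. exp (l * \<tau>) *\<^sub>R F \<tau>))" by (rule integral_cnj[symmetric])
  finally show ?thesis by (simp add: duhamel_def)
qed

text \<open>Modes are measured by the weight \<open>V k t = exp (- rad t * \<bar>k\<bar>) * sig t\<close>, whose radius decreases from
\<open>r1 + \<alpha>\<close> to \<open>r1\<close> while its amplitude decays like \<open>1 / t\<close>.  Negative times are clamped to 0, so that
the weight is defined on the whole parameter space.\<close>

locale weights =
  fixes \<rho> \<alpha> r1 :: real
  assumes \<rho>: "\<rho> > 0" and \<alpha>: "\<alpha> > 0" and r1: "r1 \<ge> 0"
begin

definition c :: real where "c = \<rho> * \<alpha> / 2"
definition \<kappa> :: real where "\<kappa> = \<rho> * \<alpha>\<^sup>2 / 4"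
definition sig :: "real \<Rightarrow> real" where "sig t = 1 / (1 + c * max 0 t)"
definition rad :: "real \<Rightarrow> real" where "rad t = r1 + \<alpha> * sig t"

lemma c_pos: "c > 0" and \<kappa>_pos: "\<kappa> > 0"
  using \<rho> \<alpha> by (simp_all add: c_def \<kappa>_def)

lemma sig_denom: "1 + c * max 0 t > 0" using c_pos by (simp add: add_pos_nonneg)

lemma sig_pos: "sig t > 0" and sig_le_1: "sig t \<le> 1" and sig_0: "sig 0 = 1"
  using sig_denom[of t] c_pos by (auto simp: sig_def divide_le_eq_1)

lemma rad_bounds: "rad t > 0" "r1 \<le> rad t" "rad t \<le> r1 + \<alpha>" "rad 0 = r1 + \<alpha>"
  using sig_pos[of t] sig_le_1[of t] \<alpha> r1 by (auto simp: rad_def sig_0 add_nonneg_pos)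

lemma sig_continuous: "continuous_on A sig"
  unfolding sig_def using sig_denom by (intro continuous_intros) (auto simp: less_imp_neq[THEN not_sym])

lemma rad_continuous: "continuous_on A rad"
  unfolding rad_def by (intro continuous_intros sig_continuous)

definition V :: "int \<Rightarrow> real \<Rightarrow> real" where
  "V k t = exp (- rad t * \<bar>real_of_int k\<bar>) * sig t"

lemma V_pos: "V k t > 0" by (simp add: V_def sig_pos)

lemma V_continuous: "continuous_on A (V k)"
  unfolding V_def by (intro continuous_intros rad_continuous sig_continuous)

lemma V_derivative:
  assumes t: "t > 0"
  shows "((\<lambda>t. exp (l * t) * V k t) has_real_derivative
      exp (l * t) * V k t * (l + 2 * \<kappa> * \<bar>real_of_int k\<bar> * (sig t)\<^sup>2 - c * sig t)) (at t)"
proof -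
  have ev: "\<forall>\<^sub>F u in nhds t. u > 0" by (rule eventually_nhds_in_open[of "{0<..}", simplified]) (use t in auto)
  have nz: "1 + c * t \<noteq> 0" using sig_denom[of t] t by simp
  have s: "(sig has_real_derivative - c * (sig t)\<^sup>2) (at t)"
  proof -
    have "((\<lambda>t. 1 / (1 + c * t)) has_real_derivative - c * (1 / (1 + c * t))\<^sup>2) (at t)"
    proof -
      have "((\<lambda>t. 1 + c * t) has_real_derivative c) (at t)" by (auto intro!: derivative_eq_intros)
      from DERIV_inverse'[OF this nz] show ?thesis by (simp add: inverse_eq_divide power2_eq_square)
    qed
    moreover have "\<forall>\<^sub>F u in nhds t. sig u = 1 / (1 + c * u)"
      using ev by eventually_elim (simp add: sig_def)
    ultimately show ?thesis using DERIV_cong_ev[OF refl, of sig "\<lambda>t. 1 / (1 + c * t)" t] t by (simp add: sig_def)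
  qed
  have r: "(rad has_real_derivative \<alpha> * (- c * (sig t)\<^sup>2)) (at t)"
    unfolding rad_def using DERIV_add[OF DERIV_const DERIV_cmult[OF s]] by simp
  have "((\<lambda>t. exp (l * t) * V k t) has_real_derivative
      (exp (l * t) * l) * V k t + (exp (- rad t * \<bar>real_of_int k\<bar>) * (- (\<alpha> * (- c * (sig t)\<^sup>2)) * \<bar>real_of_int k\<bar>) * sig t
        + exp (- rad t * \<bar>real_of_int k\<bar>) * (- c * (sig t)\<^sup>2)) * exp (l * t)) (at t)"
    unfolding V_def by (rule derivative_eq_intros r s refl | simp)+
  moreover have "\<alpha> * c = 2 * \<kappa>" by (simp add: c_def \<kappa>_def power2_eq_square)
  then have "(exp (l * t) * l) * V k t + (exp (- rad t * \<bar>real_of_int k\<bar>) * (- (\<alpha> * (- c * (sig t)\<^sup>2)) * \<bar>real_of_int k\<bar>) * sig t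
        + exp (- rad t * \<bar>real_of_int k\<bar>) * (- c * (sig t)\<^sup>2)) * exp (l * t)
     = exp (l * t) * V k t * (l + 2 * \<kappa> * \<bar>real_of_int k\<bar> * (sig t)\<^sup>2 - c * sig t)"
    unfolding V_def by (simp add: algebra_simps power2_eq_square flip: \<open>\<alpha> * c = 2 * \<kappa>\<close>)
  ultimately show ?thesis by (simp only:)
qed

text \<open>The central estimate.  Half of the gain \<open>2 \<kappa> \<bar>k\<bar> (sig t)\<^sup>2\<close> from the shrinking radius, large at high
frequencies, and the damping, large at low frequencies, together exceed by the inequality between
arithmetic and geometric means the loss \<open>c * sig t\<close> that comes from the decaying amplitude.  The other
half of the gain is left, and it carries a full factor \<open>\<bar>k\<bar>\<close>.\<close>

lemma decay_amgm:
  assumes "k \<noteq> 0"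
  shows "\<kappa> * \<bar>real_of_int k\<bar> * (sig t)\<^sup>2 \<le> decay_rate \<rho> k + 2 * \<kappa> * \<bar>real_of_int k\<bar> * (sig t)\<^sup>2 - c * sig t"
proof -
  define n where "n = \<bar>real_of_int k\<bar>"
  have n: "n > 0" using assms by (simp add: n_def)
  have "0 \<le> \<rho> / (4 * n) * (1 - \<alpha> * n * sig t)\<^sup>2" using \<rho> n by simp
  also have "\<dots> = \<rho> / (4 * n) + \<kappa> * n * (sig t)\<^sup>2 - c * sig t"
    using n by (simp add: \<kappa>_def c_def power2_eq_square field_simps)
  finally have "0 \<le> \<rho> / (4 * n) + \<kappa> * n * (sig t)\<^sup>2 - c * sig t" .
  moreover have "decay_rate \<rho> k = \<rho> / (4 * n)" using assms by (simp add: decay_rate_def n_def)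
  ultimately show ?thesis unfolding n_def[symmetric] by linarith
qed

text \<open>A forcing of size \<open>V k t * (sig t)\<^sup>2\<close> produces a response of size \<open>V k t / \<bar>k\<bar>\<close>: by \<open>decay_amgm\<close> the
multiple of \<open>V k t\<close> on the right is a supersolution.  The factor \<open>1 / \<bar>k\<bar>\<close> is exactly the derivative that
the nonlinearity, being a function of the slope, loses.\<close>

lemma mode_estimate:
  fixes u F :: "real \<Rightarrow> complex"
  assumes k: "k \<noteq> 0" and T: "0 \<le> T"
    and u: "\<And>t. t \<in> {0..T} \<Longrightarrow> (u has_vector_derivative - of_real (decay_rate \<rho> k) * u t + F t) (at t within {0..T})"
    and F: "\<And>t. t \<in> {0..T} \<Longrightarrow> norm (F t) \<le> \<beta> * (V k t * (sig t)\<^sup>2)"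
  shows "norm (exp (decay_rate \<rho> k * T) *\<^sub>R u T - u 0) \<le> \<beta> / (\<kappa> * \<bar>real_of_int k\<bar>) * (exp (decay_rate \<rho> k * T) * V k T)"
proof -
  define l where "l = decay_rate \<rho> k"
  have kp: "\<kappa> * \<bar>real_of_int k\<bar> > 0" using k \<kappa>_pos by simp
  have "0 \<le> norm (F 0)" by simp
  also have "\<dots> \<le> \<beta> * (V k 0 * (sig 0)\<^sup>2)" using F[of 0] T by simp
  finally have \<beta>: "\<beta> \<ge> 0" using V_pos[of k 0] by (simp add: sig_0 zero_le_mult_iff)
  show ?thesis
  proof (cases "T = 0")
    case True
    then show ?thesis using \<beta> kp V_pos[of k 0] by simp
  next
    case False
    define f where "f t = exp (l * t) *\<^sub>R u t" for t
    define \<phi> where "\<phi> t = \<beta> / (\<kappa> * \<bar>real_of_int k\<bar>) * (exp (l * t) * V k t)" for t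
    have ucont: "continuous_on {0..T} u"
      unfolding continuous_on_eq_continuous_within using u has_vector_derivative_continuous by blast
    have "norm (f T - f 0) \<le> \<phi> T - \<phi> 0"
    proof (rule differentiable_bound_general)
      show "0 < T" using T False by simp
      show "continuous_on {0..T} f" unfolding f_def by (intro continuous_intros ucont)
      show "continuous_on {0..T} \<phi>" unfolding \<phi>_def by (intro continuous_intros V_continuous)
      fix t assume t: "0 < t" "t < T"
      have ut: "(u has_vector_derivative - of_real l * u t + F t) (at t)"
        using u[of t] t by (simp add: at_within_Icc_at l_def)
      have e: "((\<lambda>t. exp (l * t)) has_real_derivative l * exp (l * t)) (at t)"
        by (auto intro!: derivative_eq_intros)
      have "(f has_vector_derivative exp (l * t) *\<^sub>R (- of_real l * u t + F t) + (l * exp (l * t)) *\<^sub>R u t) (at t)"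
        unfolding f_def by (rule has_vector_derivative_scaleR[OF e ut])
      then show "(f has_vector_derivative exp (l * t) *\<^sub>R F t) (at t)"
        by (simp add: scaleR_conv_of_real algebra_simps)
      show "(\<phi> has_vector_derivative \<beta> / (\<kappa> * \<bar>real_of_int k\<bar>) * (exp (l * t) * V k t * (l + 2 * \<kappa> * \<bar>real_of_int k\<bar> * (sig t)\<^sup>2 - c * sig t))) (at t)"
        unfolding \<phi>_def has_real_derivative_iff_has_vector_derivative[symmetric]
        by (rule DERIV_cmult[OF V_derivative[OF t(1)]])
      have "norm (exp (l * t) *\<^sub>R F t) \<le> exp (l * t) * (\<beta> * (V k t * (sig t)\<^sup>2))"
        using F[of t] t by simp
      also have "\<dots> = \<beta> / (\<kappa> * \<bar>real_of_int k\<bar>) * (exp (l * t) * V k t * (\<kappa> * \<bar>real_of_int k\<bar> * (sig t)\<^sup>2))"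
        using k \<kappa>_pos by simp
      also have "\<dots> \<le> \<beta> / (\<kappa> * \<bar>real_of_int k\<bar>) * (exp (l * t) * V k t * (l + 2 * \<kappa> * \<bar>real_of_int k\<bar> * (sig t)\<^sup>2 - c * sig t))"
        using decay_amgm[OF k, of t] \<beta> kp V_pos[of k t] unfolding l_def by (intro mult_left_mono) auto
      finally show "norm (exp (l * t) *\<^sub>R F t) \<le> \<beta> / (\<kappa> * \<bar>real_of_int k\<bar>) * (exp (l * t) * V k t * (l + 2 * \<kappa> * \<bar>real_of_int k\<bar> * (sig t)\<^sup>2 - c * sig t))" .
    qed
    moreover have "\<phi> 0 \<ge> 0" using \<beta> kp V_pos[of k 0] by (simp add: \<phi>_def)
    ultimately show ?thesis by (simp add: f_def \<phi>_def l_def)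
  qed
qed

text \<open>The freely decaying mode stays below the weight, since \<open>exp (decay_rate \<rho> k * t) * V k t\<close> does not
decrease.\<close>

lemma V_dominates_decay:
  assumes k: "k \<noteq> 0" and T: "0 \<le> T"
  shows "V k 0 \<le> exp (decay_rate \<rho> k * T) * V k T"
proof (cases "T = 0")
  case False
  have kp: "\<kappa> * \<bar>real_of_int k\<bar> > 0" using k \<kappa>_pos by simp
  have "\<exists>l z. 0 < z \<and> z < T \<and> ((\<lambda>t. exp (decay_rate \<rho> k * t) * V k t) has_real_derivative l) (at z)
     \<and> exp (decay_rate \<rho> k * T) * V k T - exp (decay_rate \<rho> k * 0) * V k 0 = (T - 0) * l"
    by (rule MVT) (use False T V_derivative in \<open>auto intro!: continuous_intros V_continuous simp: real_differentiable_def\<close>)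
  then obtain l z where z: "0 < z" "z < T" "((\<lambda>t. exp (decay_rate \<rho> k * t) * V k t) has_real_derivative l) (at z)"
    "exp (decay_rate \<rho> k * T) * V k T - V k 0 = T * l" by auto
  have "l = exp (decay_rate \<rho> k * z) * V k z * (decay_rate \<rho> k + 2 * \<kappa> * \<bar>real_of_int k\<bar> * (sig z)\<^sup>2 - c * sig z)"
    using DERIV_unique[OF z(3) V_derivative[OF z(1)]] .
  also have "\<dots> \<ge> 0"
  proof (rule mult_nonneg_nonneg)
    have "0 \<le> \<kappa> * \<bar>real_of_int k\<bar> * (sig z)\<^sup>2" using \<kappa>_pos by simp
    then show "0 \<le> decay_rate \<rho> k + 2 * \<kappa> * \<bar>real_of_int k\<bar> * (sig z)\<^sup>2 - c * sig z"
      using decay_amgm[OF k, of z] by linarith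
  qed (use V_pos[of k z] in simp)
  finally have "T * l \<ge> 0" using T by simp
  with z(4) show ?thesis by simp
qed simp

end

section \<open>The forcing produced by the nonlinearity\<close>

lemma nonlin_mode_continuous:
  assumes R: "continuous_on A R"
  shows "continuous_on A (\<lambda>t. nonlin_mode w b k (R t) t)"
proof (unfold continuous_on_sequentially, intro allI impI ballI)
  fix x a assume xa: "a \<in> A" "(\<forall>n. x n \<in> A) \<and> x \<longlonglongrightarrow> a"
  have Rx: "(\<lambda>n. R (x n)) \<longlonglongrightarrow> R a"
    using R xa unfolding continuous_on_sequentially o_def by blast
  have m: "(\<lambda>n. mode c k (R (x n), x n, s)) \<longlonglongrightarrow> mode c k (R a, a, s)" for c s
  proof -
    have "(\<lambda>n. (R (x n), x n, s)) \<longlonglongrightarrow> (R a, a, s)" using xa by (intro tendsto_Pair Rx tendsto_const) auto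
    moreover have "isCont (mode c k) (R a, a, s)"
      using continuous_on_apply_bcontfun[of UNIV "mode c k"] unfolding continuous_on_eq_continuous_at[OF open_UNIV] by blast
    ultimately show ?thesis by (rule isCont_tendsto_compose[rotated])
  qed
  have meas: "(\<lambda>s. of_real (log_kernel s) * mode (nonlin_log b) k (r, t, s) + mode (nonlin_reg w b) k (r, t, s)) \<in> borel_measurable circle" for r t
    using nonlin_integrand(1) by (rule borel_measurable_integrable)
  have "(\<lambda>n. nonlin_mode w b k (R (x n)) (x n)) \<longlonglongrightarrow> nonlin_mode w b k (R a) a"
    unfolding nonlin_mode_def
  proof (rule integral_dominated_convergence[where w = "\<lambda>s. log_weight s * (norm (mode (nonlin_log b) k) + norm (mode (nonlin_reg w b) k))"])
    show "integrable circle (\<lambda>s. log_weight s * (norm (mode (nonlin_log b) k) + norm (mode (nonlin_reg w b) k)))"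
      using integrable_log_weight by simp
    show "AE s in circle. (\<lambda>n. of_real (log_kernel s) * mode (nonlin_log b) k (R (x n), x n, s) + mode (nonlin_reg w b) k (R (x n), x n, s))
        \<longlonglongrightarrow> of_real (log_kernel s) * mode (nonlin_log b) k (R a, a, s) + mode (nonlin_reg w b) k (R a, a, s)"
      by (intro AE_I2 tendsto_intros m)
    show "AE s in circle. norm (of_real (log_kernel s) * mode (nonlin_log b) k (R (x n), x n, s) + mode (nonlin_reg w b) k (R (x n), x n, s))
        \<le> log_weight s * (norm (mode (nonlin_log b) k) + norm (mode (nonlin_reg w b) k))" for n
      by (intro AE_I2 norm_nonlin_integrand)
  qed (rule meas)+
  then show "((\<lambda>t. nonlin_mode w b k (R t) t) \<circ> x) \<longlonglongrightarrow> nonlin_mode w b k (R a) a" by (simp add: o_def)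
qed

context weights
begin

text \<open>The amplitude \<open>sig\<close> as an element of the algebra, constant in space.\<close>

definition decay_elem :: wiener where
  "decay_elem = scal (Bcontfun (\<lambda>p. of_real (sig (fst (snd p)))))"

lemma decay_elem_aux:
  "continuous_on UNIV (\<lambda>p::param. complex_of_real (sig (fst (snd p))))" "norm (complex_of_real (sig (fst (snd p)))) \<le> 1"
  by (auto intro!: continuous_intros continuous_on_compose2[OF sig_continuous[of UNIV]] simp: less_imp_le[OF sig_pos] sig_le_1)

lemma norm_decay_elem: "norm decay_elem \<le> 1"
  unfolding decay_elem_def norm_scal by (rule norm_Bcontfun_le[OF decay_elem_aux])

lemma eval_decay_elem: "eval (r, t, s) x decay_elem = of_real (sig t)"
  unfolding decay_elem_def eval_scal using apply_Bcontfun[OF decay_elem_aux, of "(r, t, s)"] by simp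

lemma damp_rad: "damp (rad t, t, s) k * sig t = V k t"
  using rad_bounds(1)[of t] by (simp add: damp_def V_def)

definition nl :: "wiener \<Rightarrow> int \<Rightarrow> real \<Rightarrow> complex" where
  "nl b k t = of_real (\<rho> / (8 * pi)) * nonlin_mode decay_elem b k (rad t) t"

text \<open>The cubic nonlinearity carries \<open>(sig t)\<^sup>3\<close>; one factor is part of \<open>V\<close>, and the other two are the ones that
\<open>mode_estimate\<close> requires.\<close>

definition forcing :: "wiener \<Rightarrow> int \<Rightarrow> real \<Rightarrow> complex" where
  "forcing b k t = nl b k t * of_real (V k t * (sig t)\<^sup>2)"

lemma forcing_continuous: "continuous_on A (forcing b k)"
  unfolding forcing_def nl_def
  by (intro continuous_intros nonlin_mode_continuous rad_continuous V_continuous sig_continuous)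

definition gap :: "wiener \<Rightarrow> wiener \<Rightarrow> int \<Rightarrow> real" where
  "gap b b' k = \<rho> / (8 * pi) * ((\<integral>s. log_weight s \<partial>circle) *
     (norm (mode (nonlin_log b - nonlin_log b') k) + norm (mode (nonlin_reg decay_elem b - nonlin_reg decay_elem b') k)))"

lemma log_weight_int: "0 \<le> (\<integral>s. log_weight s \<partial>circle)"
  by (rule integral_nonneg_AE) (auto simp: log_weight_def)

lemma gap_nonneg: "gap b b' k \<ge> 0"
  unfolding gap_def using \<rho> log_weight_int by (intro mult_nonneg_nonneg) auto

lemma forcing_diff: "norm (forcing b k t - forcing b' k t) \<le> gap b b' k * (V k t * (sig t)\<^sup>2)"
proof -
  have "forcing b k t - forcing b' k t = of_real (\<rho> / (8 * pi)) * (nonlin_mode decay_elem b k (rad t) t - nonlin_mode decay_elem b' k (rad t) t) * of_real (V k t * (sig t)\<^sup>2)"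
    by (simp add: forcing_def nl_def algebra_simps)
  also have "norm \<dots> = \<rho> / (8 * pi) * norm (nonlin_mode decay_elem b k (rad t) t - nonlin_mode decay_elem b' k (rad t) t) * (V k t * (sig t)\<^sup>2)"
    unfolding norm_mult norm_of_real using \<rho> V_pos[of k t] by simp
  also have "\<dots> \<le> gap b b' k * (V k t * (sig t)\<^sup>2)"
    unfolding gap_def using \<rho> V_pos[of k t]
    by (intro mult_right_mono mult_left_mono nonlin_mode_diff_bound) auto
  finally show ?thesis .
qed

lemma forcing_zero: "forcing 0 k t = 0"
  by (simp add: forcing_def nl_def nonlin_mode_zero)

lemma gap_summable: "gap b b' summable_on UNIV"
  unfolding gap_def by (intro summable_on_cmult_right summable_on_add mode_summable)

lemma gap_sum: "(\<Sum>\<^sub>\<infinity>k. gap b b' k) = \<rho> / (8 * pi) * ((\<integral>s. log_weight s \<partial>circle) *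
     (norm (nonlin_log b - nonlin_log b') + norm (nonlin_reg decay_elem b - nonlin_reg decay_elem b')))"
  unfolding gap_def infsum_cmult_right' infsum_add[OF mode_summable mode_summable] norm_wiener_def ..

lemma gap_lipschitz:
  obtains A where "A \<ge> 0" "\<And>R b b'. R \<le> 1/4 \<Longrightarrow> norm b \<le> R \<Longrightarrow> norm b' \<le> R \<Longrightarrow> (\<Sum>\<^sub>\<infinity>k. gap b b' k) \<le> A * R * norm (b - b')"
proof -
  obtain A where A: "A \<ge> 0"
    "\<And>R g g'. R \<le> 1/4 \<Longrightarrow> norm g \<le> R \<Longrightarrow> norm g' \<le> R \<Longrightarrow> norm (nonlin_log g - nonlin_log g') \<le> A * R * norm (g - g')"
    "\<And>R g g'. R \<le> 1/4 \<Longrightarrow> norm g \<le> R \<Longrightarrow> norm g' \<le> R \<Longrightarrow> norm (nonlin_reg decay_elem g - nonlin_reg decay_elem g') \<le> A * R * norm (g - g')"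
    using nonlin_lipschitz[OF norm_decay_elem] by metis
  define L where "L = \<rho> / (8 * pi) * (\<integral>s. log_weight s \<partial>circle)"
  have L: "L \<ge> 0" unfolding L_def using \<rho> log_weight_int by (intro mult_nonneg_nonneg) auto
  show thesis
  proof (rule that[of "L * (A + A)"])
    show "0 \<le> L * (A + A)" using L A(1) by simp
    fix R and b b' :: wiener assume R: "R \<le> 1/4" "norm b \<le> R" "norm b' \<le> R"
    have "(\<Sum>\<^sub>\<infinity>k. gap b b' k) = L * (norm (nonlin_log b - nonlin_log b') + norm (nonlin_reg decay_elem b - nonlin_reg decay_elem b'))"
      unfolding gap_sum L_def by simp
    also have "\<dots> \<le> L * (A * R * norm (b - b') + A * R * norm (b - b'))"
      by (intro mult_left_mono add_mono A(2)[OF R] A(3)[OF R] L)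
    finally show "(\<Sum>\<^sub>\<infinity>k. gap b b' k) \<le> L * (A + A) * R * norm (b - b')" by (simp add: algebra_simps)
  qed
qed

subsection \<open>From families of modes to elements of the algebra\<close>

text \<open>The element that represents the slope of the function with Fourier coefficients \<open>u k t\<close>, divided by
\<open>sig t\<close>; the modes are divided by \<open>V k t\<close> because evaluation damps them again.\<close>

definition lift :: "(int \<Rightarrow> real \<Rightarrow> complex) \<Rightarrow> wiener" where
  "lift u = Wiener (\<lambda>k. Bcontfun (\<lambda>p. \<i> * of_int k * u k (max 0 (fst (snd p))) / of_real (V k (fst (snd p)))))"

lemma V_max: "V k (max 0 t) = V k t"
  by (simp add: V_def rad_def sig_def)

definition tempered :: "(int \<Rightarrow> real \<Rightarrow> complex) \<Rightarrow> (int \<Rightarrow> real) \<Rightarrow> bool" where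
  "tempered u B \<longleftrightarrow> B summable_on UNIV \<and> (\<forall>k. continuous_on {0..} (u k)) \<and>
     (\<forall>k. \<forall>t\<ge>0. \<bar>real_of_int k\<bar> * norm (u k t) \<le> B k * V k t)"

lemma lift_aux:
  assumes "tempered u B"
  shows "continuous_on UNIV (\<lambda>p::param. \<i> * of_int k * u k (max 0 (fst (snd p))) / of_real (V k (fst (snd p))))"
    and "norm (\<i> * of_int k * u k (max 0 (fst (snd p))) / of_real (V k (fst (snd p)))) \<le> B k"
proof -
  have c: "continuous_on {0..} (u k)" using assms by (simp add: tempered_def)
  have "V k t \<noteq> 0" for t using V_pos[of k t] by simp
  then show "continuous_on UNIV (\<lambda>p::param. \<i> * of_int k * u k (max 0 (fst (snd p))) / of_real (V k (fst (snd p))))"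
    by (intro continuous_intros continuous_on_compose2[OF c] continuous_on_compose2[OF V_continuous[of UNIV]]) auto
  have "\<bar>real_of_int k\<bar> * norm (u k (max 0 t)) \<le> B k * V k t" for t
    using assms V_max[of k t] unfolding tempered_def by (metis max.cobounded1)
  then show "norm (\<i> * of_int k * u k (max 0 (fst (snd p))) / of_real (V k (fst (snd p)))) \<le> B k"
    using V_pos[of k "fst (snd p)"] by (simp add: norm_mult norm_divide divide_le_eq)
qed

lemma mode_lift:
  assumes u: "tempered u B"
  shows "mode (lift u) k (r, t, s) = \<i> * of_int k * u k (max 0 t) / of_real (V k t)"
    and "norm (mode (lift u) k) \<le> B k"
proof -
  have n: "norm (Bcontfun (\<lambda>p::param. \<i> * of_int k * u k (max 0 (fst (snd p))) / of_real (V k (fst (snd p))))) \<le> B k" for k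
    by (rule norm_Bcontfun_le[OF lift_aux[OF u]])
  have "B summable_on UNIV" using u by (simp add: tempered_def)
  then have "(\<lambda>k. norm (Bcontfun (\<lambda>p::param. \<i> * of_int k * u k (max 0 (fst (snd p))) / of_real (V k (fst (snd p)))))) summable_on UNIV"
    by (rule summable_on_bounded_by(3)) (rule n)
  then have m: "mode (lift u) k = Bcontfun (\<lambda>p. \<i> * of_int k * u k (max 0 (fst (snd p))) / of_real (V k (fst (snd p))))" for k
    unfolding lift_def by (subst Wiener_inverse) auto
  show "mode (lift u) k (r, t, s) = \<i> * of_int k * u k (max 0 t) / of_real (V k t)"
    unfolding m using apply_Bcontfun[OF lift_aux[OF u], of k "(r, t, s)"] by simp
  show "norm (mode (lift u) k) \<le> B k" unfolding m by (rule n)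
qed

lemma norm_lift: "tempered u B \<Longrightarrow> norm (lift u) \<le> (\<Sum>\<^sub>\<infinity>k. B k)"
  by (rule norm_wiener_le) (auto simp: mode_lift tempered_def)

lemma lift_modes:
  assumes u: "tempered u B" and t: "t \<ge> 0"
  shows "norm (u k t) * \<bar>real_of_int k\<bar> \<le> norm (mode (lift u) k) * V k t"
proof -
  have "norm (mode (lift u) k (0, t, 0)) \<le> norm (mode (lift u) k)" by (rule norm_bounded)
  then show ?thesis using t V_pos[of k t]
    by (simp add: mode_lift(1)[OF u] norm_mult norm_divide divide_le_eq mult.commute)
qed

text \<open>For a time dependent family of coefficients with small lift, the right-hand side of the graph
equation at time \<open>t\<close> is the linear damping plus the forcing of that lift.\<close>

lemma lift_profile:
  assumes u: "tempered u B" and b: "norm (lift u) \<le> 1/4" and t: "t \<ge> 0"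
    and dec: "exp_decay d (\<lambda>k. u k t)" "d > 0" and f: "\<And>x. of_real (f x) = trig_sum (\<lambda>k. u k t) x"
    and \<rho>': "\<rho>m - \<rho>p = \<rho>"
  shows "of_real (graph_rhs \<rho>p \<rho>m f x) = trig_sum (\<lambda>k. - of_real (decay_rate \<rho> k) * u k t + forcing (lift u) k t) x"
proof -
  interpret profile "\<lambda>k. u k t" f d "rad t" t "sig t" "lift u" decay_elem
  proof
    fix k :: int and s
    have "of_real (sig t) * (mode (lift u) k (rad t, t, s) * of_real (damp (rad t, t, s) k))
       = mode (lift u) k (rad t, t, s) * of_real (damp (rad t, t, s) k * sig t)" by simp
    also have "\<dots> = \<i> * of_int k * u k t"
      unfolding damp_rad mode_lift(1)[OF u] using t V_pos[of k t] by simp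
    finally show "of_real (sig t) * (mode (lift u) k (rad t, t, s) * of_real (damp (rad t, t, s) k)) = \<i> * of_int k * u k t" .
  qed (use dec f sig_pos norm_decay_elem eval_decay_elem b in auto)
  have "of_real ((\<rho>m - \<rho>p) / (8 * pi) * sig t ^ 3) * (nonlin_mode decay_elem (lift u) k (rad t) t * of_real (damp (rad t, t, 0) k)) = forcing (lift u) k t" for k
    unfolding \<rho>' forcing_def nl_def damp_rad[symmetric, of k t 0] by (simp add: power2_eq_square power3_eq_cube)
  then show ?thesis using graph_rhs_fourier[of \<rho>p \<rho>m x] by (simp only: \<rho>')
qed

end

section \<open>Solution for all times by a contraction\<close>

text \<open>Termwise differentiation in time, justified by a summable bound of the derivatives.\<close>

lemma trig_sum_time_derivative:
  fixes u v :: "int \<Rightarrow> real \<Rightarrow> complex"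
  assumes S: "convex S" and u: "\<And>k t. t \<in> S \<Longrightarrow> (u k has_vector_derivative v k t) (at t within S)"
    and v: "\<And>k t. t \<in> S \<Longrightarrow> norm (v k t) \<le> M k" and M: "M summable_on UNIV"
    and sum: "\<And>t. t \<in> S \<Longrightarrow> (\<lambda>k. norm (u k t)) summable_on UNIV" and t: "t \<in> S"
  shows "((\<lambda>t. trig_sum (\<lambda>k. u k t) x) has_vector_derivative trig_sum (\<lambda>k. v k t) x) (at t within S)"
proof -
  define f where "f n t = u (int_decode n) t * cis (of_int (int_decode n) * x)" for n t
  define w where "w n t = v (int_decode n) t * cis (of_int (int_decode n) * x)" for n t
  have eu: "trig_sum (\<lambda>k. u k t) x = (\<Sum>n. f n t) \<and> (\<lambda>n. f n t) sums trig_sum (\<lambda>k. u k t) x" if "t \<in> S" for t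
  proof -
    have "(\<lambda>k. u k t * cis (of_int k * x)) summable_on UNIV"
      by (rule summable_on_bounded_by(1)[OF sum[OF that]]) (simp add: norm_mult)
    then have "(\<lambda>n. f n t) sums trig_sum (\<lambda>k. u k t) x"
      using has_sum_int_imp_sums[OF has_sum_infsum] unfolding f_def trig_sum_def by fast
    then show ?thesis using sums_unique by blast
  qed
  have ev: "trig_sum (\<lambda>k. v k t) x = (\<Sum>n. w n t)" if "t \<in> S" for t
    unfolding trig_sum_def w_def
    by (rule infsum_int_eq_suminf, rule summable_on_bounded_by(1)[OF M]) (use v[OF that] in \<open>simp add: norm_mult\<close>)
  have U: "uniform_limit S (\<lambda>n t. \<Sum>i<n. w i t) (\<lambda>t. \<Sum>i. w i t) sequentially"
    by (rule Weierstrass_m_test[where M = "\<lambda>i. M (int_decode i)"])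
       (use v summable_int_decode[OF M] in \<open>auto simp: w_def norm_mult\<close>)
  have "\<exists>g. \<forall>t\<in>S. (\<lambda>n. f n t) sums g t \<and> (g has_derivative (\<lambda>h. h *\<^sub>R (\<Sum>n. w n t))) (at t within S)"
  proof (rule has_derivative_series[where f' = "\<lambda>n t h. h *\<^sub>R w n t"])
    show "(f n has_derivative (\<lambda>h. h *\<^sub>R w n t)) (at t within S)" if "t \<in> S" for n t
      using has_vector_derivative_mult_left[OF u[OF that, of "int_decode n"], of "cis (of_int (int_decode n) * x)"]
      unfolding f_def w_def has_vector_derivative_def .
    show "\<forall>\<^sub>F n in sequentially. \<forall>t\<in>S. \<forall>h. norm ((\<Sum>i<n. h *\<^sub>R w i t) - h *\<^sub>R (\<Sum>i. w i t)) \<le> e * norm h" if "e > 0" for e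
      using uniform_limitD[OF U that]
    proof eventually_elim
      case (elim n)
      show ?case
      proof (intro ballI allI)
        fix t h assume "t \<in> S"
        then have "norm ((\<Sum>i<n. w i t) - (\<Sum>i. w i t)) \<le> e" using elim by (auto simp: dist_norm intro: less_imp_le)
        then have "\<bar>h\<bar> * norm ((\<Sum>i<n. w i t) - (\<Sum>i. w i t)) \<le> \<bar>h\<bar> * e" by (rule mult_left_mono) simp
        then show "norm ((\<Sum>i<n. h *\<^sub>R w i t) - h *\<^sub>R (\<Sum>i. w i t)) \<le> e * norm h"
          unfolding scaleR_sum_right[symmetric] scaleR_right_diff_distrib[symmetric] norm_scaleR by (simp add: mult.commute)
      qed
    qed
    show "(\<lambda>n. f n t) sums trig_sum (\<lambda>k. u k t) x" using eu[OF t] by blast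
  qed (use S t in auto)
  then obtain g where g: "\<And>t. t \<in> S \<Longrightarrow> (\<lambda>n. f n t) sums g t \<and> (g has_derivative (\<lambda>h. h *\<^sub>R (\<Sum>n. w n t))) (at t within S)" by blast
  have "(g has_vector_derivative trig_sum (\<lambda>k. v k t) x) (at t within S)"
    using g[OF t] ev[OF t] by (simp add: has_vector_derivative_def)
  moreover have "g t = trig_sum (\<lambda>k. u k t) x" if "t \<in> S" for t
    using g[OF that] eu[OF that] sums_unique2 by blast
  ultimately show ?thesis using t has_vector_derivative_transform[of t S] by (metis (no_types, lifting))
qed

context weights
begin

lemma forcing_le_gap: "norm (forcing b k t) \<le> gap b 0 k"
proof -
  have "norm (forcing b k t) \<le> gap b 0 k * (V k t * (sig t)\<^sup>2)" using forcing_diff[of b k t 0] by (simp add: forcing_zero)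
  also have "\<dots> \<le> gap b 0 k * (1 * 1)"
  proof (intro mult_left_mono mult_mono gap_nonneg)
    have "V k t \<le> 1 * 1" unfolding V_def
      by (intro mult_mono) (use rad_bounds(1)[of t] sig_le_1[of t] less_imp_le[OF sig_pos[of t]] in auto)
    then show "V k t \<le> 1" by simp
    show "(sig t)\<^sup>2 \<le> 1" using sig_le_1[of t] less_imp_le[OF sig_pos[of t]] by (simp add: power_le_one)
  qed auto
  finally show ?thesis by simp
qed

lemma decay_rate_neg: "decay_rate \<rho> (- k) = decay_rate \<rho> k"
  by (simp add: decay_rate_def)

lemma decay_rate_le: "0 \<le> decay_rate \<rho> k" "decay_rate \<rho> k \<le> \<rho>"
proof -
  show "0 \<le> decay_rate \<rho> k" using \<rho> by (simp add: decay_rate_def)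
  show "decay_rate \<rho> k \<le> \<rho>"
  proof (cases "k = 0")
    case False
    then have "\<rho> * 1 \<le> \<rho> * (4 * \<bar>real_of_int k\<bar>)" using abs_int_ge_1[of k] \<rho> by (intro mult_left_mono) auto
    then show ?thesis using False by (simp add: decay_rate_def divide_le_eq)
  qed (use \<rho> in \<open>simp add: decay_rate_def\<close>)
qed

end

text \<open>Fourier coefficients of a real function whose derivative has a finite Wiener norm of radius
\<open>r1 + \<alpha>\<close>.\<close>

locale initial_modes = weights +
  fixes a0 :: "int \<Rightarrow> complex"
  assumes a0_sym: "\<And>k. a0 (- k) = cnj (a0 k)"
    and a0_summable: "(\<lambda>k. \<bar>real_of_int k\<bar> * exp ((r1 + \<alpha>) * \<bar>real_of_int k\<bar>) * norm (a0 k)) summable_on UNIV"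
begin

definition size0 :: "int \<Rightarrow> real" where
  "size0 k = \<bar>real_of_int k\<bar> * exp ((r1 + \<alpha>) * \<bar>real_of_int k\<bar>) * norm (a0 k)"

text \<open>The forcing, symmetrised so that the solution \<open>sol b\<close> consists of the coefficients of a real function
for every \<open>b\<close>, whether or not \<open>b\<close> itself comes from a real function.\<close>

definition sforcing :: "wiener \<Rightarrow> int \<Rightarrow> real \<Rightarrow> complex" where
  "sforcing b k t = (forcing b k t + cnj (forcing b (- k) t)) / 2"

definition sgap :: "wiener \<Rightarrow> wiener \<Rightarrow> int \<Rightarrow> real" where
  "sgap b b' k = (gap b b' k + gap b b' (- k)) / 2"

definition sol :: "wiener \<Rightarrow> int \<Rightarrow> real \<Rightarrow> complex" where
  "sol b k = duhamel (decay_rate \<rho> k) (a0 k) (sforcing b k)"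

lemma V_neg: "V (- k) t = V k t" by (simp add: V_def)

lemma sforcing_continuous: "continuous_on A (sforcing b k)"
  unfolding sforcing_def by (intro continuous_intros forcing_continuous) auto

lemma sforcing_diff: "norm (sforcing b k t - sforcing b' k t) \<le> sgap b b' k * (V k t * (sig t)\<^sup>2)"
proof -
  have "sforcing b k t - sforcing b' k t = ((forcing b k t - forcing b' k t) + cnj (forcing b (- k) t - forcing b' (- k) t)) / 2"
    by (simp add: sforcing_def algebra_simps diff_divide_distrib add_divide_distrib)
  also have "norm \<dots> \<le> (norm (forcing b k t - forcing b' k t) + norm (cnj (forcing b (- k) t - forcing b' (- k) t))) / 2"
    unfolding norm_divide by (simp add: norm_triangle_ineq divide_right_mono)
  also have "\<dots> \<le> (gap b b' k * (V k t * (sig t)\<^sup>2) + gap b b' (- k) * (V k t * (sig t)\<^sup>2)) / 2"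
    using forcing_diff[of b k t b'] forcing_diff[of b "- k" t b']
    unfolding complex_mod_cnj V_neg by (intro divide_right_mono add_mono) auto
  finally show ?thesis by (simp add: sgap_def field_simps)
qed

lemma sgap_summable: "sgap b b' summable_on UNIV" and sgap_sum: "(\<Sum>\<^sub>\<infinity>k. sgap b b' k) = (\<Sum>\<^sub>\<infinity>k. gap b b' k)"
proof -
  have bij: "bij_betw uminus (UNIV :: int set) UNIV" by (auto intro!: bij_betwI[where g = uminus])
  have n: "(\<lambda>k. gap b b' (- k)) summable_on UNIV" "(\<Sum>\<^sub>\<infinity>k. gap b b' (- k)) = (\<Sum>\<^sub>\<infinity>k. gap b b' k)"
    using summable_on_reindex_bij_betw[OF bij, of "gap b b'"] infsum_reindex_bij_betw[OF bij, of "gap b b'"] gap_summable by auto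
  have "sgap b b' = (\<lambda>k. (1/2) * (gap b b' k + gap b b' (- k)))" by (auto simp: sgap_def)
  note e = this
  show "sgap b b' summable_on UNIV" unfolding e by (intro summable_on_cmult_right summable_on_add gap_summable n)
  show "(\<Sum>\<^sub>\<infinity>k. sgap b b' k) = (\<Sum>\<^sub>\<infinity>k. gap b b' k)"
    unfolding e infsum_cmult_right' infsum_add[OF gap_summable n(1)] n(2) by simp
qed

lemma sgap_nonneg: "sgap b b' k \<ge> 0"
  using gap_nonneg[of b b' k] gap_nonneg[of b b' "- k"] by (simp add: sgap_def)

lemma sol_derivative:
  "t \<ge> 0 \<Longrightarrow> (sol b k has_vector_derivative - of_real (decay_rate \<rho> k) * sol b k t + sforcing b k t) (at t within {0..})"
  unfolding sol_def by (rule duhamel_derivative[OF sforcing_continuous])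

lemma sol_diff_bound:
  assumes t: "t \<ge> 0"
  shows "\<bar>real_of_int k\<bar> * norm (sol b k t - sol b' k t) \<le> sgap b b' k / \<kappa> * V k t"
proof (cases "k = 0")
  case True
  then show ?thesis using sgap_nonneg[of b b' 0] \<kappa>_pos V_pos[of 0 t] by simp
next
  case False
  define d where "d t = sol b k t - sol b' k t" for t
  let ?l = "decay_rate \<rho> k"
  have "norm (exp (?l * t) *\<^sub>R d t - d 0) \<le> sgap b b' k / (\<kappa> * \<bar>real_of_int k\<bar>) * (exp (?l * t) * V k t)"
  proof (rule mode_estimate[OF False t])
    fix s assume s: "s \<in> {0..t}"
    have "(d has_vector_derivative (- of_real ?l * sol b k s + sforcing b k s) - (- of_real ?l * sol b' k s + sforcing b' k s)) (at s within {0..})"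
      unfolding d_def by (rule has_vector_derivative_diff; rule sol_derivative) (use s in auto)
    then have "(d has_vector_derivative - of_real ?l * d s + (sforcing b k s - sforcing b' k s)) (at s within {0..})"
      by (simp add: d_def algebra_simps)
    then show "(d has_vector_derivative - of_real ?l * d s + (sforcing b k s - sforcing b' k s)) (at s within {0..t})"
      by (rule has_vector_derivative_within_subset) auto
    show "norm (sforcing b k s - sforcing b' k s) \<le> sgap b b' k * (V k s * (sig s)\<^sup>2)" by (rule sforcing_diff)
  qed
  then have "exp (?l * t) * norm (d t) \<le> exp (?l * t) * (sgap b b' k / (\<kappa> * \<bar>real_of_int k\<bar>) * V k t)"
    by (simp add: d_def sol_def duhamel_0 mult_ac)
  then have "norm (d t) \<le> sgap b b' k / (\<kappa> * \<bar>real_of_int k\<bar>) * V k t"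
    by (rule mult_left_le_imp_le) simp
  then have "\<bar>real_of_int k\<bar> * norm (d t) \<le> \<bar>real_of_int k\<bar> * (sgap b b' k / (\<kappa> * \<bar>real_of_int k\<bar>) * V k t)"
    by (rule mult_left_mono) simp
  then show ?thesis using False by (simp add: d_def)
qed

lemma sol_zero_bound:
  assumes t: "t \<ge> 0"
  shows "\<bar>real_of_int k\<bar> * norm (sol 0 k t) \<le> size0 k * V k t"
proof (cases "k = 0")
  case False
  let ?l = "decay_rate \<rho> k"
  have "sforcing 0 k = (\<lambda>_. 0)" by (simp add: sforcing_def forcing_zero fun_eq_iff)
  then have s: "sol 0 k t = exp (- ?l * t) *\<^sub>R a0 k" by (simp add: sol_def duhamel_def)
  have V0: "exp ((r1 + \<alpha>) * \<bar>real_of_int k\<bar>) * V k 0 = 1"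
    unfolding V_def sig_0 rad_bounds(4) by (simp add: exp_add[symmetric] algebra_simps)
  have "exp (- ?l * t) * (exp ((r1 + \<alpha>) * \<bar>real_of_int k\<bar>) * V k 0) \<le> exp (- ?l * t) * (exp ((r1 + \<alpha>) * \<bar>real_of_int k\<bar>) * (exp (?l * t) * V k t))"
    using V_dominates_decay[OF False t] by (intro mult_left_mono) auto
  also have "\<dots> = exp ((r1 + \<alpha>) * \<bar>real_of_int k\<bar>) * V k t" by (simp add: exp_minus)
  finally have "exp (- ?l * t) \<le> exp ((r1 + \<alpha>) * \<bar>real_of_int k\<bar>) * V k t" unfolding V0 by simp
  then have "\<bar>real_of_int k\<bar> * norm (a0 k) * exp (- ?l * t) \<le> \<bar>real_of_int k\<bar> * norm (a0 k) * (exp ((r1 + \<alpha>) * \<bar>real_of_int k\<bar>) * V k t)"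
    by (rule mult_left_mono) simp
  then show ?thesis by (simp add: s size0_def mult_ac)
qed (simp add: size0_def)

lemma sol_tempered: "tempered (sol b) (\<lambda>k. size0 k + sgap b 0 k / \<kappa>)"
  unfolding tempered_def
proof (intro conjI allI impI)
  have "(\<lambda>k. size0 k + (1 / \<kappa>) * sgap b 0 k) summable_on UNIV"
    using a0_summable unfolding size0_def[symmetric] by (intro summable_on_add summable_on_cmult_right sgap_summable)
  then show "(\<lambda>k. size0 k + sgap b 0 k / \<kappa>) summable_on UNIV" by simp
  show "continuous_on {0..} (sol b k)" for k unfolding sol_def by (rule duhamel_continuous[OF sforcing_continuous])
  fix k and t :: real assume t: "t \<ge> 0"
  have "\<bar>real_of_int k\<bar> * norm (sol b k t) \<le> \<bar>real_of_int k\<bar> * (norm (sol b k t - sol 0 k t) + norm (sol 0 k t))"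
    by (rule mult_left_mono) (use norm_triangle_sub[of "sol b k t" "sol 0 k t"] in auto)
  also have "\<dots> \<le> sgap b 0 k / \<kappa> * V k t + size0 k * V k t"
    unfolding distrib_left by (intro add_mono sol_diff_bound sol_zero_bound t)
  finally show "\<bar>real_of_int k\<bar> * norm (sol b k t) \<le> (size0 k + sgap b 0 k / \<kappa>) * V k t"
    by (simp add: algebra_simps)
qed

text \<open>Solve the linear equation with the forcing of \<open>b\<close>, and take the slope of the solution.  Every fixed
point yields a solution of the graph equation.\<close>

definition step :: "wiener \<Rightarrow> wiener" where "step b = lift (sol b)"

lemma step_diff: "norm (step b - step b') \<le> (\<Sum>\<^sub>\<infinity>k. gap b b' k) / \<kappa>"
proof -
  have "norm (step b - step b') \<le> (\<Sum>\<^sub>\<infinity>k. (1 / \<kappa>) * sgap b b' k)"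
  proof (rule norm_wiener_le)
    show "(\<lambda>k. (1 / \<kappa>) * sgap b b' k) summable_on UNIV" by (intro summable_on_cmult_right sgap_summable)
    fix k
    show "norm (mode (step b - step b') k) \<le> (1 / \<kappa>) * sgap b b' k"
    proof (rule norm_bound)
      fix p :: param
      obtain r t s where p: "p = (r, t, s)" by (cases p)
      have "mode (step b - step b') k p = \<i> * of_int k * (sol b k (max 0 t) - sol b' k (max 0 t)) / of_real (V k t)"
        by (simp add: p step_def mode_lift(1)[OF sol_tempered] diff_divide_distrib right_diff_distrib)
      also have "norm \<dots> = \<bar>real_of_int k\<bar> * norm (sol b k (max 0 t) - sol b' k (max 0 t)) / V k t"
        using V_pos[of k t] by (simp add: norm_mult norm_divide)
      also have "\<dots> \<le> sgap b b' k / \<kappa>"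
        using sol_diff_bound[of "max 0 t" k b b'] V_pos[of k t] unfolding V_max by (simp add: divide_le_eq)
      finally show "norm (mode (step b - step b') k p) \<le> (1 / \<kappa>) * sgap b b' k" by simp
    qed
  qed
  then show ?thesis unfolding infsum_cmult_right' sgap_sum by simp
qed

lemma norm_step_zero: "norm (step 0) \<le> (\<Sum>\<^sub>\<infinity>k. size0 k)"
proof -
  have "gap 0 0 k = 0" for k by (simp add: gap_def)
  then have "sgap 0 0 k = 0" for k by (simp add: sgap_def)
  then show ?thesis using norm_lift[OF sol_tempered[of 0]] by (simp add: step_def)
qed

text \<open>The last bound is the one that yields the estimate of the solution by the data: since \<open>q\<close> can be
taken small, the constant \<open>1 / (1 - q)\<close> is as close to 1 as desired.\<close>

lemma fixed_point:
  assumes A: "\<And>b b'. norm b \<le> R \<Longrightarrow> norm b' \<le> R \<Longrightarrow> (\<Sum>\<^sub>\<infinity>k. gap b b' k) \<le> q * \<kappa> * norm (b - b')"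
    and q: "0 \<le> q" "q \<le> 1/2" and R: "R \<ge> 0" and small: "(\<Sum>\<^sub>\<infinity>k. size0 k) \<le> R / 2"
  obtains b where "norm b \<le> R" "step b = b" "(1 - q) * norm b \<le> (\<Sum>\<^sub>\<infinity>k. size0 k)"
proof -
  have lip: "norm (step b - step b') \<le> q * norm (b - b')" if "norm b \<le> R" "norm b' \<le> R" for b b'
  proof -
    have "(\<Sum>\<^sub>\<infinity>k. gap b b' k) / \<kappa> \<le> q * \<kappa> * norm (b - b') / \<kappa>" using A[OF that] \<kappa>_pos by (intro divide_right_mono) auto
    then show ?thesis using step_diff[of b b'] \<kappa>_pos by simp
  qed
  have bnd: "norm (step b) \<le> (\<Sum>\<^sub>\<infinity>k. size0 k) + q * norm b" if "norm b \<le> R" for b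
    using lip[OF that, of 0] R norm_step_zero norm_triangle_sub[of "step b" "step 0"] by simp
  have "\<exists>!b\<in>cball 0 R. step b = b"
  proof (rule Banach_fix[where c = q])
    show "complete (cball (0::wiener) R)" by (rule complete_eq_closed[THEN iffD2]) simp
    show "cball (0::wiener) R \<noteq> {}" using R by auto
    show "step ` cball 0 R \<subseteq> cball 0 R"
    proof
      fix y assume "y \<in> step ` cball 0 R"
      then obtain b where b: "norm b \<le> R" "y = step b" by auto
      have "q * norm b \<le> (1/2) * R" using q b by (intro mult_mono) auto
      then show "y \<in> cball 0 R" using bnd[OF b(1)] small b(2) by simp
    qed
    show "dist (step x) (step y) \<le> q * dist x y" if "x \<in> cball 0 R" "y \<in> cball 0 R" for x y
      using lip that by (simp add: dist_norm)
  qed (use q in auto)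
  then obtain b where b: "norm b \<le> R" "step b = b" by auto
  moreover have "(1 - q) * norm b \<le> (\<Sum>\<^sub>\<infinity>k. size0 k)" using bnd[OF b(1)] b(2) by (simp add: algebra_simps)
  ultimately show thesis by (rule that)
qed

context
  fixes b :: wiener
  assumes b: "norm b \<le> 1/4" "step b = b"
begin

definition height :: "real \<Rightarrow> real \<Rightarrow> real" where
  "height t x = Re (trig_sum (\<lambda>k. sol b k t) x)"

lemma sol_modes: "t \<ge> 0 \<Longrightarrow> norm (sol b k t) * \<bar>real_of_int k\<bar> \<le> norm (mode b k) * V k t"
  using lift_modes[OF sol_tempered, of t b k] b(2) by (simp add: step_def)

lemma sforcing_sym: "sforcing b (- k) t = cnj (sforcing b k t)"
  by (simp add: sforcing_def add.commute)

lemma sol_sym: "sol b (- k) t = cnj (sol b k t)"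
  unfolding sol_def decay_rate_neg a0_sym by (rule duhamel_cnj) (rule sforcing_sym)

lemma sol_le: "t \<ge> 0 \<Longrightarrow> k \<noteq> 0 \<Longrightarrow> norm (sol b k t) \<le> norm (mode b k) * V k t"
  using sol_modes[of t k] abs_int_ge_1[of k] mult_left_mono[of 1 "\<bar>real_of_int k\<bar>" "norm (sol b k t)"] by simp

lemma sol_exp_decay: "t \<ge> 0 \<Longrightarrow> exp_decay (rad t) (\<lambda>k. sol b k t)"
  unfolding exp_decay_def
proof (intro exI allI)
  fix k assume t: "t \<ge> 0"
  show "norm (sol b k t) \<le> (norm b + norm (sol b 0 t)) * exp (- rad t * \<bar>real_of_int k\<bar>)"
  proof (cases "k = 0")
    case False
    have "V k t \<le> exp (- rad t * \<bar>real_of_int k\<bar>)"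
      unfolding V_def using sig_le_1[of t] by (simp add: mult_left_le)
    then have "norm (mode b k) * V k t \<le> (norm b + norm (sol b 0 t)) * exp (- rad t * \<bar>real_of_int k\<bar>)"
      using norm_mode_le[of b k] less_imp_le[OF V_pos[of k t]] by (intro mult_mono add_increasing2) auto
    then show ?thesis using sol_le[OF t False] by linarith
  qed simp
qed

lemma height: "of_real (height t x) = trig_sum (\<lambda>k. sol b k t) x"
  unfolding height_def by (rule trig_sum_real[symmetric]) (rule sol_sym)

lemma sol_summable: "t \<ge> 0 \<Longrightarrow> (\<lambda>k. norm (sol b k t)) summable_on UNIV"
  by (rule exp_decay_summable_norm[OF sol_exp_decay rad_bounds(1)])

lemma coeff_height: "t \<ge> 0 \<Longrightarrow> fourier_coeff (height t) k = sol b k t"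
  by (rule fourier_coeff_trig_sum[OF sol_summable height])

text \<open>The right-hand side of the graph equation is a real function, so its Fourier coefficients are
symmetric; hence so is the forcing at a fixed point, and the symmetrisation in \<open>sforcing\<close> has changed
nothing.\<close>

lemma rhs_height:
  assumes t: "t \<ge> 0" and \<rho>': "\<rho>m - \<rho>p = \<rho>"
  shows "of_real (graph_rhs \<rho>p \<rho>m (height t) x) = trig_sum (\<lambda>k. - of_real (decay_rate \<rho> k) * sol b k t + sforcing b k t) x"
proof -
  define n where "n k = - of_real (decay_rate \<rho> k) * sol b k t + forcing b k t" for k
  have L: "lift (sol b) = b" using b(2) by (simp add: step_def)
  have rhs: "of_real (graph_rhs \<rho>p \<rho>m (height t) x) = trig_sum n x" for x
    unfolding n_def
    using lift_profile[OF sol_tempered _ t sol_exp_decay[OF t] rad_bounds(1) height \<rho>'] b(1) unfolding L by simp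
  have sn: "(\<lambda>k. norm (n k)) summable_on UNIV"
  proof (rule summable_on_bounded_by(3))
    show "(\<lambda>k. \<rho> * norm (sol b k t) + gap b 0 k) summable_on UNIV"
      by (intro summable_on_add summable_on_cmult_right sol_summable t gap_summable)
    show "norm (n k) \<le> \<rho> * norm (sol b k t) + gap b 0 k" for k
      unfolding n_def using decay_rate_le[of k] forcing_le_gap[of b k t]
      by (intro order_trans[OF norm_triangle_ineq] add_mono) (auto simp: norm_mult intro!: mult_right_mono)
  qed
  have "n (- k) = cnj (n k)" for k
    using fourier_coeff_trig_sum[OF sn rhs] fourier_coeff_minus by metis
  then have "forcing b (- k) t = cnj (forcing b k t)" for k
    unfolding n_def decay_rate_neg sol_sym by (simp add: algebra_simps)
  then have "forcing b k t = sforcing b k t" for k by (simp add: sforcing_def)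
  then show ?thesis unfolding rhs n_def by simp
qed

lemma height_time_derivative:
  assumes t: "t \<ge> 0" and \<rho>': "\<rho>m - \<rho>p = \<rho>"
  shows "((\<lambda>\<tau>. height \<tau> x) has_real_derivative graph_rhs \<rho>p \<rho>m (height t) x) (at t within {0..})"
proof -
  define v where "v k t = (if k = 0 then sforcing b 0 t else - of_real (decay_rate \<rho> k) * sol b k t + sforcing b k t)" for k t
  have v: "v k t = - of_real (decay_rate \<rho> k) * sol b k t + sforcing b k t" for k t
    by (simp add: v_def decay_rate_def)
  have sf: "norm (sforcing b k t) \<le> sgap b 0 k" for k t
  proof -
    have "norm (sforcing b k t) = norm (forcing b k t + cnj (forcing b (- k) t)) / 2"
      unfolding sforcing_def norm_divide by simp
    also have "\<dots> \<le> (norm (forcing b k t) + norm (cnj (forcing b (- k) t))) / 2"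
      by (intro divide_right_mono norm_triangle_ineq) simp
    finally show ?thesis using forcing_le_gap[of b k t] forcing_le_gap[of b "- k" t] by (simp add: sgap_def)
  qed
  have "((\<lambda>t. trig_sum (\<lambda>k. sol b k t) x) has_vector_derivative trig_sum (\<lambda>k. v k t) x) (at t within {0..})"
  proof (rule trig_sum_time_derivative)
    show "convex {0::real..}" by (rule convex_real_interval)
    show "(sol b k has_vector_derivative v k t) (at t within {0..})" if "t \<in> {0..}" for k t
      unfolding v using that by (intro sol_derivative) auto
    show "norm (v k t) \<le> \<rho> * norm (mode b k) + sgap b 0 k" if "t \<in> {0..}" for k t
    proof (cases "k = 0")
      case True
      then show ?thesis using sf[of 0 t] \<rho> by (simp add: v_def add_increasing)
    next
      case False
      have "V k t \<le> 1 * 1" unfolding V_def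
        by (intro mult_mono) (use rad_bounds(1)[of t] sig_le_1[of t] less_imp_le[OF sig_pos[of t]] in auto)
      then have "norm (sol b k t) \<le> norm (mode b k)"
        using sol_le[of t k] that False mult_left_mono[of "V k t" 1 "norm (mode b k)"] by simp
      then have "decay_rate \<rho> k * norm (sol b k t) \<le> \<rho> * norm (mode b k)"
        using decay_rate_le[of k] by (intro mult_mono) auto
      then show ?thesis unfolding v using sf[of k t] decay_rate_le(1)[of k]
        by (intro order_trans[OF norm_triangle_ineq] add_mono) (auto simp: norm_mult)
    qed
    show "(\<lambda>k. \<rho> * norm (mode b k) + sgap b 0 k) summable_on UNIV"
      by (intro summable_on_add summable_on_cmult_right mode_summable sgap_summable)
  qed (use t sol_summable in auto)
  then have "((\<lambda>t. complex_of_real (height t x)) has_vector_derivative of_real (graph_rhs \<rho>p \<rho>m (height t) x)) (at t within {0..})"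
    unfolding height rhs_height[OF t \<rho>'] v .
  then have "((\<lambda>t. Re (complex_of_real (height t x))) has_vector_derivative Re (of_real (graph_rhs \<rho>p \<rho>m (height t) x))) (at t within {0..})"
    by (rule bounded_linear.has_vector_derivative[OF bounded_linear_Re])
  then show ?thesis by (simp add: has_real_derivative_iff_has_vector_derivative)
qed

end

end

section \<open>Local uniqueness\<close>

text \<open>A solution on a short time interval, of which only an analyticity radius \<open>r1 + 2 \<alpha>\<close> and a bound \<open>D\<close> on
its Wiener norm are known.  The radius exceeds the largest radius of the weight by \<open>\<alpha>\<close>, which turns
the bound on each mode into a summable one.\<close>

locale decaying_flow = weights +
  fixes a :: "int \<Rightarrow> real \<Rightarrow> complex" and f :: "real \<Rightarrow> real \<Rightarrow> real" and \<eta> D \<rho>p \<rho>m :: real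
  assumes \<eta>: "0 < \<eta>" "\<eta> \<le> 1"
    and a_cont: "\<And>k. continuous_on {0..\<eta>} (a k)"
    and a_bound: "\<And>k t. t \<in> {0..\<eta>} \<Longrightarrow> \<bar>real_of_int k\<bar> * norm (a k t) \<le> D * exp (- (r1 + 2 * \<alpha>) * \<bar>real_of_int k\<bar>)"
    and f: "\<And>t x. t \<in> {0..\<eta>} \<Longrightarrow> of_real (f t x) = trig_sum (\<lambda>k. a k t) x"
    and eqn: "\<And>t x. t \<in> {0..\<eta>} \<Longrightarrow> ((\<lambda>\<tau>. f \<tau> x) has_real_derivative graph_rhs \<rho>p \<rho>m (f t) x) (at t within {0..\<eta>})"
    and \<rho>': "\<rho>m - \<rho>p = \<rho>"
    and small: "D * (1 + c) * (\<Sum>\<^sub>\<infinity>k. exp (- \<alpha> * \<bar>real_of_int k\<bar>)) \<le> 1/4"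
begin

lemma D_nonneg: "D \<ge> 0" using a_bound[of 0 0] \<eta> by simp

text \<open>The coefficients are continued beyond the time \<open>\<eta>\<close> in constant ratio to the weight, so that the lift is
defined for all times and keeps its norm.\<close>

definition ext :: "int \<Rightarrow> real \<Rightarrow> complex" where
  "ext k t = a k (min \<eta> t) * of_real (V k t / V k (min \<eta> t))"

lemma ext: "t \<in> {0..\<eta>} \<Longrightarrow> ext k t = a k t"
  using V_pos[of k t] by (simp add: ext_def min_absorb2)

lemma a_decay:
  assumes t: "t \<in> {0..\<eta>}" and k: "k \<noteq> 0"
  shows "norm (a k t) \<le> D * exp (- \<alpha> * \<bar>real_of_int k\<bar>)"
proof -
  have "norm (a k t) \<le> \<bar>real_of_int k\<bar> * norm (a k t)"
    using abs_int_ge_1[OF k] mult_right_mono[of 1 "\<bar>real_of_int k\<bar>" "norm (a k t)"] by simp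
  also have "\<dots> \<le> D * exp (- (r1 + 2 * \<alpha>) * \<bar>real_of_int k\<bar>)" by (rule a_bound[OF t])
  also have "\<dots> \<le> D * exp (- \<alpha> * \<bar>real_of_int k\<bar>)"
  proof (rule mult_left_mono[OF _ D_nonneg])
    have "- (r1 + 2 * \<alpha>) * \<bar>real_of_int k\<bar> \<le> - \<alpha> * \<bar>real_of_int k\<bar>" using \<alpha> r1 by (intro mult_right_mono) auto
    then show "exp (- (r1 + 2 * \<alpha>) * \<bar>real_of_int k\<bar>) \<le> exp (- \<alpha> * \<bar>real_of_int k\<bar>)" by simp
  qed
  finally show ?thesis .
qed

lemma a_exp_decay: "t \<in> {0..\<eta>} \<Longrightarrow> exp_decay \<alpha> (\<lambda>k. a k t)"
  unfolding exp_decay_def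
proof (intro exI allI)
  fix k assume t: "t \<in> {0..\<eta>}"
  show "norm (a k t) \<le> (D + norm (a 0 t)) * exp (- \<alpha> * \<bar>real_of_int k\<bar>)"
  proof (cases "k = 0")
    case False
    have "D * exp (- \<alpha> * \<bar>real_of_int k\<bar>) \<le> (D + norm (a 0 t)) * exp (- \<alpha> * \<bar>real_of_int k\<bar>)" by (intro mult_right_mono) auto
    then show ?thesis using a_decay[OF t False] by linarith
  qed (use D_nonneg in simp)
qed

lemma ext_tempered: "tempered ext (\<lambda>k. D * (1 + c) * exp (- \<alpha> * \<bar>real_of_int k\<bar>))"
  unfolding tempered_def
proof (intro conjI allI impI)
  show "(\<lambda>k. D * (1 + c) * exp (- \<alpha> * \<bar>real_of_int k\<bar>)) summable_on UNIV"
    by (intro summable_on_cmult_right exp_decay_summable \<alpha>)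
  fix k
  have "V k t \<noteq> 0" for t using V_pos[of k t] by simp
  then show "continuous_on {0..} (ext k)" unfolding ext_def[abs_def]
    by (intro continuous_intros continuous_on_compose2[OF a_cont] continuous_on_compose2[OF V_continuous[of UNIV]] V_continuous)
       (use \<eta> in auto)
  fix t :: real assume t: "t \<ge> 0"
  define m where "m = min \<eta> t"
  have m: "m \<in> {0..\<eta>}" using t \<eta> by (auto simp: m_def)
  have "1 / sig m = 1 + c * m" using m by (simp add: sig_def)
  also have "\<dots> \<le> 1 + c" using m \<eta> c_pos mult_left_mono[of m 1 c] by simp
  finally have "1 / sig m \<le> 1 + c" .
  then have "1 \<le> (1 + c) * sig m" using sig_pos[of m] by (simp add: divide_le_eq)
  have "exp (- (r1 + 2 * \<alpha>) * \<bar>real_of_int k\<bar>) = exp (- \<alpha> * \<bar>real_of_int k\<bar>) * exp (- (r1 + \<alpha>) * \<bar>real_of_int k\<bar>)"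
    by (simp add: exp_add[symmetric] algebra_simps)
  also have "\<dots> \<le> exp (- \<alpha> * \<bar>real_of_int k\<bar>) * (exp (- rad m * \<bar>real_of_int k\<bar>) * ((1 + c) * sig m))"
  proof (intro mult_left_mono)
    have "- (r1 + \<alpha>) * \<bar>real_of_int k\<bar> \<le> - rad m * \<bar>real_of_int k\<bar>" using rad_bounds(3)[of m] by (intro mult_right_mono) auto
    then have "exp (- (r1 + \<alpha>) * \<bar>real_of_int k\<bar>) * 1 \<le> exp (- rad m * \<bar>real_of_int k\<bar>) * ((1 + c) * sig m)"
      using \<open>1 \<le> (1 + c) * sig m\<close> by (intro mult_mono) auto
    then show "exp (- (r1 + \<alpha>) * \<bar>real_of_int k\<bar>) \<le> exp (- rad m * \<bar>real_of_int k\<bar>) * ((1 + c) * sig m)" by simp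
  qed simp
  also have "\<dots> = (1 + c) * exp (- \<alpha> * \<bar>real_of_int k\<bar>) * V k m" by (simp add: V_def)
  finally have "D * exp (- (r1 + 2 * \<alpha>) * \<bar>real_of_int k\<bar>) \<le> D * ((1 + c) * exp (- \<alpha> * \<bar>real_of_int k\<bar>) * V k m)"
    using D_nonneg by (rule mult_left_mono)
  then have "\<bar>real_of_int k\<bar> * norm (a k m) \<le> D * ((1 + c) * exp (- \<alpha> * \<bar>real_of_int k\<bar>) * V k m)"
    using a_bound[OF m] by (rule order_trans[rotated])
  then have "\<bar>real_of_int k\<bar> * norm (a k m) * (V k t / V k m) \<le> D * ((1 + c) * exp (- \<alpha> * \<bar>real_of_int k\<bar>) * V k m) * (V k t / V k m)"
    using V_pos[of k m] V_pos[of k t] by (intro mult_right_mono) auto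
  also have "\<dots> = D * (1 + c) * exp (- \<alpha> * \<bar>real_of_int k\<bar>) * V k t" using V_pos[of k m] by simp
  finally show "\<bar>real_of_int k\<bar> * norm (ext k t) \<le> D * (1 + c) * exp (- \<alpha> * \<bar>real_of_int k\<bar>) * V k t"
    using V_pos[of k m] V_pos[of k t] by (simp add: ext_def m_def[symmetric] norm_mult norm_divide mult_ac)
qed

definition elem :: wiener where "elem = lift ext"

lemma norm_elem: "norm elem \<le> D * (1 + c) * (\<Sum>\<^sub>\<infinity>k. exp (- \<alpha> * \<bar>real_of_int k\<bar>))"
  using norm_lift[OF ext_tempered] unfolding elem_def infsum_cmult_right' .

definition vel :: "int \<Rightarrow> real \<Rightarrow> complex" where
  "vel k t = - of_real (decay_rate \<rho> k) * a k t + forcing elem k t"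

lemma rhs_vel:
  assumes t: "t \<in> {0..\<eta>}"
  shows "of_real (graph_rhs \<rho>p \<rho>m (f t) x) = trig_sum (\<lambda>k. vel k t) x"
  using lift_profile[OF ext_tempered order_trans[OF norm_elem[unfolded elem_def] small], of t \<alpha> "f t" \<rho>m \<rho>p x]
    t \<alpha> a_exp_decay[OF t] f[OF t] \<rho>' by (simp add: ext vel_def elem_def)

lemma vel_bound:
  assumes t: "t \<in> {0..\<eta>}"
  shows "norm (vel k t) \<le> \<rho> * (D * exp (- \<alpha> * \<bar>real_of_int k\<bar>)) + gap elem 0 k"
proof -
  have "decay_rate \<rho> k * norm (a k t) \<le> \<rho> * (D * exp (- \<alpha> * \<bar>real_of_int k\<bar>))"
  proof (cases "k = 0")
    case True
    then show ?thesis using \<rho> D_nonneg by (simp add: decay_rate_def)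
  next
    case False
    then show ?thesis using decay_rate_le[of k] a_decay[OF t False] by (intro mult_mono) auto
  qed
  then show ?thesis unfolding vel_def using forcing_le_gap[of elem k t] decay_rate_le(1)[of k]
    by (intro order_trans[OF norm_triangle_ineq] add_mono) (auto simp: norm_mult)
qed

text \<open>The equation holds at each point \<open>x\<close>; the claim is that it may be read mode by mode.  The integrals
\<open>U\<close> of the expected derivatives sum to a function with the same time derivative and the same initial
values as \<open>f\<close>, hence to \<open>f\<close> itself, and Fourier coefficients are unique.\<close>

lemma a_derivative:
  assumes t: "t \<in> {0..\<eta>}"
  shows "(a k has_vector_derivative vel k t) (at t within {0..\<eta>})"
proof -
  define M where "M k = \<rho> * (D * exp (- \<alpha> * \<bar>real_of_int k\<bar>)) + gap elem 0 k" for k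
  define U where "U k t = a k 0 + integral {0..t} (vel k)" for k t
  have M: "M summable_on UNIV" unfolding M_def
    by (intro summable_on_add summable_on_cmult_right exp_decay_summable \<alpha> gap_summable)
  have vc: "continuous_on {0..\<eta>} (vel k)" for k
    unfolding vel_def[abs_def] by (intro continuous_intros a_cont forcing_continuous)
  have Ud: "(U k has_vector_derivative vel k t) (at t within {0..\<eta>})" if "t \<in> {0..\<eta>}" for k t
    unfolding U_def[abs_def] using has_vector_derivative_add[OF has_vector_derivative_const integral_has_vector_derivative[OF vc that]] by simp
  have a0: "(\<lambda>k. norm (a k t)) summable_on UNIV" if "t \<in> {0..\<eta>}" for t
    using exp_decay_summable_norm[OF a_exp_decay[OF that] \<alpha>] .
  have Us: "(\<lambda>k. norm (U k t)) summable_on UNIV" if t: "t \<in> {0..\<eta>}" for t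
  proof (rule summable_on_bounded_by(3))
    show "(\<lambda>k. norm (a k 0) + \<eta> * M k) summable_on UNIV"
      by (intro summable_on_add summable_on_cmult_right M a0) (use \<eta> in simp)
    fix k
    have "norm (integral {0..t} (vel k)) \<le> M k * (t - 0)"
      by (rule integral_bound) (use t vel_bound continuous_on_subset[OF vc] in \<open>auto simp: M_def\<close>)
    also have "\<dots> \<le> M k * \<eta>"
      using t order_trans[OF norm_ge_zero vel_bound[of 0 k]] \<eta> by (intro mult_left_mono) (auto simp: M_def)
    finally show "norm (U k t) \<le> norm (a k 0) + \<eta> * M k"
      unfolding U_def by (intro order_trans[OF norm_triangle_ineq] add_mono) (auto simp: mult.commute)
  qed
  have eqU: "a k t = U k t" if t: "t \<in> {0..\<eta>}" for k t
  proof -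
    have "of_real (f t x) = trig_sum (\<lambda>k. U k t) x" for x
    proof -
      define d where "d t = complex_of_real (f t x) - trig_sum (\<lambda>k. U k t) x" for t
      have "(d has_vector_derivative 0) (at t within {0..\<eta>})" if t: "t \<in> {0..\<eta>}" for t
      proof -
        have "((\<lambda>t. trig_sum (\<lambda>k. U k t) x) has_vector_derivative trig_sum (\<lambda>k. vel k t) x) (at t within {0..\<eta>})"
          by (rule trig_sum_time_derivative[where M = M]) (use Ud vel_bound M Us t in \<open>auto simp: M_def\<close>)
        moreover have "((\<lambda>t. complex_of_real (f t x)) has_vector_derivative of_real (graph_rhs \<rho>p \<rho>m (f t) x)) (at t within {0..\<eta>})"
          using bounded_linear.has_vector_derivative[OF bounded_linear_of_real eqn[OF t, unfolded has_real_derivative_iff_has_vector_derivative]] .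
        ultimately show ?thesis unfolding d_def rhs_vel[OF t] using has_vector_derivative_diff by fastforce
      qed
      then obtain C where C: "\<And>t. t \<in> {0..\<eta>} \<Longrightarrow> d t = C"
        using has_vector_derivative_zero_constant[of "{0..\<eta>}" d] by auto
      have "d 0 = 0" using f[of 0 x] \<eta> by (simp add: d_def U_def)
      then show ?thesis using C[OF t] C[of 0] \<eta> by (simp add: d_def)
    qed
    then show ?thesis
      using fourier_coeff_trig_sum[OF Us[OF t], of "f t" k] fourier_coeff_trig_sum[OF a0[OF t] f[OF t], of k] by simp
  qed
  show ?thesis
    by (rule has_vector_derivative_transform[OF t _ Ud[OF t]]) (simp add: eqU)
qed

end

text \<open>The contraction estimate of the existence proof, applied to the difference of two solutions, first
identifies their lifts, that is, all modes except the mean.  The means then agree because their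
derivatives are functions of the lifts.\<close>

lemma (in weights) decaying_flow_unique:
  assumes 1: "decaying_flow \<rho> \<alpha> r1 a f \<eta> D \<rho>p \<rho>m" and 2: "decaying_flow \<rho> \<alpha> r1 a' f' \<eta> D \<rho>p \<rho>m"
    and init: "\<And>k. a k 0 = a' k 0"
    and contr: "\<And>b b'. norm b \<le> D * (1 + c) * (\<Sum>\<^sub>\<infinity>k. exp (- \<alpha> * \<bar>real_of_int k\<bar>)) \<Longrightarrow>
       norm b' \<le> D * (1 + c) * (\<Sum>\<^sub>\<infinity>k. exp (- \<alpha> * \<bar>real_of_int k\<bar>)) \<Longrightarrow> (\<Sum>\<^sub>\<infinity>k. gap b b' k) \<le> q * \<kappa> * norm (b - b')"
    and q: "q < 1" and t: "t \<in> {0..\<eta>}"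
  shows "f t x = f' t x"
proof -
  interpret X: decaying_flow \<rho> \<alpha> r1 a f \<eta> D \<rho>p \<rho>m by (rule 1)
  interpret Y: decaying_flow \<rho> \<alpha> r1 a' f' \<eta> D \<rho>p \<rho>m by (rule 2)
  note \<eta> = X.\<eta>
  define d where "d k t = a k t - a' k t" for k t
  have dd: "(d k has_vector_derivative - of_real (decay_rate \<rho> k) * d k t + (forcing X.elem k t - forcing Y.elem k t)) (at t within {0..\<eta>})"
    if "t \<in> {0..\<eta>}" for k t
    using has_vector_derivative_diff[OF X.a_derivative[OF that, of k] Y.a_derivative[OF that, of k]]
    by (simp add: d_def[abs_def] X.vel_def Y.vel_def algebra_simps)
  have est: "\<bar>real_of_int k\<bar> * norm (d k t) \<le> gap X.elem Y.elem k / \<kappa> * V k t" if t: "t \<in> {0..\<eta>}" for k t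
  proof (cases "k = 0")
    case True
    then show ?thesis using gap_nonneg[of X.elem Y.elem 0] \<kappa>_pos V_pos[of 0 t] by simp
  next
    case False
    let ?l = "decay_rate \<rho> k"
    have "norm (exp (?l * t) *\<^sub>R d k t - d k 0) \<le> gap X.elem Y.elem k / (\<kappa> * \<bar>real_of_int k\<bar>) * (exp (?l * t) * V k t)"
      by (rule mode_estimate[OF False _ has_vector_derivative_within_subset[OF dd] forcing_diff]) (use t in auto)
    then have "exp (?l * t) * norm (d k t) \<le> exp (?l * t) * (gap X.elem Y.elem k / (\<kappa> * \<bar>real_of_int k\<bar>) * V k t)"
      by (simp add: d_def init mult_ac)
    then have "norm (d k t) \<le> gap X.elem Y.elem k / (\<kappa> * \<bar>real_of_int k\<bar>) * V k t" by (rule mult_left_le_imp_le) simp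
    then have "\<bar>real_of_int k\<bar> * norm (d k t) \<le> \<bar>real_of_int k\<bar> * (gap X.elem Y.elem k / (\<kappa> * \<bar>real_of_int k\<bar>) * V k t)"
      by (rule mult_left_mono) simp
    then show ?thesis using False by simp
  qed
  have "norm (X.elem - Y.elem) \<le> (\<Sum>\<^sub>\<infinity>k. (1 / \<kappa>) * gap X.elem Y.elem k)"
  proof (rule norm_wiener_le)
    show "(\<lambda>k. (1 / \<kappa>) * gap X.elem Y.elem k) summable_on UNIV" by (intro summable_on_cmult_right gap_summable)
    fix k
    show "norm (mode (X.elem - Y.elem) k) \<le> (1 / \<kappa>) * gap X.elem Y.elem k"
    proof (rule norm_bound)
      fix p :: param
      obtain r t s where p: "p = (r, t, s)" by (cases p)
      define m where "m = min \<eta> (max 0 t)"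
      have m: "m \<in> {0..\<eta>}" using \<eta> by (auto simp: m_def)
      have "mode (X.elem - Y.elem) k p = \<i> * of_int k * (X.ext k (max 0 t) - Y.ext k (max 0 t)) / of_real (V k t)"
        by (simp add: p X.elem_def Y.elem_def mode_lift(1)[OF X.ext_tempered] mode_lift(1)[OF Y.ext_tempered] diff_divide_distrib right_diff_distrib)
      also have "X.ext k (max 0 t) - Y.ext k (max 0 t) = d k m * of_real (V k t / V k m)"
        by (simp add: X.ext_def Y.ext_def d_def m_def[symmetric] V_max left_diff_distrib diff_divide_distrib)
      also have "norm (\<i> * of_int k * (d k m * of_real (V k t / V k m)) / of_real (V k t)) = \<bar>real_of_int k\<bar> * norm (d k m) / V k m"
        using V_pos[of k t] V_pos[of k m] by (simp add: norm_mult norm_divide)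
      also have "\<dots> \<le> gap X.elem Y.elem k / \<kappa>" using est[OF m, of k] V_pos[of k m] by (simp add: divide_le_eq)
      finally show "norm (mode (X.elem - Y.elem) k p) \<le> (1 / \<kappa>) * gap X.elem Y.elem k" by simp
    qed
  qed
  also have "\<dots> \<le> (1 / \<kappa>) * (q * \<kappa> * norm (X.elem - Y.elem))"
    unfolding infsum_cmult_right' using \<kappa>_pos by (intro mult_left_mono contr X.norm_elem Y.norm_elem) auto
  also have "\<dots> = q * norm (X.elem - Y.elem)" using \<kappa>_pos by simp
  finally have "(1 - q) * norm (X.elem - Y.elem) \<le> 0" by (simp add: algebra_simps)
  then have eq: "X.elem = Y.elem" using q by (simp add: mult_le_0_iff)
  have "d k t = 0" for k
  proof (cases "k = 0")
    case True
    have "(d k has_vector_derivative 0) (at t within {0..\<eta>})" if "t \<in> {0..\<eta>}" for t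
      using dd[OF that, of k] True by (simp add: eq decay_rate_def)
    then obtain C where "\<And>t. t \<in> {0..\<eta>} \<Longrightarrow> d k t = C"
      using has_vector_derivative_zero_constant[of "{0..\<eta>}" "d k"] by auto
    then show ?thesis using t \<eta> by (metis atLeastAtMost_iff d_def diff_self init less_imp_le order_refl)
  next
    case False
    have "gap X.elem X.elem k = 0" by (simp add: gap_def)
    then show ?thesis using est[OF t, of k] False unfolding eq[symmetric] by (simp add: mult_le_0_iff)
  qed
  then have "a k t = a' k t" for k by (simp add: d_def)
  then have "complex_of_real (f t x) = of_real (f' t x)" using X.f[OF t, of x] Y.f[OF t, of x] by simp
  then show ?thesis using of_real_eq_iff by blast
qed

section \<open>Wiener spaces and global uniqueness\<close>

lemma wiener_term_mono: "\<nu> \<le> \<nu>' \<Longrightarrow> wiener_term s \<nu> u k \<le> wiener_term s \<nu>' u k"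
  unfolding wiener_term_def by (intro mult_right_mono) (auto intro: mult_right_mono)

lemma wiener_term_nonneg: "0 \<le> wiener_term s \<nu> u k"
  by (simp add: wiener_term_def)

lemma wiener_space_mono: "\<nu> \<le> \<nu>' \<Longrightarrow> u \<in> wiener_space s \<nu>' \<Longrightarrow> u \<in> wiener_space s \<nu>"
  unfolding wiener_space_def using wiener_term_mono[of \<nu> \<nu>' s u]
  by (auto intro: summable_on_bounded_by(1)[where b = "wiener_term s \<nu>' u"] simp: wiener_term_nonneg)

lemma fourier_coeff_diff:
  assumes "integrable circle u" "integrable circle v"
  shows "fourier_coeff (\<lambda>x. u x - v x) k = fourier_coeff u k - fourier_coeff v k"
proof -
  have m: "(\<lambda>x. cis (- (of_int k * x))) \<in> borel_measurable circle" by (rule borel_measurable_circle) measurable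
  note i = integrable_circle_mult[OF integrable_of_real m, where B = 1]
  show ?thesis
    unfolding fourier_coeff_circle of_real_diff left_diff_distrib
    by (subst Bochner_Integration.integral_diff[OF i i]) (auto simp: assms diff_divide_distrib)
qed

lemma wiener_term_diff_le:
  assumes "u \<in> wiener_space s \<nu>" "v \<in> wiener_space s \<nu>"
  shows "wiener_term s \<nu> (\<lambda>x. u x - v x) k \<le> wiener_term s \<nu> u k + wiener_term s \<nu> v k"
proof -
  have "cmod (fourier_coeff (\<lambda>x. u x - v x) k) \<le> cmod (fourier_coeff u k) + cmod (fourier_coeff v k)"
    using assms by (subst fourier_coeff_diff) (auto simp: wiener_space_def torus_L2_integrable norm_triangle_ineq4)
  then show ?thesis unfolding wiener_term_def distrib_left[symmetric] by (rule mult_left_mono) simp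
qed

lemma wiener_term_diff_summable:
  assumes "u \<in> wiener_space s \<nu>" "v \<in> wiener_space s \<nu>"
  shows "wiener_term s \<nu> (\<lambda>x. u x - v x) summable_on UNIV"
proof (rule summable_on_bounded_by(1))
  show "(\<lambda>k. wiener_term s \<nu> u k + wiener_term s \<nu> v k) summable_on UNIV"
    using assms by (auto simp: wiener_space_def intro: summable_on_add)
qed (use wiener_term_diff_le[OF assms] in \<open>simp add: wiener_term_nonneg\<close>)

lemma wiener_norm_triangle:
  assumes "u \<in> wiener_space s \<nu>" "v \<in> wiener_space s \<nu>"
  shows "wiener_norm s \<nu> u \<le> wiener_norm s \<nu> (\<lambda>x. u x - v x) + wiener_norm s \<nu> v"
  unfolding wiener_norm_def
proof (subst infsum_add[symmetric])
  show d: "wiener_term s \<nu> (\<lambda>x. u x - v x) summable_on UNIV" by (rule wiener_term_diff_summable[OF assms])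
  show v: "wiener_term s \<nu> v summable_on UNIV" using assms by (simp add: wiener_space_def)
  show "infsum (wiener_term s \<nu> u) UNIV \<le> (\<Sum>\<^sub>\<infinity>k. wiener_term s \<nu> (\<lambda>x. u x - v x) k + wiener_term s \<nu> v k)"
  proof (rule infsum_mono)
    show "wiener_term s \<nu> u summable_on UNIV" using assms by (simp add: wiener_space_def)
    show "(\<lambda>k. wiener_term s \<nu> (\<lambda>x. u x - v x) k + wiener_term s \<nu> v k) summable_on UNIV" by (intro summable_on_add d v)
    fix k
    have "cmod (fourier_coeff u k) \<le> cmod (fourier_coeff u k - fourier_coeff v k) + cmod (fourier_coeff v k)"
      using norm_triangle_sub[of "fourier_coeff u k" "fourier_coeff v k"] by simp
    then have "cmod (fourier_coeff u k) \<le> cmod (fourier_coeff (\<lambda>x. u x - v x) k) + cmod (fourier_coeff v k)"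
      using assms by (subst fourier_coeff_diff) (auto simp: wiener_space_def torus_L2_integrable)
    then show "wiener_term s \<nu> u k \<le> wiener_term s \<nu> (\<lambda>x. u x - v x) k + wiener_term s \<nu> v k"
      unfolding wiener_term_def distrib_left[symmetric] by (rule mult_left_mono) simp
  qed
qed

lemma wiener_term_le_norm:
  assumes "wiener_term s \<nu> u summable_on UNIV"
  shows "wiener_term s \<nu> u k \<le> wiener_norm s \<nu> u"
proof -
  have "sum (wiener_term s \<nu> u) {k} \<le> infsum (wiener_term s \<nu> u) UNIV"
    by (rule finite_sum_le_infsum[OF assms]) (auto simp: wiener_term_nonneg)
  then show ?thesis by (simp add: wiener_norm_def)
qed

text \<open>The weight of the mean is 0, so the mean is estimated separately, by any summable family that is 1 at
0.\<close>

lemma coeff_le_wiener_term: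
  assumes "\<nu> \<ge> 0"
  shows "norm (fourier_coeff u k) \<le> wiener_term 1 \<nu> u k + norm (fourier_coeff u 0) * exp (- 1 * \<bar>real_of_int k\<bar>)"
proof (cases "k = 0")
  case False
  have "1 * 1 \<le> exp (\<nu> * \<bar>real_of_int k\<bar>) * \<bar>real_of_int k\<bar>" using abs_int_ge_1[OF False] assms by (intro mult_mono) auto
  then have "norm (fourier_coeff u k) \<le> wiener_term 1 \<nu> u k"
    unfolding wiener_term_def using mult_right_mono[of 1 _ "norm (fourier_coeff u k)"] by fastforce
  then show ?thesis by (simp add: add_increasing2)
qed (simp add: wiener_term_def)

lemma wiener_space_coeff_summable:
  assumes "u \<in> wiener_space 1 \<nu>" "\<nu> \<ge> 0"
  shows "(\<lambda>k. norm (fourier_coeff u k)) summable_on UNIV"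
proof (rule summable_on_bounded_by(3)[OF _ coeff_le_wiener_term[OF assms(2)]])
  show "(\<lambda>k. wiener_term 1 \<nu> u k + norm (fourier_coeff u 0) * exp (- 1 * \<bar>real_of_int k\<bar>)) summable_on UNIV"
    using assms exp_decay_summable[of 1] by (intro summable_on_add summable_on_cmult_right) (auto simp: wiener_space_def)
qed

lemma real_analytic_continuous:
  assumes "real_analytic u" shows "continuous_on UNIV u"
proof -
  obtain F where F: "F analytic_on \<real>" "\<And>x. F (complex_of_real x) = complex_of_real (u x)"
    using assms unfolding real_analytic_def by blast
  have "continuous_on \<real> F" using F(1) by (intro holomorphic_on_imp_continuous_on analytic_imp_holomorphic)
  then have "continuous_on UNIV (\<lambda>x. F (complex_of_real x))"
    by (rule continuous_on_compose2) (auto intro: continuous_intros)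
  then have "continuous_on UNIV (\<lambda>x. Re (F (complex_of_real x)))" by (intro continuous_intros)
  then show ?thesis using F(2) by simp
qed

text \<open>A global solution that is continuous in the Wiener space of the fixed radius \<open>2 \<alpha>\<close>; with \<open>r1 = 0\<close> this
radius suffices for \<open>decaying_flow\<close>.\<close>

locale analytic_flow = weights +
  fixes h :: "real \<Rightarrow> real \<Rightarrow> real" and \<rho>p \<rho>m :: real
  assumes r1_0: "r1 = 0" and \<rho>': "\<rho>m - \<rho>p = \<rho>"
    and analytic: "\<And>t. t \<ge> 0 \<Longrightarrow> real_analytic (h t)"
    and in_space: "\<And>t. t \<ge> 0 \<Longrightarrow> h t \<in> wiener_space 1 (2 * \<alpha>)"
    and wiener_cont: "\<And>t T. T > 0 \<Longrightarrow> t \<in> {0..T} \<Longrightarrow>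
       ((\<lambda>\<tau>. wiener_norm 1 (2 * \<alpha>) (\<lambda>x. h \<tau> x - h t x)) \<longlongrightarrow> 0) (at t within {0..T})"
    and eqn: "solves_graph_eq \<rho>p \<rho>m h"
begin

lemma h_fourier: "t \<ge> 0 \<Longrightarrow> of_real (h t x) = trig_sum (fourier_coeff (h t)) x"
proof (rule fourier_series)
  assume t: "t \<ge> 0"
  show "(\<lambda>k. norm (fourier_coeff (h t) k)) summable_on UNIV"
    using wiener_space_coeff_summable[OF in_space[OF t]] \<alpha> by simp
  show "periodic_2pi (h t)" "integrable circle (h t)"
    using in_space[OF t] by (auto simp: wiener_space_def torus_L2_integrable torus_L2_def)
  show "continuous_on UNIV (h t)" by (rule real_analytic_continuous[OF analytic[OF t]])
qed

lemma h_time_continuous: "continuous_on {0..} (\<lambda>t. h t x)"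
  unfolding continuous_on_eq_continuous_within
  using eqn by (auto simp: solves_graph_eq_def intro!: DERIV_continuous)

lemma coeff_diff_le:
  assumes "\<tau> \<ge> 0" "t \<ge> 0"
  shows "wiener_term 1 (2 * \<alpha>) (\<lambda>x. h \<tau> x - h t x) summable_on UNIV"
    "norm (fourier_coeff (h \<tau>) k - fourier_coeff (h t) k)
      \<le> wiener_term 1 (2 * \<alpha>) (\<lambda>x. h \<tau> x - h t x) k + (if k = 0 then norm (fourier_coeff (h \<tau>) 0 - fourier_coeff (h t) 0) else 0)"
proof -
  note m = in_space[OF assms(1)] in_space[OF assms(2)]
  show "wiener_term 1 (2 * \<alpha>) (\<lambda>x. h \<tau> x - h t x) summable_on UNIV" by (rule wiener_term_diff_summable[OF m])
  have d: "fourier_coeff (\<lambda>x. h \<tau> x - h t x) k = fourier_coeff (h \<tau>) k - fourier_coeff (h t) k" for k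
    using m by (intro fourier_coeff_diff) (auto simp: wiener_space_def torus_L2_integrable)
  show "norm (fourier_coeff (h \<tau>) k - fourier_coeff (h t) k)
      \<le> wiener_term 1 (2 * \<alpha>) (\<lambda>x. h \<tau> x - h t x) k + (if k = 0 then norm (fourier_coeff (h \<tau>) 0 - fourier_coeff (h t) 0) else 0)"
  proof (cases "k = 0")
    case False
    have "1 * 1 \<le> exp (2 * \<alpha> * \<bar>real_of_int k\<bar>) * \<bar>real_of_int k\<bar>" using abs_int_ge_1[OF False] \<alpha> by (intro mult_mono) auto
    then show ?thesis
      using False mult_right_mono[of 1 "exp (2 * \<alpha> * \<bar>real_of_int k\<bar>) * \<bar>real_of_int k\<bar>" "norm (fourier_coeff (h \<tau>) k - fourier_coeff (h t) k)"]
      unfolding wiener_term_def d by simp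
  qed (simp add: wiener_term_nonneg)
qed

text \<open>The Wiener seminorm does not see the mean.  It is recovered from the value at one point, which is
continuous in time because it is differentiable there.\<close>

lemma mean_diff_le:
  assumes "\<tau> \<ge> 0" "t \<ge> 0"
  shows "norm (fourier_coeff (h \<tau>) 0 - fourier_coeff (h t) 0) \<le> \<bar>h \<tau> 0 - h t 0\<bar> + wiener_norm 1 (2 * \<alpha>) (\<lambda>x. h \<tau> x - h t x)"
proof -
  define d where "d k = fourier_coeff (h \<tau>) k - fourier_coeff (h t) k" for k
  have s: "(\<lambda>k. norm (fourier_coeff (h u) k)) summable_on UNIV" if "u \<ge> 0" for u
    using wiener_space_coeff_summable[OF in_space[OF that]] \<alpha> by simp
  have s': "fourier_coeff (h u) summable_on UNIV" if "u \<ge> 0" for u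
    using summable_on_bounded_by(1)[OF s[OF that], of "fourier_coeff (h u)"] by simp
  have "complex_of_real (h \<tau> 0) - of_real (h t 0) = (\<Sum>\<^sub>\<infinity>k. d k)"
    unfolding d_def h_fourier[OF assms(1)] h_fourier[OF assms(2)] trig_sum_def
    using infsum_add[OF s'[OF assms(1)] summable_on_uminus[THEN iffD2, OF s'[OF assms(2)]]] by (simp add: infsum_uminus left_diff_distrib)
  also have "\<dots> = d 0 + (\<Sum>\<^sub>\<infinity>k\<in>UNIV - {0}. d k)"
  proof -
    have "d summable_on UNIV"
      using summable_on_add[OF s'[OF assms(1)] summable_on_uminus[THEN iffD2, OF s'[OF assms(2)]]] by (simp add: d_def[abs_def])
    then have "infsum d ({0} \<union> (UNIV - {0})) = infsum d {0} + infsum d (UNIV - {0})"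
      by (intro infsum_Un_disjoint) (auto intro: summable_on_subset_banach)
    then show ?thesis by (simp add: Un_absorb1)
  qed
  finally have e: "d 0 = of_real (h \<tau> 0 - h t 0) - (\<Sum>\<^sub>\<infinity>k\<in>UNIV - {0}. d k)" by simp
  have "norm (\<Sum>\<^sub>\<infinity>k\<in>UNIV - {0}. d k) \<le> infsum (wiener_term 1 (2 * \<alpha>) (\<lambda>x. h \<tau> x - h t x)) (UNIV - {0})"
  proof (rule summable_on_bounded_by(2)[OF summable_on_subset_banach[OF coeff_diff_le(1)[OF assms]]])
    show "norm (d k) \<le> wiener_term 1 (2 * \<alpha>) (\<lambda>x. h \<tau> x - h t x) k" if "k \<in> UNIV - {0}" for k
      using coeff_diff_le(2)[OF assms, of k] that by (simp add: d_def)
  qed simp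
  also have "\<dots> \<le> wiener_norm 1 (2 * \<alpha>) (\<lambda>x. h \<tau> x - h t x)"
    unfolding wiener_norm_def
    by (rule infsum_mono2[OF summable_on_subset_banach[OF coeff_diff_le(1)[OF assms]] coeff_diff_le(1)[OF assms]])
       (auto simp: wiener_term_nonneg)
  finally have "norm (\<Sum>\<^sub>\<infinity>k\<in>UNIV - {0}. d k) \<le> wiener_norm 1 (2 * \<alpha>) (\<lambda>x. h \<tau> x - h t x)" .
  moreover have "norm (d 0) \<le> \<bar>h \<tau> 0 - h t 0\<bar> + norm (\<Sum>\<^sub>\<infinity>k\<in>UNIV - {0}. d k)"
    unfolding e using norm_triangle_ineq4[of "complex_of_real (h \<tau> 0 - h t 0)"] by (metis norm_of_real)
  ultimately show ?thesis by (simp add: d_def)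
qed

lemma coeff_continuous: "continuous_on {0..T} (\<lambda>t. fourier_coeff (h t) k)"
proof (cases "T > 0")
  case False
  then have "{0..T} = {} \<or> {0..T} = {0}" by auto
  then show ?thesis by auto
next
  case T: True
  show ?thesis unfolding continuous_on_def
  proof
    fix t assume t: "t \<in> {0..T}"
    let ?F = "at t within {0..T}"
    have "((\<lambda>\<tau>. h \<tau> 0 - h t 0) \<longlongrightarrow> h t 0 - h t 0) ?F"
      using continuous_on_subset[OF h_time_continuous[of 0], of "{0..T}"] t
      by (intro tendsto_diff tendsto_const) (auto simp: continuous_on_def)
    then have "((\<lambda>\<tau>. \<bar>h \<tau> 0 - h t 0\<bar> + 2 * wiener_norm 1 (2 * \<alpha>) (\<lambda>x. h \<tau> x - h t x)) \<longlongrightarrow> \<bar>0\<bar> + 2 * 0) ?F"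
      by (intro tendsto_intros wiener_cont[OF T t]) simp
    then have lim: "((\<lambda>\<tau>. \<bar>h \<tau> 0 - h t 0\<bar> + 2 * wiener_norm 1 (2 * \<alpha>) (\<lambda>x. h \<tau> x - h t x)) \<longlongrightarrow> 0) ?F" by simp
    have "\<forall>\<^sub>F \<tau> in ?F. norm (fourier_coeff (h \<tau>) k - fourier_coeff (h t) k) \<le> \<bar>h \<tau> 0 - h t 0\<bar> + 2 * wiener_norm 1 (2 * \<alpha>) (\<lambda>x. h \<tau> x - h t x)"
      unfolding eventually_at_filter
    proof (intro always_eventually allI impI)
      fix \<tau> assume "\<tau> \<in> {0..T}"
      then have nn: "\<tau> \<ge> 0" "t \<ge> 0" using t by auto
      have "0 \<le> wiener_norm 1 (2 * \<alpha>) (\<lambda>x. h \<tau> x - h t x)"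
        unfolding wiener_norm_def by (rule infsum_nonneg) (simp add: wiener_term_nonneg)
      then show "norm (fourier_coeff (h \<tau>) k - fourier_coeff (h t) k) \<le> \<bar>h \<tau> 0 - h t 0\<bar> + 2 * wiener_norm 1 (2 * \<alpha>) (\<lambda>x. h \<tau> x - h t x)"
        using coeff_diff_le(2)[OF nn, of k] mean_diff_le[OF nn] wiener_term_le_norm[OF coeff_diff_le(1)[OF nn], of k]
        by (cases "k = 0") (auto simp: wiener_term_def)
    qed
    then have "((\<lambda>\<tau>. fourier_coeff (h \<tau>) k - fourier_coeff (h t) k) \<longlongrightarrow> 0) ?F" by (rule Lim_null_comparison[OF _ lim])
    then show "((\<lambda>t. fourier_coeff (h t) k) \<longlongrightarrow> fourier_coeff (h t) k) ?F" by (rule LIM_zero_cancel)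
  qed
qed

lemma decaying_flow:
  assumes t0: "t0 \<ge> 0" and \<eta>: "0 < \<eta>" "\<eta> \<le> 1"
    and D: "\<And>t. t \<in> {0..\<eta>} \<Longrightarrow> wiener_norm 1 (2 * \<alpha>) (h (t0 + t)) \<le> D"
    and small: "D * (1 + c) * (\<Sum>\<^sub>\<infinity>k. exp (- \<alpha> * \<bar>real_of_int k\<bar>)) \<le> 1/4"
  shows "decaying_flow \<rho> \<alpha> r1 (\<lambda>k t. fourier_coeff (h (t0 + t)) k) (\<lambda>t. h (t0 + t)) \<eta> D \<rho>p \<rho>m"
proof -
  have a1: "continuous_on {0..\<eta>} (\<lambda>t. fourier_coeff (h (t0 + t)) k)" for k
    by (rule continuous_on_compose2[OF coeff_continuous[of "t0 + \<eta>" k]]) (use t0 in \<open>auto intro!: continuous_intros\<close>)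
  have a2: "\<bar>real_of_int k\<bar> * norm (fourier_coeff (h (t0 + t)) k) \<le> D * exp (- (r1 + 2 * \<alpha>) * \<bar>real_of_int k\<bar>)" if t: "t \<in> {0..\<eta>}" for k t
  proof -
    have "wiener_term 1 (2 * \<alpha>) (h (t0 + t)) k \<le> D"
      using wiener_term_le_norm[of 1 "2 * \<alpha>" "h (t0 + t)" k] in_space[of "t0 + t"] D[OF t] t t0 by (auto simp: wiener_space_def)
    then have "exp (- (2 * \<alpha>) * \<bar>real_of_int k\<bar>) * wiener_term 1 (2 * \<alpha>) (h (t0 + t)) k \<le> exp (- (2 * \<alpha>) * \<bar>real_of_int k\<bar>) * D"
      by (rule mult_left_mono) simp
    then show ?thesis by (simp add: wiener_term_def r1_0 exp_minus mult_ac)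
  qed
  have a3: "of_real (h (t0 + t) x) = trig_sum (\<lambda>k. fourier_coeff (h (t0 + t)) k) x" if "t \<in> {0..\<eta>}" for t x
    by (rule h_fourier) (use that t0 in auto)
  have a4: "((\<lambda>\<tau>. h (t0 + \<tau>) x) has_real_derivative graph_rhs \<rho>p \<rho>m (h (t0 + t)) x) (at t within {0..\<eta>})" if t: "t \<in> {0..\<eta>}" for t x
  proof -
    have "((\<lambda>\<tau>. h \<tau> x) has_real_derivative graph_rhs \<rho>p \<rho>m (h (t0 + t)) x) (at (t0 + t) within (+) t0 ` {0..\<eta>})"
      by (rule has_field_derivative_subset[where s = "{0..}"]) (use eqn t t0 in \<open>auto simp: solves_graph_eq_def\<close>)
    then have "((\<lambda>\<tau>. h \<tau> x) \<circ> (+) t0 has_real_derivative graph_rhs \<rho>p \<rho>m (h (t0 + t)) x * 1) (at t within {0..\<eta>})"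
      by (rule DERIV_image_chain) (auto intro!: derivative_eq_intros)
    then show ?thesis by (simp add: o_def)
  qed
  show ?thesis by unfold_locales (assumption | rule a1 a2 a3 a4 \<eta> \<rho>' small)+
qed

end

text \<open>Continuation.  The set of times up to which the two solutions agree is closed, by continuity in
time.  It is also open: at its last time the second solution inherits the bound \<open>\<delta>\<close> of the first one,
by continuity its norm stays below \<open>2 \<delta>\<close> for a while, and local uniqueness applies there.\<close>

lemma (in weights) analytic_flow_unique:
  assumes 1: "analytic_flow \<rho> \<alpha> r1 h \<rho>p \<rho>m" and 2: "analytic_flow \<rho> \<alpha> r1 h' \<rho>p \<rho>m"
    and init: "\<And>x. h' 0 x = h 0 x"
    and bnd: "\<And>t. t \<ge> 0 \<Longrightarrow> wiener_norm 1 (2 * \<alpha>) (h t) < \<delta>"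
    and small: "2 * \<delta> * (1 + c) * (\<Sum>\<^sub>\<infinity>k. exp (- \<alpha> * \<bar>real_of_int k\<bar>)) \<le> R" "R \<le> 1/4"
    and contr: "\<And>b b'. norm b \<le> R \<Longrightarrow> norm b' \<le> R \<Longrightarrow> (\<Sum>\<^sub>\<infinity>k. gap b b' k) \<le> q * \<kappa> * norm (b - b')"
    and q: "q < 1" and T: "T \<ge> 0"
  shows "h' T x = h T x"
proof (rule ccontr)
  interpret X: analytic_flow \<rho> \<alpha> r1 h \<rho>p \<rho>m by (rule 1)
  interpret Y: analytic_flow \<rho> \<alpha> r1 h' \<rho>p \<rho>m by (rule 2)
  assume ne: "h' T x \<noteq> h T x"
  have nn: "0 \<le> wiener_norm 1 (2 * \<alpha>) (h t)" for t
    unfolding wiener_norm_def by (rule infsum_nonneg) (simp add: wiener_term_nonneg)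
  have \<delta>: "\<delta> > 0" using bnd[of 0] nn[of 0] by simp
  define E where "E = {t. t \<ge> 0 \<and> (\<forall>s\<in>{0..t}. h' s = h s)}"
  have E0: "0 \<in> E" using init by (auto simp: E_def)
  have ET: "t \<le> T" if "t \<in> E" for t
    using that ne T by (auto simp: E_def not_le[symmetric] dest!: bspec[of _ _ T])
  then have bdd: "bdd_above E" by (auto simp: bdd_above_def)
  define t0 where "t0 = Sup E"
  have t0: "t0 \<ge> 0" unfolding t0_def by (rule cSup_upper[OF E0 bdd])
  have before: "h' s = h s" if s: "0 \<le> s" "s < t0" for s
  proof -
    obtain e where "e \<in> E" "s < e" using s less_cSup_iff[of E s] E0 bdd by (auto simp: t0_def)
    then show ?thesis using s by (auto simp: E_def)
  qed
  have at0: "h' t0 = h t0"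
  proof (cases "t0 = 0")
    case True
    then show ?thesis using init by auto
  next
    case False
    have "h' t0 x - h t0 x = 0" for x
    proof (rule continuous_constant_on_closure[where f = "\<lambda>t. h' t x - h t x" and x = t0])
      show "continuous_on (closure {0..<t0}) (\<lambda>t. h' t x - h t x)"
        using t0 False by (intro continuous_on_subset[OF continuous_on_diff[OF Y.h_time_continuous X.h_time_continuous]]) auto
    qed (use before t0 False in auto)
    then show ?thesis by auto
  qed
  have "\<forall>\<^sub>F \<tau> in at t0 within {0..t0 + 1}. wiener_norm 1 (2 * \<alpha>) (\<lambda>x. k \<tau> x - k t0 x) < \<delta>"
    if "analytic_flow \<rho> \<alpha> r1 k \<rho>p \<rho>m" for k
    using analytic_flow.wiener_cont[OF that, of "t0 + 1" t0] t0 \<delta> by (auto dest!: order_tendstoD(2))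
  from eventually_conj[OF this[OF 1] this[OF 2]]
  obtain d where d: "d > 0" "\<And>\<tau>. \<tau> \<in> {0..t0 + 1} \<Longrightarrow> \<tau> \<noteq> t0 \<Longrightarrow> dist \<tau> t0 < d \<Longrightarrow>
      wiener_norm 1 (2 * \<alpha>) (\<lambda>x. h \<tau> x - h t0 x) < \<delta> \<and> wiener_norm 1 (2 * \<alpha>) (\<lambda>x. h' \<tau> x - h' t0 x) < \<delta>"
    unfolding eventually_at by auto
  define \<eta> where "\<eta> = min 1 (d / 2)"
  have \<eta>: "0 < \<eta>" "\<eta> \<le> 1" using d by (auto simp: \<eta>_def)
  have le: "wiener_norm 1 (2 * \<alpha>) (k (t0 + t)) \<le> 2 * \<delta>"
    if k: "analytic_flow \<rho> \<alpha> r1 k \<rho>p \<rho>m" "k t0 = h t0" and t: "t \<in> {0..\<eta>}"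
      and close: "t \<noteq> 0 \<Longrightarrow> wiener_norm 1 (2 * \<alpha>) (\<lambda>x. k (t0 + t) x - k t0 x) < \<delta>" for k t
  proof (cases "t = 0")
    case True
    then show ?thesis using k(2) bnd[OF t0] nn[of t0] by simp
  next
    case False
    have "wiener_norm 1 (2 * \<alpha>) (k (t0 + t)) \<le> wiener_norm 1 (2 * \<alpha>) (\<lambda>x. k (t0 + t) x - k t0 x) + wiener_norm 1 (2 * \<alpha>) (k t0)"
      by (intro wiener_norm_triangle analytic_flow.in_space[OF k(1)]) (use t t0 in auto)
    then show ?thesis using close[OF False] bnd[OF t0] k(2) by simp
  qed
  have dd: "wiener_norm 1 (2 * \<alpha>) (\<lambda>x. h (t0 + t) x - h t0 x) < \<delta> \<and> wiener_norm 1 (2 * \<alpha>) (\<lambda>x. h' (t0 + t) x - h' t0 x) < \<delta>"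
    if "t \<in> {0..\<eta>}" "t \<noteq> 0" for t
    by (rule d(2)) (use that t0 \<eta> in \<open>auto simp: \<eta>_def dist_real_def\<close>)
  have s: "2 * \<delta> * (1 + c) * (\<Sum>\<^sub>\<infinity>k. exp (- \<alpha> * \<bar>real_of_int k\<bar>)) \<le> 1/4" using small by linarith
  have X: "decaying_flow \<rho> \<alpha> r1 (\<lambda>k t. fourier_coeff (h (t0 + t)) k) (\<lambda>t. h (t0 + t)) \<eta> (2 * \<delta>) \<rho>p \<rho>m"
    by (rule X.decaying_flow[OF t0 \<eta> le[OF 1 refl] s]) (use dd in auto)
  have Y: "decaying_flow \<rho> \<alpha> r1 (\<lambda>k t. fourier_coeff (h' (t0 + t)) k) (\<lambda>t. h' (t0 + t)) \<eta> (2 * \<delta>) \<rho>p \<rho>m"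
    by (rule Y.decaying_flow[OF t0 \<eta> le[OF 2 at0] s]) (use dd in auto)
  have after: "h (t0 + t) x = h' (t0 + t) x" if "t \<in> {0..\<eta>}" for t x
    by (rule decaying_flow_unique[OF X Y _ contr q that]) (use at0 small in auto)
  have "t0 + \<eta> \<in> E"
    unfolding E_def
  proof (intro CollectI conjI ballI ext)
    show "0 \<le> t0 + \<eta>" using t0 \<eta> by simp
    fix s x assume "s \<in> {0..t0 + \<eta>}"
    then show "h' s x = h s x" using before[of s] after[of "s - t0" x] by (cases "s < t0") auto
  qed
  then have "t0 + \<eta> \<le> t0" unfolding t0_def by (rule cSup_upper[OF _ bdd])
  then show False using \<eta> by simp
qed

section \<open>Well-posedness for small data\<close>

context initial_modes
begin

context
  fixes b :: wiener
  assumes b: "norm b \<le> 1/4" "step b = b"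
begin

lemma height_real_analytic:
  assumes t: "t \<ge> 0" shows "real_analytic (height b t)"
proof -
  obtain g g' where g: "\<And>z. \<bar>Im z\<bar> < rad t \<Longrightarrow> (g has_field_derivative g' z) (at z)"
    "\<And>x. g (of_real x) = trig_sum (\<lambda>k. sol b k t) x"
    using exp_decay_holomorphic[OF sol_exp_decay[OF b t] rad_bounds(1)] by metis
  have "open {z. \<bar>Im z\<bar> < rad t}" by (intro open_Collect_less continuous_intros)
  then have "g analytic_on {z. \<bar>Im z\<bar> < rad t}"
    using g(1) by (auto simp: analytic_on_open holomorphic_on_open)
  then have "g analytic_on \<real>"
    by (rule analytic_on_subset) (use rad_bounds(1)[of t] in \<open>auto simp: complex_is_Real_iff\<close>)
  then show ?thesis unfolding real_analytic_def using g(2) height[OF b] by metis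
qed

lemma height_torus_L2:
  assumes t: "t \<ge> 0" shows "height b t \<in> torus_L2"
proof -
  have c: "continuous_on A (height b t)" for A
    using real_analytic_continuous[OF height_real_analytic[OF t]] continuous_on_subset by blast
  have "periodic_2pi (height b t)"
    unfolding periodic_2pi_def height_def[OF b] trig_sum_periodic by simp
  moreover have "set_integrable lborel {0..2*pi} (\<lambda>x. (height b t x)\<^sup>2)"
    by (intro borel_integrable_atLeastAtMost' continuous_intros c)
  ultimately show ?thesis by (simp add: torus_L2_def borel_measurable_continuous_onI c)
qed

lemma height_wiener_term:
  assumes t: "t \<ge> 0" shows "wiener_term 1 r1 (height b t) k \<le> norm (mode b k)"
proof -
  have "V k t \<le> exp (- r1 * \<bar>real_of_int k\<bar>) * 1" unfolding V_def
    using rad_bounds(2)[of t] sig_le_1[of t] less_imp_le[OF sig_pos[of t]]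
    by (intro mult_mono) (auto intro: mult_right_mono)
  then have "norm (mode b k) * V k t \<le> norm (mode b k) * exp (- r1 * \<bar>real_of_int k\<bar>)" by (intro mult_left_mono) auto
  then have "norm (sol b k t) * \<bar>real_of_int k\<bar> \<le> norm (mode b k) * exp (- r1 * \<bar>real_of_int k\<bar>)"
    using sol_modes[OF b t, of k] by linarith
  then have "exp (r1 * \<bar>real_of_int k\<bar>) * (norm (sol b k t) * \<bar>real_of_int k\<bar>) \<le> exp (r1 * \<bar>real_of_int k\<bar>) * (norm (mode b k) * exp (- r1 * \<bar>real_of_int k\<bar>))"
    by (rule mult_left_mono) simp
  then show ?thesis unfolding wiener_term_def coeff_height[OF b t] by (simp add: exp_minus mult_ac)
qed

lemma height_wiener_space: "t \<ge> 0 \<Longrightarrow> height b t \<in> wiener_space 1 r1"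
  unfolding wiener_space_def
  using summable_on_bounded_by(1)[OF mode_summable, of "wiener_term 1 r1 (height b t)" b] height_wiener_term[of t]
  by (simp add: height_torus_L2 wiener_term_nonneg)

lemma height_wiener_norm: "t \<ge> 0 \<Longrightarrow> wiener_norm 1 r1 (height b t) \<le> norm b"
  unfolding wiener_norm_def norm_wiener_def
  using height_wiener_space[of t] by (intro infsum_mono mode_summable height_wiener_term) (auto simp: wiener_space_def)

text \<open>The series of differences converges uniformly in time, with the norms of the modes of \<open>b\<close> as majorant.\<close>

lemma height_wiener_continuous:
  assumes t: "t \<ge> 0"
  shows "((\<lambda>\<tau>. wiener_norm 1 r1 (\<lambda>x. height b \<tau> x - height b t x)) \<longlongrightarrow> 0) (at t within {0..})"
proof -
  define g where "g k \<tau> = wiener_term 1 r1 (\<lambda>x. height b \<tau> x - height b t x) k" for k \<tau>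
  have gsol: "g k \<tau> = exp (r1 * \<bar>real_of_int k\<bar>) * \<bar>real_of_int k\<bar> * norm (sol b k \<tau> - sol b k t)" if "\<tau> \<ge> 0" for k \<tau>
    unfolding g_def wiener_term_def
    using fourier_coeff_diff[of "height b \<tau>" "height b t" k] height_torus_L2[OF that] height_torus_L2[OF t]
    by (simp add: torus_L2_integrable coeff_height[OF b] that t)
  have gb: "norm (g k \<tau>) \<le> 2 * norm (mode b k)" if "\<tau> \<ge> 0" for k \<tau>
    using wiener_term_diff_le[OF height_wiener_space[OF that] height_wiener_space[OF t], of k]
      height_wiener_term[OF that, of k] height_wiener_term[OF t, of k] by (simp add: g_def wiener_term_nonneg)
  have ms: "(\<lambda>k. 2 * norm (mode b k)) summable_on UNIV" by (intro summable_on_cmult_right mode_summable)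
  have "uniform_limit {0..} (\<lambda>n \<tau>. \<Sum>i<n. g (int_decode i) \<tau>) (\<lambda>\<tau>. \<Sum>i. g (int_decode i) \<tau>) sequentially"
    by (rule Weierstrass_m_test[OF _ summable_int_decode[OF ms]]) (use gb in auto)
  moreover have "continuous_on {0..} (g k)" for k
  proof -
    have "continuous_on {0..} (\<lambda>\<tau>. exp (r1 * \<bar>real_of_int k\<bar>) * \<bar>real_of_int k\<bar> * norm (sol b k \<tau> - sol b k t))"
      unfolding sol_def by (intro continuous_intros duhamel_continuous sforcing_continuous)
    then show ?thesis by (subst continuous_on_cong[OF refl gsol]) auto
  qed
  ultimately have "continuous_on {0..} (\<lambda>\<tau>. \<Sum>i. g (int_decode i) \<tau>)"
    by (intro uniform_limit_theorem[where F = sequentially]) (auto intro!: always_eventually continuous_intros)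
  moreover have "wiener_norm 1 r1 (\<lambda>x. height b \<tau> x - height b t x) = (\<Sum>i. g (int_decode i) \<tau>)" if "\<tau> \<ge> 0" for \<tau>
    unfolding wiener_norm_def g_def
    by (rule infsum_int_eq_suminf[OF wiener_term_diff_summable[OF height_wiener_space[OF that] height_wiener_space[OF t]]])
  ultimately have c: "continuous_on {0..} (\<lambda>\<tau>. wiener_norm 1 r1 (\<lambda>x. height b \<tau> x - height b t x))"
    by (subst continuous_on_cong[OF refl]) auto
  have z: "wiener_norm 1 r1 (\<lambda>x. height b t x - height b t x) = 0"
    by (simp add: wiener_norm_def wiener_term_def fourier_coeff_circle)
  show ?thesis using bspec[OF c[unfolded continuous_on_def], of t] t unfolding z by simp
qed

end

end

text \<open>Giving up the radius \<open>\<alpha>\<close> gains a factor \<open>exp (- \<alpha>)\<close> in every mode except the mean, which has weight 0.\<close>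

lemma size0_le:
  assumes "\<alpha> > 0"
  shows "\<bar>real_of_int k\<bar> * exp ((2 * \<alpha> + \<alpha>) * \<bar>real_of_int k\<bar>) * norm (fourier_coeff u k) \<le> exp (- \<alpha>) * wiener_term 1 (4 * \<alpha>) u k"
proof (cases "k = 0")
  case False
  have "(2 * \<alpha> + \<alpha>) * \<bar>real_of_int k\<bar> \<le> - \<alpha> + 4 * \<alpha> * \<bar>real_of_int k\<bar>"
    using abs_int_ge_1[OF False] mult_left_mono[of 1 "\<bar>real_of_int k\<bar>" \<alpha>] assms by (simp add: algebra_simps)
  then have "exp ((2 * \<alpha> + \<alpha>) * \<bar>real_of_int k\<bar>) \<le> exp (- \<alpha>) * exp (4 * \<alpha> * \<bar>real_of_int k\<bar>)"
    unfolding exp_add[symmetric] by simp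
  then have "exp ((2 * \<alpha> + \<alpha>) * \<bar>real_of_int k\<bar>) * (\<bar>real_of_int k\<bar> * norm (fourier_coeff u k))
     \<le> exp (- \<alpha>) * exp (4 * \<alpha> * \<bar>real_of_int k\<bar>) * (\<bar>real_of_int k\<bar> * norm (fourier_coeff u k))"
    by (rule mult_right_mono) simp
  then show ?thesis by (simp add: wiener_term_def mult_ac)
qed (simp add: wiener_term_nonneg)

text \<open>The radius drops to one half immediately after the initial time.  Continuity on \<open>[0, T']\<close> is measured
with the radius at the final time \<open>T'\<close>, so a jump at 0 is compatible with it.\<close>

definition halved :: "real \<Rightarrow> real \<Rightarrow> real" where
  "halved \<nu>0 t = (if t = 0 then \<nu>0 else \<nu>0 / 2)"

definition well_posed :: "real \<Rightarrow> real \<Rightarrow> real \<Rightarrow> (real \<Rightarrow> real) \<Rightarrow> bool" where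
  "well_posed \<rho>p \<rho>m \<nu>0 h0 \<longleftrightarrow> (\<exists>h. global_analytic_solution \<rho>p \<rho>m (halved \<nu>0) h0 h \<and>
     (\<forall>h'. global_analytic_solution \<rho>p \<rho>m (halved \<nu>0) h0 h' \<longrightarrow> (\<forall>t\<ge>0. \<forall>x. h' t x = h t x)) \<and>
     (\<forall>t\<ge>0. wiener_norm 1 (halved \<nu>0 t) (h t) \<le> wiener_norm 1 \<nu>0 h0))"

text \<open>With \<open>\<alpha> = \<nu>0 / 4\<close>, existence uses the weight whose radius decreases from \<open>3 \<alpha>\<close> to \<open>2 \<alpha>\<close>: the factor
\<open>exp (- \<alpha>)\<close> gained by passing from radius \<open>4 \<alpha>\<close> to \<open>3 \<alpha>\<close> compensates the constant \<open>1 / (1 - q)\<close> of the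
fixed point, and the norm of the solution never exceeds that of the data.  A competitor is only known
to have radius \<open>2 \<alpha>\<close>, so uniqueness uses the weight whose radius decreases from \<open>\<alpha>\<close> to 0.\<close>

lemma small_data_well_posed:
  assumes \<rho>: "\<rho> > 0" and \<nu>0: "\<nu>0 > 0"
  shows "\<exists>\<delta>>0. \<forall>\<rho>p \<rho>m h0. \<rho>m - \<rho>p = \<rho> \<longrightarrow> h0 \<in> wiener_space 1 \<nu>0 \<longrightarrow>
    wiener_norm 1 \<nu>0 h0 < \<delta> \<longrightarrow> well_posed \<rho>p \<rho>m \<nu>0 h0"
proof -
  define \<alpha> where "\<alpha> = \<nu>0 / 4"
  have \<alpha>: "\<alpha> > 0" "\<nu>0 = 4 * \<alpha>" "\<nu>0 / 2 = 2 * \<alpha>" using \<nu>0 by (auto simp: \<alpha>_def)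
  interpret U: weights \<rho> \<alpha> 0 by unfold_locales (use \<rho> \<alpha> in auto)
  interpret E: weights \<rho> \<alpha> "2 * \<alpha>" by unfold_locales (use \<rho> \<alpha> in auto)
  obtain A where A: "A \<ge> 0" "\<And>R b b'. R \<le> 1/4 \<Longrightarrow> norm b \<le> R \<Longrightarrow> norm b' \<le> R \<Longrightarrow> (\<Sum>\<^sub>\<infinity>k. U.gap b b' k) \<le> A * R * norm (b - b')"
    by (rule U.gap_lipschitz) blast
  obtain A' where A': "A' \<ge> 0" "\<And>R b b'. R \<le> 1/4 \<Longrightarrow> norm b \<le> R \<Longrightarrow> norm b' \<le> R \<Longrightarrow> (\<Sum>\<^sub>\<infinity>k. E.gap b b' k) \<le> A' * R * norm (b - b')"
    by (rule E.gap_lipschitz) blast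
  \<comment> \<open>a contraction constant with \<open>1 - q \<ge> exp (- \<alpha>)\<close>\<close>
  define q where "q = min (1/2) (1 - exp (- \<alpha>))"
  have q: "0 < q" "q \<le> 1/2" "q \<le> 1 - exp (- \<alpha>)"
    using \<alpha>(1) min.cobounded1[of "1/2" "1 - exp (- \<alpha>)"] min.cobounded2[of "1/2" "1 - exp (- \<alpha>)"]
    unfolding q_def by simp_all
  \<comment> \<open>on the ball of this radius both fixed point maps contract by the factor \<open>q\<close>\<close>
  define R where "R = min (1/4) (q * U.\<kappa> / (A + A' + 1))"
  have R0: "0 < R" using q(1) U.\<kappa>_pos A(1) A'(1) by (simp add: R_def)
  have R4: "R \<le> 1/4" unfolding R_def by (rule min.cobounded1)
  note R = R0 R4
  have "R \<le> q * U.\<kappa> / (A + A' + 1)" unfolding R_def by (rule min.cobounded2)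
  then have "(A + A' + 1) * R \<le> q * U.\<kappa>" using A(1) A'(1) by (simp add: le_divide_eq mult.commute)
  moreover have "0 \<le> A * R" "0 \<le> A' * R" using A(1) A'(1) R by auto
  ultimately have AR: "A * R \<le> q * U.\<kappa>" "A' * R \<le> q * E.\<kappa>"
    using R by (auto simp: algebra_simps U.\<kappa>_def E.\<kappa>_def)
  have contrU: "(\<Sum>\<^sub>\<infinity>k. U.gap b b' k) \<le> q * U.\<kappa> * norm (b - b')" if "norm b \<le> R" "norm b' \<le> R" for b b'
    using A(2)[OF R(2) that] mult_right_mono[OF AR(1), of "norm (b - b')"] by simp
  have contrE: "(\<Sum>\<^sub>\<infinity>k. E.gap b b' k) \<le> q * E.\<kappa> * norm (b - b')" if "norm b \<le> R" "norm b' \<le> R" for b b'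
    using A'(2)[OF R(2) that] mult_right_mono[OF AR(2), of "norm (b - b')"] by simp
  define S where "S = (\<Sum>\<^sub>\<infinity>k::int. exp (- \<alpha> * \<bar>real_of_int k\<bar>))"
  have "sum (\<lambda>k::int. exp (- \<alpha> * \<bar>real_of_int k\<bar>)) {0} \<le> S"
    unfolding S_def by (rule finite_sum_le_infsum[OF exp_decay_summable[OF \<alpha>(1)]]) auto
  then have S: "S > 0" by simp
  \<comment> \<open>the first bound serves existence; the second one makes the lift of a solution of norm at most
    \<open>2 \<delta>\<close> lie in the ball of radius \<open>R\<close>\<close>
  define \<delta> where "\<delta> = min (R / 2) (R / (2 * (1 + U.c) * S))"
  have cS: "2 * (1 + U.c) * S > 0" using S U.c_pos by simp
  have \<delta>0: "0 < \<delta>" using R cS by (simp add: \<delta>_def)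
  have \<delta>1: "\<delta> \<le> R / 2" unfolding \<delta>_def by (rule min.cobounded1)
  note \<delta> = \<delta>0 \<delta>1
  have "\<delta> \<le> R / (2 * (1 + U.c) * S)" unfolding \<delta>_def by (rule min.cobounded2)
  then have \<delta>': "2 * \<delta> * (1 + U.c) * S \<le> R" using cS by (simp add: le_divide_eq mult_ac)
  define \<nu> where "\<nu> = halved \<nu>0"
  have \<nu>: "\<nu> t = (if t = 0 then \<nu>0 else \<nu>0 / 2)" for t by (simp add: \<nu>_def halved_def)
  show ?thesis
  proof (intro exI[of _ \<delta>] conjI allI impI \<delta>(1))
    fix \<rho>p \<rho>m h0
    assume \<rho>': "\<rho>m - \<rho>p = \<rho>" and h0: "h0 \<in> wiener_space 1 \<nu>0" "wiener_norm 1 \<nu>0 h0 < \<delta>"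
    let ?z = "\<lambda>k. \<bar>real_of_int k\<bar> * exp ((2 * \<alpha> + \<alpha>) * \<bar>real_of_int k\<bar>) * norm (fourier_coeff h0 k)"
    have ws: "(\<lambda>k. exp (- \<alpha>) * wiener_term 1 (4 * \<alpha>) h0 k) summable_on UNIV"
      using h0(1) unfolding \<alpha>(2) by (intro summable_on_cmult_right) (simp add: wiener_space_def)
    have zs: "?z summable_on UNIV" by (rule summable_on_bounded_by(1)[OF ws]) (use size0_le[OF \<alpha>(1)] in simp)
    have zb: "(\<Sum>\<^sub>\<infinity>k. ?z k) \<le> exp (- \<alpha>) * wiener_norm 1 \<nu>0 h0"
      unfolding wiener_norm_def \<alpha>(2) infsum_cmult_right'[symmetric] by (rule infsum_mono[OF zs ws size0_le[OF \<alpha>(1)]])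
    interpret I: initial_modes \<rho> \<alpha> "2 * \<alpha>" "fourier_coeff h0"
      by unfold_locales (rule fourier_coeff_minus, rule zs)
    have Iz: "(\<Sum>\<^sub>\<infinity>k. I.size0 k) \<le> exp (- \<alpha>) * wiener_norm 1 \<nu>0 h0" using zb unfolding I.size0_def .
    have nn: "0 \<le> wiener_norm 1 \<nu>0 h0" unfolding wiener_norm_def by (rule infsum_nonneg) (simp add: wiener_term_nonneg)
    have "exp (- \<alpha>) * wiener_norm 1 \<nu>0 h0 \<le> 1 * wiener_norm 1 \<nu>0 h0" using \<alpha> by (intro mult_right_mono nn) auto
    then have "(\<Sum>\<^sub>\<infinity>k. I.size0 k) \<le> R / 2" using Iz h0(2) \<delta>(2) by linarith
    note small0 = this
    obtain b where b: "norm b \<le> R" "I.step b = b" "(1 - q) * norm b \<le> (\<Sum>\<^sub>\<infinity>k. I.size0 k)"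
      by (rule I.fixed_point[where R = R and q = q, OF contrE _ q(2) _ small0]) (use q R in auto)
    have b4: "norm b \<le> 1/4" using b(1) R by simp
    note B = b4 b(2)
    have "exp (- \<alpha>) * norm b \<le> (1 - q) * norm b" using q by (intro mult_right_mono) auto
    then have "exp (- \<alpha>) * norm b \<le> exp (- \<alpha>) * wiener_norm 1 \<nu>0 h0" using b(3) Iz by linarith
    then have nb: "norm b \<le> wiener_norm 1 \<nu>0 h0" by simp
    define h where "h = I.height b"
    have coeff0: "fourier_coeff (h 0) = fourier_coeff h0"
      unfolding h_def by (rule ext) (simp add: I.coeff_height[OF B] I.sol_def duhamel_0)
    have term0: "wiener_term s \<mu> (h 0) = wiener_term s \<mu> h0" for s \<mu>
      by (simp add: wiener_term_def coeff0 fun_eq_iff)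
    have L2: "h t \<in> torus_L2" if "t \<ge> 0" for t unfolding h_def by (rule I.height_torus_L2[OF B that])
    have an: "real_analytic (h t)" if "t \<ge> 0" for t unfolding h_def by (rule I.height_real_analytic[OF B that])
    have mem: "h t \<in> wiener_space 1 (2 * \<alpha>)" if "t \<ge> 0" for t unfolding h_def by (rule I.height_wiener_space[OF B that])
    have mem0: "h 0 \<in> wiener_space 1 \<nu>0" using h0(1) L2[of 0] by (simp add: wiener_space_def term0)
    have nrm: "wiener_norm 1 (2 * \<alpha>) (h t) \<le> wiener_norm 1 \<nu>0 h0" if "t \<ge> 0" for t
      unfolding h_def using I.height_wiener_norm[OF B that] nb by linarith
    have cont: "((\<lambda>\<tau>. wiener_norm 1 (2 * \<alpha>) (\<lambda>x. h \<tau> x - h t x)) \<longlongrightarrow> 0) (at t within {0..T})" if "t \<in> {0..T}" for t T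
      unfolding h_def by (rule tendsto_within_subset[OF I.height_wiener_continuous[OF B]]) (use that in auto)
    have eqn: "solves_graph_eq \<rho>p \<rho>m h"
      unfolding solves_graph_eq_def h_def using I.height_time_derivative[OF B _ \<rho>'] by blast
    have ae: "AE x in lborel. h 0 x = h0 x"
    proof -
      have "AE x in lborel. of_real (h0 x) = trig_sum (fourier_coeff h0) x"
        by (rule fourier_series_AE)
           (use h0(1) \<nu>0 wiener_space_coeff_summable[OF h0(1)] in \<open>auto simp: wiener_space_def torus_L2_integrable torus_L2_def\<close>)
      moreover have "of_real (h 0 x) = trig_sum (fourier_coeff h0) x" for x
        unfolding h_def I.height[OF B] by (simp add: I.sol_def duhamel_0)
      ultimately have "AE x in lborel. complex_of_real (h0 x) = of_real (h 0 x)" by simp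
      then show ?thesis by eventually_elim (simp only: of_real_eq_iff)
    qed
    have sol: "global_analytic_solution \<rho>p \<rho>m \<nu> h0 h"
      unfolding global_analytic_solution_def wiener_continuous_def
    proof (intro conjI allI impI ballI an eqn ae)
      fix T t :: real assume "T > 0" "t \<in> {0..T}"
      then show "h t \<in> wiener_space 1 (\<nu> t)" using mem[of t] mem0 by (auto simp: \<nu> \<alpha>(3))
    next
      fix T T' t :: real assume *: "T > 0" "T' \<in> {0..T}" "t \<in> {0..T'}"
      show "((\<lambda>\<tau>. wiener_norm 1 (\<nu> T') (\<lambda>x. h \<tau> x - h t x)) \<longlongrightarrow> 0) (at t within {0..T'})"
      proof (cases "T' = 0")
        case True
        then have "t = 0" using * by auto
        then have "at t within {0..T'} = bot" unfolding True by (simp add: at_within_eq_bot_iff)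
        then show ?thesis by simp
      next
        case False
        then show ?thesis using cont[OF *(3)] by (simp add: \<nu> \<alpha>(3))
      qed
    qed
    have flow: "analytic_flow \<rho> \<alpha> 0 g \<rho>p \<rho>m" if g: "global_analytic_solution \<rho>p \<rho>m \<nu> h0 g" for g
    proof
      have w: "wiener_continuous 1 \<nu> T g" if "T > 0" for T using g that by (simp add: global_analytic_solution_def)
      show "real_analytic (g t)" if "t \<ge> 0" for t using g that by (simp add: global_analytic_solution_def)
      show "solves_graph_eq \<rho>p \<rho>m g" using g by (simp add: global_analytic_solution_def)
      show "g t \<in> wiener_space 1 (2 * \<alpha>)" if "t \<ge> 0" for t
      proof (rule wiener_space_mono)
        show "2 * \<alpha> \<le> \<nu> t" using \<alpha> by (auto simp: \<nu>)
        show "g t \<in> wiener_space 1 (\<nu> t)" using w[of "t + 1"] that by (auto simp: wiener_continuous_def)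
      qed
      show "((\<lambda>\<tau>. wiener_norm 1 (2 * \<alpha>) (\<lambda>x. g \<tau> x - g t x)) \<longlongrightarrow> 0) (at t within {0..T})" if "T > 0" "t \<in> {0..T}" for t T
      proof -
        have "((\<lambda>\<tau>. wiener_norm 1 (\<nu> T) (\<lambda>x. g \<tau> x - g t x)) \<longlongrightarrow> 0) (at t within {0..T})"
          using w[OF that(1)] that unfolding wiener_continuous_def by (meson atLeastAtMost_iff less_imp_le order_refl)
        then show ?thesis using that(1) by (simp add: \<nu> \<alpha>(3))
      qed
    qed (use \<rho>' in auto)
    have uniq: "h' t x = h t x" if h': "global_analytic_solution \<rho>p \<rho>m \<nu> h0 h'" and t: "t \<ge> 0" for h' t x
    proof (rule U.analytic_flow_unique[OF flow[OF sol] flow[OF h'] _ _ _ R(2) contrU _ t])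
      show "wiener_norm 1 (2 * \<alpha>) (h t) < \<delta>" if "t \<ge> 0" for t using nrm[OF that] h0(2) by simp
      show "2 * \<delta> * (1 + U.c) * (\<Sum>\<^sub>\<infinity>k. exp (- \<alpha> * \<bar>real_of_int k\<bar>)) \<le> R" using \<delta>' by (simp add: S_def)
      show "q < 1" using q by simp
      fix x
      have "complex_of_real (h' 0 x - h 0 x) = 0"
      proof (rule continuous_AE_zero[where G = "\<lambda>x. complex_of_real (h' 0 x - h 0 x)" and x = x])
        show "continuous_on UNIV (\<lambda>x. complex_of_real (h' 0 x - h 0 x))"
          using h' an[of 0] by (intro continuous_intros real_analytic_continuous) (auto simp: global_analytic_solution_def)
        have "AE x in lborel. h' 0 x = h0 x" using h' by (simp add: global_analytic_solution_def)
        then show "AE x in lborel. complex_of_real (h' 0 x - h 0 x) = 0" using ae by eventually_elim simp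
      qed
      then show "h' 0 x = h 0 x" by simp
    qed
    have "wiener_norm 1 (\<nu> t) (h t) \<le> wiener_norm 1 \<nu>0 h0" if "t \<ge> 0" for t
      using nrm[OF that] by (auto simp: \<nu> \<alpha>(3) wiener_norm_def term0)
    with sol uniq show "well_posed \<rho>p \<rho>m \<nu>0 h0"
      unfolding well_posed_def \<nu>_def by (intro exI[of _ h] conjI) auto
  qed
qed

theorem theorem2:
  shows "\<exists>\<delta> :: real \<Rightarrow> real \<Rightarrow> real. \<forall>\<rho>p \<rho>m \<nu>0 :: real. \<rho>m - \<rho>p > 0 \<longrightarrow> \<nu>0 > 0 \<longrightarrow>
    \<delta> (\<rho>m - \<rho>p) \<nu>0 > 0 \<and>
    (\<exists>(M :: real \<Rightarrow> real) c.
       (\<forall>x\<ge>0. M x \<ge> 0) \<and> c > 0 \<and>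
       (\<lambda>x. M x - c * x) \<in> O[at_right 0](\<lambda>x. x\<^sup>2) \<and>
       (\<forall>h0 \<in> wiener_space 1 \<nu>0. wiener_norm 1 \<nu>0 h0 < \<delta> (\<rho>m - \<rho>p) \<nu>0 \<longrightarrow>
          \<nu>0 - M (wiener_norm 1 \<nu>0 h0) > 0 \<and>
          (\<exists>\<nu> :: real \<Rightarrow> real.
             (\<forall>t\<ge>0. 0 < \<nu> t \<and> \<nu> t \<le> \<nu>0) \<and> antimono_on {0..} \<nu> \<and> \<nu> 0 = \<nu>0 \<and>
             (\<exists>h. global_analytic_solution \<rho>p \<rho>m \<nu> h0 h \<and>
                  (\<forall>h'. global_analytic_solution \<rho>p \<rho>m \<nu> h0 h' \<longrightarrow>
                        (\<forall>t\<ge>0. \<forall>x. h' t x = h t x)) \<and>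
                  (\<forall>t\<ge>0. wiener_norm 1 (\<nu> t) (h t) \<le> wiener_norm 1 \<nu>0 h0)))))"
proof -
  define good where "good \<rho> \<nu>0 \<delta> \<longleftrightarrow> \<delta> > 0 \<and>
    (\<forall>\<rho>p \<rho>m h0. \<rho>m - \<rho>p = \<rho> \<longrightarrow> h0 \<in> wiener_space 1 \<nu>0 \<longrightarrow> wiener_norm 1 \<nu>0 h0 < \<delta> \<longrightarrow>
      well_posed \<rho>p \<rho>m \<nu>0 h0)" for \<rho> \<nu>0 \<delta> :: real
  define \<delta> where "\<delta> \<rho> \<nu>0 = (SOME \<delta>. good \<rho> \<nu>0 \<delta>)" for \<rho> \<nu>0
  have \<delta>: "good \<rho> \<nu>0 (\<delta> \<rho> \<nu>0)" if "\<rho> > 0" "\<nu>0 > 0" for \<rho> \<nu>0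
    unfolding \<delta>_def by (rule someI_ex) (use small_data_well_posed[OF that] in \<open>simp add: good_def\<close>)
  show ?thesis
  proof (intro exI[of _ \<delta>] allI impI conjI)
    fix \<rho>p \<rho>m \<nu>0 :: real assume pos: "\<rho>m - \<rho>p > 0" "\<nu>0 > 0"
    define d where "d = \<delta> (\<rho>m - \<rho>p) \<nu>0"
    have d: "good (\<rho>m - \<rho>p) \<nu>0 d" unfolding d_def by (rule \<delta>[OF pos])
    then have d0: "d > 0" by (simp add: good_def)
    then show "\<delta> (\<rho>m - \<rho>p) \<nu>0 > 0" by (simp add: d_def)
    \<comment> \<open>\<open>M x = C x\<close> then stays below \<open>\<nu>0 / 2\<close> for \<open>x < d\<close>\<close>
    define C where "C = \<nu>0 / (2 * d)"
    have C: "C > 0" using pos d0 by (simp add: C_def)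
    show "\<exists>(M :: real \<Rightarrow> real) c.
       (\<forall>x\<ge>0. M x \<ge> 0) \<and> c > 0 \<and>
       (\<lambda>x. M x - c * x) \<in> O[at_right 0](\<lambda>x. x\<^sup>2) \<and>
       (\<forall>h0 \<in> wiener_space 1 \<nu>0. wiener_norm 1 \<nu>0 h0 < \<delta> (\<rho>m - \<rho>p) \<nu>0 \<longrightarrow>
          \<nu>0 - M (wiener_norm 1 \<nu>0 h0) > 0 \<and>
          (\<exists>\<nu> :: real \<Rightarrow> real.
             (\<forall>t\<ge>0. 0 < \<nu> t \<and> \<nu> t \<le> \<nu>0) \<and> antimono_on {0..} \<nu> \<and> \<nu> 0 = \<nu>0 \<and>
             (\<exists>h. global_analytic_solution \<rho>p \<rho>m \<nu> h0 h \<and>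
                  (\<forall>h'. global_analytic_solution \<rho>p \<rho>m \<nu> h0 h' \<longrightarrow>
                        (\<forall>t\<ge>0. \<forall>x. h' t x = h t x)) \<and>
                  (\<forall>t\<ge>0. wiener_norm 1 (\<nu> t) (h t) \<le> wiener_norm 1 \<nu>0 h0))))"
      unfolding d_def[symmetric]
    proof (rule exI[of _ "\<lambda>x. C * x"], rule exI[of _ C], intro conjI ballI impI)
      show "\<forall>x\<ge>0. C * x \<ge> 0" using C by simp
      show "(\<lambda>x. C * x - C * x) \<in> O[at_right 0](\<lambda>x. x\<^sup>2)" by simp
      fix h0 assume h0: "h0 \<in> wiener_space 1 \<nu>0" "wiener_norm 1 \<nu>0 h0 < d"
      have "C * wiener_norm 1 \<nu>0 h0 < C * d" using h0(2) C by (rule mult_strict_left_mono)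
      also have "C * d = \<nu>0 / 2" using d0 by (simp add: C_def)
      finally show "\<nu>0 - C * wiener_norm 1 \<nu>0 h0 > 0" using pos by simp
      show "\<exists>\<nu> :: real \<Rightarrow> real.
             (\<forall>t\<ge>0. 0 < \<nu> t \<and> \<nu> t \<le> \<nu>0) \<and> antimono_on {0..} \<nu> \<and> \<nu> 0 = \<nu>0 \<and>
             (\<exists>h. global_analytic_solution \<rho>p \<rho>m \<nu> h0 h \<and>
                  (\<forall>h'. global_analytic_solution \<rho>p \<rho>m \<nu> h0 h' \<longrightarrow>
                        (\<forall>t\<ge>0. \<forall>x. h' t x = h t x)) \<and>
                  (\<forall>t\<ge>0. wiener_norm 1 (\<nu> t) (h t) \<le> wiener_norm 1 \<nu>0 h0))"
      proof (intro exI[of _ "halved \<nu>0"] conjI)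
        show "antimono_on {0..} (halved \<nu>0)" using pos by (auto simp: monotone_on_def halved_def)
        show "\<forall>t\<ge>0. 0 < halved \<nu>0 t \<and> halved \<nu>0 t \<le> \<nu>0" "halved \<nu>0 0 = \<nu>0"
          using pos by (auto simp: halved_def)
        show "\<exists>h. global_analytic_solution \<rho>p \<rho>m (halved \<nu>0) h0 h \<and>
                  (\<forall>h'. global_analytic_solution \<rho>p \<rho>m (halved \<nu>0) h0 h' \<longrightarrow>
                        (\<forall>t\<ge>0. \<forall>x. h' t x = h t x)) \<and>
                  (\<forall>t\<ge>0. wiener_norm 1 (halved \<nu>0 t) (h t) \<le> wiener_norm 1 \<nu>0 h0)"
          unfolding well_posed_def[symmetric] using d h0 by (simp add: good_def)
      qed
    qed (rule C)
  qed
qed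

end
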